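(* Let $N$ be a compact manifold, $q\in N$, and let $V$ be a ($J_0$-convex) open neighborhood of the zero section $o_N$ in $T^*N$. Then there exists some $\delta_0>0$ such that for any $0<\delta\le\delta_0$, any $H\in\mathcal H_\delta^{engulf}(T^*N)$ and any element $w\in\widetilde{\mathcal M}_3(L_H,o_N,T_q^*N)$, where $L_H=\phi_H^1(o_N)$, the following alternative holds: (1) either $\operatorname{Image}w\subset V$ and $\max_{z\in\partial D^2}d(w(z),o_N)\le\delta$; (2) or $\operatorname{Image}w\not\subset V$ and $\int w^*\omega\ge C(J_0,V)$, where $C(J_0,V)>0$ is a constant depending only on $J_0$ and $V$.
   Context: $T^*N$ carries $\omega=-d\theta$, $\theta=p\,dq$. Fix a Riemannian metric $g$ on $N$; $J_g$ is the canonical (Sasakian) almost complex structure on $T^*N$ sending the horizontal lift of $X$ to the vertical lift of $g(X,\cdot)$; $J_0$ is a time-independent tame $\omega$-compatible almost complex structure equal to $J_g$ on $V$, and $V$ has $J_0$-convex boundary (standing assumption; e.g. $V$ a disc bundle $\{|p|<r\}$). The distance $d$ is that of $\omega(\cdot,J_0\cdot)$, so that $d((q,p),o_N)=|p|$ near $o_N$. $\overline d(\phi,\psi)=\max\{\sup_x d(\phi(x),\psi(x)),\sup_x d(\phi^{-1}(x),\psi^{-1}(x))\}$, and $\mathcal H_\delta^{engulf}(T^*N)$ is the set of Hamiltonians $H:[0,1]\times T^*N\to\mathbb R$ with $\phi_H^t(o_N)\subset V$ for all $t\in[0,1]$ and $\overline d(\phi_H^1,id)\le\delta$. It is assumed that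 $L_H$ intersects both $o_N$ and $T_q^*N$ transversely. $\widetilde{\mathcal M}_3(L_H,o_N,T_q^*N)$ denotes the union over all triples $x_1\in L_H\cap o_N$, $x_2\in o_N\cap T_q^*N$, $x_0\in L_H\cap T_q^*N$ of the spaces $\widetilde{\mathcal M}_3(D^2;x_1,x_2;x_0)$ of pairs $(w,(z_0,z_1,z_2))$ such that: $z_0,z_1,z_2\in\partial D^2$ are distinct points in counter-clockwise cyclic order; $w:D^2\to T^*N$ is continuous and $J_0$-holomorphic on $D^2\setminus\{z_0,z_1,z_2\}$ (with finite energy); $w(z_i)=x_i$ for $i=0,1,2$; and $w$ maps the boundary arc between $z_0$ and $z_1$ into $L_H$, the arc between $z_1$ and $z_2$ into $o_N$, and the arc between $z_2$ and $z_0$ into $T_q^*N$. *)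

theory Defs
  imports "HOL-Analysis.Analysis"
begin

section \<open>Smooth maps between Euclidean spaces\<close>

primrec Ck_on :: "nat \<Rightarrow> 'a::euclidean_space set \<Rightarrow> ('a \<Rightarrow> 'b::real_normed_vector) \<Rightarrow> bool" where
  "Ck_on 0 U f \<longleftrightarrow> continuous_on U f"
| "Ck_on (Suc k) U f \<longleftrightarrow>
     f differentiable_on U \<and> (\<forall>v. Ck_on k U (\<lambda>x. frechet_derivative f (at x) v))"

text \<open>On an arbitrary set, smooth means locally the restriction of a map that is smooth
  on an open set. This covers open sets, \<open>[0,1] \<times> U\<close>, and the closed disc.\<close>

definition smooth_on :: "'a::euclidean_space set \<Rightarrow> ('a \<Rightarrow> 'b::real_normed_vector) \<Rightarrow> bool" where
  "smooth_on S f \<longleftrightarrow>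
     (\<forall>x\<in>S. \<exists>U F. open U \<and> x \<in> U \<and> (\<forall>k. Ck_on k U F) \<and> (\<forall>y\<in>U \<inter> S. F y = f y))"

text \<open>Exterior derivative of a one-form \<open>\<alpha>\<close> on a vector space:
  \<open>d\<alpha>(X,Y) = X(\<alpha>(Y)) - Y(\<alpha>(X))\<close> for constant \<open>X\<close>, \<open>Y\<close>.\<close>

definition ext_deriv :: "('v::euclidean_space \<Rightarrow> 'v \<Rightarrow> real) \<Rightarrow> 'v \<Rightarrow> 'v \<Rightarrow> 'v \<Rightarrow> real" where
  "ext_deriv \<alpha> z u v =
     frechet_derivative (\<lambda>y. \<alpha> y v) (at z) u - frechet_derivative (\<lambda>y. \<alpha> y u) (at z) v"


section \<open>Manifolds given by an atlas\<close>

text \<open>A chart is a domain with a coordinate map. A manifold is given by its atlas alone: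
  the underlying set is the union of the domains and the topology is the one for which the
  charts are homeomorphisms onto open sets. The model space \<open>'v\<close> is an arbitrary
  Euclidean space (of positive dimension).\<close>

type_synonym ('a, 'v) chart = "'a set \<times> ('a \<Rightarrow> 'v)"

abbreviation cdom :: "('a, 'v) chart \<Rightarrow> 'a set" where "cdom \<equiv> fst"
abbreviation coord :: "('a, 'v) chart \<Rightarrow> 'a \<Rightarrow> 'v" where "coord \<equiv> snd"
abbreviation cimg :: "('a, 'v) chart \<Rightarrow> 'v set" where "cimg c \<equiv> coord c ` cdom c"
abbreviation cinv :: "('a, 'v) chart \<Rightarrow> 'v \<Rightarrow> 'a" where "cinv c \<equiv> inv_into (cdom c) (coord c)"

definition carrier :: "('a, 'v) chart set \<Rightarrow> 'a set" where
  "carrier A = (\<Union>c\<in>A. cdom c)"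

definition mtop :: "('a, 'v::euclidean_space) chart set \<Rightarrow> 'a topology" where
  "mtop A = topology (\<lambda>U. U \<subseteq> carrier A \<and> (\<forall>c\<in>A. open (coord c ` (U \<inter> cdom c))))"

definition transition :: "('a, 'v) chart \<Rightarrow> ('a, 'v) chart \<Rightarrow> 'v \<Rightarrow> 'v" where
  "transition c c' = coord c' \<circ> cinv c"

definition transition_deriv ::
    "('a, 'v::euclidean_space) chart \<Rightarrow> ('a, 'v) chart \<Rightarrow> 'a \<Rightarrow> 'v \<Rightarrow> 'v" where
  "transition_deriv c c' x = frechet_derivative (transition c c') (at (coord c x))"

definition smooth_atlas :: "('a, 'v::euclidean_space) chart set \<Rightarrow> bool" where
  "smooth_atlas A \<longleftrightarrow>
     (\<forall>c\<in>A. inj_on (coord c) (cdom c) \<and> open (cimg c)) \<and>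
     (\<forall>c\<in>A. \<forall>c'\<in>A. open (coord c ` (cdom c \<inter> cdom c')) \<and>
        smooth_on (coord c ` (cdom c \<inter> cdom c')) (transition c c'))"

definition manifold :: "('a, 'v::euclidean_space) chart set \<Rightarrow> bool" where
  "manifold A \<longleftrightarrow>
     smooth_atlas A \<and> Hausdorff_space (mtop A) \<and> second_countable (mtop A)"

lemma openin_mtop:
  assumes "smooth_atlas A"
  shows "openin (mtop A) U \<longleftrightarrow> U \<subseteq> carrier A \<and> (\<forall>c\<in>A. open (coord c ` (U \<inter> cdom c)))"
proof -
  let ?P = "\<lambda>U. U \<subseteq> carrier A \<and> (\<forall>c\<in>A. open (coord c ` (U \<inter> cdom c)))"
  have inj: "inj_on (coord c) (cdom c)" if "c \<in> A" for c
    using assms that by (auto simp: smooth_atlas_def)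
  have "istopology ?P"
    unfolding istopology_def
  proof (intro conjI allI impI ballI)
    fix S T c assume S: "?P S" and T: "?P T" and c: "c \<in> A"
    have "coord c ` (S \<inter> T \<inter> cdom c) = coord c ` (S \<inter> cdom c) \<inter> coord c ` (T \<inter> cdom c)"
      using inj[OF c] by (auto simp: inj_on_def)
    with S T c show "open (coord c ` (S \<inter> T \<inter> cdom c))" by auto
  next
    fix \<K> c assume K: "\<forall>K\<in>\<K>. ?P K" and c: "c \<in> A"
    have "coord c ` (\<Union>\<K> \<inter> cdom c) = (\<Union>K\<in>\<K>. coord c ` (K \<inter> cdom c))" by auto
    with K c show "open (coord c ` (\<Union>\<K> \<inter> cdom c))" by auto
  qed auto
  then show ?thesis by (simp add: mtop_def)
qed

text \<open>For continuous \<open>f\<close> the sets on which smoothness is tested are relatively open in \<open>S\<close>.\<close>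

definition smooth_map_into ::
    "'s::euclidean_space set \<Rightarrow> ('a, 'v::euclidean_space) chart set \<Rightarrow> ('s \<Rightarrow> 'a) \<Rightarrow> bool" where
  "smooth_map_into S A f \<longleftrightarrow>
     continuous_map (top_of_set S) (mtop A) f \<and>
     (\<forall>c\<in>A. smooth_on {s\<in>S. f s \<in> cdom c} (coord c \<circ> f))"

text \<open>A chart around \<open>x\<close>, used only to evaluate chart independent quantities.\<close>

definition chart_at :: "('a, 'v) chart set \<Rightarrow> 'a \<Rightarrow> ('a, 'v) chart" where
  "chart_at A x = (SOME c. c \<in> A \<and> x \<in> cdom c)"

text \<open>Tangent space, in the chart \<open>c\<close>, of an embedded submanifold \<open>S\<close>:
  velocities at \<open>x\<close> of smooth curves that stay in \<open>S\<close>.\<close>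

definition tangent_space ::
    "('a, 'v::euclidean_space) chart set \<Rightarrow> 'a set \<Rightarrow> 'a \<Rightarrow> ('a, 'v) chart \<Rightarrow> 'v set" where
  "tangent_space A S x c =
     {v. \<exists>\<epsilon>>0. \<exists>\<gamma>::real \<Rightarrow> 'a. smooth_map_into {-\<epsilon><..<\<epsilon>} A \<gamma> \<and> \<gamma> ` {-\<epsilon><..<\<epsilon>} \<subseteq> S \<and> \<gamma> 0 = x \<and>
        ((coord c \<circ> \<gamma>) has_vector_derivative v) (at 0)}"

definition transverse :: "('a, 'v::euclidean_space) chart set \<Rightarrow> 'a set \<Rightarrow> 'a set \<Rightarrow> bool" where
  "transverse A S T \<longleftrightarrow>
     (\<forall>x\<in>S \<inter> T. \<forall>c\<in>A. x \<in> cdom c \<longrightarrow>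
        {u + v | u v. u \<in> tangent_space A S x c \<and> v \<in> tangent_space A T x c} = UNIV)"


section \<open>Tensor fields, as components in each chart with their transformation laws\<close>

text \<open>\<open>g c y u v\<close> is the value at the point with coordinates \<open>y\<close> in the chart \<open>c\<close> on the
  vectors with components \<open>u\<close> and \<open>v\<close>; similarly for endomorphism fields.\<close>

type_synonym ('a, 'v) bilin_field = "('a, 'v) chart \<Rightarrow> 'v \<Rightarrow> 'v \<Rightarrow> 'v \<Rightarrow> real"
type_synonym ('a, 'v) endo_field = "('a, 'v) chart \<Rightarrow> 'v \<Rightarrow> 'v \<Rightarrow> 'v"

definition riemannian_metric ::
    "('a, 'v::euclidean_space) chart set \<Rightarrow> ('a, 'v) bilin_field \<Rightarrow> bool" where
  "riemannian_metric A g \<longleftrightarrow>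
     (\<forall>c\<in>A. (\<forall>u v. smooth_on (cimg c) (\<lambda>y. g c y u v)) \<and>
        (\<forall>y\<in>cimg c. bilinear (g c y) \<and> (\<forall>u v. g c y u v = g c y v u) \<and>
           (\<forall>u. u \<noteq> 0 \<longrightarrow> g c y u u > 0))) \<and>
     (\<forall>c\<in>A. \<forall>c'\<in>A. \<forall>x\<in>cdom c \<inter> cdom c'. \<forall>u v.
        g c' (coord c' x) (transition_deriv c c' x u) (transition_deriv c c' x v)
          = g c (coord c x) u v)"

definition almost_complex ::
    "('a, 'v::euclidean_space) chart set \<Rightarrow> ('a, 'v) endo_field \<Rightarrow> bool" where
  "almost_complex A J \<longleftrightarrow>
     (\<forall>c\<in>A. (\<forall>u. smooth_on (cimg c) (\<lambda>y. J c y u)) \<and>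
        (\<forall>y\<in>cimg c. linear (J c y) \<and> (\<forall>u. J c y (J c y u) = - u))) \<and>
     (\<forall>c\<in>A. \<forall>c'\<in>A. \<forall>x\<in>cdom c \<inter> cdom c'. \<forall>u.
        J c' (coord c' x) (transition_deriv c c' x u)
          = transition_deriv c c' x (J c (coord c x) u))"

text \<open>Riemannian distance: infimum of lengths of smooth paths. (Piecewise smooth paths become
  smooth after reparametrisation, so they give the same infimum.) It is \<open>\<infinity>\<close> between points in
  different components.\<close>

definition path_length ::
    "('a, 'v::euclidean_space) chart set \<Rightarrow> ('a, 'v) bilin_field \<Rightarrow> (real \<Rightarrow> 'a) \<Rightarrow> ennreal" where
  "path_length A g \<gamma> =
     (\<integral>\<^sup>+ s. ennreal
        (let c = chart_at A (\<gamma> s);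
             v = vector_derivative (coord c \<circ> \<gamma>) (at s within {0..1})
         in sqrt (g c (coord c (\<gamma> s)) v v)) * indicator {0..1} s \<partial>lborel)"

definition riem_dist ::
    "('a, 'v::euclidean_space) chart set \<Rightarrow> ('a, 'v) bilin_field \<Rightarrow> 'a \<Rightarrow> 'a \<Rightarrow> ennreal" where
  "riem_dist A g x y =
     (INF \<gamma>\<in>{\<gamma>. smooth_map_into {0..1} A \<gamma> \<and> \<gamma> 0 = x \<and> \<gamma> 1 = y}. path_length A g \<gamma>)"


section \<open>The cotangent bundle\<close>

text \<open>A covector at \<open>q\<close> is the family \<open>P\<close> of its component vectors \<open>P c\<close> in all the charts \<open>c\<close>
  of the atlas around \<open>q\<close>, which transform contragrediently; \<open>P c\<close> acts on the vector with
  components \<open>u\<close> by \<open>P c \<bullet> u\<close>. Irrelevant indices carry the value 0.\<close>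

type_synonym ('n, 'e) cotpt = "'n \<times> (('n, 'e) chart \<Rightarrow> 'e)"

definition cotangent :: "('n, 'e::euclidean_space) chart set \<Rightarrow> ('n, 'e) cotpt set" where
  "cotangent A = {(q, P). q \<in> carrier A \<and>
     (\<forall>c. c \<notin> A \<or> q \<notin> cdom c \<longrightarrow> P c = 0) \<and>
     (\<forall>c\<in>A. \<forall>c'\<in>A. q \<in> cdom c \<inter> cdom c' \<longrightarrow>
        (\<forall>u. P c \<bullet> u = P c' \<bullet> transition_deriv c c' q u))}"

definition cot_chart ::
    "('n, 'e::euclidean_space) chart set \<Rightarrow> ('n, 'e) chart \<Rightarrow> (('n, 'e) cotpt, 'e \<times> 'e) chart" where
  "cot_chart A c = ({x \<in> cotangent A. fst x \<in> cdom c}, \<lambda>x. (coord c (fst x), snd x c))"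

definition cot_atlas ::
    "('n, 'e::euclidean_space) chart set \<Rightarrow> (('n, 'e) cotpt, 'e \<times> 'e) chart set" where
  "cot_atlas A = cot_chart A ` A"

definition zero_section :: "('n, 'e::euclidean_space) chart set \<Rightarrow> ('n, 'e) cotpt set" where
  "zero_section A = {(q, \<lambda>_. 0) | q. q \<in> carrier A}"

definition cot_fibre :: "('n, 'e::euclidean_space) chart set \<Rightarrow> 'n \<Rightarrow> ('n, 'e) cotpt set" where
  "cot_fibre A q = {x \<in> cotangent A. fst x = q}"

text \<open>The Liouville form \<open>\<theta> = p dq\<close> and \<open>\<omega> = -d\<theta>\<close> have the same expression in all charts
  of the cotangent atlas.\<close>

definition liouville :: "'e::euclidean_space \<times> 'e \<Rightarrow> 'e \<times> 'e \<Rightarrow> real" where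
  "liouville z u = snd z \<bullet> fst u"

definition omega :: "'e::euclidean_space \<times> 'e \<Rightarrow> 'e \<times> 'e \<Rightarrow> 'e \<times> 'e \<Rightarrow> real" where
  "omega z u v = - ext_deriv liouville z u v"

lemma omega_eq: "omega z u v = fst u \<bullet> snd v - snd u \<bullet> fst v"
proof -
  have "((\<lambda>y. liouville y v) has_derivative (\<lambda>h. snd h \<bullet> fst v)) (at z)"
    for z v :: "'a \<times> 'a"
    unfolding liouville_def by (auto intro!: derivative_eq_intros)
  from frechet_derivative_at[OF this]
  have "frechet_derivative (\<lambda>y. liouville y v) (at z) = (\<lambda>h. snd h \<bullet> fst v)"
    for z v :: "'a \<times> 'a"
    by simp
  then show ?thesis by (simp add: omega_def ext_deriv_def inner_commute)
qed

text \<open>Compatible means tame together with invariance.\<close>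

definition omega_tame ::
    "('n, 'e::euclidean_space) chart set \<Rightarrow> (('n, 'e) cotpt, 'e \<times> 'e) endo_field \<Rightarrow> bool" where
  "omega_tame A J \<longleftrightarrow> (\<forall>C\<in>cot_atlas A. \<forall>z\<in>cimg C. \<forall>u. u \<noteq> 0 \<longrightarrow> omega z u (J C z u) > 0)"

definition omega_compatible ::
    "('n, 'e::euclidean_space) chart set \<Rightarrow> (('n, 'e) cotpt, 'e \<times> 'e) endo_field \<Rightarrow> bool" where
  "omega_compatible A J \<longleftrightarrow> omega_tame A J \<and>
     (\<forall>C\<in>cot_atlas A. \<forall>z\<in>cimg C. \<forall>u v. omega z (J C z u) (J C z v) = omega z u v)"

definition metric_of ::
    "(('n, 'e::euclidean_space) cotpt, 'e \<times> 'e) endo_field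
       \<Rightarrow> (('n, 'e) cotpt, 'e \<times> 'e) bilin_field" where
  "metric_of J C z u v = omega z u (J C z v)"

definition cdist ::
    "('n, 'e::euclidean_space) chart set \<Rightarrow> (('n, 'e) cotpt, 'e \<times> 'e) endo_field
       \<Rightarrow> ('n, 'e) cotpt \<Rightarrow> ('n, 'e) cotpt \<Rightarrow> ennreal" where
  "cdist A J = riem_dist (cot_atlas A) (metric_of J)"

definition dist_zero ::
    "('n, 'e::euclidean_space) chart set \<Rightarrow> (('n, 'e) cotpt, 'e \<times> 'e) endo_field
       \<Rightarrow> ('n, 'e) cotpt \<Rightarrow> ennreal" where
  "dist_zero A J x = (INF y\<in>zero_section A. cdist A J x y)"


section \<open>The canonical almost complex structure of a Riemannian metric\<close>

text \<open>Here \<open>g :: 'e \<Rightarrow> 'e \<Rightarrow> 'e \<Rightarrow> real\<close> is a metric in one chart. \<open>christoffel g y X Y\<close> is the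
  vector \<open>\<Gamma>(X,Y)\<close>, given by the Koszul formula for constant vector fields.\<close>

definition christoffel ::
    "('e::euclidean_space \<Rightarrow> 'e \<Rightarrow> 'e \<Rightarrow> real) \<Rightarrow> 'e \<Rightarrow> 'e \<Rightarrow> 'e \<Rightarrow> 'e" where
  "christoffel g y X Y = (THE W. \<forall>Z. 2 * g y W Z =
       frechet_derivative (\<lambda>y. g y Y Z) (at y) X
     + frechet_derivative (\<lambda>y. g y X Z) (at y) Y
     - frechet_derivative (\<lambda>y. g y X Y) (at y) Z)"

text \<open>The musical isomorphisms: components of \<open>g(X,\<cdot>)\<close>, and the inverse.\<close>

definition flat :: "('e::euclidean_space \<Rightarrow> 'e \<Rightarrow> 'e \<Rightarrow> real) \<Rightarrow> 'e \<Rightarrow> 'e \<Rightarrow> 'e" where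
  "flat g y X = (\<Sum>b\<in>Basis. g y X b *\<^sub>R b)"

definition sharp :: "('e::euclidean_space \<Rightarrow> 'e \<Rightarrow> 'e \<Rightarrow> real) \<Rightarrow> 'e \<Rightarrow> 'e \<Rightarrow> 'e" where
  "sharp g y a = (THE X. flat g y X = a)"

text \<open>Horizontal lift of \<open>X\<close> at \<open>z = (y,p)\<close> for the Levi-Civita connection: parallel covectors
  along a curve with velocity \<open>X\<close> satisfy \<open>p' = p \<circ> \<Gamma>(X,\<cdot>)\<close>. The vertical lift of a covector
  \<open>a\<close> is \<open>(0,a)\<close>.\<close>

definition hlift :: "('e::euclidean_space \<Rightarrow> 'e \<Rightarrow> 'e \<Rightarrow> real) \<Rightarrow> 'e \<times> 'e \<Rightarrow> 'e \<Rightarrow> 'e \<times> 'e" where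
  "hlift g z X = (X, \<Sum>b\<in>Basis. (snd z \<bullet> christoffel g (fst z) X b) *\<^sub>R b)"

text \<open>A tangent vector \<open>u\<close> is the horizontal lift of \<open>X = fst u\<close> plus the vertical lift of
  \<open>g(Y,\<cdot>)\<close>; the former is sent to the vertical lift of \<open>g(X,\<cdot>)\<close>, the latter to minus the
  horizontal lift of \<open>Y\<close>.\<close>

definition sasaki_J :: "('e::euclidean_space \<Rightarrow> 'e \<Rightarrow> 'e \<Rightarrow> real) \<Rightarrow> 'e \<times> 'e \<Rightarrow> 'e \<times> 'e \<Rightarrow> 'e \<times> 'e" where
  "sasaki_J g z u =
     (let X = fst u; Y = sharp g (fst z) (snd (u - hlift g z X))
      in (0, flat g (fst z) X) - hlift g z Y)"

definition equals_sasaki_on ::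
    "('n, 'e::euclidean_space) chart set \<Rightarrow> ('n, 'e) bilin_field \<Rightarrow>
       (('n, 'e) cotpt, 'e \<times> 'e) endo_field \<Rightarrow> ('n, 'e) cotpt set \<Rightarrow> bool" where
  "equals_sasaki_on A g J V \<longleftrightarrow>
     (\<forall>c\<in>A. \<forall>x\<in>V. fst x \<in> cdom c \<longrightarrow>
        (let C = cot_chart A c in J C (coord C x) = sasaki_J (g c) (coord C x)))"


section \<open>Pseudoconvex boundary\<close>

text \<open>Near each boundary point \<open>V\<close> is a regular sublevel set \<open>{\<rho> < 0}\<close>, and the Levi form
  \<open>-d(d\<rho> \<circ> J)(v, J v)\<close> is positive on the complex tangencies of the boundary. The condition
  does not depend on the choice of chart and of \<open>\<rho>\<close>.\<close>

definition J_convex_boundary ::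
    "('a, 'v::euclidean_space) chart set \<Rightarrow> ('a, 'v) endo_field \<Rightarrow> 'a set \<Rightarrow> bool" where
  "J_convex_boundary A J V \<longleftrightarrow>
     (\<forall>x \<in> (mtop A) frontier_of V. \<exists>c\<in>A. x \<in> cdom c \<and>
       (\<exists>W (\<rho>::'v \<Rightarrow> real). open W \<and> W \<subseteq> cimg c \<and> coord c x \<in> W \<and> smooth_on W \<rho> \<and>
          coord c ` (V \<inter> cdom c) \<inter> W = {y\<in>W. \<rho> y < 0} \<and>
          (\<forall>y\<in>W. frechet_derivative \<rho> (at y) \<noteq> (\<lambda>_. 0)) \<and>
          (let y = coord c x; d\<rho> = (\<lambda>y. frechet_derivative \<rho> (at y)) in
             \<forall>v. v \<noteq> 0 \<and> d\<rho> y v = 0 \<and> d\<rho> y (J c y v) = 0 \<longrightarrow>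
               - ext_deriv (\<lambda>y u. d\<rho> y (J c y u)) y v (J c y v) > 0)))"


section \<open>Hamiltonian flows\<close>

definition smooth_hamiltonian ::
    "('n, 'e::euclidean_space) chart set \<Rightarrow> (real \<Rightarrow> ('n, 'e) cotpt \<Rightarrow> real) \<Rightarrow> bool" where
  "smooth_hamiltonian A H \<longleftrightarrow>
     (\<forall>C\<in>cot_atlas A. smooth_on ({0..1} \<times> cimg C) (\<lambda>(t, z). H t (cinv C z)))"

text \<open>The convention is \<open>\<omega>(X_H, \<cdot>) = dH\<close>.\<close>

definition ham_vf ::
    "(('n, 'e::euclidean_space) cotpt, 'e \<times> 'e) chart \<Rightarrow> (('n, 'e) cotpt \<Rightarrow> real) \<Rightarrow>
       'e \<times> 'e \<Rightarrow> 'e \<times> 'e" where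
  "ham_vf C h z = (THE X. \<forall>v. omega z X v = frechet_derivative (h \<circ> cinv C) (at z) v)"

text \<open>A flow must exist for all times in \<open>[0,1]\<close> and consist of bijections of the cotangent
  bundle, which is a condition on \<open>H\<close> at infinity.\<close>

definition is_ham_flow ::
    "('n, 'e::euclidean_space) chart set \<Rightarrow> (real \<Rightarrow> ('n, 'e) cotpt \<Rightarrow> real) \<Rightarrow>
       (real \<Rightarrow> ('n, 'e) cotpt \<Rightarrow> ('n, 'e) cotpt) \<Rightarrow> bool" where
  "is_ham_flow A H \<phi> \<longleftrightarrow>
     (\<forall>t\<in>{0..1}. bij_betw (\<phi> t) (cotangent A) (cotangent A)) \<and>
     (\<forall>x\<in>cotangent A. \<phi> 0 x = x \<and>
        continuous_map (top_of_set {0..1}) (mtop (cot_atlas A)) (\<lambda>t. \<phi> t x) \<and>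
        (\<forall>t\<in>{0..1}. \<forall>C\<in>cot_atlas A. \<phi> t x \<in> cdom C \<longrightarrow>
           ((\<lambda>s. coord C (\<phi> s x)) has_vector_derivative ham_vf C (H t) (coord C (\<phi> t x)))
             (at t within {0..1})))"

definition ham_flow ::
    "('n, 'e::euclidean_space) chart set \<Rightarrow> (real \<Rightarrow> ('n, 'e) cotpt \<Rightarrow> real) \<Rightarrow>
       real \<Rightarrow> ('n, 'e) cotpt \<Rightarrow> ('n, 'e) cotpt" where
  "ham_flow A H = (SOME \<phi>. is_ham_flow A H \<phi>)"

definition dbar ::
    "('n, 'e::euclidean_space) chart set \<Rightarrow> (('n, 'e) cotpt, 'e \<times> 'e) endo_field \<Rightarrow>
       (('n, 'e) cotpt \<Rightarrow> ('n, 'e) cotpt) \<Rightarrow> (('n, 'e) cotpt \<Rightarrow> ('n, 'e) cotpt) \<Rightarrow> ennreal" where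
  "dbar A J \<phi> \<psi> =
     max (SUP x\<in>cotangent A. cdist A J (\<phi> x) (\<psi> x))
         (SUP x\<in>cotangent A. cdist A J (inv_into (cotangent A) \<phi> x) (inv_into (cotangent A) \<psi> x))"

definition H_engulf ::
    "('n, 'e::euclidean_space) chart set \<Rightarrow> (('n, 'e) cotpt, 'e \<times> 'e) endo_field \<Rightarrow>
       ('n, 'e) cotpt set \<Rightarrow> real \<Rightarrow> (real \<Rightarrow> ('n, 'e) cotpt \<Rightarrow> real) set" where
  "H_engulf A J V \<delta> = {H. smooth_hamiltonian A H \<and> (\<exists>\<phi>. is_ham_flow A H \<phi>) \<and>
     (\<forall>t\<in>{0..1}. ham_flow A H t ` zero_section A \<subseteq> V) \<and>
     dbar A J (ham_flow A H 1) id \<le> ennreal \<delta>}"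

definition L_ham ::
    "('n, 'e::euclidean_space) chart set \<Rightarrow> (real \<Rightarrow> ('n, 'e) cotpt \<Rightarrow> real) \<Rightarrow>
       ('n, 'e) cotpt set" where
  "L_ham A H = ham_flow A H 1 ` zero_section A"


section \<open>Pseudoholomorphic triangles\<close>

text \<open>The disc is \<open>cball 0 1\<close> in the complex plane. On \<open>S\<close>, the disc without the three marked
  points, the map is smooth up to the boundary and its differential is complex linear.\<close>

definition J_holomorphic_on ::
    "('a, 'v::euclidean_space) chart set \<Rightarrow> ('a, 'v) endo_field \<Rightarrow> complex set \<Rightarrow>
       (complex \<Rightarrow> 'a) \<Rightarrow> bool" where
  "J_holomorphic_on A J S w \<longleftrightarrow> smooth_map_into S A w \<and>
     (\<forall>z\<in>S. \<forall>c\<in>A. w z \<in> cdom c \<longrightarrow>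
        (\<exists>D. ((coord c \<circ> w) has_derivative D) (at z within S) \<and>
             (\<forall>\<xi>. D (\<i> * \<xi>) = J c (coord c (w z)) (D \<xi>))))"

text \<open>\<open>pullback A \<beta> w z \<xi> \<eta>\<close> is \<open>(w\<^sup>*\<beta>)(\<xi>,\<eta>)\<close> at \<open>z\<close>, for \<open>z\<close> interior to the domain of \<open>w\<close>.\<close>

definition pullback ::
    "('a, 'v::euclidean_space) chart set \<Rightarrow> ('a, 'v) bilin_field \<Rightarrow> (complex \<Rightarrow> 'a) \<Rightarrow>
       complex \<Rightarrow> complex \<Rightarrow> complex \<Rightarrow> real" where
  "pullback A \<beta> w z \<xi> \<eta> =
     (let c = chart_at A (w z); D = frechet_derivative (coord c \<circ> w) (at z)
      in \<beta> c (coord c (w z)) (D \<xi>) (D \<eta>))"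

definition finite_energy ::
    "('n, 'e::euclidean_space) chart set \<Rightarrow> (('n, 'e) cotpt, 'e \<times> 'e) endo_field \<Rightarrow>
       (complex \<Rightarrow> ('n, 'e) cotpt) \<Rightarrow> bool" where
  "finite_energy A J w \<longleftrightarrow>
     set_integrable lborel (ball 0 1)
       (\<lambda>z. (pullback (cot_atlas A) (metric_of J) w z 1 1
           + pullback (cot_atlas A) (metric_of J) w z \<i> \<i>) / 2)"

definition area :: "('n, 'e::euclidean_space) chart set \<Rightarrow> (complex \<Rightarrow> ('n, 'e) cotpt) \<Rightarrow> real" where
  "area A w = (LINT z:ball 0 1|lborel. pullback (cot_atlas A) (\<lambda>_. omega) w z 1 \<i>)"

text \<open>The three marked points, and the arcs between them, are parametrised by angles
  \<open>t0 < t1 < t2 < t0 + 2 * pi\<close>.\<close>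

definition M3_at ::
    "('n, 'e::euclidean_space) chart set \<Rightarrow> (('n, 'e) cotpt, 'e \<times> 'e) endo_field \<Rightarrow>
       ('n, 'e) cotpt set \<Rightarrow> ('n, 'e) cotpt set \<Rightarrow> ('n, 'e) cotpt set \<Rightarrow>
       ('n, 'e) cotpt \<Rightarrow> ('n, 'e) cotpt \<Rightarrow> ('n, 'e) cotpt \<Rightarrow>
       ((complex \<Rightarrow> ('n, 'e) cotpt) \<times> (complex \<times> complex \<times> complex)) set" where
  "M3_at A J L0 L1 L2 x1 x2 x0 = {(w, (z0, z1, z2)).
     continuous_map (top_of_set (cball 0 1)) (mtop (cot_atlas A)) w \<and>
     J_holomorphic_on (cot_atlas A) J (cball 0 1 - {z0, z1, z2}) w \<and>
     finite_energy A J w \<and>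
     w z0 = x0 \<and> w z1 = x1 \<and> w z2 = x2 \<and>
     (\<exists>t0 t1 t2. t0 < t1 \<and> t1 < t2 \<and> t2 < t0 + 2 * pi \<and>
        z0 = cis t0 \<and> z1 = cis t1 \<and> z2 = cis t2 \<and>
        w ` cis ` {t0..t1} \<subseteq> L0 \<and> w ` cis ` {t1..t2} \<subseteq> L1 \<and> w ` cis ` {t2..t0 + 2 * pi} \<subseteq> L2)}"

definition M3 ::
    "('n, 'e::euclidean_space) chart set \<Rightarrow> (('n, 'e) cotpt, 'e \<times> 'e) endo_field \<Rightarrow>
       ('n, 'e) cotpt set \<Rightarrow> ('n, 'e) cotpt set \<Rightarrow> ('n, 'e) cotpt set \<Rightarrow>
       ((complex \<Rightarrow> ('n, 'e) cotpt) \<times> (complex \<times> complex \<times> complex)) set" where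
  "M3 A J L0 L1 L2 = (\<Union>x1\<in>L0 \<inter> L1. \<Union>x2\<in>L1 \<inter> L2. \<Union>x0\<in>L0 \<inter> L2. M3_at A J L0 L1 L2 x1 x2 x0)"

end

theory Submission
  imports Defs
begin

text \<open>Let \<open>F\<close> be the composition of \<open>w\<close> with the energy \<open>|p|\<^sup>2 / 2\<close>, and choose \<open>r\<close> such that energy less
  than \<open>r\<close> forces membership in \<open>V\<close>. For the Sasakian structure the differential of the energy
  composed with \<open>J\<close> is the Liouville form; hence on \<open>V\<close> the area density of \<open>w\<close> is the Laplacian of
  \<open>F\<close>, and \<open>F\<close> has vanishing normal derivative along boundary arcs in a cotangent fibre. If the image
  lies in \<open>V\<close>, the divergence theorem for \<open>\<chi>(F) \<nabla>F\<close> bounds \<open>F\<close> by its maximum on the arc in \<open>L_H\<close>,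
  where \<open>F \<le> \<delta>\<^sup>2 / 2\<close>; radial paths in the fibres turn this into the distance bound. Otherwise some
  point of the disc which is not critical for \<open>F\<close> has energy between \<open>3 r / 8\<close> and \<open>3 r / 4\<close>, and
  there is such a point either on the fibre arc or in the interior, away from all boundary values of
  \<open>F\<close>. The area inside a coordinate ball about its image is bounded below by the monotonicity
  argument: Stokes' theorem for \<open>\<phi>(rho) \<lambda>\<close>, with \<open>rho\<close> the squared distance to the centre for the
  frozen metric, \<open>\<lambda>\<close> the radial primitive of the frozen symplectic form, and \<open>\<phi>\<close> a cutoff of
  \<open>(1 / sqrt rho + C)\<^sup>2\<close>. The primitive vanishes along the fibre through the centre, so a centre on the
  fibre arc is admissible. The constants are uniform because \<open>N\<close> is compact.\<close>

section \<open>Mixed partial derivatives\<close>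

text \<open>The obstacle is the marked points: \<open>w\<close> is merely continuous there, and its
  first derivatives may be unbounded. So the divergence theorem is needed in a form that asks only
  for an integrable divergence and for a normal component tending to 0 at the circle. Each field is
  multiplied by a function of a scalar (the energy, or the distance to a centre) that vanishes near
  the marked points, and its divergence is dominated by a multiple of the area density, which is
  integrable by finite energy. In the second alternative the area is sought at energies below
  \<open>r\<close>, where points lie in \<open>V\<close> and momenta are bounded. The centre must be
  an immersed point, because the decisive contribution comes from an arbitrarily small neighbourhood
  in which \<open>w\<close> is compared with its linear part; a nonzero derivative of the energy
  along a curve certifies such a point. The structure differs from its frozen value by a Lipschitz
  error, which disturbs the scale-invariant monotonicity inequality by a factor
  \<open>1 + 6 * \<kappa> * sqrt s\<close>; the weight solves the differential equation with this
  factor.\<close>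

lemma has_derivative_along_line:
  assumes "(f has_derivative f') (at (w + x *\<^sub>R v))"
  shows "((\<lambda>t. f (w + t *\<^sub>R v)) has_derivative (\<lambda>t. f' (t *\<^sub>R v))) (at x within S)"
  by (rule has_derivative_compose[where f = "\<lambda>t. w + t *\<^sub>R v" and g = f, OF _ assms])
    (auto intro!: derivative_eq_intros)

text \<open>Difference quotients in direction \<open>v\<close> integrate to 0 because Lebesgue
  measure is translation invariant; dominated convergence carries this over to the
  derivative.\<close>

lemma integral_directional_derivative_eq_0:
  fixes u :: "'a::euclidean_space \<Rightarrow> real"
  assumes D: "\<And>z. (u has_derivative u' z) (at z)"
    and cont: "continuous_on UNIV (\<lambda>z. u' z v)"
    and supp: "\<And>z. norm z > r \<Longrightarrow> u z = 0"
  shows "integral\<^sup>L lborel (\<lambda>z. u' z v) = 0"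
proof -
  \<comment> \<open>Large enough to contain the support of every difference quotient with step at
    most 1.\<close>
  define K where "K = cball (0::'a) (\<bar>r\<bar> + norm v)"
  have [measurable]: "u \<in> borel_measurable borel"
    using D by (intro borel_measurable_continuous_onI)
      (meson continuous_at_imp_continuous_on has_derivative_continuous)
  have contu: "continuous_on S u" for S
    using D by (meson continuous_at_imp_continuous_on has_derivative_continuous)
  have [measurable]: "(\<lambda>z. u' z v) \<in> borel_measurable borel"
    using cont by (intro borel_measurable_continuous_onI)
  have u'0: "u' z v = 0" if "norm z > r" for z
  proof -
    have "open {z::'a. r < norm z}" by (intro open_Collect_less continuous_intros)
    then have "((\<lambda>_. 0) has_derivative u' z) (at z)"
      using D[of z] that supp by (intro has_derivative_transform_within_open[OF D[of z], of "{z. r < norm z}"]) auto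
    then have "u' z = (\<lambda>_. 0)"
      using has_derivative_unique[OF _ has_derivative_const[of 0 "at z"]] by blast
    then show ?thesis by simp
  qed
  have "compact ((\<lambda>z. u' z v) ` K)"
    unfolding K_def by (intro compact_continuous_image continuous_on_subset[OF cont]) auto
  then obtain B0 where B0: "\<And>z. z \<in> K \<Longrightarrow> \<bar>u' z v\<bar> \<le> B0"
    by (metis bounded_iff compact_imp_bounded imageI real_norm_def)
  define B where "B = max B0 0"
  have B: "\<bar>u' z v\<bar> \<le> B" for z
  proof (cases "z \<in> K")
    case False
    then have "norm z > \<bar>r\<bar> + norm v" by (simp add: K_def)
    then have "norm z > r" using norm_ge_zero[of v] by linarith
    then show ?thesis using u'0 by (auto simp: B_def)
  qed (use B0 in \<open>force simp: B_def\<close>)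
  define h where "h n = 1 / real (Suc n)" for n
  have h: "0 < h n" "h n \<le> 1" for n by (auto simp: h_def)
  define s where "s n z = (u (z + h n *\<^sub>R v) - u z) / h n" for n z
  have intu: "integrable lborel u"
  proof -
    have "integrable lborel (\<lambda>x. indicat_real K x *\<^sub>R u x)"
      unfolding K_def by (intro borel_integrable_compact contu) auto
    moreover have "indicat_real K x *\<^sub>R u x = u x" for x
    proof (cases "x \<in> K")
      case False
      then have "norm x > \<bar>r\<bar> + norm v" by (simp add: K_def)
      then have "norm x > r" using norm_ge_zero[of v] by linarith
      then show ?thesis by (simp add: supp)
    qed simp
    ultimately show ?thesis by (simp only:)
  qed
  have shift: "integral\<^sup>L lborel (\<lambda>z. u (z + c)) = integral\<^sup>L lborel u"
    and ishift: "integrable lborel (\<lambda>z. u (z + c))" for c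
  proof -
    have *: "distr lborel borel ((+) c) = (lborel :: 'a measure)" by (rule lborel_distr_plus)
    have "integral\<^sup>L (distr lborel borel ((+) c)) u = integral\<^sup>L lborel (\<lambda>z. u (c + z))"
      by (rule integral_distr) auto
    then show "integral\<^sup>L lborel (\<lambda>z. u (z + c)) = integral\<^sup>L lborel u"
      by (simp add: * add.commute)
    have "integrable (distr lborel borel ((+) c)) u = integrable lborel (\<lambda>z. u (c + z))"
      by (rule integrable_distr_eq) auto
    then show "integrable lborel (\<lambda>z. u (z + c))"
      using intu by (simp add: * add.commute)
  qed
  have "integral\<^sup>L lborel (s n) = 0" for n
    unfolding s_def using intu ishift shift by (simp add: Bochner_Integration.integral_diff)
  moreover have "(\<lambda>n. integral\<^sup>L lborel (s n)) \<longlonglongrightarrow> integral\<^sup>L lborel (\<lambda>z. u' z v)"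
  proof (rule integral_dominated_convergence[where w = "\<lambda>z. indicat_real K z *\<^sub>R B"])
    show "integrable lborel (\<lambda>z. indicat_real K z *\<^sub>R B)"
      unfolding K_def by (intro borel_integrable_compact) auto
    have [measurable]: "s n \<in> borel_measurable borel" for n
      unfolding s_def by measurable
    show "s n \<in> borel_measurable lborel" for n by simp
    show "AE z in lborel. (\<lambda>n. s n z) \<longlonglongrightarrow> u' z v"
    proof (rule AE_I2)
      fix z
      have "((\<lambda>t. u (z + t *\<^sub>R v)) has_derivative (\<lambda>t. u' z (t *\<^sub>R v))) (at 0)"
        using D[of z] by (intro has_derivative_along_line) simp
      moreover have "u' z (t *\<^sub>R v) = u' z v * t" for t
        using has_derivative_linear[OF D[of z]] by (simp add: linear_cmul)
      ultimately have "((\<lambda>t. u (z + t *\<^sub>R v)) has_field_derivative u' z v) (at 0)"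
        by (simp add: has_field_derivative_def)
      then have lim: "((\<lambda>t. (u (z + t *\<^sub>R v) - u z) / t) \<longlongrightarrow> u' z v) (at 0)"
        by (simp add: DERIV_def)
      have "h \<longlonglongrightarrow> 0" unfolding h_def by (rule LIMSEQ_Suc[OF lim_1_over_n])
      then have "filterlim h (at 0) sequentially"
        using h by (simp add: filterlim_at less_imp_neq[symmetric])
      from filterlim_compose[OF lim this] show "(\<lambda>n. s n z) \<longlonglongrightarrow> u' z v"
        by (simp add: s_def)
    qed
    show "AE z in lborel. norm (s n z) \<le> indicat_real K z *\<^sub>R B" for n
    proof (rule AE_I2)
      fix z
      show "norm (s n z) \<le> indicat_real K z *\<^sub>R B"
      proof (cases "z \<in> K")
        case True
        have d: "((\<lambda>t. u (z + t *\<^sub>R v)) has_derivative (\<lambda>t. u' (z + x *\<^sub>R v) (t *\<^sub>R v))) (at x within {0..h n})" for x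
          by (intro has_derivative_along_line D)
        obtain x where "u (z + h n *\<^sub>R v) - u (z + 0 *\<^sub>R v) = u' (z + x *\<^sub>R v) ((h n - 0) *\<^sub>R v)"
          using mvt_simple[OF h(1)[of n], of "\<lambda>t. u (z + t *\<^sub>R v)", OF d] by auto
        then have "u (z + h n *\<^sub>R v) - u z = h n * u' (z + x *\<^sub>R v) v"
          using has_derivative_linear[OF D] by (simp add: linear_cmul)
        then have "s n z = u' (z + x *\<^sub>R v) v" using h[of n] by (simp add: s_def)
        then show ?thesis using B True by simp
      next
        case False
        then have z: "norm z > \<bar>r\<bar> + norm v" by (simp add: K_def)
        have "norm (h n *\<^sub>R v) \<le> norm v" using h[of n] by (simp add: mult_left_le_one_le)
        then have "norm (z + h n *\<^sub>R v) > r" using z norm_triangle_ineq4[of "z + h n *\<^sub>R v" "h n *\<^sub>R v"] by auto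
        moreover have "norm z > r" using z norm_ge_zero[of v] by linarith
        ultimately show ?thesis using False by (simp add: s_def supp)
      qed
    qed
  qed simp
  ultimately show ?thesis by (simp add: LIMSEQ_const_iff)
qed

text \<open>Two applications of the mean value theorem, along \<open>v\<close> and then along
  \<open>u\<close>. The second difference on the left is symmetric in \<open>u\<close> and
  \<open>v\<close>, so exchanging them expresses it by the other mixed derivative.\<close>

lemma second_difference_eq:
  fixes f :: "'a::real_normed_vector \<Rightarrow> real"
  assumes h: "h > 0"
    and dom: "\<And>s t. s \<in> {0..h} \<Longrightarrow> t \<in> {0..h} \<Longrightarrow> z + s *\<^sub>R u + t *\<^sub>R v \<in> U"
    and f: "\<And>x. x \<in> U \<Longrightarrow> (f has_derivative f' x) (at x)"
    and f': "\<And>x. x \<in> U \<Longrightarrow> ((\<lambda>y. f' y v) has_derivative f2 x) (at x)"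
  shows "\<exists>s\<in>{0..h}. \<exists>t\<in>{0..h}.
    f (z + h *\<^sub>R u + h *\<^sub>R v) - f (z + h *\<^sub>R v) - f (z + h *\<^sub>R u) + f z = h\<^sup>2 * f2 (z + s *\<^sub>R u + t *\<^sub>R v) u"
proof -
  have d1: "((\<lambda>t. f (z + h *\<^sub>R u + t *\<^sub>R v) - f (z + 0 *\<^sub>R u + t *\<^sub>R v)) has_derivative
      (\<lambda>\<tau>. f' (z + h *\<^sub>R u + t *\<^sub>R v) (\<tau> *\<^sub>R v) - f' (z + 0 *\<^sub>R u + t *\<^sub>R v) (\<tau> *\<^sub>R v))) (at t within {0..h})"
    if "t \<in> {0..h}" for t
  proof (intro has_derivative_diff)
    have g: "((\<lambda>t. f (w + t *\<^sub>R v)) has_derivative (\<lambda>\<tau>. f' (w + t *\<^sub>R v) (\<tau> *\<^sub>R v))) (at t within {0..h})"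
      if "w + t *\<^sub>R v \<in> U" for w
      using f[OF that] by (rule has_derivative_along_line)
    show "((\<lambda>t. f (z + h *\<^sub>R u + t *\<^sub>R v)) has_derivative (\<lambda>\<tau>. f' (z + h *\<^sub>R u + t *\<^sub>R v) (\<tau> *\<^sub>R v))) (at t within {0..h})"
      using g dom that h by (simp add: dom)
    show "((\<lambda>t. f (z + 0 *\<^sub>R u + t *\<^sub>R v)) has_derivative (\<lambda>\<tau>. f' (z + 0 *\<^sub>R u + t *\<^sub>R v) (\<tau> *\<^sub>R v))) (at t within {0..h})"
      by (rule g, rule dom) (use that h in auto)
  qed
  obtain t where t: "t \<in> {0<..<h}"
    and e1: "(f (z + h *\<^sub>R u + h *\<^sub>R v) - f (z + 0 *\<^sub>R u + h *\<^sub>R v)) - (f (z + h *\<^sub>R u + 0 *\<^sub>R v) - f (z + 0 *\<^sub>R u + 0 *\<^sub>R v))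
      = f' (z + h *\<^sub>R u + t *\<^sub>R v) ((h - 0) *\<^sub>R v) - f' (z + 0 *\<^sub>R u + t *\<^sub>R v) ((h - 0) *\<^sub>R v)"
    using mvt_simple[OF h, OF d1] by fastforce
  have lin: "f' (z + s *\<^sub>R u + t *\<^sub>R v) (h *\<^sub>R v) = h * f' (z + s *\<^sub>R u + t *\<^sub>R v) v" if "s \<in> {0..h}" for s
    using has_derivative_linear[OF f[OF dom[OF that, of t]]] t by (simp add: linear_cmul)
  have d2: "((\<lambda>s. f' (z + s *\<^sub>R u + t *\<^sub>R v) v) has_derivative
      (\<lambda>\<sigma>. f2 (z + s *\<^sub>R u + t *\<^sub>R v) (\<sigma> *\<^sub>R u))) (at s within {0..h})" if "s \<in> {0..h}" for s
    using has_derivative_along_line[of "\<lambda>y. f' y v" _ "z + t *\<^sub>R v" s u "{0..h}"] f'[OF dom[OF that, of t]] t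
    by (simp add: add.assoc add.commute add.left_commute)
  obtain s where s: "s \<in> {0<..<h}"
    and e2: "f' (z + h *\<^sub>R u + t *\<^sub>R v) v - f' (z + 0 *\<^sub>R u + t *\<^sub>R v) v = f2 (z + s *\<^sub>R u + t *\<^sub>R v) ((h - 0) *\<^sub>R u)"
    using mvt_simple[OF h, OF d2] by fastforce
  have lin2: "f2 (z + s *\<^sub>R u + t *\<^sub>R v) (h *\<^sub>R u) = h * f2 (z + s *\<^sub>R u + t *\<^sub>R v) u"
    using has_derivative_linear[OF f'[OF dom[of s t]]] s t by (simp add: linear_cmul)
  have "f (z + h *\<^sub>R u + h *\<^sub>R v) - f (z + h *\<^sub>R v) - f (z + h *\<^sub>R u) + f z = h * (h * f2 (z + s *\<^sub>R u + t *\<^sub>R v) u)"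
    using e1 e2 lin[of h] lin[of 0] lin2 h by (simp add: right_diff_distrib [symmetric])
  then show ?thesis using s t by (intro bexI[of _ s] bexI[of _ t]) (auto simp: power2_eq_square)
qed

text \<open>Both mixed derivatives arise from the same second difference divided by
  \<open>h\<^sup>2\<close>, at two points that tend to \<open>z\<close>. Continuity is asked of the
  derivatives in fixed directions, the form in which \<open>chart_rep\<close> records the second
  derivatives.\<close>

lemma mixed_derivatives_commute_real:
  fixes f :: "'a::real_normed_vector \<Rightarrow> real"
  assumes U: "open U" "z \<in> U"
    and f: "\<And>x. x \<in> U \<Longrightarrow> (f has_derivative f' x) (at x)"
    and fu: "\<And>x. x \<in> U \<Longrightarrow> ((\<lambda>y. f' y u) has_derivative fu x) (at x)"
    and fv: "\<And>x. x \<in> U \<Longrightarrow> ((\<lambda>y. f' y v) has_derivative fv x) (at x)"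
    and cu: "continuous_on U (\<lambda>x. fu x v)" and cv: "continuous_on U (\<lambda>x. fv x u)"
  shows "fu z v = fv z u"
proof -
  obtain r where r: "r > 0" "ball z r \<subseteq> U" using U open_contains_ball by blast
  \<comment> \<open>For \<open>h < k\<close> the parallelogram with sides \<open>h\<close> times
    \<open>u\<close> and \<open>v\<close> at \<open>z\<close> stays inside
    \<open>ball z r\<close>.\<close>
  define k where "k = r / (1 + norm u + norm v)"
  have k: "k > 0" using r by (auto simp: k_def intro!: divide_pos_pos add_pos_nonneg)
  have N: "1 + norm u + norm v > 0" by (auto intro!: add_pos_nonneg)
  have bd: "norm (s *\<^sub>R u + t *\<^sub>R v) \<le> h * (norm u + norm v)" if "s \<in> {0..h}" "t \<in> {0..h}" for s t h
    using that norm_triangle_ineq[of "s *\<^sub>R u" "t *\<^sub>R v"] mult_right_mono[of s h "norm u"] mult_right_mono[of t h "norm v"]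
    by (auto simp: algebra_simps)
  have dom: "z + s *\<^sub>R u + t *\<^sub>R v \<in> U" if "s \<in> {0..h}" "t \<in> {0..h}" "0 < h" "h < k" for s t h
  proof -
    have "h * (norm u + norm v) \<le> h * (1 + norm u + norm v)" using that by (simp add: mult_left_mono)
    also have "\<dots> < r" using that N by (simp add: k_def pos_less_divide_eq)
    finally have "dist z (z + s *\<^sub>R u + t *\<^sub>R v) < r"
      using bd[OF that(1,2)] by (subst dist_commute) (simp add: dist_norm add.assoc)
    then show ?thesis using r by auto
  qed
  have ex: "\<exists>p q. norm (p - z) \<le> h * (norm u + norm v) \<and> norm (q - z) \<le> h * (norm u + norm v) \<and> fv p u = fu q v"
    if h: "0 < h" "h < k" for h
  proof -
    obtain s t where 1: "s \<in> {0..h}" "t \<in> {0..h}"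
      "f (z + h *\<^sub>R u + h *\<^sub>R v) - f (z + h *\<^sub>R v) - f (z + h *\<^sub>R u) + f z = h\<^sup>2 * fv (z + s *\<^sub>R u + t *\<^sub>R v) u"
      using second_difference_eq[OF h(1), of z u v U f f' fv, OF dom[OF _ _ h] f fv] by blast
    have dom': "z + s *\<^sub>R v + t *\<^sub>R u \<in> U" if "s \<in> {0..h}" "t \<in> {0..h}" for s t
      using dom[OF that(2,1) h] by (simp add: algebra_simps)
    obtain s' t' where 2: "s' \<in> {0..h}" "t' \<in> {0..h}"
      "f (z + h *\<^sub>R v + h *\<^sub>R u) - f (z + h *\<^sub>R u) - f (z + h *\<^sub>R v) + f z = h\<^sup>2 * fu (z + s' *\<^sub>R v + t' *\<^sub>R u) v"
      using second_difference_eq[OF h(1), of z v u U f f' fu, OF dom' f fu] by blast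
    have "f (z + h *\<^sub>R u + h *\<^sub>R v) = f (z + h *\<^sub>R v + h *\<^sub>R u)" by (simp add: algebra_simps)
    then have "h\<^sup>2 * fv (z + s *\<^sub>R u + t *\<^sub>R v) u = h\<^sup>2 * fu (z + s' *\<^sub>R v + t' *\<^sub>R u) v" using 1(3) 2(3) by linarith
    then have "fv (z + s *\<^sub>R u + t *\<^sub>R v) u = fu (z + s' *\<^sub>R v + t' *\<^sub>R u) v" using h(1) by simp
    moreover have "norm (z + s *\<^sub>R u + t *\<^sub>R v - z) \<le> h * (norm u + norm v)" using bd[OF 1(1,2)] by (simp add: add.assoc)
    moreover have "norm (z + s' *\<^sub>R v + t' *\<^sub>R u - z) \<le> h * (norm u + norm v)" using bd[OF 2(2,1)] by (simp add: algebra_simps)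
    ultimately show ?thesis by blast
  qed
  have "\<bar>fu z v - fv z u\<bar> < e" if "e > 0" for e
  proof -
    obtain d1 where d1: "d1 > 0" "\<And>x. dist x z < d1 \<Longrightarrow> dist (fu x v) (fu z v) < e/2"
    proof -
      have "isCont (\<lambda>x. fu x v) z" using cu U by (simp add: continuous_on_eq_continuous_at)
      then show ?thesis using that half_gt_zero[OF \<open>e > 0\<close>] unfolding continuous_at_eps_delta by blast
    qed
    obtain d2 where d2: "d2 > 0" "\<And>x. dist x z < d2 \<Longrightarrow> dist (fv x u) (fv z u) < e/2"
    proof -
      have "isCont (\<lambda>x. fv x u) z" using cv U by (simp add: continuous_on_eq_continuous_at)
      then show ?thesis using that half_gt_zero[OF \<open>e > 0\<close>] unfolding continuous_at_eps_delta by blast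
    qed
    define h where "h = min (k/2) (min d1 d2 / (2 * (1 + norm u + norm v)))"
    have h: "0 < h" "h < k" using k d1 d2 N by (auto simp: h_def)
    have "h * (norm u + norm v) \<le> h * (1 + norm u + norm v)" using h by (simp add: mult_left_mono)
    also have "\<dots> \<le> min d1 d2 / 2"
    proof -
      have "h \<le> min d1 d2 / 2 / (1 + norm u + norm v)" by (simp add: h_def)
      then show ?thesis using N by (subst (asm) pos_le_divide_eq)
    qed
    also have "\<dots> < min d1 d2" using d1 d2 by auto
    finally have "h * (norm u + norm v) < min d1 d2" .
    then obtain p q where "dist p z < d2" "dist q z < d1" "fv p u = fu q v"
      using ex[OF h] by (force simp: dist_norm)
    then have "\<bar>fu q v - fu z v\<bar> < e/2" "\<bar>fu q v - fv z u\<bar> < e/2"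
      using d1(2)[of q] d2(2)[of p] by (auto simp: dist_real_def)
    then show ?thesis by linarith
  qed
  from this[of "\<bar>fu z v - fv z u\<bar>"] show ?thesis by fastforce
qed

lemma mixed_derivatives_commute:
  fixes f :: "'a::real_normed_vector \<Rightarrow> 'b::euclidean_space"
  assumes U: "open U" "z \<in> U"
    and f: "\<And>x. x \<in> U \<Longrightarrow> (f has_derivative f' x) (at x)"
    and fu: "\<And>x. x \<in> U \<Longrightarrow> ((\<lambda>y. f' y u) has_derivative fu x) (at x)"
    and fv: "\<And>x. x \<in> U \<Longrightarrow> ((\<lambda>y. f' y v) has_derivative fv x) (at x)"
    and cu: "continuous_on U (\<lambda>x. fu x v)" and cv: "continuous_on U (\<lambda>x. fv x u)"
  shows "fu z v = fv z u"
proof (rule euclidean_eqI)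
  fix b :: 'b assume "b \<in> Basis"
  show "fu z v \<bullet> b = fv z u \<bullet> b"
    by (rule mixed_derivatives_commute_real[where f = "\<lambda>x. f x \<bullet> b" and f' = "\<lambda>x h. f' x h \<bullet> b" and U = U
          and fu = "\<lambda>x h. fu x h \<bullet> b" and fv = "\<lambda>x h. fv x h \<bullet> b"])
      (use U in \<open>auto intro!: has_derivative_inner_left f fu fv continuous_intros cu cv\<close>)
qed

section \<open>The kinetic energy of a Riemannian metric\<close>

lemma Ck_on_subset:
  assumes "T \<subseteq> S" "Ck_on k S f"
  shows "Ck_on k T f"
  using assms(2)
proof (induction k arbitrary: f)
  case 0
  then show ?case using assms(1) continuous_on_subset by simp
next
  case (Suc k)
  then show ?case using differentiable_on_subset[OF _ assms(1), of f] by simp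
qed

text \<open>The extension \<open>F\<close> agrees with \<open>f\<close> on an open set, so the
  Frechet derivatives agree as well, and those of \<open>F\<close> are local extensions of those of
  \<open>f\<close>. Asking for an extension of the given order \<open>k\<close> only is what lets
  the induction pass to the derivatives.\<close>

lemma smooth_on_imp_Ck_on:
  assumes S: "open S"
    and "\<And>x. x \<in> S \<Longrightarrow> \<exists>U F. open U \<and> x \<in> U \<and> Ck_on k U F \<and> (\<forall>y\<in>U \<inter> S. F y = f y)"
  shows "Ck_on k S f"
  using assms(2)
proof (induction k arbitrary: f)
  case 0
  have "isCont f x" if x: "x \<in> S" for x
  proof -
    obtain U F where U: "open U" "x \<in> U" "continuous_on U F" "\<forall>y\<in>U \<inter> S. F y = f y"
      using 0[OF x] by auto
    have "continuous_on (U \<inter> S) f"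
      using U by (intro continuous_on_eq[OF continuous_on_subset[OF U(3)]]) auto
    then show ?thesis using U S x by (simp add: continuous_on_eq_continuous_at open_Int)
  qed
  then show ?case by (simp add: continuous_at_imp_continuous_on)
next
  case (Suc k)
  have loc: "\<exists>U F. open U \<and> x \<in> U \<and> U \<subseteq> S \<and> F differentiable (at x) \<and> f differentiable (at x) \<and>
      (\<forall>v. Ck_on k U (\<lambda>x. frechet_derivative F (at x) v)) \<and>
      (\<forall>y\<in>U. frechet_derivative f (at y) = frechet_derivative F (at y))" if x: "x \<in> S" for x
  proof -
    obtain U F where U: "open U" "x \<in> U" "F differentiable_on U"
      "\<forall>v. Ck_on k U (\<lambda>x. frechet_derivative F (at x) v)" "\<forall>y\<in>U \<inter> S. F y = f y"
      using Suc.prems[OF x] by auto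
    have der: "(f has_derivative frechet_derivative F (at y)) (at y)" if y: "y \<in> U \<inter> S" for y
    proof (rule has_derivative_transform_within_open[OF _ open_Int[OF U(1) S] y])
      show "(F has_derivative frechet_derivative F (at y)) (at y)"
        using U(1,3) y by (simp add: differentiable_on_eq_differentiable_at frechet_derivative_works[symmetric])
      show "F x = f x" if "x \<in> U \<inter> S" for x using U(5) that by blast
    qed
    show ?thesis
    proof (intro exI conjI allI ballI)
      show "open (U \<inter> S)" "x \<in> U \<inter> S" "U \<inter> S \<subseteq> S" using U S x by auto
      show "F differentiable (at x)" using U(1-3) by (simp add: differentiable_on_eq_differentiable_at)
      show "f differentiable (at x)" using der[of x] U(2) x by (auto simp: differentiable_def)
      show "Ck_on k (U \<inter> S) (\<lambda>x. frechet_derivative F (at x) v)" for v by (rule Ck_on_subset[OF _ spec[OF U(4)]]) auto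
      show "frechet_derivative f (at y) = frechet_derivative F (at y)" if "y \<in> U \<inter> S" for y
        by (rule frechet_derivative_at[OF der[OF that], symmetric])
    qed
  qed
  have "f differentiable_on S" using loc S by (auto simp: differentiable_on_eq_differentiable_at)
  moreover have "Ck_on k S (\<lambda>x. frechet_derivative f (at x) v)" for v
  proof (rule Suc.IH)
    fix x assume x: "x \<in> S"
    obtain U F where U: "open U" "x \<in> U" "\<forall>v. Ck_on k U (\<lambda>x. frechet_derivative F (at x) v)"
      "\<forall>y\<in>U. frechet_derivative f (at y) = frechet_derivative F (at y)"
      using loc[OF x] by (elim exE conjE) (rule that)
    then show "\<exists>U G. open U \<and> x \<in> U \<and> Ck_on k U G \<and> (\<forall>y\<in>U \<inter> S. G y = frechet_derivative f (at y) v)"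
      by (intro exI[of _ U] exI[of _ "\<lambda>x. frechet_derivative F (at x) v"]) auto
  qed
  ultimately show ?case by simp
qed

lemma smooth_on_open_Ck:
  "open S \<Longrightarrow> smooth_on S f \<Longrightarrow> Ck_on k S f"
proof (rule smooth_on_imp_Ck_on, assumption)
  fix x assume f: "smooth_on S f" and x: "x \<in> S"
  obtain U F where "open U" "x \<in> U" "\<forall>k. Ck_on k U F" "\<forall>y\<in>U \<inter> S. F y = f y"
    using bspec[OF f[unfolded smooth_on_def] x] by (elim exE conjE) (rule that)
  then show "\<exists>U F. open U \<and> x \<in> U \<and> Ck_on k U F \<and> (\<forall>y\<in>U \<inter> S. F y = f y)"
    by (intro exI[of _ U] exI[of _ F]) simp
qed

lemma smooth_on_open_differentiable:
  "open S \<Longrightarrow> smooth_on S f \<Longrightarrow> x \<in> S \<Longrightarrow> f differentiable (at x)"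
  using smooth_on_open_Ck[of S f "Suc 0"] by (simp add: differentiable_on_eq_differentiable_at)

lemma has_derivative_zero_comparison:
  fixes f :: "'a::real_normed_vector \<Rightarrow> real"
  assumes "eventually (\<lambda>x. \<bar>f x\<bar> \<le> g x) (at a)" "f a = 0" "g a = 0" "(g has_derivative (\<lambda>_. 0)) (at a)"
  shows "(f has_derivative (\<lambda>_. 0)) (at a)"
proof -
  have "((\<lambda>y. (g y - g a - 0) /\<^sub>R norm (y - a)) \<longlongrightarrow> 0) (at a)"
    using assms(4) by (simp add: has_derivative_at_within)
  then have g: "((\<lambda>y. g y / norm (y - a)) \<longlongrightarrow> 0) (at a)"
    by (simp add: assms(3) divide_inverse mult.commute)
  have "((\<lambda>y. f y / norm (y - a)) \<longlongrightarrow> 0) (at a)"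
    by (rule Lim_null_comparison[OF _ g]) (use assms(1) in \<open>auto elim!: eventually_mono intro!: divide_right_mono\<close>)
  then show ?thesis
    by (simp add: has_derivative_at_within assms(2) divide_inverse mult.commute)
qed

lemma linear_Basis_expand:
  fixes f :: "'a::euclidean_space \<Rightarrow> 'b::real_vector"
  assumes "linear f"
  shows "f v = (\<Sum>b\<in>Basis. (v \<bullet> b) *\<^sub>R f b)"
proof -
  have "f v = f (\<Sum>b\<in>Basis. (v \<bullet> b) *\<^sub>R b)" by (simp add: euclidean_representation)
  also have "\<dots> = (\<Sum>b\<in>Basis. (v \<bullet> b) *\<^sub>R f b)"
    using assms by (simp add: linear_sum linear_cmul)
  finally show ?thesis .
qed

section \<open>A Riemannian metric in one chart\<close>

locale local_metric =
  fixes Y :: "'e::euclidean_space set" and h :: "'e \<Rightarrow> 'e \<Rightarrow> 'e \<Rightarrow> real"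
  assumes open_Y: "open Y"
    and smooth_h: "\<And>u v. smooth_on Y (\<lambda>y. h y u v)"
    and bilinear_h: "\<And>y. y \<in> Y \<Longrightarrow> bilinear (h y)"
    and sym_h: "\<And>y u v. y \<in> Y \<Longrightarrow> h y u v = h y v u"
    and pos_h: "\<And>y u. y \<in> Y \<Longrightarrow> u \<noteq> 0 \<Longrightarrow> h y u u > 0"
begin

definition dh :: "'e \<Rightarrow> 'e \<Rightarrow> 'e \<Rightarrow> 'e \<Rightarrow> real" where
  "dh y w u v = frechet_derivative (\<lambda>y. h y u v) (at y) w"

lemma lin: "y \<in> Y \<Longrightarrow> linear (h y u)" "y \<in> Y \<Longrightarrow> linear (\<lambda>v. h y v u)"
  using bilinear_h by (auto simp: bilinear_def)

lemma h_add: "y \<in> Y \<Longrightarrow> h y (u + u') v = h y u v + h y u' v" "y \<in> Y \<Longrightarrow> h y u (v + v') = h y u v + h y u v'"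
  using bilinear_h by (auto simp: bilinear_ladd bilinear_radd)

lemma h_scale: "y \<in> Y \<Longrightarrow> h y (c *\<^sub>R u) v = c * h y u v" "y \<in> Y \<Longrightarrow> h y u (c *\<^sub>R v) = c * h y u v"
  using bilinear_h by (auto simp: bilinear_lmul bilinear_rmul)

lemma h_diff: "y \<in> Y \<Longrightarrow> h y (u - u') v = h y u v - h y u' v" "y \<in> Y \<Longrightarrow> h y u (v - v') = h y u v - h y u v'"
  using bilinear_h by (auto simp: bilinear_lsub bilinear_rsub)

lemma has_derivative_h: "y \<in> Y \<Longrightarrow> ((\<lambda>y. h y u v) has_derivative (\<lambda>w. dh y w u v)) (at y)"
  using smooth_on_open_differentiable[OF open_Y smooth_h, of y u v]
  unfolding dh_def by (simp add: frechet_derivative_works eta_contract_eq)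

lemma dh_unique: "y \<in> Y \<Longrightarrow> (\<And>x. x \<in> Y \<Longrightarrow> h x u v = F x) \<Longrightarrow> (F has_derivative F') (at y) \<Longrightarrow> dh y w u v = F' w"
  using has_derivative_unique[OF has_derivative_h, of y u v F']
    has_derivative_transform_within_open[of F F' y UNIV Y "\<lambda>y. h y u v"] open_Y by metis

lemma linear_dh:
  assumes "y \<in> Y"
  shows "linear (\<lambda>w. dh y w u v)" "linear (\<lambda>u. dh y w u v)" "linear (\<lambda>v. dh y w u v)"
proof -
  show "linear (\<lambda>w. dh y w u v)" using has_derivative_linear[OF has_derivative_h[OF assms]] .
  show "linear (\<lambda>u. dh y w u v)"
    by (rule linearI; rule dh_unique[OF assms])
      (auto simp: h_add h_scale intro!: derivative_eq_intros has_derivative_h assms)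
  show "linear (\<lambda>v. dh y w u v)"
    by (rule linearI; rule dh_unique[OF assms])
      (auto simp: h_add h_scale intro!: derivative_eq_intros has_derivative_h assms)
qed

lemma flat_inner: "y \<in> Y \<Longrightarrow> flat h y X \<bullet> Z = h y X Z"
  using linear_Basis_expand[OF lin(1), of y X Z]
  by (simp add: flat_def inner_sum_left inner_commute[of Z] mult.commute)

lemma linear_flat: "y \<in> Y \<Longrightarrow> linear (flat h y)"
  unfolding flat_def by (intro linearI) (simp_all add: h_add h_scale scaleR_add_left sum.distrib scaleR_sum_right)

lemma flat_bij: assumes "y \<in> Y" shows "bij (flat h y)"
proof -
  have "inj (flat h y)"
    unfolding linear_injective_0[OF linear_flat[OF assms]]
    using flat_inner[OF assms] pos_h[OF assms] by (metis inner_zero_left less_irrefl)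
  then show ?thesis using linear_flat[OF assms] by (simp add: bij_def linear_injective_imp_surjective)
qed

lemma flat_sharp: assumes "y \<in> Y" shows "flat h y (sharp h y a) = a"
  unfolding sharp_def
  by (rule theI'[where P = "\<lambda>X. flat h y X = a"]) (use flat_bij[OF assms] in \<open>metis bij_pointE\<close>)

lemma h_sharp: "y \<in> Y \<Longrightarrow> h y (sharp h y a) Z = a \<bullet> Z"
  using flat_inner flat_sharp by metis

lemma sharp_unique: assumes "y \<in> Y" "\<And>Z. h y W Z = a \<bullet> Z" shows "W = sharp h y a"
proof -
  have "h y (W - sharp h y a) (W - sharp h y a) = 0" using assms by (simp add: h_diff h_sharp)
  then show ?thesis using pos_h[OF assms(1), of "W - sharp h y a"] by (metis eq_iff_diff_eq_0 less_irrefl)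
qed

lemma linear_sharp: assumes "y \<in> Y" shows "linear (sharp h y)"
  by (rule linearI; rule sharp_unique[OF assms, symmetric])
    (simp_all add: assms h_add h_scale h_sharp inner_add_left)

lemma sharp_sym: "y \<in> Y \<Longrightarrow> a \<bullet> sharp h y b = b \<bullet> sharp h y a"
  using h_sharp[of y a "sharp h y b"] h_sharp[of y b "sharp h y a"] sym_h by metis

lemma h_expand: "y \<in> Y \<Longrightarrow> h y u v = (\<Sum>i\<in>Basis. \<Sum>j\<in>Basis. (u \<bullet> i) * (v \<bullet> j) * h y i j)"
  by (subst linear_Basis_expand[OF lin(2)], assumption, subst linear_Basis_expand[OF lin(1)], assumption)
    (simp add: sum_distrib_left mult.assoc)

lemma continuous_h: "continuous_on Y (\<lambda>y. h y u v)"
  by (intro continuous_at_imp_continuous_on ballI has_derivative_continuous[OF has_derivative_h])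

lemma compact_bounds:
  assumes K: "compact K" "K \<subseteq> Y"
  shows "\<exists>m M. 0 < m \<and> 0 < M \<and> (\<forall>y\<in>K. \<forall>u. m * (u \<bullet> u) \<le> h y u u \<and> h y u u \<le> M * (u \<bullet> u))"
proof (cases "K = {}")
  case True then show ?thesis by (intro exI[of _ 1]) auto
next
  case False
  let ?S = "K \<times> sphere (0::'e) 1" and ?f = "\<lambda>(y, u). h y u u"
  have "continuous_on ?S (\<lambda>x. \<Sum>i\<in>Basis. \<Sum>j\<in>Basis. (snd x \<bullet> i) * (snd x \<bullet> j) * h (fst x) i j)"
    by (intro continuous_intros continuous_on_compose2[OF continuous_h]) (use K in auto)
  then have c: "continuous_on ?S ?f"
    by (rule continuous_on_eq) (use K in \<open>auto simp: h_expand[symmetric]\<close>)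
  have cpt: "compact ?S" using K by (intro compact_Times) auto
  obtain b :: 'e where "b \<in> Basis" using nonempty_Basis by blast
  then have ne: "?S \<noteq> {}" using False by (auto intro!: exI[of _ b])
  obtain x1 where x1: "x1 \<in> ?S" "\<forall>x\<in>?S. ?f x1 \<le> ?f x" using continuous_attains_inf[OF cpt ne c] by blast
  obtain x2 where x2: "x2 \<in> ?S" "\<forall>x\<in>?S. ?f x \<le> ?f x2" using continuous_attains_sup[OF cpt ne c] by blast
  have "?f x > 0" if "x \<in> ?S" for x using that K by (cases x) (auto intro!: pos_h)
  then have "?f x1 > 0" "?f x2 > 0" using x1 x2 by blast+
  moreover have "?f x1 * (u \<bullet> u) \<le> h y u u \<and> h y u u \<le> ?f x2 * (u \<bullet> u)" if y: "y \<in> K" for y u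
  proof (cases "u = 0")
    case False
    have yY: "y \<in> Y" using y K by auto
    define v where "v = u /\<^sub>R norm u"
    have v: "(y, v) \<in> ?S" using y False by (simp add: v_def)
    have "u = norm u *\<^sub>R v" using False by (simp add: v_def)
    then have "h y u u = h y (norm u *\<^sub>R v) (norm u *\<^sub>R v)" by simp
    also have "\<dots> = (u \<bullet> u) * h y v v"
      by (simp add: h_scale yY power2_norm_eq_inner[symmetric] power2_eq_square)
    finally have "h y u u = (u \<bullet> u) * h y v v" .
    moreover have "?f x1 \<le> h y v v" "h y v v \<le> ?f x2" using bspec[OF x1(2) v] bspec[OF x2(2) v] by auto
    ultimately show ?thesis using mult_right_mono[of "?f x1" "h y v v" "u \<bullet> u"] mult_right_mono[of "h y v v" "?f x2" "u \<bullet> u"]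
      by (simp add: mult.commute)
  qed (use y K h_scale[of y 0 0 0] in auto)
  ultimately show ?thesis by blast
qed

lemma local_bounds:
  assumes "y0 \<in> Y"
  shows "\<exists>e m M. 0 < e \<and> 0 < m \<and> 0 < M \<and> cball y0 e \<subseteq> Y \<and>
    (\<forall>y\<in>cball y0 e. \<forall>u. m * (u \<bullet> u) \<le> h y u u \<and> h y u u \<le> M * (u \<bullet> u))"
proof -
  obtain e where "e > 0" "cball y0 e \<subseteq> Y" using open_Y assms open_contains_cball by blast
  then show ?thesis using compact_bounds[OF compact_cball, of y0 e] by blast
qed

section \<open>The kinetic energy and its differential\<close>

definition kin :: "'e \<times> 'e \<Rightarrow> real" where
  "kin z = (snd z \<bullet> sharp h (fst z) (snd z)) / 2"

text \<open>The second term is the derivative of the inverse metric: with \<open>S\<close> dual to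
  the momentum \<open>p\<close>, the differential of the inverse metric on \<open>(p, p)\<close> is
  minus the differential of \<open>h\<close> on \<open>(S, S)\<close>.\<close>

definition dkin :: "'e \<times> 'e \<Rightarrow> 'e \<times> 'e \<Rightarrow> real" where
  "dkin z u = (let S = sharp h (fst z) (snd z) in snd u \<bullet> S - dh (fst z) (fst u) S S / 2)"

lemma sharp_bound:
  assumes "y \<in> Y" "0 < m" "\<And>u. m * (u \<bullet> u) \<le> h y u u"
  shows "a \<bullet> sharp h y a \<le> (a \<bullet> a) / m"
proof -
  let ?S = "sharp h y a"
  have "m * (norm ?S)\<^sup>2 \<le> a \<bullet> ?S" using assms(3)[of ?S] h_sharp[OF assms(1), of a ?S] by (simp add: power2_norm_eq_inner)
  also have "\<dots> \<le> norm a * norm ?S" by (rule norm_cauchy_schwarz)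
  finally have "m * norm ?S \<le> norm a" by (cases "?S = 0") (auto simp: power2_eq_square)
  then have "norm a * (m * norm ?S) \<le> norm a * norm a" by (rule mult_left_mono) auto
  moreover have "m * (a \<bullet> ?S) \<le> m * (norm a * norm ?S)"
    using norm_cauchy_schwarz[of a ?S] assms(2) by (intro mult_left_mono) auto
  ultimately have "m * (a \<bullet> ?S) \<le> a \<bullet> a"
    by (simp add: power2_norm_eq_inner[symmetric] power2_eq_square mult.left_commute)
  then show ?thesis using assms(2) by (simp add: field_simps)
qed

text \<open>With \<open>S\<close> frozen at the base point, the remainder \<open>kin - (p \<bullet> S - h y S S / 2)\<close> is a
  quadratic expression in \<open>p - flat h y S\<close>, which vanishes at the base point; hence the
  derivative of \<open>sharp\<close> is never needed.\<close>

lemma has_derivative_kin: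
  assumes y: "fst z \<in> Y"
  shows "(kin has_derivative dkin z) (at z)"
proof -
  define S where "S = sharp h (fst z) (snd z)"
  define r where "r x = snd x - flat h (fst x) S" for x :: "'e \<times> 'e"
  define r' where "r' u = snd u - (\<Sum>b\<in>Basis. dh (fst z) (fst u) S b *\<^sub>R b)" for u :: "'e \<times> 'e"
  have dfst: "((\<lambda>x. h (fst x) a b) has_derivative (\<lambda>u. dh (fst z) (fst u) a b)) (at z)" for a b
    by (rule has_derivative_compose[where f = fst and g = "\<lambda>y. h y a b", OF _ has_derivative_h[OF y]])
      (auto intro!: derivative_eq_intros)
  have Dr: "(r has_derivative r') (at z)"
    unfolding r_def r'_def flat_def by (auto intro!: derivative_eq_intros dfst)
  have rz: "r z = 0" by (simp add: r_def S_def flat_sharp y)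
  \<comment> \<open>The lower bound \<open>m\<close> holds on a whole neighbourhood and so controls
    the quadratic remainder there by the squared norm of \<open>r x\<close> divided by
    \<open>m\<close>.\<close>
  obtain e m M where e: "0 < e" "0 < m" "cball (fst z) e \<subseteq> Y"
    "\<And>y u. y \<in> cball (fst z) e \<Longrightarrow> m * (u \<bullet> u) \<le> h y u u"
    using local_bounds[OF y] by metis
  define L where "L x = snd x \<bullet> S - h (fst x) S S / 2" for x :: "'e \<times> 'e"
  have DL: "(L has_derivative dkin z) (at z)"
    unfolding L_def dkin_def Let_def S_def[symmetric] by (auto intro!: derivative_eq_intros dfst)
  have id: "kin x = L x + r x \<bullet> sharp h (fst x) (r x) / 2" if x: "fst x \<in> Y" for x
  proof -
    have 1: "sharp h (fst x) (snd x) = S + sharp h (fst x) (r x)"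
      by (rule sharp_unique[OF x, symmetric]) (simp add: x h_add h_sharp r_def inner_diff_left flat_inner)
    have "snd x \<bullet> sharp h (fst x) (r x) = r x \<bullet> sharp h (fst x) (snd x)" by (rule sharp_sym[OF x])
    also have "\<dots> = r x \<bullet> S + r x \<bullet> sharp h (fst x) (r x)" by (simp add: 1 inner_add_right)
    finally have "snd x \<bullet> sharp h (fst x) (snd x) = snd x \<bullet> S + r x \<bullet> S + r x \<bullet> sharp h (fst x) (r x)"
      by (simp add: 1 inner_add_right)
    moreover have "r x \<bullet> S = snd x \<bullet> S - h (fst x) S S" by (simp add: r_def inner_diff_left flat_inner x)
    ultimately show ?thesis by (simp add: kin_def L_def field_simps)
  qed
  have "((\<lambda>x. kin x - L x) has_derivative (\<lambda>_. 0)) (at z)"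
  proof (rule has_derivative_zero_comparison[where g = "\<lambda>x. (r x \<bullet> r x) / m / 2"])
    have "eventually (\<lambda>x. dist x z < e) (at z)" using e(1) unfolding eventually_at by blast
    then show "eventually (\<lambda>x. \<bar>kin x - L x\<bar> \<le> (r x \<bullet> r x) / m / 2) (at z)"
    proof (rule eventually_mono)
      fix x :: "'e \<times> 'e" assume "dist x z < e"
      then have "dist (fst z) (fst x) < e" by (metis dist_commute dist_fst_le order_le_less_trans)
      then have x: "fst x \<in> cball (fst z) e" by simp
      then have xY: "fst x \<in> Y" using e by auto
      have "0 \<le> r x \<bullet> sharp h (fst x) (r x)"
        using h_sharp[OF xY, of "r x" "sharp h (fst x) (r x)"] pos_h[OF xY, of "sharp h (fst x) (r x)"]
        by (cases "sharp h (fst x) (r x) = 0") auto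
      moreover have "r x \<bullet> sharp h (fst x) (r x) \<le> (r x \<bullet> r x) / m"
        by (rule sharp_bound[OF xY e(2)]) (use e(4) x in blast)
      ultimately show "\<bar>kin x - L x\<bar> \<le> (r x \<bullet> r x) / m / 2" by (simp add: id[OF xY])
    qed
    show "kin z - L z = 0" using id[OF y] by (simp add: rz)
    show "(r z \<bullet> r z) / m / 2 = 0" by (simp add: rz)
    show "((\<lambda>x. (r x \<bullet> r x) / m / 2) has_derivative (\<lambda>_. 0)) (at z)"
      using has_derivative_divide[OF has_derivative_divide[OF has_derivative_inner[OF Dr Dr] has_derivative_const[of m]] has_derivative_const[of 2]] e(2)
      by (simp add: rz)
  qed
  from has_derivative_add[OF this DL] show ?thesis by simp
qed

text \<open>\<open>christoffel\<close> is a definite description, so existence and uniqueness have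
  to be supplied: the Koszul functional is linear in \<open>Z\<close>, half of it is represented by
  a covector \<open>a\<close>, and \<open>sharp h y a\<close> is the only solution.\<close>

lemma christoffel_Koszul:
  assumes y: "y \<in> Y"
  shows "2 * h y (christoffel h y X W) Z = dh y X W Z + dh y W X Z - dh y Z X W"
proof -
  define K where "K Z = dh y X W Z + dh y W X Z - dh y Z X W" for Z
  have "linear K" unfolding K_def
    by (intro linear_compose_add linear_compose_sub linear_dh[OF y])
  define a where "a = (\<Sum>b\<in>Basis. (K b / 2) *\<^sub>R b)"
  have a: "2 * (a \<bullet> Z) = K Z" for Z
    using linear_Basis_expand[OF \<open>linear K\<close>, of Z]
    by (simp add: a_def inner_sum_left sum_distrib_left inner_commute[of Z] mult.commute)
  have "\<exists>!V. \<forall>Z. 2 * h y V Z = K Z"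
  proof (rule ex1I[of _ "sharp h y a"])
    show "\<forall>Z. 2 * h y (sharp h y a) Z = K Z" using y a by (simp add: h_sharp)
    show "V = sharp h y a" if "\<forall>Z. 2 * h y V Z = K Z" for V
    proof (rule sharp_unique[OF y])
      fix Z show "h y V Z = a \<bullet> Z" using that a by (metis mult_left_cancel zero_neq_numeral)
    qed
  qed
  from theI'[OF this] have "\<forall>Z. 2 * h y (christoffel h y X W) Z = K Z"
    by (simp add: christoffel_def K_def dh_def)
  then show ?thesis by (simp add: K_def)
qed

lemma dkin_linear: "fst z \<in> Y \<Longrightarrow> linear (dkin z)"
  using has_derivative_linear[OF has_derivative_kin] .

text \<open>Parallel transport for the Levi-Civita connection preserves lengths. In coordinates, the
  Koszul expression \<open>K\<close> at \<open>S\<close> retains only the derivative of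
  \<open>h\<close> in direction \<open>X\<close> on \<open>(S, S)\<close>, which cancels the second
  term of \<open>dkin\<close>.\<close>

lemma dkin_hlift:
  assumes y: "fst z \<in> Y"
  shows "dkin z (hlift h z X) = 0"
proof -
  define S where "S = sharp h (fst z) (snd z)"
  define K where "K W = dh (fst z) X W S + dh (fst z) W X S - dh (fst z) S X W" for W
  have "linear K" unfolding K_def
    by (intro linear_compose_add linear_compose_sub linear_dh[OF y])
  have G: "snd z \<bullet> christoffel h (fst z) X b = K b / 2" for b
    using h_sharp[OF y, of "snd z" "christoffel h (fst z) X b"] christoffel_Koszul[OF y, of X b S] sym_h[OF y]
    by (simp add: K_def S_def)
  then have "(\<Sum>b\<in>Basis. (snd z \<bullet> christoffel h (fst z) X b) *\<^sub>R b) \<bullet> S = K S / 2"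
    using linear_Basis_expand[OF \<open>linear K\<close>, of S] unfolding G
    by (simp add: inner_sum_left sum_divide_distrib inner_commute[of S] mult.commute)
  then show ?thesis by (simp add: dkin_def hlift_def Let_def S_def[symmetric] K_def)
qed

text \<open>The image of \<open>u\<close> is the vertical lift of \<open>flat X\<close> minus a
  horizontal vector. The horizontal part does not change the energy, and the vertical part pairs
  with \<open>S\<close> to the value of the Liouville form on \<open>u\<close>.\<close>

lemma dkin_sasaki_J:
  assumes y: "fst z \<in> Y"
  shows "dkin z (sasaki_J h z u) = snd z \<bullet> fst u"
proof -
  define Y' where "Y' = sharp h (fst z) (snd (u - hlift h z (fst u)))"
  have "dkin z (0, flat h (fst z) (fst u)) = snd z \<bullet> fst u"
    using linear_0[OF linear_dh(1)[OF y]] h_sharp[OF y, of "snd z" "fst u"] sym_h[OF y]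
    by (simp add: dkin_def Let_def flat_inner y)
  then show ?thesis
    using dkin_hlift[OF y, of Y'] linear_diff[OF dkin_linear[OF y]]
    by (simp add: sasaki_J_def Let_def Y'_def)
qed

text \<open>Euler's relation for a function that is homogeneous of degree 2 in the momentum.\<close>

lemma dkin_vertical: "fst z \<in> Y \<Longrightarrow> dkin z (0, snd z) = 2 * kin z"
  using linear_0[OF linear_dh(1)] by (simp add: dkin_def kin_def Let_def)

lemma kin_nonneg: assumes y: "fst z \<in> Y" shows "0 \<le> kin z"
  using h_sharp[OF y, of "snd z" "sharp h (fst z) (snd z)"] pos_h[OF y, of "sharp h (fst z) (snd z)"]
  by (cases "sharp h (fst z) (snd z) = 0") (auto simp: kin_def)

lemma kin_scale: "fst z \<in> Y \<Longrightarrow> kin (fst z, c *\<^sub>R snd z) = c\<^sup>2 * kin z"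
  using linear_cmul[OF linear_sharp] by (simp add: kin_def power2_eq_square)

text \<open>The bound on \<open>h\<close> is inverted by expanding
  \<open>h (fst z) q q \<ge> 0\<close> for \<open>q = p / M - S\<close>, where \<open>S\<close> is
  dual to \<open>p\<close>.\<close>

lemma kin_lower:
  assumes y: "fst z \<in> Y" and "0 < M" "\<And>u. h (fst z) u u \<le> M * (u \<bullet> u)"
  shows "snd z \<bullet> snd z \<le> 2 * M * kin z"
proof -
  let ?S = "sharp h (fst z) (snd z)" and ?p = "snd z"
  define q where "q = (1 / M) *\<^sub>R ?p - ?S"
  have "0 \<le> h (fst z) q q" using pos_h[OF y, of q] h_scale[OF y, of 0 0 0] by (cases "q = 0") auto
  also have "\<dots> = (1/M)^2 * h (fst z) ?p ?p - 2 * (1 / M) * (?p \<bullet> ?p) + ?p \<bullet> ?S"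
    using sym_h[OF y, of ?p ?S]
    by (simp add: q_def h_diff h_scale y h_sharp power2_eq_square diff_divide_distrib)
  also have "\<dots> \<le> (1/M)^2 * (M * (?p \<bullet> ?p)) - 2 * (1 / M) * (?p \<bullet> ?p) + ?p \<bullet> ?S"
    using assms(3)[of ?p] by (intro add_right_mono diff_right_mono mult_left_mono) auto
  also have "\<dots> = ?p \<bullet> ?S - (?p \<bullet> ?p) / M" using assms(2) by (simp add: power2_eq_square field_simps)
  finally have "(?p \<bullet> ?p) / M \<le> ?p \<bullet> ?S" by simp
  then show ?thesis using assms(2) by (simp add: kin_def field_simps)
qed

end

section \<open>The divergence theorem on the disc\<close>

text \<open>The squared positive part is continuously differentiable. Every cutoff below is built
  from it, since the divergence theorem needs just one continuous derivative.\<close>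

lemma DERIV_max_0_squared: "((\<lambda>x::real. (max 0 x)\<^sup>2) has_real_derivative 2 * max 0 x) (at x)"
proof (cases x "0::real" rule: linorder_cases)
  case less
  have "((\<lambda>x::real. 0) has_real_derivative 0) (at x)" by simp
  then have "((\<lambda>x::real. (max 0 x)\<^sup>2) has_real_derivative 0) (at x)"
    by (rule has_field_derivative_transform_within_open[of _ _ _ "{..<0}"]) (use less in auto)
  then show ?thesis using less by simp
next
  case equal
  have "(\<lambda>h::real. (max 0 h)\<^sup>2 / h) \<midarrow>0\<rightarrow> 0"
  proof (rule tendsto_0_le[where f = "\<lambda>h. h" and K = 1])
    show "\<forall>\<^sub>F x in at 0. norm ((max 0 x)\<^sup>2 / x) \<le> norm (x::real) * 1"
      by (intro always_eventually) (auto simp: max_def power2_eq_square)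
  qed (auto intro: tendsto_ident_at)
  then show ?thesis by (simp add: equal DERIV_def)
next
  case greater
  have "((\<lambda>x::real. x\<^sup>2) has_real_derivative 2 * x) (at x)" by (auto intro!: derivative_eq_intros)
  then have "((\<lambda>x::real. (max 0 x)\<^sup>2) has_real_derivative 2 * x) (at x)"
    by (rule has_field_derivative_transform_within_open[of _ _ _ "{0<..}"]) (use greater in auto)
  then show ?thesis using greater by simp
qed

text \<open>On the unit interval this is \<open>1 - (1 - t\<^sup>2)\<^sup>2\<close>, with vanishing
  slope at both ends.\<close>

definition smooth_step :: "real \<Rightarrow> real" where
  "smooth_step t = 1 - (max 0 (1 - (max 0 t)\<^sup>2))\<^sup>2"

definition smooth_step' :: "real \<Rightarrow> real" where
  "smooth_step' t = 4 * max 0 (1 - (max 0 t)\<^sup>2) * max 0 t"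

lemma DERIV_smooth_step: "(smooth_step has_real_derivative smooth_step' t) (at t)"
proof -
  have "((\<lambda>x. 1 - (max 0 x)\<^sup>2) has_real_derivative - (2 * max 0 t)) (at t)"
    using DERIV_diff[OF DERIV_const[of 1] DERIV_max_0_squared] by simp
  from DERIV_chain[OF DERIV_max_0_squared this]
  have "((\<lambda>t. (max 0 (1 - (max 0 t)\<^sup>2))\<^sup>2) has_real_derivative - smooth_step' t) (at t)"
    by (simp add: o_def smooth_step'_def mult.assoc)
  from DERIV_diff[OF DERIV_const[of 1] this] show ?thesis
    by (simp add: smooth_step_def[abs_def])
qed

lemma smooth_step_simps:
  "t \<le> 0 \<Longrightarrow> smooth_step t = 0" "t \<ge> 1 \<Longrightarrow> smooth_step t = 1"
  "t \<le> 0 \<Longrightarrow> smooth_step' t = 0" "t \<ge> 1 \<Longrightarrow> smooth_step' t = 0"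
proof -
  assume "t \<ge> 1"
  then have "1 - (max 0 t)\<^sup>2 \<le> 0" using one_le_power[of t 2] by simp
  then have "max 0 (1 - (max 0 t)\<^sup>2) = 0" by (rule max_absorb1)
  then show "smooth_step t = 1" "smooth_step' t = 0" by (simp_all add: smooth_step_def smooth_step'_def)
qed (auto simp: smooth_step_def smooth_step'_def)

lemma smooth_step_bounds: "0 \<le> smooth_step t" "smooth_step t \<le> 1"
  "0 \<le> smooth_step' t" "smooth_step' t \<le> 4"
proof -
  have "(max 0 (1 - (max 0 t)\<^sup>2))\<^sup>2 \<le> 1\<^sup>2" by (rule power_mono) auto
  then show "0 \<le> smooth_step t" by (simp add: smooth_step_def)
  show "smooth_step t \<le> 1" by (simp add: smooth_step_def)
  show "0 \<le> smooth_step' t" by (simp add: smooth_step'_def)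
  show "smooth_step' t \<le> 4"
  proof (cases "t \<ge> 1")
    case False
    then have "max 0 (1 - (max 0 t)\<^sup>2) * max 0 t \<le> 1 * 1" by (intro mult_mono) auto
    then show ?thesis by (simp add: smooth_step'_def)
  qed (simp add: smooth_step_simps)
qed

lemma continuous_on_smooth_step': "continuous_on S smooth_step'"
  unfolding smooth_step'_def[abs_def] by (intro continuous_intros)

text \<open>Compactness of the circle, through a Lebesgue number for its cover by balls on which the
  limit is already within \<open>e\<close>.\<close>

lemma boundary_limit_uniform:
  fixes B :: "complex \<Rightarrow> real"
  assumes "\<And>\<zeta>. \<zeta> \<in> sphere 0 1 \<Longrightarrow> (B \<longlongrightarrow> 0) (at \<zeta> within ball 0 1)" "e > 0"
  shows "\<exists>d>0. \<forall>z\<in>ball 0 1. norm z > 1 - d \<longrightarrow> \<bar>B z\<bar> < e"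
proof -
  have "\<exists>d>0. \<forall>z\<in>ball 0 1. dist z \<zeta> < d \<longrightarrow> \<bar>B z\<bar> < e" if \<zeta>: "\<zeta> \<in> sphere 0 1" for \<zeta>
  proof -
    obtain d where d: "d > 0" "\<forall>x\<in>ball 0 1. 0 < dist x \<zeta> \<and> dist x \<zeta> < d \<longrightarrow> dist (B x) 0 < e"
      using assms(1)[OF \<zeta>] assms(2) unfolding Lim_within by blast
    have "\<bar>B z\<bar> < e" if z: "z \<in> ball 0 1" "dist z \<zeta> < d" for z
    proof -
      have "z \<noteq> \<zeta>" using z \<open>\<zeta> \<in> sphere 0 1\<close> by auto
      then show ?thesis using d z by (auto simp: dist_real_def)
    qed
    then show ?thesis using d by blast
  qed
  then obtain d where d: "\<And>\<zeta>. \<zeta> \<in> sphere 0 1 \<Longrightarrow> d \<zeta> > 0"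
    "\<And>\<zeta> z. \<zeta> \<in> sphere 0 1 \<Longrightarrow> z \<in> ball 0 1 \<Longrightarrow> dist z \<zeta> < d \<zeta> \<Longrightarrow> \<bar>B z\<bar> < e"
    by metis
  define \<G> where "\<G> = (\<lambda>\<zeta>. ball \<zeta> (d \<zeta>)) ` sphere (0::complex) 1"
  have "sphere (0::complex) 1 \<subseteq> \<Union>\<G>" using d(1) by (force simp: \<G>_def)
  moreover have "\<And>G. G \<in> \<G> \<Longrightarrow> open G" by (auto simp: \<G>_def)
  ultimately obtain r where r: "r > 0" "\<And>x. x \<in> sphere (0::complex) 1 \<Longrightarrow> \<exists>G\<in>\<G>. ball x r \<subseteq> G"
    using Heine_Borel_lemma[OF compact_sphere[of "0::complex" 1]] by metis
  have "\<bar>B z\<bar> < e" if z: "z \<in> ball 0 1" "norm z > 1 - min r 1" for z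
  proof -
    have nz: "norm z > 0" using z(2) by auto
    \<comment> \<open>The radial projection of \<open>z\<close>; its distance to \<open>z\<close> is
      \<open>1 - norm z\<close>.\<close>
    define x where "x = z / of_real (norm z)"
    have x: "x \<in> sphere 0 1" using nz by (auto simp: x_def norm_divide)
    have "x - z = of_real (1 / norm z - 1) * z" by (simp add: x_def field_simps)
    then have "norm (x - z) = \<bar>1 / norm z - 1\<bar> * norm z" by (simp only: norm_mult norm_of_real)
    also have "\<dots> = 1 - norm z" using nz z by (auto simp: abs_if field_simps)
    finally have "z \<in> ball x r" using z by (simp add: dist_norm)
    then show ?thesis using r(2)[OF x] d(2) z by (fastforce simp: \<G>_def dist_commute)
  qed
  then show ?thesis using r by (intro exI[of _ "min r 1"]) auto
qed

text \<open>The field is given only inside the disc and may be unbounded near the circle. It is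
  multiplied by radial cutoffs \<open>\<kappa> n\<close>, whose gradient sees just the normal
  component \<open>B\<close>. This gradient has size of order \<open>n\<close> on an annulus of area
  of order \<open>1 / n\<close>, so uniform smallness of \<open>B\<close> removes the error.\<close>

lemma divergence_disc:
  fixes X Y :: "complex \<Rightarrow> real"
  assumes DX: "\<And>z. z \<in> ball 0 1 \<Longrightarrow> (X has_derivative X' z) (at z)"
    and DY: "\<And>z. z \<in> ball 0 1 \<Longrightarrow> (Y has_derivative Y' z) (at z)"
    and cX: "continuous_on (ball 0 1) (\<lambda>z. X' z 1)" and cY: "continuous_on (ball 0 1) (\<lambda>z. Y' z \<i>)"
    and int: "set_integrable lborel (ball 0 1) (\<lambda>z. X' z 1 + Y' z \<i>)"
    and bd: "\<And>\<zeta>. \<zeta> \<in> sphere 0 1 \<Longrightarrow> ((\<lambda>z. X z * Re z + Y z * Im z) \<longlongrightarrow> 0) (at \<zeta> within ball 0 1)"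
  shows "(LINT z:ball 0 1|lborel. X' z 1 + Y' z \<i>) = 0"
proof -
  let ?D = "ball (0::complex) 1"
  define B where "B z = X z * Re z + Y z * Im z" for z
  \<comment> \<open>The cutoff \<open>\<kappa> n\<close> is 1 where \<open>z \<bullet> z\<close> is
    at most \<open>1 - 2 / n\<close> and 0 where it is at least \<open>1 - 1 / n\<close>.\<close>
  define \<tau> where "\<tau> n z = real n * (1 - z \<bullet> z) - 1" for n and z :: complex
  define \<kappa> where "\<kappa> n z = smooth_step (\<tau> n z)" for n and z :: complex
  define \<kappa>' where "\<kappa>' n z v = smooth_step' (\<tau> n z) * (- real n * (2 * (z \<bullet> v)))" for n and z v :: complex
  have D\<kappa>: "(\<kappa> n has_derivative \<kappa>' n z) (at z)" for n z
  proof -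
    have "(\<tau> n has_derivative (\<lambda>v. - real n * (2 * (z \<bullet> v)))) (at z)"
      unfolding \<tau>_def by (auto intro!: derivative_eq_intros simp: inner_commute algebra_simps)
    from has_derivative_compose[OF this DERIV_smooth_step[of "\<tau> n z", unfolded has_field_derivative_def]]
    show ?thesis by (simp add: \<kappa>_def[abs_def] \<kappa>'_def[abs_def])
  qed
  have c\<tau>: "continuous_on S (\<tau> n)" for n S unfolding \<tau>_def by (intro continuous_intros)
  have c\<kappa>: "continuous_on S (\<kappa> n)" for n S
    using D\<kappa> by (meson continuous_at_imp_continuous_on has_derivative_continuous)
  have c\<kappa>': "continuous_on S (\<lambda>z. \<kappa>' n z v)" for n S v
    unfolding \<kappa>'_def by (intro continuous_intros continuous_on_compose2[OF continuous_on_smooth_step' c\<tau>]) auto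
  have out: "\<tau> n z < 0" if "z \<notin> ?D" for n z
  proof -
    have "1 \<le> z \<bullet> z" using that power_mono[of 1 "norm z" 2] by (auto simp: power2_norm_eq_inner)
    then have "real n * (1 - z \<bullet> z) \<le> 0" by (intro mult_nonneg_nonpos) auto
    then show ?thesis by (simp add: \<tau>_def)
  qed
  have open_out: "open {z. \<tau> n z < 0}" for n by (intro open_Collect_less c\<tau> continuous_intros)
  have UN: "UNIV = ?D \<union> {z. \<tau> n z < 0}" for n using out by auto
  have \<kappa>0: "\<kappa> n z = 0" "\<kappa>' n z v = 0" if "\<tau> n z < 0" for n z v
    using that by (auto simp: \<kappa>_def \<kappa>'_def smooth_step_simps)
  \<comment> \<open>After the cutoff the product extends by 0 to the plane, with a continuous
    derivative in direction \<open>v\<close>, which therefore integrates to 0.\<close>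
  have cut: "integral\<^sup>L lborel (\<lambda>z. indicat_real ?D z * (\<kappa> n z * f' z v + \<kappa>' n z v * f z)) = 0
      \<and> integrable lborel (\<lambda>z. indicat_real ?D z * (\<kappa> n z * f' z v + \<kappa>' n z v * f z))"
    if f: "\<And>z. z \<in> ?D \<Longrightarrow> (f has_derivative f' z) (at z)"
      and cf': "continuous_on ?D (\<lambda>z. f' z v)" for f f' n v
  proof -
    define u where "u z = indicat_real ?D z * (\<kappa> n z * f z)" for z
    define u' where "u' z v = indicat_real ?D z * (\<kappa> n z * f' z v + \<kappa>' n z v * f z)" for z v
    have Du: "(u has_derivative u' z) (at z)" for z
    proof (cases "z \<in> ?D")
      case True
      have "((\<lambda>z. \<kappa> n z * f z) has_derivative (\<lambda>v. \<kappa> n z * f' z v + \<kappa>' n z v * f z)) (at z)"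
        by (rule has_derivative_mult[OF D\<kappa> f[OF True]])
      then have "(u has_derivative (\<lambda>v. \<kappa> n z * f' z v + \<kappa>' n z v * f z)) (at z)"
        by (rule has_derivative_transform_within_open[of _ _ _ _ ?D]) (use True in \<open>auto simp: u_def\<close>)
      then show ?thesis using True by (simp add: u'_def[abs_def])
    next
      case False
      have "((\<lambda>z. 0) has_derivative (\<lambda>v. 0)) (at z)" by simp
      then have "(u has_derivative (\<lambda>v. 0)) (at z)"
        by (rule has_derivative_transform_within_open[OF _ open_out[of n]]) (use out[OF False] in \<open>auto simp: u_def \<kappa>0\<close>)
      then show ?thesis using False by (simp add: u'_def[abs_def])
    qed
    have cu': "continuous_on UNIV (\<lambda>z. u' z v)"
    proof (subst UN[of n], rule continuous_on_open_Un)
      have "continuous_on ?D f" using f by (meson continuous_at_imp_continuous_on has_derivative_continuous)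
      then have "continuous_on ?D (\<lambda>z. \<kappa> n z * f' z v + \<kappa>' n z v * f z)"
        by (intro continuous_intros c\<kappa> c\<kappa>' cf')
      then show "continuous_on ?D (\<lambda>z. u' z v)"
        by (rule continuous_on_eq) (auto simp: u'_def)
      show "continuous_on {z. \<tau> n z < 0} (\<lambda>z. u' z v)"
        by (rule continuous_on_eq[of _ "\<lambda>_. 0"]) (auto simp: u'_def \<kappa>0)
    qed (auto intro: open_out)
    have "integral\<^sup>L lborel (\<lambda>z. u' z v) = 0"
      by (rule integral_directional_derivative_eq_0[OF Du cu', of 1]) (auto simp: u_def)
    moreover have "integrable lborel (\<lambda>z. u' z v)"
    proof -
      have "integrable lborel (\<lambda>x. indicat_real (cball 0 1) x *\<^sub>R u' x v)"
        by (rule borel_integrable_compact[OF compact_cball continuous_on_subset[OF cu']]) auto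
      moreover have "indicat_real (cball 0 1) x *\<^sub>R u' x v = u' x v" for x
        by (auto simp: u'_def indicator_def)
      ultimately show ?thesis by (simp only:)
    qed
    ultimately show ?thesis by (simp add: u'_def)
  qed
  define dv where "dv z = X' z 1 + Y' z \<i>" for z
  have intd: "integrable lborel (\<lambda>z. indicat_real ?D z * dv z)"
    using int by (simp add: set_integrable_def dv_def)
  have m1: "(\<lambda>z. indicat_real ?D z * dv z) \<in> borel_measurable borel"
    using borel_measurable_integrable[OF intd] by simp
  have [measurable]: "\<kappa> n \<in> borel_measurable borel" for n
    by (rule borel_measurable_continuous_onI[OF c\<kappa>])
  have i1: "integrable lborel (\<lambda>z. \<kappa> n z * (indicat_real ?D z * dv z))" for n
  proof (rule Bochner_Integration.integrable_bound[OF intd])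
    show "(\<lambda>z. \<kappa> n z * (indicat_real ?D z * dv z)) \<in> borel_measurable lborel" using m1 by simp
    show "AE z in lborel. norm (\<kappa> n z * (indicat_real ?D z * dv z)) \<le> norm (indicat_real ?D z * dv z)"
      by (intro AE_I2) (auto simp: abs_mult \<kappa>_def intro!: mult_left_le_one_le simp: smooth_step_bounds)
  qed
  \<comment> \<open>The contribution of the gradient of the cutoff; being radial, it combines
    \<open>X\<close> and \<open>Y\<close> into \<open>B\<close>.\<close>
  define R where "R n z = indicat_real ?D z * (smooth_step' (\<tau> n z) * (- real n * 2) * B z)" for n z
  have eq: "indicat_real ?D z * (\<kappa> n z * X' z 1 + \<kappa>' n z 1 * X z) + indicat_real ?D z * (\<kappa> n z * Y' z \<i> + \<kappa>' n z \<i> * Y z)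
      = \<kappa> n z * (indicat_real ?D z * dv z) + R n z" for n z
    by (simp add: \<kappa>'_def R_def dv_def B_def inner_complex_def algebra_simps)
  have isum: "integrable lborel (\<lambda>z. \<kappa> n z * (indicat_real ?D z * dv z) + R n z)"
    and ssum: "integral\<^sup>L lborel (\<lambda>z. \<kappa> n z * (indicat_real ?D z * dv z) + R n z) = 0" for n
    using cut[OF DX cX, of n] cut[OF DY cY, of n]
    by (simp_all add: eq[symmetric] Bochner_Integration.integral_add)
  have iR: "integrable lborel (R n)" for n
    using Bochner_Integration.integrable_diff[OF isum[of n] i1[of n]] by simp
  have I: "integral\<^sup>L lborel (\<lambda>z. \<kappa> n z * (indicat_real ?D z * dv z)) = - integral\<^sup>L lborel (R n)" for n
    using ssum[of n] Bochner_Integration.integral_add[OF i1 iR, of n n] by simp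
  have lim: "(\<lambda>n. integral\<^sup>L lborel (\<lambda>z. \<kappa> n z * (indicat_real ?D z * dv z))) \<longlonglongrightarrow> integral\<^sup>L lborel (\<lambda>z. indicat_real ?D z * dv z)"
  proof (rule integral_dominated_convergence[where w = "\<lambda>z. norm (indicat_real ?D z * dv z)"])
    show "AE z in lborel. (\<lambda>n. \<kappa> n z * (indicat_real ?D z * dv z)) \<longlonglongrightarrow> indicat_real ?D z * dv z"
    proof (rule AE_I2, cases)
      fix z assume z: "z \<in> ?D"
      have "z \<bullet> z < 1" using z power_strict_mono[of "norm z" 1 2] by (auto simp: power2_norm_eq_inner)
      then obtain N where N: "real N * (1 - z \<bullet> z) > 2" using reals_Archimedean3[of "1 - z \<bullet> z"] by auto
      have "\<forall>\<^sub>F n in sequentially. \<kappa> n z * (indicat_real ?D z * dv z) = indicat_real ?D z * dv z"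
      proof (rule eventually_sequentiallyI[of N])
        fix n assume "N \<le> n"
        then have "real N * (1 - z \<bullet> z) \<le> real n * (1 - z \<bullet> z)" using \<open>z \<bullet> z < 1\<close> by (intro mult_right_mono) auto
        then have "\<kappa> n z = 1" using N by (simp add: \<kappa>_def \<tau>_def smooth_step_simps)
        then show "\<kappa> n z * (indicat_real ?D z * dv z) = indicat_real ?D z * dv z" by simp
      qed
      then show "(\<lambda>n. \<kappa> n z * (indicat_real ?D z * dv z)) \<longlonglongrightarrow> indicat_real ?D z * dv z"
        by (rule tendsto_eventually)
    qed simp
    show "AE z in lborel. norm (\<kappa> n z * (indicat_real ?D z * dv z)) \<le> norm (indicat_real ?D z * dv z)" for n
      by (intro AE_I2) (auto simp: abs_mult \<kappa>_def intro!: mult_left_le_one_le simp: smooth_step_bounds)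
    show "integrable lborel (\<lambda>z. norm (indicat_real ?D z * dv z))" by (rule integrable_norm[OF intd])
  qed (use m1 in \<open>simp_all\<close>)
  define c where "c = unit_ball_vol 2"
  have c: "c > 0" by (simp add: c_def)
  have small: "\<exists>N. \<forall>n\<ge>N. \<bar>integral\<^sup>L lborel (R n)\<bar> \<le> 8 * c * e" if e: "e > 0" for e
  proof -
    obtain d where d: "d > 0" "\<And>z. z \<in> ?D \<Longrightarrow> norm z > 1 - d \<Longrightarrow> \<bar>B z\<bar> < e"
      using boundary_limit_uniform[of B e] bd e by (auto simp: B_def[abs_def])
    obtain N where N: "real N > max 2 (2 / d)" using reals_Archimedean2 by blast
    have "\<bar>integral\<^sup>L lborel (R n)\<bar> \<le> 8 * c * e" if "n \<ge> N" for n
    proof -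
      have n: "real n > 2" "2 / real n < d"
        using N that d by (auto simp: field_simps) (smt (verit) mult_left_mono of_nat_le_iff)
      define a b where "a = sqrt (1 - 1 / n)" and "b = sqrt (1 - 2 / n)"
      have ab: "0 \<le> a" "0 \<le> b" "a\<^sup>2 = 1 - 1/n" "b\<^sup>2 = 1 - 2/n" "b \<le> a"
        using n divide_right_mono[of 1 2 "real n"] by (auto simp: a_def b_def)
      \<comment> \<open>The annulus on which the cutoff varies;
        \<open>a\<^sup>2 - b\<^sup>2 = 1 / n\<close> makes its area exactly
        \<open>c / n\<close>.\<close>
      define A where "A = cball (0::complex) a - ball 0 b"
      have fin: "emeasure lborel A < \<infinity>"
        unfolding A_def by (rule emeasure_bounded_finite) (auto intro: bounded_subset[OF bounded_cball])
      have "measure lborel A = measure lborel (cball (0::complex) a) - measure lborel (ball (0::complex) b)"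
        unfolding A_def using ab emeasure_bounded_finite[OF bounded_cball[of "0::complex" a]]
        by (intro measure_Diff) auto
      also have "\<dots> = c * (1 / n)"
        using ab by (simp add: content_cball content_ball c_def right_diff_distrib[symmetric])
      finally have mA: "measure lborel A = c / n" by simp
      have bnd: "norm (R n z) \<le> 8 * n * e * indicat_real A z" for z
      proof (cases "z \<in> ?D \<and> 0 < \<tau> n z \<and> \<tau> n z < 1")
        case False
        then have "R n z = 0" by (cases "z \<in> ?D") (auto simp: R_def smooth_step_simps not_less)
        then show ?thesis using e by simp
      next
        case True
        then have "z \<bullet> z < 1 - 1/n" "z \<bullet> z > 1 - 2/n" using n by (auto simp: \<tau>_def field_simps)
        then have nz: "(norm z)\<^sup>2 < 1 - 1/n" "(norm z)\<^sup>2 > 1 - 2/n" by (auto simp: power2_norm_eq_inner)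
        have "norm z \<le> a" "b \<le> norm z" using nz by (auto simp: a_def b_def intro: real_le_rsqrt real_le_lsqrt)
        then have zA: "z \<in> A" by (auto simp: A_def)
        have "(norm z)\<^sup>2 \<le> norm z" using True by (auto simp: power2_eq_square intro: mult_left_le_one_le)
        then have "\<bar>B z\<bar> < e" using nz n True d(2)[of z] by auto
        then have "\<bar>B z\<bar> * smooth_step' (\<tau> n z) \<le> e * 4" using smooth_step_bounds[of "\<tau> n z"] by (intro mult_mono) auto
        then have "(\<bar>B z\<bar> * smooth_step' (\<tau> n z)) * (2 * n) \<le> (e * 4) * (2 * n)" by (intro mult_right_mono) auto
        then show ?thesis using True zA smooth_step_bounds[of "\<tau> n z"] by (simp add: R_def abs_mult algebra_simps)
      qed
      have iA: "integrable lborel (\<lambda>z. 8 * n * e * indicat_real A z)"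
        using fin by (intro integrable_mult_right) (auto simp: A_def)
      have "norm (integral\<^sup>L lborel (R n)) \<le> integral\<^sup>L lborel (\<lambda>z. 8 * n * e * indicat_real A z)"
        by (rule Bochner_Integration.integral_norm_bound_integral[OF iR iA]) (use bnd in auto)
      also have "\<dots> = 8 * n * e * (c / n)"
        using fin mA by (simp add: A_def)
      also have "\<dots> = 8 * c * e" using n by simp
      finally show ?thesis by simp
    qed
    then show ?thesis by blast
  qed
  have "\<bar>integral\<^sup>L lborel (\<lambda>z. indicat_real ?D z * dv z)\<bar> \<le> 8 * c * e" if e: "e > 0" for e
  proof -
    obtain N where N: "\<And>n. n \<ge> N \<Longrightarrow> \<bar>integral\<^sup>L lborel (R n)\<bar> \<le> 8 * c * e"
      using small[OF e] by blast
    show ?thesis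
      by (rule LIMSEQ_le_const2[OF tendsto_rabs[OF lim]]) (use N in \<open>auto simp: I\<close>)
  qed
  \<comment> \<open>With this \<open>e\<close> the bound is half of the absolute value that it
    bounds.\<close>
  from this[of "\<bar>integral\<^sup>L lborel (\<lambda>z. indicat_real ?D z * dv z)\<bar> / (16 * c)"] c
  have "integral\<^sup>L lborel (\<lambda>z. indicat_real ?D z * dv z) = 0"
    by (auto simp: field_simps)
  then show ?thesis by (simp add: set_lebesgue_integral_def dv_def)
qed

section \<open>The energy on the cotangent bundle\<close>

text \<open>The description of the open sets rests on injectivity of the charts alone. It is stated
  this way because injectivity is what is established for the cotangent atlas, in
  \<open>inj_cot_chart\<close>.\<close>

lemma openin_mtop_inj:
  assumes inj: "\<And>c. c \<in> A \<Longrightarrow> inj_on (coord c) (cdom c)"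
  shows "openin (mtop A) U \<longleftrightarrow> U \<subseteq> carrier A \<and> (\<forall>c\<in>A. open (coord c ` (U \<inter> cdom c)))"
proof -
  let ?P = "\<lambda>U. U \<subseteq> carrier A \<and> (\<forall>c\<in>A. open (coord c ` (U \<inter> cdom c)))"
  have "istopology ?P"
    unfolding istopology_def
  proof (intro conjI allI impI ballI)
    fix S T c assume S: "?P S" and T: "?P T" and c: "c \<in> A"
    have "coord c ` (S \<inter> T \<inter> cdom c) = coord c ` (S \<inter> cdom c) \<inter> coord c ` (T \<inter> cdom c)"
      using inj[OF c] by (auto simp: inj_on_def)
    with S T c show "open (coord c ` (S \<inter> T \<inter> cdom c))" by auto
  next
    fix \<K> c assume K: "\<forall>K\<in>\<K>. ?P K" and c: "c \<in> A"
    have "coord c ` (\<Union>\<K> \<inter> cdom c) = (\<Union>K\<in>\<K>. coord c ` (K \<inter> cdom c))" by auto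
    with K c show "open (coord c ` (\<Union>\<K> \<inter> cdom c))" by auto
  qed auto
  then show ?thesis by (simp add: mtop_def)
qed

lemma cot_chart_simps [simp]:
  "cdom (cot_chart A c) = {x \<in> cotangent A. fst x \<in> cdom c}"
  "coord (cot_chart A c) x = (coord c (fst x), snd x c)"
  by (simp_all add: cot_chart_def)

section \<open>Charts and topology of the cotangent bundle\<close>

locale riem_manifold =
  fixes A :: "('n, 'e::euclidean_space) chart set" and g :: "('n, 'e) bilin_field"
  assumes manifold_A: "manifold A" and metric_g: "riemannian_metric A g"
begin

lemma atlas: "smooth_atlas A" using manifold_A by (simp add: manifold_def)

lemma inj_coord: "c \<in> A \<Longrightarrow> inj_on (coord c) (cdom c)"
  and open_cimg: "c \<in> A \<Longrightarrow> open (cimg c)"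
  using atlas by (auto simp: smooth_atlas_def)

lemma local_metric: assumes "c \<in> A" shows "local_metric (cimg c) (g c)"
proof
  show "open (cimg c)" by (rule open_cimg[OF assms])
qed (use metric_g assms in \<open>auto simp: riemannian_metric_def\<close>)

lemma cinv_coord: "c \<in> A \<Longrightarrow> q \<in> cdom c \<Longrightarrow> cinv c (coord c q) = q"
  using inj_coord by simp

lemma transition_coord: "c \<in> A \<Longrightarrow> q \<in> cdom c \<Longrightarrow> transition c c' (coord c q) = coord c' q"
  by (simp add: transition_def cinv_coord)

lemma open_overlap: "c \<in> A \<Longrightarrow> c' \<in> A \<Longrightarrow> open (coord c ` (cdom c \<inter> cdom c'))"
  using atlas by (auto simp: smooth_atlas_def)

lemma transition_has_derivative:
  assumes "c \<in> A" "c' \<in> A" "q \<in> cdom c" "q \<in> cdom c'"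
  shows "(transition c c' has_derivative transition_deriv c c' q) (at (coord c q))"
proof -
  have "smooth_on (coord c ` (cdom c \<inter> cdom c')) (transition c c')"
    using atlas assms by (auto simp: smooth_atlas_def)
  from smooth_on_open_differentiable[OF open_overlap[OF assms(1,2)] this, of "coord c q"]
  show ?thesis unfolding transition_deriv_def frechet_derivative_works[symmetric] using assms by auto
qed

lemma linear_transition_deriv:
  "c \<in> A \<Longrightarrow> c' \<in> A \<Longrightarrow> q \<in> cdom c \<Longrightarrow> q \<in> cdom c' \<Longrightarrow> linear (transition_deriv c c' q)"
  using has_derivative_linear[OF transition_has_derivative] .

lemma transition_deriv_chain:
  assumes c: "c \<in> A" "c' \<in> A" "c'' \<in> A" and q: "q \<in> cdom c" "q \<in> cdom c'" "q \<in> cdom c''"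
  shows "transition_deriv c' c'' q (transition_deriv c c' q u) = transition_deriv c c'' q u"
proof -
  have "((\<lambda>y. transition c' c'' (transition c c' y)) has_derivative
      (\<lambda>u. transition_deriv c' c'' q (transition_deriv c c' q u))) (at (coord c q))"
    by (rule has_derivative_compose[OF transition_has_derivative])
      (use assms transition_has_derivative in \<open>auto simp: transition_coord\<close>)
  moreover have "transition c' c'' (transition c c' y) = transition c c'' y" if "y \<in> coord c ` (cdom c \<inter> cdom c')" for y
    using that c by (auto simp: transition_coord)
  ultimately have "(transition c c'' has_derivative
      (\<lambda>u. transition_deriv c' c'' q (transition_deriv c c' q u))) (at (coord c q))"
    using has_derivative_transform_within_open[OF _ open_overlap[OF c(1,2)], of _ _ "coord c q" UNIV] q by blast
  from has_derivative_unique[OF this transition_has_derivative[OF c(1,3) q(1,3)]]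
  show ?thesis by metis
qed

lemma transition_deriv_self:
  assumes c: "c \<in> A" and q: "q \<in> cdom c"
  shows "transition_deriv c c q u = u"
proof -
  have "((\<lambda>y. y) has_derivative (\<lambda>u. u)) (at (coord c q))" by simp
  then have "(transition c c has_derivative (\<lambda>u. u)) (at (coord c q))"
    by (rule has_derivative_transform_within_open[OF _ open_cimg[OF c]]) (use c q in \<open>auto simp: transition_coord\<close>)
  from has_derivative_unique[OF this transition_has_derivative[OF c c q q]] show ?thesis by metis
qed

lemma transition_deriv_surj:
  assumes c: "c \<in> A" "c' \<in> A" and q: "q \<in> cdom c" "q \<in> cdom c'"
  shows "\<exists>u. transition_deriv c c' q u = v"
  by (rule exI[of _ "transition_deriv c' c q v"]) (simp add: transition_deriv_chain transition_deriv_self assms)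

lemma cotangentD:
  assumes "x \<in> cotangent A"
  shows "fst x \<in> carrier A" "c \<in> A \<Longrightarrow> c' \<in> A \<Longrightarrow> fst x \<in> cdom c \<Longrightarrow> fst x \<in> cdom c' \<Longrightarrow>
    snd x c \<bullet> u = snd x c' \<bullet> transition_deriv c c' (fst x) u"
    "c \<notin> A \<or> fst x \<notin> cdom c \<Longrightarrow> snd x c = 0"
proof -
  obtain q P where x: "x = (q, P)" by (cases x)
  have *: "fst x \<in> carrier A" "\<forall>c. c \<notin> A \<or> fst x \<notin> cdom c \<longrightarrow> snd x c = 0"
    "\<forall>c\<in>A. \<forall>c'\<in>A. fst x \<in> cdom c \<inter> cdom c' \<longrightarrow> (\<forall>u. snd x c \<bullet> u = snd x c' \<bullet> transition_deriv c c' (fst x) u)"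
    using assms unfolding x cotangent_def mem_Collect_eq prod.case fst_conv snd_conv by blast+
  show "fst x \<in> carrier A" by (rule *(1))
  show "c \<in> A \<Longrightarrow> c' \<in> A \<Longrightarrow> fst x \<in> cdom c \<Longrightarrow> fst x \<in> cdom c' \<Longrightarrow>
    snd x c \<bullet> u = snd x c' \<bullet> transition_deriv c c' (fst x) u" using *(3) by blast
  show "c \<notin> A \<or> fst x \<notin> cdom c \<Longrightarrow> snd x c = 0" using *(2) by blast
qed

text \<open>The components in one chart determine those in every other chart around the point by the
  transformation law, and all irrelevant indices carry 0; hence the whole families agree.\<close>

lemma cotangent_eqI:
  assumes x: "x \<in> cotangent A" "x' \<in> cotangent A" and c: "c \<in> A" "fst x \<in> cdom c"
    and eq: "fst x = fst x'" "snd x c = snd x' c"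
  shows "x = x'"
proof (rule prod_eqI[OF eq(1)], rule ext)
  fix c'
  show "snd x c' = snd x' c'"
  proof (cases "c' \<in> A \<and> fst x \<in> cdom c'")
    case True
    have "snd x c' \<bullet> u = snd x' c' \<bullet> u" for u
      using cotangentD(2)[OF x(1), of c' c u] cotangentD(2)[OF x(2), of c' c u] True c eq by simp
    then show ?thesis using vector_eq_rdot[of "snd x c'" "snd x' c'"] by simp
  next
    case False
    then show ?thesis using cotangentD(3)[OF x(1), of c'] cotangentD(3)[OF x(2), of c'] eq by auto
  qed
qed

lemma inj_cot_chart: "C \<in> cot_atlas A \<Longrightarrow> inj_on (coord C) (cdom C)"
  unfolding cot_atlas_def
proof (elim imageE, rule inj_onI)
  fix c x x' assume c: "C = cot_chart A c" "c \<in> A" and x: "x \<in> cdom C" "x' \<in> cdom C" "coord C x = coord C x'"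
  then have "fst x = fst x'" using inj_coord[OF c(2)] by (auto simp: inj_on_def)
  then show "x = x'" using c x by (intro cotangent_eqI[of x x' c]) auto
qed

lemma carrier_cot: "carrier (cot_atlas A) = cotangent A"
proof (intro equalityI subsetI)
  fix x assume "x \<in> cotangent A"
  moreover from cotangentD(1)[OF this] obtain c where "c \<in> A" "fst x \<in> cdom c" by (auto simp: carrier_def)
  ultimately show "x \<in> carrier (cot_atlas A)" by (auto simp: carrier_def cot_atlas_def)
qed (auto simp: carrier_def cot_atlas_def)

lemma openin_cot:
  "openin (mtop (cot_atlas A)) U \<longleftrightarrow> U \<subseteq> cotangent A \<and> (\<forall>c\<in>A. open (coord (cot_chart A c) ` (U \<inter> cdom (cot_chart A c))))"
  by (subst openin_mtop_inj[of "cot_atlas A", OF inj_cot_chart]) (simp_all only: carrier_cot, simp only: cot_atlas_def ball_simps)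

text \<open>The other components are forced by the transformation law; the chain rule for transition
  maps makes the resulting family consistent.\<close>

lemma covector_exists:
  assumes c: "c \<in> A" and q: "q \<in> cdom c"
  shows "\<exists>x\<in>cotangent A. fst x = q \<and> snd x c = p"
proof -
  define P where "P c' = (if c' \<in> A \<and> q \<in> cdom c' then \<Sum>b\<in>Basis. (p \<bullet> transition_deriv c' c q b) *\<^sub>R b else 0)" for c'
  have P: "P c' \<bullet> u = p \<bullet> transition_deriv c' c q u" if "c' \<in> A" "q \<in> cdom c'" for c' u
    using linear_Basis_expand[OF linear_transition_deriv[OF that(1) c that(2) q], of u] that
    by (simp add: P_def inner_sum_left inner_sum_right inner_commute[of u] mult.commute)
  have "(q, P) \<in> cotangent A"
    unfolding cotangent_def using c q P transition_deriv_chain by (auto simp: P_def[of _] carrier_def)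
  moreover have "P c = p"
    using P[OF c q] transition_deriv_self[OF c q] vector_eq_rdot[of "P c" p] by simp
  ultimately show ?thesis by (intro bexI[of _ "(q, P)"]) auto
qed

lemma cot_point_exists:
  assumes "c \<in> A" "z \<in> cimg c \<times> UNIV"
  obtains x where "x \<in> cotangent A" "fst x \<in> cdom c" "z = (coord c (fst x), snd x c)"
proof -
  obtain q where q: "q \<in> cdom c" "fst z = coord c q" using assms(2) by (cases z) auto
  obtain x where "x \<in> cotangent A" "fst x = q" "snd x c = snd z" using covector_exists[OF assms(1) q(1)] by blast
  then show ?thesis using q by (intro that[of x]) (auto simp: prod_eq_iff)
qed

lemma cimg_cot: assumes "c \<in> A" shows "cimg (cot_chart A c) = cimg c \<times> UNIV"
proof (intro equalityI subsetI)
  fix z assume "z \<in> cimg c \<times> (UNIV :: 'e set)"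
  then obtain x where "x \<in> cotangent A" "fst x \<in> cdom c" "z = (coord c (fst x), snd x c)"
    by (rule cot_point_exists[OF assms])
  then show "z \<in> cimg (cot_chart A c)" by (intro image_eqI[of _ _ x]) auto
qed auto

section \<open>The energy as a function on the cotangent bundle\<close>

definition fibre_energy :: "('n, 'e) cotpt \<Rightarrow> real" where
  "fibre_energy x = (let c = SOME c. c \<in> A \<and> fst x \<in> cdom c in local_metric.kin (g c) (coord c (fst x), snd x c))"

text \<open>The transition derivative is an isometry and components are contragredient, so it
  carries the vector dual to \<open>snd x c\<close> to the one dual to \<open>snd x c'\<close>. The
  energy is half the pairing of a covector with its dual vector.\<close>

lemma fibre_energy_chart:
  assumes x: "x \<in> cotangent A" and c: "c \<in> A" "fst x \<in> cdom c"
  shows "fibre_energy x = local_metric.kin (g c) (coord (cot_chart A c) x)"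
proof -
  define c' where "c' = (SOME c. c \<in> A \<and> fst x \<in> cdom c)"
  have c': "c' \<in> A" "fst x \<in> cdom c'" using someI_ex[of "\<lambda>c. c \<in> A \<and> fst x \<in> cdom c"] c unfolding c'_def by blast+
  interpret m: local_metric "cimg c" "g c" by (rule local_metric[OF c(1)])
  interpret m': local_metric "cimg c'" "g c'" by (rule local_metric[OF c'(1)])
  define S where "S = sharp (g c) (coord c (fst x)) (snd x c)"
  define T where "T = transition_deriv c c' (fst x)"
  have gT: "g c' (coord c' (fst x)) (T u) (T v) = g c (coord c (fst x)) u v" for u v
    using metric_g c c' unfolding riemannian_metric_def T_def by blast
  have "T S = sharp (g c') (coord c' (fst x)) (snd x c')"
  proof (rule m'.sharp_unique)
    show "coord c' (fst x) \<in> cimg c'" using c' by auto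
    fix Z
    obtain u where u: "Z = T u" using transition_deriv_surj[OF c(1) c'(1) c(2) c'(2)] unfolding T_def by metis
    have "g c (coord c (fst x)) S u = snd x c \<bullet> u" unfolding S_def using c by (intro m.h_sharp) auto
    also have "\<dots> = snd x c' \<bullet> T u" unfolding T_def by (rule cotangentD(2)[OF x c(1) c'(1) c(2) c'(2)])
    finally show "g c' (coord c' (fst x)) (T S) Z = snd x c' \<bullet> Z" by (simp add: u gT)
  qed
  then have "snd x c' \<bullet> sharp (g c') (coord c' (fst x)) (snd x c') = snd x c \<bullet> S"
    unfolding T_def using cotangentD(2)[OF x c(1) c'(1) c(2) c'(2), of S] by simp
  then show ?thesis unfolding fibre_energy_def c'_def[symmetric] Let_def
    by (simp add: m.kin_def m'.kin_def S_def)
qed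

lemma fibre_energy_nonneg:
  assumes "x \<in> cotangent A" shows "0 \<le> fibre_energy x"
proof -
  obtain c where c: "c \<in> A" "fst x \<in> cdom c" using cotangentD(1)[OF assms] by (auto simp: carrier_def)
  interpret m: local_metric "cimg c" "g c" by (rule local_metric[OF c(1)])
  show ?thesis unfolding fibre_energy_chart[OF assms c] by (rule m.kin_nonneg) (use c in auto)
qed

lemma continuous_kin: assumes "c \<in> A" shows "continuous_on (cimg c \<times> UNIV) (local_metric.kin (g c))"
proof -
  interpret m: local_metric "cimg c" "g c" by (rule local_metric[OF assms])
  show ?thesis by (intro continuous_at_imp_continuous_on ballI has_derivative_continuous[OF m.has_derivative_kin]) auto
qed

text \<open>Continuity of the energy, in the form in which \<open>mtop\<close> is tested.\<close>

lemma openin_fibre_energy: 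
  assumes "open I" shows "openin (mtop (cot_atlas A)) {x \<in> cotangent A. fibre_energy x \<in> I}"
  unfolding openin_cot
proof (intro conjI ballI)
  fix c assume c: "c \<in> A"
  have "coord (cot_chart A c) ` ({x \<in> cotangent A. fibre_energy x \<in> I} \<inter> cdom (cot_chart A c))
      = (cimg c \<times> UNIV) \<inter> local_metric.kin (g c) -` I" (is "?L = ?R")
  proof (intro equalityI subsetI)
    fix z assume "z \<in> ?L"
    then obtain x where x: "z = coord (cot_chart A c) x" "x \<in> cotangent A" "fibre_energy x \<in> I" "fst x \<in> cdom c" by auto
    then show "z \<in> ?R" unfolding fibre_energy_chart[OF x(2) c x(4)] by simp
  next
    fix z assume z: "z \<in> ?R"
    then obtain x where x: "x \<in> cotangent A" "fst x \<in> cdom c" "z = (coord c (fst x), snd x c)"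
      using cot_point_exists[OF c, of z] by blast
    then have "fibre_energy x \<in> I" using z fibre_energy_chart[OF x(1) c x(2)] by simp
    then show "z \<in> ?L" using x by (intro image_eqI[of _ _ x]) auto
  qed
  moreover have "open ?R"
    by (rule continuous_open_preimage[OF continuous_kin[OF c] _ assms]) (intro open_Times open_cimg c open_UNIV)
  ultimately show "open (coord (cot_chart A c) ` ({x \<in> cotangent A. fibre_energy x \<in> I} \<inter> cdom (cot_chart A c)))" by simp
qed auto

lemma openin_fst:
  assumes U: "openin (mtop A) U"
  shows "openin (mtop (cot_atlas A)) {x \<in> cotangent A. fst x \<in> U}"
  unfolding openin_cot
proof (intro conjI ballI)
  fix c assume c: "c \<in> A"
  have "coord (cot_chart A c) ` ({x \<in> cotangent A. fst x \<in> U} \<inter> cdom (cot_chart A c)) = coord c ` (U \<inter> cdom c) \<times> UNIV" (is "?L = ?R")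
  proof (intro equalityI subsetI)
    fix z assume "z \<in> ?R"
    then obtain q where q: "q \<in> cdom c" "q \<in> U" "fst z = coord c q" by (cases z) auto
    obtain x where "x \<in> cotangent A" "fst x = q" "snd x c = snd z" using covector_exists[OF c q(1)] by blast
    then show "z \<in> ?L" using q by (intro image_eqI[of _ _ x]) (auto simp: prod_eq_iff)
  qed auto
  moreover have "open (coord c ` (U \<inter> cdom c))" using U c by (auto simp: openin_mtop[OF atlas])
  ultimately show "open (coord (cot_chart A c) ` ({x \<in> cotangent A. fst x \<in> U} \<inter> cdom (cot_chart A c)))"
    by (simp add: open_Times)
qed auto

lemma openin_chart:
  assumes c: "c \<in> A" and W: "open W"
  shows "openin (mtop A) {q \<in> cdom c. coord c q \<in> W}"
  unfolding openin_mtop[OF atlas]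
proof (intro conjI ballI)
  show "{q \<in> cdom c. coord c q \<in> W} \<subseteq> carrier A" using c by (auto simp: carrier_def)
  fix c' assume c': "c' \<in> A"
  have "coord c' ` ({q \<in> cdom c. coord c q \<in> W} \<inter> cdom c') = coord c' ` (cdom c' \<inter> cdom c) \<inter> transition c' c -` W"
    using c' by (auto simp: transition_coord)
  moreover have "continuous_on (coord c' ` (cdom c' \<inter> cdom c)) (transition c' c)"
    using transition_has_derivative[OF c' c]
    by (intro continuous_at_imp_continuous_on) (auto intro: has_derivative_continuous)
  ultimately show "open (coord c' ` ({q \<in> cdom c. coord c q \<in> W} \<inter> cdom c'))"
    using continuous_open_preimage[OF _ open_overlap[OF c' c] W] by simp
qed

lemma openin_cdom_cot: assumes "c \<in> A" shows "openin (mtop (cot_atlas A)) (cdom (cot_chart A c))"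
  using openin_fst[OF openin_chart[OF assms open_UNIV]] by simp

text \<open>In a Hausdorff manifold the compact set of points with coordinates in \<open>B\<close>
  is closed. This prevents points of the disc that are mapped into a coordinate ball from
  accumulating at a point that is mapped outside the chart.\<close>

lemma openin_not_in_compact:
  assumes c: "c \<in> A" and B: "compact B" "B \<subseteq> cimg c"
  shows "openin (mtop (cot_atlas A)) {x \<in> cotangent A. \<not> (fst x \<in> cdom c \<and> coord c (fst x) \<in> B)}"
proof -
  have top: "topspace (mtop A) = carrier A"
  proof -
    have "openin (mtop A) (carrier A)"
      unfolding openin_mtop[OF atlas]
    proof (intro conjI ballI)
      fix c assume "c \<in> A"
      then have "carrier A \<inter> cdom c = cdom c" by (auto simp: carrier_def)
      then show "open (coord c ` (carrier A \<inter> cdom c))" using open_cimg[OF \<open>c \<in> A\<close>] by simp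
    qed simp
    moreover have "topspace (mtop A) \<subseteq> carrier A" using openin_mtop[OF atlas] openin_topspace by blast
    ultimately show ?thesis by (simp add: openin_subset subset_antisym)
  qed
  have "continuous_map (top_of_set (cimg c)) (mtop A) (cinv c)"
    unfolding continuous_map_def
  proof (intro conjI allI impI)
    show "cinv c \<in> topspace (top_of_set (cimg c)) \<rightarrow> topspace (mtop A)"
      using cinv_coord[OF c] c unfolding top by (fastforce simp: carrier_def)
    fix U assume U: "openin (mtop A) U"
    have "{x \<in> topspace (top_of_set (cimg c)). cinv c x \<in> U} = coord c ` (U \<inter> cdom c)"
      using c by (auto simp: cinv_coord)
    moreover have "open (coord c ` (U \<inter> cdom c))" using U c by (auto simp: openin_mtop[OF atlas])
    ultimately show "openin (top_of_set (cimg c)) {x \<in> topspace (top_of_set (cimg c)). cinv c x \<in> U}"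
      using openin_open_eq[OF open_cimg[OF c]] by auto
  qed
  moreover have "compactin (top_of_set (cimg c)) B" using B by (simp add: compactin_subtopology)
  ultimately have "compactin (mtop A) (cinv c ` B)" using image_compactin by blast
  then have "closedin (mtop A) (cinv c ` B)"
    using manifold_A compactin_imp_closedin unfolding manifold_def by blast
  moreover have "cinv c ` B = {q \<in> cdom c. coord c q \<in> B}"
  proof (intro equalityI subsetI)
    fix q assume "q \<in> cinv c ` B" then show "q \<in> {q \<in> cdom c. coord c q \<in> B}" using B c by (auto simp: cinv_coord)
  next
    fix q assume "q \<in> {q \<in> cdom c. coord c q \<in> B}" then show "q \<in> cinv c ` B"
      using c by (intro image_eqI[of _ _ "coord c q"]) (auto simp: cinv_coord)
  qed
  ultimately have "openin (mtop A) (carrier A - {q \<in> cdom c. coord c q \<in> B})"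
    by (simp add: closedin_def top)
  from openin_fst[OF this] show ?thesis
    by (rule back_subst[of "openin (mtop (cot_atlas A))"]) (use cotangentD(1) in auto)
qed

lemma zero_section_cotangent: "zero_section A \<subseteq> cotangent A"
  by (auto simp: zero_section_def cotangent_def)

lemma fibre_energy_zero_section: assumes "x \<in> zero_section A" shows "fibre_energy x = 0"
proof -
  have x: "x \<in> cotangent A" using assms zero_section_cotangent by blast
  obtain c where c: "c \<in> A" "fst x \<in> cdom c" using cotangentD(1)[OF x] by (auto simp: carrier_def)
  interpret m: local_metric "cimg c" "g c" by (rule local_metric[OF c(1)])
  show ?thesis using assms c by (simp add: fibre_energy_chart[OF x c] m.kin_def zero_section_def) auto
qed

text \<open>Local positive constants become a uniform one: \<open>P\<close> is inherited by smaller
  numbers, so the minimum over a finite subcover works. The two instances are the energy bound that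
  forces membership in \<open>V\<close> and the area constant.\<close>

lemma compact_cover:
  assumes cpt: "compact_space (mtop A)"
    and loc: "\<And>q. q \<in> carrier A \<Longrightarrow> \<exists>U r. openin (mtop A) U \<and> q \<in> U \<and> (r::real) > 0 \<and> P U r"
    and mono: "\<And>U r s. P U r \<Longrightarrow> 0 < s \<Longrightarrow> s \<le> r \<Longrightarrow> P U s"
  shows "\<exists>r>0. \<forall>q\<in>carrier A. \<exists>U. q \<in> U \<and> P U r"
proof -
  have top: "topspace (mtop A) \<subseteq> carrier A" using openin_mtop[OF atlas] openin_topspace by blast
  have "\<forall>q\<in>carrier A. \<exists>W. openin (mtop A) (fst W) \<and> q \<in> fst W \<and> snd W > (0::real) \<and> P (fst W) (snd W)"
    using loc by (metis fst_conv snd_conv)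
  then obtain W where W: "\<forall>q\<in>carrier A. openin (mtop A) (fst (W q)) \<and> q \<in> fst (W q) \<and> snd (W q) > (0::real) \<and> P (fst (W q)) (snd (W q))"
    by (rule bchoice[THEN exE])
  define U where "U = fst \<circ> W"
  define r where "r = snd \<circ> W"
  have U: "\<And>q. q \<in> carrier A \<Longrightarrow> openin (mtop A) (U q)" "\<And>q. q \<in> carrier A \<Longrightarrow> q \<in> U q"
    "\<And>q. q \<in> carrier A \<Longrightarrow> r q > (0::real)" "\<And>q. q \<in> carrier A \<Longrightarrow> P (U q) (r q)"
    using W by (auto simp: U_def r_def)
  have car: "carrier A \<subseteq> topspace (mtop A)" using U(1,2) openin_subset by blast
  have "compactin (mtop A) (topspace (mtop A))" using cpt by (simp add: compact_space_def)
  moreover have "\<And>V. V \<in> U ` carrier A \<Longrightarrow> openin (mtop A) V" using U(1) by blast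
  moreover have "topspace (mtop A) \<subseteq> \<Union>(U ` carrier A)" using top U(2) by blast
  ultimately obtain F where "finite F" "F \<subseteq> U ` carrier A" "topspace (mtop A) \<subseteq> \<Union>F"
    by (rule compactinD[THEN exE]) auto
  then obtain Q where Q: "finite Q" "Q \<subseteq> carrier A" "topspace (mtop A) \<subseteq> \<Union>(U ` Q)"
    using finite_subset_image[of F U "carrier A"] by blast
  \<comment> \<open>The inserted 1 keeps \<open>Min\<close> meaningful when the manifold, and with
    it \<open>Q\<close>, is empty.\<close>
  define s where "s = Min (insert 1 (r ` Q))"
  have s: "s > 0" using Q U(3) by (auto simp: s_def)
  have "\<exists>U. q \<in> U \<and> P U s" if q: "q \<in> carrier A" for q
  proof -
    obtain q' where q': "q' \<in> Q" "q \<in> U q'" using q car Q(3) by blast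
    have "s \<le> r q'" using q' Q(1) by (simp add: s_def)
    then show ?thesis using mono[OF U(4)[of q'] s] q' Q(2) by blast
  qed
  then show ?thesis using s by blast
qed

lemma energy_sublevel_subset:
  assumes cpt: "compact_space (mtop A)" and V: "openin (mtop (cot_atlas A)) V" "zero_section A \<subseteq> V"
  shows "\<exists>r>0. \<forall>x\<in>cotangent A. fibre_energy x < r \<longrightarrow> x \<in> V"
proof -
  have "\<exists>r>0. \<forall>q\<in>carrier A. \<exists>U. q \<in> U \<and> (\<forall>x\<in>cotangent A. fst x \<in> U \<and> fibre_energy x < r \<longrightarrow> x \<in> V)"
  proof (rule compact_cover[OF cpt])
    fix q assume "q \<in> carrier A"
    then obtain c where c: "c \<in> A" "q \<in> cdom c" by (auto simp: carrier_def)
    interpret m: local_metric "cimg c" "g c" by (rule local_metric[OF c(1)])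
    let ?C = "cot_chart A c"
    define x where "x = (q, \<lambda>_::('n,'e) chart. 0::'e)"
    have x: "x \<in> zero_section A" using c by (auto simp: x_def zero_section_def carrier_def)
    have "(coord c q, 0) \<in> coord ?C ` (V \<inter> cdom ?C)"
      using x V(2) zero_section_cotangent c by (intro image_eqI[of _ _ x]) (auto simp: x_def)
    moreover have "open (coord ?C ` (V \<inter> cdom ?C))" using V(1) c by (auto simp: openin_cot)
    ultimately obtain e1 where e1: "e1 > 0" "ball (coord c q, 0) e1 \<subseteq> coord ?C ` (V \<inter> cdom ?C)"
      using open_contains_ball by blast
    obtain e2 m M where e2: "0 < e2" "0 < M" "cball (coord c q) e2 \<subseteq> cimg c"
      "\<And>y u. y \<in> cball (coord c q) e2 \<Longrightarrow> g c y u u \<le> M * (u \<bullet> u)"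
      using m.local_bounds[of "coord c q"] c by auto
    define e where "e = min (e1/2) e2"
    \<comment> \<open>By \<open>kin_lower\<close>, energy below this \<open>r\<close> bounds the
      momentum by \<open>e1/2\<close>; the displacement of the base point takes up the other half of
      \<open>e1\<close>.\<close>
    define r where "r = (e1/2)\<^sup>2 / (2 * M)"
    define U where "U = {q' \<in> cdom c. coord c q' \<in> ball (coord c q) e}"
    have "r > 0" using e1 e2 by (simp add: r_def)
    moreover have "openin (mtop A) U" unfolding U_def by (rule openin_chart[OF c(1) open_ball])
    moreover have "q \<in> U" using c e1 e2 by (simp add: U_def e_def)
    moreover have "\<forall>x\<in>cotangent A. fst x \<in> U \<and> fibre_energy x < r \<longrightarrow> x \<in> V"
    proof (intro ballI impI)
      fix x assume x: "x \<in> cotangent A" and "fst x \<in> U \<and> fibre_energy x < r"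
      then have xc: "fst x \<in> cdom c" "dist (coord c q) (coord c (fst x)) < e" and f: "fibre_energy x < r" by (auto simp: U_def)
      have "snd x c \<bullet> snd x c \<le> 2 * M * fibre_energy x"
        using m.kin_lower[of "coord ?C x" M] e2 xc fibre_energy_chart[OF x c(1) xc(1)] by (auto simp: e_def)
      also have "\<dots> < 2 * M * r" using f e2 by simp
      also have "\<dots> = (e1/2)\<^sup>2" using e2 by (simp add: r_def)
      finally have "(norm (snd x c))\<^sup>2 < (e1/2)\<^sup>2" by (simp add: power2_norm_eq_inner)
      then have "norm (snd x c) < e1/2" by (rule power_less_imp_less_base) (use e1 in simp)
      moreover have "dist (coord c q, 0) (coord ?C x) \<le> dist (coord c q) (coord c (fst x)) + norm (snd x c)"
        by (simp add: dist_Pair_Pair sqrt_sum_squares_le_sum)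
      ultimately have "coord ?C x \<in> ball (coord c q, 0) e1" using xc by (simp add: e_def)
      then have "coord ?C x \<in> coord ?C ` (V \<inter> cdom ?C)" using e1(2) by blast
      then obtain x' where x': "x' \<in> V" "x' \<in> cdom ?C" "coord ?C x = coord ?C x'" by auto
      have "fst x = fst x'" using inj_coord[OF c(1)] x' xc(1) by (auto simp: inj_on_def)
      then have "x = x'" using x' by (intro cotangent_eqI[OF x _ c(1) xc(1)]) auto
      then show "x \<in> V" using x' by simp
    qed
    ultimately show "\<exists>U r. openin (mtop A) U \<and> q \<in> U \<and> r > 0 \<and> (\<forall>x\<in>cotangent A. fst x \<in> U \<and> fibre_energy x < r \<longrightarrow> x \<in> V)"
      by blast
  qed auto
  then show ?thesis using cotangentD(1) by metis
qed

end

section \<open>Compatible structures on a vector space\<close>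

definition sform :: "'e::euclidean_space \<times> 'e \<Rightarrow> 'e \<times> 'e \<Rightarrow> real" where
  "sform u v = fst u \<bullet> snd v - snd u \<bullet> fst v"

text \<open>Cotangent charts are Darboux charts: \<open>omega\<close> has constant coefficients, so
  freezing the almost complex structure at a point leaves the symplectic form unchanged.\<close>

lemma omega_sform: "omega z = sform"
  by (intro ext) (simp add: omega_eq sform_def inner_commute)

lemma sform_skew: "sform u v = - sform v u"
  by (simp add: sform_def inner_commute)

lemma sform_self [simp]: "sform u u = 0"
  using sform_skew[of u u] by simp

lemma sform_linear:
  "sform (u + u') v = sform u v + sform u' v" "sform u (v + v') = sform u v + sform u v'"
  "sform (u - u') v = sform u v - sform u' v" "sform u (v - v') = sform u v - sform u v'"
  "sform (c *\<^sub>R u) v = c * sform u v" "sform u (c *\<^sub>R v) = c * sform u v"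
  "sform (- u) v = - sform u v" "sform u (- v) = - sform u v" "sform 0 v = 0" "sform u 0 = 0"
  by (simp_all add: sform_def algebra_simps)

lemma bounded_bilinear_sform: "bounded_bilinear (sform :: 'e::euclidean_space \<times> 'e \<Rightarrow> _)"
proof
  show "\<exists>K. \<forall>a b. norm (sform a b) \<le> norm (a :: 'e \<times> 'e) * norm b * K"
  proof (intro exI allI)
    fix a b :: "'e \<times> 'e"
    have "norm (sform a b) \<le> \<bar>fst a \<bullet> snd b\<bar> + \<bar>snd a \<bullet> fst b\<bar>" by (simp add: sform_def)
    also have "\<dots> \<le> norm (fst a) * norm (snd b) + norm (snd a) * norm (fst b)"
      by (intro add_mono Cauchy_Schwarz_ineq2)
    also have "\<dots> \<le> norm a * norm b + norm a * norm b"
      using norm_fst_le[of "fst a" "snd a"] norm_snd_le[of "snd a" "fst a"]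
        norm_fst_le[of "fst b" "snd b"] norm_snd_le[of "snd b" "fst b"]
      by (intro add_mono mult_mono) auto
    finally show "norm (sform a b) \<le> norm a * norm b * 2" by simp
  qed
qed (simp_all add: sform_linear)

locale compatible_structure =
  fixes J0 :: "'e::euclidean_space \<times> 'e \<Rightarrow> 'e \<times> 'e"
  assumes linear_J0: "linear J0" and J0_J0 [simp]: "J0 (J0 u) = - u"
    and tame_J0: "u \<noteq> 0 \<Longrightarrow> sform u (J0 u) > 0"
    and compatible_J0: "sform (J0 u) (J0 v) = sform u v"
begin

definition G :: "'e \<times> 'e \<Rightarrow> 'e \<times> 'e \<Rightarrow> real" where "G u v = sform u (J0 v)"

lemma J0_linear [simp]: "J0 (u + v) = J0 u + J0 v" "J0 (u - v) = J0 u - J0 v" "J0 (c *\<^sub>R u) = c *\<^sub>R J0 u" "J0 (- u) = - J0 u"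
  using linear_J0 by (simp_all add: linear_add linear_diff linear_cmul linear_neg)

lemma G_linear:
  "G (u + u') v = G u v + G u' v" "G u (v + v') = G u v + G u v'"
  "G (u - u') v = G u v - G u' v" "G u (v - v') = G u v - G u v'"
  "G (c *\<^sub>R u) v = c * G u v" "G u (c *\<^sub>R v) = c * G u v" "G (- u) v = - G u v" "G u (- v) = - G u v"
  by (simp_all add: G_def sform_linear)

lemma G_sym: "G u v = G v u"
proof -
  have "sform u (J0 v) = sform (J0 u) (- v)" using compatible_J0[of u "J0 v"] by simp
  also have "\<dots> = sform v (J0 u)" using sform_skew[of "J0 u" v] by (simp add: sform_linear)
  finally show ?thesis by (simp add: G_def)
qed

lemma G_J0: "G (J0 u) (J0 v) = G u v"
  using compatible_J0[of u "J0 v"] by (simp add: G_def)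

lemma sform_G: "sform u v = - G u (J0 v)"
  by (simp add: G_def sform_linear)

lemma G_orth [simp]: "G u (J0 u) = 0"
  by (simp add: G_def sform_linear)

lemma G_pos: "u \<noteq> 0 \<Longrightarrow> G u u > 0"
  by (simp add: G_def tame_J0)

lemma G_nonneg: "G u u \<ge> 0"
  using G_pos[of u] by (cases "u = 0") (auto simp: G_def sform_linear)

lemma G_Cauchy_Schwarz: "(G u v)\<^sup>2 \<le> G u u * G v v"
proof (cases "v = 0")
  case False
  have "0 \<le> G (G v v *\<^sub>R u - G u v *\<^sub>R v) (G v v *\<^sub>R u - G u v *\<^sub>R v)" by (rule G_nonneg)
  also have "\<dots> = G v v * (G u u * G v v - (G u v)\<^sup>2)"
    using G_sym[of v u] by (simp add: G_linear power2_eq_square algebra_simps)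
  finally show ?thesis using G_pos[OF False] by (simp add: zero_le_mult_iff)
qed (simp add: G_def sform_linear J0_linear(3)[of 0, simplified])

text \<open>\<open>a\<close> and \<open>J0 a\<close> are orthogonal and of equal length, so this is
  Bessel's inequality for the plane that they span. Two separate Cauchy-Schwarz estimates would lose
  a factor 2, which the monotonicity estimate cannot afford.\<close>

lemma G_Bessel: "(G u a)\<^sup>2 + (G u (J0 a))\<^sup>2 \<le> G u u * G a a"
proof -
  define s where "s = (G u a)\<^sup>2 + (G u (J0 a))\<^sup>2"
  define v where "v = G u a *\<^sub>R a + G u (J0 a) *\<^sub>R J0 a"
  have "G u v = s" by (simp add: v_def s_def G_linear power2_eq_square)
  moreover have "G v v = s * G a a"
    using G_sym[of "J0 a" a] by (simp add: v_def s_def G_linear G_J0 power2_eq_square algebra_simps)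
  ultimately have "s * s \<le> s * (G u u * G a a)"
    using G_Cauchy_Schwarz[of u v] by (simp add: power2_eq_square algebra_simps)
  moreover have "s \<ge> 0" by (simp add: s_def)
  ultimately have "s \<le> G u u * G a a"
    using G_nonneg[of u] G_nonneg[of a] by (cases "s = 0") auto
  then show ?thesis by (simp add: s_def)
qed

text \<open>\<open>a, b\<close> play the role of the partial derivatives of a map which is holomorphic for a
  structure close to \<open>J0\<close>, and \<open>\<zeta>\<close> that of its displacement from the centre.\<close>

lemma two_form_estimate:
  assumes t: "0 \<le> t" "t \<le> 1/2" and d: "G (b - J0 a) (b - J0 a) \<le> t\<^sup>2 * G a a"
  shows "\<bar>G \<zeta> a * sform \<zeta> b - G \<zeta> b * sform \<zeta> a\<bar> \<le> G \<zeta> \<zeta> * (1 + 6 * t) * sform a b"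
    and "(1 - t) * G a a \<le> sform a b" "G a a \<le> 2 * sform a b"
proof -
  define N where "N = sqrt (G a a)"
  define Z where "Z = sqrt (G \<zeta> \<zeta>)"
  define d where "d = b - J0 a"
  have N: "N \<ge> 0" "N * N = G a a" and Z: "Z \<ge> 0" "Z * Z = G \<zeta> \<zeta>" by (simp_all add: N_def Z_def G_nonneg)
  have bd: "\<bar>G u v\<bar> \<le> x * y" if "G u u \<le> x * x" "G v v \<le> y * y" "x \<ge> 0" "y \<ge> 0" for u v x y
  proof (rule power2_le_imp_le[OF _ mult_nonneg_nonneg[OF that(3,4)]])
    have "\<bar>G u v\<bar>\<^sup>2 \<le> G u u * G v v" using G_Cauchy_Schwarz[of u v] by simp
    also have "\<dots> \<le> (x * x) * (y * y)" using that G_nonneg by (intro mult_mono) auto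
    finally show "\<bar>G u v\<bar>\<^sup>2 \<le> (x * y)\<^sup>2" by (simp add: power2_eq_square algebra_simps)
  qed
  have dd: "G d d \<le> (t * N) * (t * N)" using d by (simp add: d_def power2_eq_square N(2)[symmetric] mult_ac)
  have Jd: "G (J0 d) (J0 d) \<le> (t * N) * (t * N)" using dd by (simp add: G_J0)
  have tN: "t * N \<ge> 0" using t N by simp
  have b: "b = J0 a + d" by (simp add: d_def)
  have 1: "\<bar>G a (J0 d)\<bar> \<le> N * (t * N)" by (rule bd) (use N Jd tN in auto)
  have sf: "sform a b = G a a - G a (J0 d)" by (simp add: b sform_linear G_def)
  show lower: "(1 - t) * G a a \<le> sform a b" 
  proof -
    have "N * (t * N) = t * G a a" by (simp add: N(2)[symmetric])
    from 1[unfolded this] show ?thesis by (simp add: sf left_diff_distrib)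
  qed
  have "(1/2) * G a a \<le> (1 - t) * G a a" using t G_nonneg[of a] by (intro mult_right_mono) auto
  then show "G a a \<le> 2 * sform a b" using lower by simp
  have "G \<zeta> a * sform \<zeta> b - G \<zeta> b * sform \<zeta> a
      = ((G \<zeta> a)\<^sup>2 + (G \<zeta> (J0 a))\<^sup>2) - G \<zeta> a * G \<zeta> (J0 d) + G \<zeta> d * G \<zeta> (J0 a)"
    by (simp add: sform_G b G_linear power2_eq_square algebra_simps)
  also have "\<bar>\<dots>\<bar> \<le> Z * Z * (N * N) + (Z * N) * (Z * (t * N)) + (Z * (t * N)) * (Z * N)"
  proof -
    have 2: "\<bar>G \<zeta> a\<bar> \<le> Z * N" by (rule bd) (use N Z in auto)
    have 3: "\<bar>G \<zeta> (J0 a)\<bar> \<le> Z * N" by (rule bd) (use N Z in \<open>auto simp: G_J0\<close>)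
    have 4: "\<bar>G \<zeta> d\<bar> \<le> Z * (t * N)" by (rule bd) (use Z dd tN in auto)
    have 5: "\<bar>G \<zeta> (J0 d)\<bar> \<le> Z * (t * N)" by (rule bd) (use Z Jd tN in auto)
    have "\<bar>G \<zeta> a * G \<zeta> (J0 d)\<bar> \<le> (Z * N) * (Z * (t * N))"
      unfolding abs_mult by (intro mult_mono 2 5) (use Z N in auto)
    moreover have "\<bar>G \<zeta> d * G \<zeta> (J0 a)\<bar> \<le> (Z * (t * N)) * (Z * N)"
      unfolding abs_mult by (intro mult_mono 3 4) (use Z tN in auto)
    moreover have "0 \<le> (G \<zeta> a)\<^sup>2 + (G \<zeta> (J0 a))\<^sup>2" by simp
    moreover have "(G \<zeta> a)\<^sup>2 + (G \<zeta> (J0 a))\<^sup>2 \<le> Z * Z * (N * N)" using G_Bessel[of \<zeta> a] Z N by simp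
    ultimately show ?thesis by linarith
  qed
  also have "\<dots> = G \<zeta> \<zeta> * ((1 + 2 * t) * G a a)" by (simp add: Z(2)[symmetric] N(2)[symmetric] algebra_simps)
  also have "\<dots> \<le> G \<zeta> \<zeta> * ((1 + 6 * t) * sform a b)"
  proof (intro mult_left_mono G_nonneg)
    \<comment> \<open>The origin of the 6: dividing by the factor \<open>1 - t\<close> lost in
      \<open>lower\<close> turns \<open>1 + 2 * t\<close> into at most \<open>1 + 6 * t\<close> for
      \<open>t\<close> at most 1/2.\<close>
    have "t * t \<le> t * (1/2)" using t by (intro mult_left_mono) auto
    then have "1 + 2 * t \<le> (1 + 6 * t) * (1 - t)" by (simp add: algebra_simps)
    then have "(1 + 2 * t) * G a a \<le> (1 + 6 * t) * (1 - t) * G a a" by (intro mult_right_mono G_nonneg)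
    also have "\<dots> \<le> (1 + 6 * t) * sform a b" using lower t by (simp add: mult.assoc mult_left_mono)
    finally show "(1 + 2 * t) * G a a \<le> (1 + 6 * t) * sform a b" .
  qed
  finally show "\<bar>G \<zeta> a * sform \<zeta> b - G \<zeta> b * sform \<zeta> a\<bar> \<le> G \<zeta> \<zeta> * (1 + 6 * t) * sform a b"
    by (simp add: mult.assoc)
qed

end

section \<open>Holomorphic discs\<close>

lemma set_integral_lower_bound:
  fixes f :: "'a::euclidean_space \<Rightarrow> real"
  assumes int: "set_integrable lborel D f" and nn: "\<And>z. z \<in> D \<Longrightarrow> 0 \<le> f z"
    and B: "B \<subseteq> D" "B \<in> sets borel" "bounded B" and c: "\<And>z. z \<in> B \<Longrightarrow> c \<le> f z"
  shows "c * measure lborel B \<le> (LINT z:D|lborel. f z)"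
proof -
  have fin: "emeasure lborel B < \<infinity>" by (rule emeasure_bounded_finite[OF B(3)])
  have "integral\<^sup>L lborel (\<lambda>z. c * indicat_real B z) \<le> integral\<^sup>L lborel (\<lambda>z. indicat_real D z *\<^sub>R f z)"
  proof (rule integral_mono)
    show "integrable lborel (\<lambda>z. c * indicat_real B z)" using fin B by (intro integrable_mult_right) auto
    show "integrable lborel (\<lambda>z. indicat_real D z *\<^sub>R f z)" using int by (simp add: set_integrable_def)
    show "c * indicat_real B z \<le> indicat_real D z *\<^sub>R f z" for z
      using B(1) c nn by (auto simp: indicator_def)
  qed
  then show ?thesis using fin B by (simp add: set_lebesgue_integral_def)
qed

lemma continuous_set_integral_eq_0:
  fixes f :: "'a::euclidean_space \<Rightarrow> real"
  assumes int: "set_integrable lborel D f" and nn: "\<And>z. z \<in> D \<Longrightarrow> 0 \<le> f z" and D: "open D"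
    and cont: "continuous_on D f" and 0: "(LINT z:D|lborel. f z) = 0" and z: "z \<in> D"
  shows "f z = 0"
proof (rule ccontr)
  assume "f z \<noteq> 0"
  then have pos: "f z > 0" using nn[OF z] by simp
  have "open {x \<in> D. f z / 2 < f x}" 
    using continuous_open_preimage[OF cont D open_greaterThan[of "f z / 2"]]
    by (simp add: vimage_def Int_def)
  then obtain r where r: "r > 0" "ball z r \<subseteq> {x \<in> D. f z / 2 < f x}"
    using open_contains_ball[of "{x \<in> D. f z / 2 < f x}"] z pos by auto
  have "(f z / 2) * measure lborel (ball z r) \<le> 0"
    using set_integral_lower_bound[OF int nn, of "ball z r" "f z / 2"] r 0 by fastforce
  then show False using pos content_ball_pos[OF r(1), of z] by (simp add: mult_le_0_iff)
qed

locale tame_setup = riem_manifold A g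
  for A :: "('n, 'e::euclidean_space) chart set" and g :: "('n, 'e) bilin_field" +
  fixes J :: "(('n, 'e) cotpt, 'e \<times> 'e) endo_field" and V :: "('n, 'e) cotpt set"
  assumes ac: "almost_complex (cot_atlas A) J" and tame: "omega_tame A J" and compat: "omega_compatible A J"
    and V_open: "openin (mtop (cot_atlas A)) V" and J_V: "equals_sasaki_on A g J V"
begin

lemma cot_atlasI: "c \<in> A \<Longrightarrow> cot_chart A c \<in> cot_atlas A"
  by (simp add: cot_atlas_def)

lemma linear_J: "c \<in> A \<Longrightarrow> z \<in> cimg c \<times> UNIV \<Longrightarrow> linear (J (cot_chart A c) z)"
  using ac cot_atlasI cimg_cot unfolding almost_complex_def by blast

lemma compatible: 
  assumes c: "c \<in> A" and z: "z \<in> cimg c \<times> UNIV"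
  shows "compatible_structure (J (cot_chart A c) z)"
proof (rule compatible_structure.intro)
  have z': "z \<in> cimg (cot_chart A c)" using z cimg_cot[OF c] by simp
  show "linear (J (cot_chart A c) z)" by (rule linear_J[OF c z])
  show "J (cot_chart A c) z (J (cot_chart A c) z u) = - u" for u
    using ac cot_atlasI[OF c] z' unfolding almost_complex_def by blast
  show "0 < sform u (J (cot_chart A c) z u)" if "u \<noteq> 0" for u
    using tame cot_atlasI[OF c] z' that unfolding omega_tame_def omega_sform by blast
  show "sform (J (cot_chart A c) z u) (J (cot_chart A c) z v) = sform u v" for u v
    using compat cot_atlasI[OF c] z' unfolding omega_compatible_def omega_sform by blast
qed

lemma smooth_J: "c \<in> A \<Longrightarrow> smooth_on (cimg c \<times> UNIV) (\<lambda>z. J (cot_chart A c) z u)"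
  using ac cot_atlasI cimg_cot unfolding almost_complex_def by metis

lemma continuous_J:
  assumes c: "c \<in> A" and f: "continuous_on T f" "\<And>x. x \<in> T \<Longrightarrow> f x \<in> cimg c \<times> UNIV" and v: "continuous_on T v"
  shows "continuous_on T (\<lambda>x. J (cot_chart A c) (f x) (v x))"
proof -
  have "continuous_on (cimg c \<times> UNIV) (\<lambda>z. J (cot_chart A c) z b)" for b
    using smooth_on_open_Ck[OF _ smooth_J[OF c], of 0] open_Times[OF open_cimg[OF c] open_UNIV] by simp
  then have "continuous_on T (\<lambda>x. J (cot_chart A c) (f x) b)" for b
    by (rule continuous_on_compose2[OF _ f(1)]) (intro image_subsetI f(2))
  then have "continuous_on T (\<lambda>x. \<Sum>b\<in>Basis. (v x \<bullet> b) *\<^sub>R J (cot_chart A c) (f x) b)"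
    by (intro continuous_intros v)
  then show ?thesis
    by (rule continuous_on_eq) (use f(2) linear_Basis_expand[OF linear_J[OF c]] in metis)
qed

lemma dkin_J:
  assumes c: "c \<in> A" and x: "x \<in> V" "x \<in> cotangent A" "fst x \<in> cdom c"
  shows "local_metric.dkin (g c) (coord (cot_chart A c) x) (J (cot_chart A c) (coord (cot_chart A c) x) u) = snd x c \<bullet> fst u"
proof -
  interpret m: local_metric "cimg c" "g c" by (rule local_metric[OF c])
  have "J (cot_chart A c) (coord (cot_chart A c) x) = sasaki_J (g c) (coord (cot_chart A c) x)"
    using J_V c x unfolding equals_sasaki_on_def Let_def by blast
  then show ?thesis using m.dkin_sasaki_J[of "coord (cot_chart A c) x" u] x by simp
qed

end

text \<open>The marked set \<open>M\<close> is an arbitrary finite subset of the circle here; the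
  cyclic order of the three points enters only in \<open>triangle_dichotomy\<close>.\<close>

locale hol_disc = tame_setup A g J V
  for A :: "('n, 'e::euclidean_space) chart set" and g :: "('n, 'e) bilin_field"
    and J :: "(('n, 'e) cotpt, 'e \<times> 'e) endo_field" and V :: "('n, 'e) cotpt set" +
  fixes w :: "complex \<Rightarrow> ('n, 'e) cotpt" and M :: "complex set"
  assumes M: "finite M" "M \<subseteq> sphere 0 1"
    and cont_w: "continuous_map (top_of_set (cball 0 1)) (mtop (cot_atlas A)) w"
    and hol: "J_holomorphic_on (cot_atlas A) J (cball 0 1 - M) w"
    and energy: "finite_energy A J w"
begin

lemma w_cot: assumes "z \<in> cball 0 1" shows "w z \<in> cotangent A"
proof -
  have "w z \<in> topspace (mtop (cot_atlas A))"
    using cont_w assms by (auto simp: continuous_map_def)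
  then show ?thesis using openin_cot openin_topspace by blast
qed

lemma w_preimage:
  assumes "openin (mtop (cot_atlas A)) T"
  shows "\<exists>Q. open Q \<and> {z \<in> cball 0 1. w z \<in> T} = cball 0 1 \<inter> Q"
  using cont_w assms unfolding continuous_map_def by (auto simp: openin_open)

definition F :: "complex \<Rightarrow> real" where "F z = fibre_energy (w z)"

lemma continuous_F: "continuous_on (cball 0 1) F"
  unfolding continuous_on_open_invariant
proof (intro allI impI)
  fix B :: "real set" assume "open B"
  from w_preimage[OF openin_fibre_energy[OF this]] obtain Q where
    "open Q" "{z \<in> cball 0 1. w z \<in> {x \<in> cotangent A. fibre_energy x \<in> B}} = cball 0 1 \<inter> Q" by blast
  moreover have "{z \<in> cball 0 1. w z \<in> {x \<in> cotangent A. fibre_energy x \<in> B}} = F -` B \<inter> cball 0 1"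
    using w_cot by (auto simp: F_def)
  ultimately show "\<exists>A. open A \<and> A \<inter> cball 0 1 = F -` B \<inter> cball 0 1" by (intro exI[of _ Q]) auto
qed

text \<open>Here \<open>W\<close> extends the coordinate expression of \<open>w\<close> across the boundary of the disc: smoothness
  up to the boundary means existence of local smooth extensions. The Cauchy--Riemann equation, by
  contrast, holds on the closed disc only.\<close>

definition chart_rep where
  "chart_rep c U W W1 W2 D1 D2 \<longleftrightarrow> open U \<and> U \<inter> M = {} \<and>
     (\<forall>z\<in>U \<inter> cball 0 1. fst (w z) \<in> cdom c \<and> coord (cot_chart A c) (w z) = W z) \<and>
     (\<forall>z\<in>U. W z \<in> cimg c \<times> UNIV) \<and>
     (\<forall>z\<in>U. (W has_derivative (\<lambda>h. Re h *\<^sub>R W1 z + Im h *\<^sub>R W2 z)) (at z)) \<and>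
     (\<forall>z\<in>U. (W1 has_derivative D1 z) (at z)) \<and> (\<forall>z\<in>U. (W2 has_derivative D2 z) (at z)) \<and>
     (\<forall>h. continuous_on U (\<lambda>z. D1 z h)) \<and> (\<forall>h. continuous_on U (\<lambda>z. D2 z h)) \<and>
     (\<forall>z\<in>U \<inter> cball 0 1. W2 z = J (cot_chart A c) (W z) (W1 z))"

lemma complex_linear_expand:
  assumes "linear (L :: complex \<Rightarrow> 'b::real_vector)"
  shows "L h = Re h *\<^sub>R L 1 + Im h *\<^sub>R L \<i>"
proof -
  have "h = Re h *\<^sub>R 1 + Im h *\<^sub>R \<i>" by (simp add: complex_eq_iff)
  then have "L h = L (Re h *\<^sub>R 1 + Im h *\<^sub>R \<i>)" by simp
  then show ?thesis by (simp only: linear_add[OF assms] linear_cmul[OF assms])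
qed

lemma chart_rep_exists:
  assumes \<zeta>: "\<zeta> \<in> cball 0 1 - M" and c: "c \<in> A" "fst (w \<zeta>) \<in> cdom c"
  shows "\<exists>U W W1 W2 D1 D2. \<zeta> \<in> U \<and> chart_rep c U W W1 W2 D1 D2"
proof -
  let ?C = "cot_chart A c" and ?S = "cball 0 1 - M"
  have sm: "smooth_on {s \<in> ?S. w s \<in> cdom ?C} (coord ?C \<circ> w)"
    using hol cot_atlasI[OF c(1)] unfolding J_holomorphic_on_def smooth_map_into_def by blast
  have \<zeta>': "\<zeta> \<in> {s \<in> ?S. w s \<in> cdom ?C}" using \<zeta> c w_cot by auto
  obtain U0 W where U0: "open U0" "\<zeta> \<in> U0" "\<forall>k. Ck_on k U0 W"
    "\<forall>y\<in>U0 \<inter> {s \<in> ?S. w s \<in> cdom ?C}. W y = (coord ?C \<circ> w) y"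
    using bspec[OF sm[unfolded smooth_on_def] \<zeta>'] by (elim exE conjE) (rule that)
  obtain Q where Q: "open Q" "{z \<in> cball 0 1. w z \<in> cdom ?C} = cball 0 1 \<inter> Q"
    using w_preimage[OF openin_cdom_cot[OF c(1)]] by blast
  have C2: "Ck_on (Suc (Suc 0)) U0 W" using U0(3) by blast
  have W_diff: "W differentiable_on U0" using C2 by simp
  then have contW: "continuous_on U0 W" by (rule differentiable_imp_continuous_on)
  have opI: "open (cimg c \<times> (UNIV :: 'e set))" by (intro open_Times open_cimg c open_UNIV)
  \<comment> \<open>On \<open>U\<close> the extension \<open>W\<close> takes values in the chart
    image, and \<open>w\<close> maps the points of the closed disc in \<open>U\<close> into the
    chart domain, so the two agree there.\<close>
  define U where "U = (U0 \<inter> W -` (cimg c \<times> UNIV)) \<inter> Q \<inter> - M"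
  have "open U" unfolding U_def
    by (intro open_Int[OF open_Int[OF continuous_open_preimage[OF contW U0(1) opI] Q(1)]] open_Compl finite_imp_closed M(1))
  have inO: "w z \<in> cdom ?C \<and> z \<in> U0" if "z \<in> U" "z \<in> cball 0 1" for z
    using Q(2) that unfolding U_def by blast
  have WU: "fst (w z) \<in> cdom c \<and> coord ?C (w z) = W z" if "z \<in> U" "z \<in> cball 0 1" for z
  proof -
    have "z \<in> U0 \<inter> {s \<in> ?S. w s \<in> cdom ?C}" using inO[OF that] that by (auto simp: U_def)
    from bspec[OF U0(4) this] show ?thesis using inO[OF that] by simp
  qed
  have "\<zeta> \<in> U"
  proof -
    have "W \<zeta> = coord ?C (w \<zeta>)" using bspec[OF U0(4), of \<zeta>] U0(2) \<zeta>' by simp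
    moreover have "\<zeta> \<in> Q" using Q(2) \<zeta> \<zeta>' by blast
    ultimately show ?thesis using U0(2) \<zeta> c by (auto simp: U_def)
  qed
  define W1 where "W1 z = frechet_derivative W (at z) 1" for z
  define W2 where "W2 z = frechet_derivative W (at z) \<i>" for z
  define D1 where "D1 z = frechet_derivative W1 (at z)" for z
  define D2 where "D2 z = frechet_derivative W2 (at z)" for z
  have C1: "Ck_on (Suc 0) U0 (\<lambda>x. frechet_derivative W (at x) v)" for v
    using C2 by (subst (asm) Ck_on.simps) blast
  have dW: "(W has_derivative frechet_derivative W (at z)) (at z)" if "z \<in> U" for z
    using W_diff that U0(1) unfolding U_def
    by (simp add: differentiable_on_eq_differentiable_at frechet_derivative_works[symmetric])
  have W1': "Ck_on (Suc 0) U0 W1" "Ck_on (Suc 0) U0 W2"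
    using C1[of 1] C1[of \<i>] by (simp_all add: W1_def[abs_def] W2_def[abs_def])
  have der: "(f has_derivative frechet_derivative f (at z)) (at z)" "continuous_on U (\<lambda>z. frechet_derivative f (at z) h)"
    if "Ck_on (Suc 0) U0 f" "z \<in> U" for f :: "complex \<Rightarrow> 'e \<times> 'e" and z h
  proof -
    show "(f has_derivative frechet_derivative f (at z)) (at z)"
      using that U0(1) unfolding U_def
      by (simp add: differentiable_on_eq_differentiable_at frechet_derivative_works[symmetric])
    have "continuous_on U0 (\<lambda>z. frechet_derivative f (at z) h)" using that by simp
    then show "continuous_on U (\<lambda>z. frechet_derivative f (at z) h)"
      by (rule continuous_on_subset) (auto simp: U_def)
  qed
  have W1c: "continuous_on U W1" "continuous_on U W2"
  proof -
    have "continuous_on U f" if "Ck_on (Suc 0) U0 f" for f :: "complex \<Rightarrow> 'e \<times> 'e"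
    proof -
      have "continuous_on U0 f" using that by (intro differentiable_imp_continuous_on) simp
      then show ?thesis by (rule continuous_on_subset) (auto simp: U_def)
    qed
    then show "continuous_on U W1" "continuous_on U W2" using W1' by blast+
  qed
  have Wc: "continuous_on U W" by (rule continuous_on_subset[OF contW]) (auto simp: U_def)
  have holW: "W2 z = J ?C (W z) (W1 z)" if z: "z \<in> U" "z \<in> ball 0 1" for z
  proof -
    have zc: "z \<in> cball 0 1" using z by auto
    have zM: "z \<notin> M" using z by (auto simp: U_def)
    obtain D where D: "((coord ?C \<circ> w) has_derivative D) (at z within ?S)"
      "\<forall>\<xi>. D (\<i> * \<xi>) = J ?C (coord ?C (w z)) (D \<xi>)"
      using hol cot_atlasI[OF c(1)] inO[OF z(1) zc] zc zM unfolding J_holomorphic_on_def by blast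
    have "open (ball 0 1 - M)" using M(1) by (intro open_Diff finite_imp_closed) auto
    moreover have "ball 0 1 - M \<subseteq> ?S" "z \<in> ball 0 1 - M" using z zM by auto
    ultimately have "z \<in> interior ?S" by (meson interiorI)
    then have "((coord ?C \<circ> w) has_derivative D) (at z)" using D(1) at_within_interior by metis
    then have "(W has_derivative D) (at z)"
      by (rule has_derivative_transform_within_open[of _ _ _ _ "U \<inter> ball 0 1"]) (use z \<open>open U\<close> WU in auto)
    then have "D = frechet_derivative W (at z)" by (rule frechet_derivative_at)
    then show ?thesis using D(2)[rule_format, of 1] WU[OF z(1) zc] by (simp add: W1_def W2_def)
  qed
  \<comment> \<open>The equation reaches the circle by continuity along the radial sequence
    \<open>s\<close>; thus the derivative of the extension never has to be compared with a one-sided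
    derivative.\<close>
  have J_eq: "W2 z = J ?C (W z) (W1 z)" if z: "z \<in> U" "z \<in> cball 0 1" for z
  proof -
    have UI: "\<forall>x\<in>U. W x \<in> cimg c \<times> UNIV" by (auto simp: U_def)
    have "continuous_on U (\<lambda>z. W2 z - J ?C (W z) (W1 z))"
      by (intro continuous_intros W1c continuous_J[OF c(1) Wc]) (use UI in auto)
    then have cont: "isCont (\<lambda>z. W2 z - J ?C (W z) (W1 z)) z"
      using z(1) \<open>open U\<close> by (simp add: continuous_on_eq_continuous_at)
    define s where "s n = (1 - 1 / real (Suc n)) *\<^sub>R z" for n
    have "s \<longlonglongrightarrow> (1 - 0) *\<^sub>R z" unfolding s_def
      by (intro tendsto_intros LIMSEQ_Suc[OF lim_1_over_n])
    then have s: "s \<longlonglongrightarrow> z" by simp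
    have lim: "(\<lambda>n. W2 (s n) - J ?C (W (s n)) (W1 (s n))) \<longlonglongrightarrow> W2 z - J ?C (W z) (W1 z)"
      using isCont_tendsto_compose[OF cont s] .
    have "\<forall>\<^sub>F n in sequentially. s n \<in> U" using topological_tendstoD[OF s \<open>open U\<close> z(1)] .
    moreover have "s n \<in> ball 0 1" for n
    proof -
      have "norm (s n) = (1 - 1 / real (Suc n)) * norm z" by (simp add: s_def)
      also have "\<dots> \<le> (1 - 1 / real (Suc n)) * 1" using z by (intro mult_left_mono) auto
      also have "\<dots> < 1" by simp
      finally show ?thesis by simp
    qed
    ultimately have "\<forall>\<^sub>F n in sequentially. W2 (s n) - J ?C (W (s n)) (W1 (s n)) = 0"
      using holW by (auto elim!: eventually_mono)
    then have "(\<lambda>n. W2 (s n) - J ?C (W (s n)) (W1 (s n))) \<longlonglongrightarrow> 0" by (rule tendsto_eventually)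
    from LIMSEQ_unique[OF lim this] show ?thesis by simp
  qed
  have "chart_rep c U W W1 W2 D1 D2"
    unfolding chart_rep_def
  proof (intro conjI ballI allI)
    show "U \<inter> M = {}" by (auto simp: U_def)
    show "W z \<in> cimg c \<times> UNIV" if "z \<in> U" for z using that by (auto simp: U_def)
    show "(W has_derivative (\<lambda>h. Re h *\<^sub>R W1 z + Im h *\<^sub>R W2 z)) (at z)" if "z \<in> U" for z
    proof -
      have "frechet_derivative W (at z) = (\<lambda>h. Re h *\<^sub>R W1 z + Im h *\<^sub>R W2 z)"
        unfolding W1_def W2_def using complex_linear_expand[OF has_derivative_linear[OF dW[OF that]]] by (intro ext)
      then show ?thesis using dW[OF that] by simp
    qed
    show "continuous_on U (\<lambda>z. D1 z h)" "continuous_on U (\<lambda>z. D2 z h)" for h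
      unfolding D1_def D2_def using der(2)[OF W1'(1) \<open>\<zeta> \<in> U\<close>] der(2)[OF W1'(2) \<open>\<zeta> \<in> U\<close>] by auto
  qed (use \<open>open U\<close> WU J_eq der(1)[OF W1'(1)] der(1)[OF W1'(2)] in \<open>auto simp: D1_def D2_def\<close>)
  then show ?thesis using \<open>\<zeta> \<in> U\<close> by blast
qed

end

section \<open>The cutoff for the monotonicity estimate\<close>

text \<open>The weight \<open>m s = (1 / sqrt s + C)\<^sup>2\<close> solves \<open>m + s (1 + C sqrt s) m' = 0\<close>. Shifting the
  argument by \<open>\<epsilon>\<close> makes it smooth and leaves the positive excess \<open>\<epsilon> m / (s + \<epsilon>)\<close>; composing with the
  convex function \<open>k t = (max 0 (t - m R))\<^sup>2 / t\<close> cuts it off at \<open>R\<close>.\<close>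

lemma monotonicity_cutoff:
  fixes R C \<epsilon> :: real
  defines "M0 \<equiv> (1 / sqrt R + C)\<^sup>2"
  assumes R: "R > 0" and C: "C \<ge> 0" and \<epsilon>: "\<epsilon> > 0" "\<epsilon> \<le> 1 / (4 * M0)"
  shows "\<exists>\<phi> \<phi>'. (\<forall>s\<ge>0. (\<phi> has_real_derivative \<phi>' s) (at s)) \<and> continuous_on {0..} \<phi>' \<and>
    (\<forall>s\<ge>0. \<phi> s \<ge> 0 \<and> \<phi>' s \<le> 0) \<and> (\<forall>s\<ge>R. \<phi> s = 0 \<and> \<phi>' s = 0) \<and>
    (\<forall>s\<ge>0. \<phi> s + \<phi>' s * (s * (1 + C * sqrt s)) \<ge> - 2 * M0) \<and>
    (\<forall>s\<ge>0. s \<le> \<epsilon> \<longrightarrow> \<phi> s + \<phi>' s * (s * (1 + C * sqrt s)) \<ge> - 2 * M0 + 3 / (16 * \<epsilon>))"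
proof -
  \<comment> \<open>With \<open>(r s)\<^sup>2 = s + \<epsilon>\<close> the product of
    \<open>m' s\<close> and \<open>(r s)\<^sup>2 * (1 + C * r s)\<close> is exactly
    \<open>- m s\<close>; the excess stems from writing \<open>s\<close> as
    \<open>(r s)\<^sup>2 - \<epsilon>\<close>.\<close>
  define r where "r s = sqrt (s + \<epsilon>)" for s
  define m where "m s = (1 / r s + C)\<^sup>2" for s
  define m' where "m' s = - (1 / r s + C) / (r s ^ 3)" for s
  define u where "u t = max 0 (t - M0)" for t
  define k where "k t = (u t)\<^sup>2 / t" for t
  define k' where "k' t = 2 * u t / t - (u t)\<^sup>2 / t\<^sup>2" for t
  have "1 / sqrt R + C > 0" using R C by (intro add_pos_nonneg) auto
  then have M0: "M0 > 0" by (simp add: M0_def)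
  have r: "r s > 0" "(r s)\<^sup>2 = s + \<epsilon>" if "s \<ge> 0" for s using that \<epsilon> by (simp_all add: r_def)
  have m: "m s > 0" if "s \<ge> 0" for s
  proof -
    have "1 / r s + C > 0" using r(1)[OF that] C by (intro add_pos_nonneg) auto
    then show ?thesis by (simp add: m_def)
  qed
  have Dr: "(r has_real_derivative 1 / (2 * r s)) (at s)" if "s \<ge> 0" for s
    unfolding r_def using that \<epsilon> by (auto intro!: derivative_eq_intros simp: inverse_eq_divide field_simps)
  have Dm: "(m has_real_derivative m' s) (at s)" if s: "s \<ge> 0" for s
  proof -
    have "(m has_real_derivative 2 * (1 / r s + C) * (- (1 / (2 * r s)) / (r s)\<^sup>2)) (at s)"
      unfolding m_def using r(1)[OF s] by (auto intro!: derivative_eq_intros Dr[OF s] simp: power2_eq_square field_simps)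
    moreover have "2 * (1 / r s + C) * (- (1 / (2 * r s)) / (r s)\<^sup>2) = m' s"
      using r(1)[OF s] by (simp add: m'_def power2_eq_square power3_eq_cube field_simps)
    ultimately show ?thesis by simp
  qed
  have Dk: "(k has_real_derivative k' t) (at t)" if t: "t > 0" for t
  proof -
    have "((\<lambda>t. (u t)\<^sup>2) has_real_derivative 2 * u t * 1) (at t)"
      unfolding u_def by (rule DERIV_chain2[OF DERIV_max_0_squared]) (auto intro!: derivative_eq_intros)
    from DERIV_divide[OF this DERIV_ident] t
    have "(k has_real_derivative (2 * u t * 1 * t - (u t)\<^sup>2 * 1) / (t * t)) (at t)" by (simp add: k_def[abs_def])
    moreover have "(2 * u t * 1 * t - (u t)\<^sup>2 * 1) / (t * t) = k' t"
      using t by (simp add: k'_def power2_eq_square diff_divide_distrib)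
    ultimately show ?thesis by simp
  qed
  have ut: "0 \<le> u t" "t > 0 \<Longrightarrow> u t \<le> t" for t using M0 by (auto simp: u_def)
  \<comment> \<open>The last expression equals \<open>- 2 * (M0 * (u t / t))\<close>, with
    \<open>u t / t\<close> between 0 and 1. The constant \<open>2 * M0\<close> is the price of the
    cutoff.\<close>
  have k: "k t \<ge> 0" "k' t \<ge> 0" "k t - t * k' t \<ge> - 2 * M0" if t: "t > 0" for t
  proof -
    show "k t \<ge> 0" using t by (simp add: k_def)
    have "k' t = (u t / t) * (2 - u t / t)" using t by (simp add: k'_def power2_eq_square field_simps)
    moreover have "u t / t \<le> 1" "u t / t \<ge> 0" using t ut by auto
    then have "0 \<le> (u t / t) * (2 - u t / t)" by (intro mult_nonneg_nonneg) auto
    ultimately show "k' t \<ge> 0" by (simp only:)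
    have 1: "k t - t * k' t = - 2 * (u t * (t - u t)) / t" using t by (simp add: k_def k'_def power2_eq_square field_simps)
    have 2: "u t * (t - u t) = u t * M0" by (auto simp: u_def max_def)
    have "k t - t * k' t = - 2 * (M0 * (u t / t))" unfolding 1 2 by simp
    moreover have "M0 * (u t / t) \<le> M0 * 1" using \<open>u t / t \<le> 1\<close> M0 by (intro mult_left_mono) auto
    ultimately show "k t - t * k' t \<ge> - 2 * M0" by simp
  qed
  define \<phi> where "\<phi> s = k (m s)" for s
  define \<phi>' where "\<phi>' s = k' (m s) * m' s" for s
  have m'neg: "m' s \<le> 0" if "s \<ge> 0" for s
  proof -
    have "0 \<le> (1 / r s + C) / (r s ^ 3)" using r(1)[OF that] C by (intro divide_nonneg_pos add_nonneg_nonneg) auto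
    then show ?thesis unfolding m'_def minus_divide_left[symmetric] by simp
  qed
  have \<phi>'neg: "\<phi>' s \<le> 0" if "s \<ge> 0" for s
    using k(2)[OF m[OF that]] m'neg[OF that] by (simp add: \<phi>'_def mult_nonneg_nonpos)
  have main: "\<phi> s + \<phi>' s * (s * (1 + C * sqrt s)) \<ge> (k (m s) - m s * k' (m s)) + k' (m s) * (\<epsilon> * m s / (s + \<epsilon>))"
    if s: "s \<ge> 0" for s
  proof -
    have "sqrt s \<le> r s" using \<epsilon> by (simp add: r_def)
    then have "s * (1 + C * sqrt s) \<le> s * (1 + C * r s)" using s C by (intro mult_left_mono add_left_mono) auto
    then have "\<phi>' s * (s * (1 + C * r s)) \<le> \<phi>' s * (s * (1 + C * sqrt s))"
      by (rule mult_left_mono_neg[OF _ \<phi>'neg[OF s]])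
    moreover have "m' s * (s * (1 + C * r s)) = - m s + \<epsilon> * m s / (s + \<epsilon>)"
    proof -
      have "s = (r s)\<^sup>2 - \<epsilon>" using r(2)[OF s] by simp
      then have "m' s * (s * (1 + C * r s)) = m' s * (((r s)\<^sup>2 - \<epsilon>) * (1 + C * r s))" by simp
      also have "\<dots> = - m s + \<epsilon> * m s / (r s)\<^sup>2"
        using r(1)[OF s] by (simp add: m'_def m_def power2_eq_square power3_eq_cube field_simps)
      finally show ?thesis using r(2)[OF s] by simp
    qed
    then have "\<phi>' s * (s * (1 + C * r s)) = k' (m s) * (- m s + \<epsilon> * m s / (s + \<epsilon>))" by (simp add: \<phi>'_def mult.assoc)
    ultimately show ?thesis by (simp add: \<phi>_def algebra_simps)
  qed
  have exc: "k' (m s) * (\<epsilon> * m s / (s + \<epsilon>)) \<ge> 0" if "s \<ge> 0" for s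
    using k(2)[OF m[OF that]] m[OF that] that \<epsilon> by simp
  have A: "\<phi> s + \<phi>' s * (s * (1 + C * sqrt s)) \<ge> - 2 * M0" if "s \<ge> 0" for s
    using main[OF that] exc[OF that] k(3)[OF m[OF that]] by linarith
  \<comment> \<open>Since \<open>\<epsilon> \<le> 1 / (4 * M0)\<close>, the weight is at least
    \<open>2 * M0\<close> near the centre, so \<open>q\<close> is at least 1/2 and \<open>k'\<close>
    at least 3/4. The excess factor is at least \<open>1 / (4 * \<epsilon>)\<close>, and the product
    is \<open>3 / (16 * \<epsilon>)\<close>.\<close>
  have B: "\<phi> s + \<phi>' s * (s * (1 + C * sqrt s)) \<ge> - 2 * M0 + 3 / (16 * \<epsilon>)" if s: "s \<ge> 0" "s \<le> \<epsilon>" for s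
  proof -
    have "(1 / r s)\<^sup>2 \<le> m s" unfolding m_def using r(1)[OF s(1)] C by (intro power_mono) auto
    then have ms: "1 / (s + \<epsilon>) \<le> m s" using r(2)[OF s(1)] by (simp add: power_divide)
    have se: "1 / (2 * \<epsilon>) \<le> 1 / (s + \<epsilon>)" using s \<epsilon> by (intro divide_left_mono) auto
    have "2 * M0 \<le> 1 / (2 * \<epsilon>)" using \<epsilon> M0 by (simp add: field_simps)
    then have m2: "m s \<ge> 2 * M0" using ms se by linarith
    define q where "q = u (m s) / m s"
    have q: "1/2 \<le> q" "q \<le> 1" using m2 M0 m[OF s(1)] by (auto simp: q_def u_def field_simps max_def)
    have "k' (m s) = q * (2 - q)" using m[OF s(1)] by (simp add: k'_def q_def power2_eq_square field_simps)
    moreover have "q * (2 - q) - 3/4 = (q - 1/2) * (3/2 - q)" by algebra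
    moreover have "0 \<le> (q - 1/2) * (3/2 - q)" using q by simp
    ultimately have k34: "k' (m s) \<ge> 3/4" by linarith
    have "1 / (4 * \<epsilon>) = \<epsilon> * (1 / (2 * \<epsilon>)) * (1 / (2 * \<epsilon>))" using \<epsilon> by simp
    also have "\<dots> \<le> \<epsilon> * m s * (1 / (s + \<epsilon>))" using ms se \<epsilon> s m[OF s(1)] by (intro mult_mono) auto
    finally have e4: "1 / (4 * \<epsilon>) \<le> \<epsilon> * m s / (s + \<epsilon>)" by simp
    have "3/4 * (1 / (4 * \<epsilon>)) \<le> k' (m s) * (\<epsilon> * m s / (s + \<epsilon>))" using k34 e4 \<epsilon> by (intro mult_mono) auto
    then show ?thesis using main[OF s(1)] k(3)[OF m[OF s(1)]] by simp
  qed
  have Z: "\<phi> s = 0 \<and> \<phi>' s = 0" if s: "s \<ge> R" for s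
  proof -
    have s0: "s \<ge> 0" using s R by simp
    have "sqrt R \<le> r s" using s \<epsilon> by (simp add: r_def)
    then have "1 / r s \<le> 1 / sqrt R" using R by (intro divide_left_mono) (auto simp: r(1)[OF s0])
    then have "m s \<le> M0" unfolding m_def M0_def using r(1)[OF s0] C by (intro power_mono) auto
    then have "u (m s) = 0" by (simp add: u_def)
    then show ?thesis by (simp add: \<phi>_def \<phi>'_def k_def k'_def)
  qed
  have "continuous_on {0..} m" using Dm by (intro continuous_at_imp_continuous_on ballI DERIV_isCont) auto
  moreover have "continuous_on {0..} r" using Dr by (intro continuous_at_imp_continuous_on ballI DERIV_isCont) auto
  ultimately have P1: "continuous_on {0..} \<phi>'"
    unfolding \<phi>'_def k'_def u_def m'_def
    by (intro continuous_intros) (use m r in \<open>force simp: less_le\<close>)+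
  have P2: "(\<phi> has_real_derivative \<phi>' s) (at s)" if "s \<ge> 0" for s
    unfolding \<phi>_def \<phi>'_def by (rule DERIV_chain2[OF Dk[OF m[OF that]] Dm[OF that]])
  have P3: "\<phi> s \<ge> 0" if "s \<ge> 0" for s using k(1)[OF m[OF that]] by (simp add: \<phi>_def)
  show ?thesis
    by (intro exI[of _ \<phi>] exI[of _ \<phi>'] conjI allI impI)
      ((rule P1 P2 P3 \<phi>'neg A B conjunct1[OF Z] conjunct2[OF Z]; assumption)+)
qed

section \<open>The maximum principle\<close>

lemma has_derivative_frechet:
  "(f has_derivative f') (at x) \<Longrightarrow> (f has_derivative frechet_derivative f (at x)) (at x)"
  unfolding frechet_derivative_works[symmetric] by (rule differentiableI)

context hol_disc begin

context
  fixes c U W W1 W2 D1 D2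
  assumes c: "c \<in> A" and rep: "chart_rep c U W W1 W2 D1 D2"
begin

lemma repD:
  "open U" "U \<inter> M = {}"
  "z \<in> U \<Longrightarrow> z \<in> cball 0 1 \<Longrightarrow> fst (w z) \<in> cdom c"
  "z \<in> U \<Longrightarrow> z \<in> cball 0 1 \<Longrightarrow> coord (cot_chart A c) (w z) = W z"
  "z \<in> U \<Longrightarrow> W z \<in> cimg c \<times> UNIV"
  "z \<in> U \<Longrightarrow> (W has_derivative (\<lambda>h. Re h *\<^sub>R W1 z + Im h *\<^sub>R W2 z)) (at z)"
  "z \<in> U \<Longrightarrow> (W1 has_derivative D1 z) (at z)" "z \<in> U \<Longrightarrow> (W2 has_derivative D2 z) (at z)"
  "continuous_on U (\<lambda>z. D1 z h)" "continuous_on U (\<lambda>z. D2 z h)"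
  "z \<in> U \<Longrightarrow> z \<in> cball 0 1 \<Longrightarrow> W2 z = J (cot_chart A c) (W z) (W1 z)"
  using rep unfolding chart_rep_def by blast+

lemma rep_components:
  "z \<in> U \<Longrightarrow> z \<in> cball 0 1 \<Longrightarrow> fst (W z) = coord c (fst (w z))"
  "z \<in> U \<Longrightarrow> z \<in> cball 0 1 \<Longrightarrow> snd (W z) = snd (w z) c"
  by (simp_all add: repD(4)[symmetric])

lemma rep_continuous: "continuous_on U W" "continuous_on U W1" "continuous_on U W2"
  using has_derivative_continuous[OF repD(6)] has_derivative_continuous[OF repD(7)] has_derivative_continuous[OF repD(8)]
  by (auto intro: continuous_at_imp_continuous_on)

lemma rep_mixed: "z \<in> U \<Longrightarrow> D1 z \<i> = D2 z 1"
  by (rule mixed_derivatives_commute[OF repD(1), where f = W and f' = "\<lambda>z h. Re h *\<^sub>R W1 z + Im h *\<^sub>R W2 z"])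
    (auto intro: repD)

lemma rep_compatible: "z \<in> U \<Longrightarrow> compatible_structure (J (cot_chart A c) (W z))"
  by (rule compatible[OF c repD(5)])

lemma F_rep: "z \<in> U \<Longrightarrow> z \<in> cball 0 1 \<Longrightarrow> F z = local_metric.kin (g c) (W z)"
  using fibre_energy_chart[OF w_cot c repD(3)] repD(4) by (simp add: F_def)

text \<open>The Cauchy-Riemann equation \<open>W2 = J W1\<close>, equivalently
  \<open>W1 = - J W2\<close>, turns the differential of the energy into the Liouville form. The
  resulting formula contains neither \<open>g\<close> nor \<open>J\<close>, so it is easily
  differentiated again.\<close>

lemma F_rep_has_derivative:
  assumes z: "z \<in> U" "z \<in> ball 0 1" "w z \<in> V"
  shows "(F has_derivative (\<lambda>h. Re h * (- (snd (W z) \<bullet> fst (W2 z))) + Im h * (snd (W z) \<bullet> fst (W1 z)))) (at z)"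
proof -
  interpret m: local_metric "cimg c" "g c" by (rule local_metric[OF c])
  interpret j: compatible_structure "J (cot_chart A c) (W z)" by (rule rep_compatible[OF z(1)])
  have zc: "z \<in> cball 0 1" using z(2) by auto
  have fz: "fst (W z) \<in> cimg c" using repD(5)[OF z(1)] by (simp add: mem_Times_iff)
  have dJ: "m.dkin (W z) (J (cot_chart A c) (W z) u) = snd (W z) \<bullet> fst u" for u
  proof -
    have "snd (W z) = snd (w z) c" by (rule rep_components(2)[OF z(1) zc])
    then show ?thesis using dkin_J[OF c z(3) w_cot[OF zc] repD(3)[OF z(1) zc], of u] unfolding repD(4)[OF z(1) zc] by simp
  qed
  have W2: "W2 z = J (cot_chart A c) (W z) (W1 z)" by (rule repD(11)[OF z(1) zc])
  have W1: "W1 z = - J (cot_chart A c) (W z) (W2 z)" by (simp add: W2)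
  have lin: "linear (m.dkin (W z))" by (rule m.dkin_linear[OF fz])
  have d1: "m.dkin (W z) (W1 z) = - (snd (W z) \<bullet> fst (W2 z))"
    by (subst W1) (simp add: linear_neg[OF lin] dJ)
  have d2: "m.dkin (W z) (W2 z) = snd (W z) \<bullet> fst (W1 z)"
    by (subst W2) (simp add: dJ)
  have "((\<lambda>z. m.kin (W z)) has_derivative (\<lambda>h. m.dkin (W z) (Re h *\<^sub>R W1 z + Im h *\<^sub>R W2 z))) (at z)"
    by (rule has_derivative_compose[OF repD(6)[OF z(1)] m.has_derivative_kin[OF fz]])
  then have "(F has_derivative (\<lambda>h. m.dkin (W z) (Re h *\<^sub>R W1 z + Im h *\<^sub>R W2 z))) (at z)"
    by (rule has_derivative_transform_within_open[of _ _ _ _ "U \<inter> ball 0 1"])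
      (use z repD(1) F_rep in auto)
  then show ?thesis by (simp add: linear_add[OF lin] linear_cmul[OF lin] d1 d2)
qed

end

section \<open>Gradient and Laplacian of the energy along the disc\<close>

definition F1 :: "complex \<Rightarrow> real" where "F1 z = frechet_derivative F (at z) 1"
definition F2 :: "complex \<Rightarrow> real" where "F2 z = frechet_derivative F (at z) \<i>"

definition disc_V :: "complex set" where "disc_V = {z \<in> ball 0 1. w z \<in> V}"

lemma open_disc_V: "open disc_V"
proof -
  obtain Q where Q: "open Q" "{z \<in> cball 0 1. w z \<in> V} = cball 0 1 \<inter> Q" using w_preimage[OF V_open] by blast
  then have "disc_V = ball 0 1 \<inter> Q" unfolding disc_V_def using ball_subset_cball[of "0::complex" 1] by blast
  then show ?thesis using Q(1) by (simp add: open_Int)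
qed

lemma interior_not_marked: "z \<in> ball 0 1 \<Longrightarrow> z \<in> cball 0 1 - M"
  using M by auto

lemma interior_chart:
  assumes "z \<in> cball 0 1" shows "\<exists>c\<in>A. fst (w z) \<in> cdom c"
  using cotangentD(1)[OF w_cot[OF assms]] by (auto simp: carrier_def)

lemma F12_rep:
  assumes "c \<in> A" "chart_rep c U W W1 W2 D1 D2" "z \<in> U" "z \<in> disc_V"
  shows "F1 z = - (snd (W z) \<bullet> fst (W2 z))" "F2 z = snd (W z) \<bullet> fst (W1 z)"
  using frechet_derivative_at[OF F_rep_has_derivative[OF assms(1,2,3)], symmetric] assms(4)
  by (simp_all add: F1_def F2_def disc_V_def)

lemma F12_rep_has_derivative:
  assumes c: "c \<in> A" and rep: "chart_rep c U W W1 W2 D1 D2" and z: "z \<in> U" "z \<in> disc_V"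
  shows "(F1 has_derivative (\<lambda>h. - (snd (Re h *\<^sub>R W1 z + Im h *\<^sub>R W2 z) \<bullet> fst (W2 z) + snd (W z) \<bullet> fst (D2 z h)))) (at z)"
    "(F2 has_derivative (\<lambda>h. snd (Re h *\<^sub>R W1 z + Im h *\<^sub>R W2 z) \<bullet> fst (W1 z) + snd (W z) \<bullet> fst (D1 z h))) (at z)"
proof -
  note r = repD[OF c rep]
  have o: "open (U \<inter> disc_V)" using r(1) open_disc_V by (rule open_Int)
  have "((\<lambda>z. - (snd (W z) \<bullet> fst (W2 z))) has_derivative
    (\<lambda>h. - (snd (Re h *\<^sub>R W1 z + Im h *\<^sub>R W2 z) \<bullet> fst (W2 z) + snd (W z) \<bullet> fst (D2 z h)))) (at z)"
    using has_derivative_inner[OF has_derivative_snd[OF r(6)[OF z(1)]] has_derivative_fst[OF r(8)[OF z(1)]]]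
    by (intro has_derivative_minus) (simp add: add.commute)
  then show "(F1 has_derivative (\<lambda>h. - (snd (Re h *\<^sub>R W1 z + Im h *\<^sub>R W2 z) \<bullet> fst (W2 z) + snd (W z) \<bullet> fst (D2 z h)))) (at z)"
    by (rule has_derivative_transform_within_open[OF _ o]) (use z F12_rep[OF c rep] in auto)
  have "((\<lambda>z. snd (W z) \<bullet> fst (W1 z)) has_derivative
    (\<lambda>h. snd (Re h *\<^sub>R W1 z + Im h *\<^sub>R W2 z) \<bullet> fst (W1 z) + snd (W z) \<bullet> fst (D1 z h))) (at z)"
    using has_derivative_inner[OF has_derivative_snd[OF r(6)[OF z(1)]] has_derivative_fst[OF r(7)[OF z(1)]]]
    by (simp add: add.commute)
  then show "(F2 has_derivative (\<lambda>h. snd (Re h *\<^sub>R W1 z + Im h *\<^sub>R W2 z) \<bullet> fst (W1 z) + snd (W z) \<bullet> fst (D1 z h))) (at z)"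
    by (rule has_derivative_transform_within_open[OF _ o]) (use z F12_rep[OF c rep] in auto)
qed

text \<open>The gradient is the pull-back of the Liouville form rotated by a quarter turn, so its
  divergence is the pull-back of \<open>omega\<close>; the second derivatives of \<open>W\<close>
  cancel by \<open>rep_mixed\<close>.\<close>

lemma laplace_rep:
  assumes c: "c \<in> A" and rep: "chart_rep c U W W1 W2 D1 D2" and z: "z \<in> U" "z \<in> disc_V"
  shows "frechet_derivative F1 (at z) 1 + frechet_derivative F2 (at z) \<i> = sform (W1 z) (W2 z)"
  unfolding frechet_derivative_at[OF F12_rep_has_derivative(1)[OF assms], symmetric]
    frechet_derivative_at[OF F12_rep_has_derivative(2)[OF assms], symmetric]
  using rep_mixed[OF c rep z(1)] by (simp add: sform_def inner_commute)

lemma F12_differentiable: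
  assumes z: "z \<in> disc_V"
  shows "(F has_derivative (\<lambda>h. Re h * F1 z + Im h * F2 z)) (at z)"
    "(F1 has_derivative frechet_derivative F1 (at z)) (at z)" "(F2 has_derivative frechet_derivative F2 (at z)) (at z)"
    "isCont (\<lambda>z. frechet_derivative F1 (at z) h) z" "isCont (\<lambda>z. frechet_derivative F2 (at z) h) z"
proof -
  have zb: "z \<in> ball 0 1" "w z \<in> V" "z \<in> cball 0 1" using z by (auto simp: disc_V_def)
  obtain c where c: "c \<in> A" "fst (w z) \<in> cdom c" using interior_chart[OF zb(3)] by blast
  obtain U W W1 W2 D1 D2 where zU: "z \<in> U" and rep: "chart_rep c U W W1 W2 D1 D2"
    using chart_rep_exists[OF interior_not_marked[OF zb(1)] c] by blast
  note r = repD[OF c(1) rep]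
  show "(F has_derivative (\<lambda>h. Re h * F1 z + Im h * F2 z)) (at z)"
    unfolding F12_rep[OF c(1) rep zU z] by (rule F_rep_has_derivative[OF c(1) rep zU zb(1,2)])
  show "(F1 has_derivative frechet_derivative F1 (at z)) (at z)" "(F2 has_derivative frechet_derivative F2 (at z)) (at z)"
    by (rule has_derivative_frechet[OF F12_rep_has_derivative(1)[OF c(1) rep zU z]],
      rule has_derivative_frechet[OF F12_rep_has_derivative(2)[OF c(1) rep zU z]])
  have o: "open (U \<inter> disc_V)" using r(1) open_disc_V by (rule open_Int)
  have "continuous_on (U \<inter> disc_V) (\<lambda>z. - (snd (Re h *\<^sub>R W1 z + Im h *\<^sub>R W2 z) \<bullet> fst (W2 z) + snd (W z) \<bullet> fst (D2 z h)))"
    by (intro continuous_intros continuous_on_subset[OF rep_continuous(1)[OF c(1) rep]]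
      continuous_on_subset[OF rep_continuous(2)[OF c(1) rep]] continuous_on_subset[OF rep_continuous(3)[OF c(1) rep]]
      continuous_on_subset[OF r(10)]) auto
  then have "continuous_on (U \<inter> disc_V) (\<lambda>z. frechet_derivative F1 (at z) h)"
    by (rule continuous_on_eq) (simp add: frechet_derivative_at[OF F12_rep_has_derivative(1)[OF c(1) rep], symmetric])
  then show "isCont (\<lambda>z. frechet_derivative F1 (at z) h) z"
    using o zU z by (simp add: continuous_on_eq_continuous_at)
  have "continuous_on (U \<inter> disc_V) (\<lambda>z. snd (Re h *\<^sub>R W1 z + Im h *\<^sub>R W2 z) \<bullet> fst (W1 z) + snd (W z) \<bullet> fst (D1 z h))"
    by (intro continuous_intros continuous_on_subset[OF rep_continuous(1)[OF c(1) rep]]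
      continuous_on_subset[OF rep_continuous(2)[OF c(1) rep]] continuous_on_subset[OF rep_continuous(3)[OF c(1) rep]]
      continuous_on_subset[OF r(9)]) auto
  then have "continuous_on (U \<inter> disc_V) (\<lambda>z. frechet_derivative F2 (at z) h)"
    by (rule continuous_on_eq) (simp add: frechet_derivative_at[OF F12_rep_has_derivative(2)[OF c(1) rep], symmetric])
  then show "isCont (\<lambda>z. frechet_derivative F2 (at z) h) z"
    using o zU z by (simp add: continuous_on_eq_continuous_at)
qed

section \<open>The area density\<close>

definition edens :: "complex \<Rightarrow> real" where
  "edens z = pullback (cot_atlas A) (\<lambda>_. omega) w z 1 \<i>"

lemma pullback_rep:
  assumes z: "z \<in> ball 0 1"
  shows "\<exists>c\<in>A. fst (w z) \<in> cdom c \<and> (\<forall>U W W1 W2 D1 D2. z \<in> U \<and> chart_rep c U W W1 W2 D1 D2 \<longrightarrow>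
    (\<forall>\<beta>. pullback (cot_atlas A) \<beta> w z 1 1 = \<beta> (cot_chart A c) (W z) (W1 z) (W1 z) \<and>
         pullback (cot_atlas A) \<beta> w z \<i> \<i> = \<beta> (cot_chart A c) (W z) (W2 z) (W2 z) \<and>
         pullback (cot_atlas A) \<beta> w z 1 \<i> = \<beta> (cot_chart A c) (W z) (W1 z) (W2 z)))"
proof -
  have zc: "z \<in> cball 0 1" using z by auto
  obtain c0 where "c0 \<in> A" "fst (w z) \<in> cdom c0" using interior_chart[OF zc] by blast
  then have "\<exists>C. C \<in> cot_atlas A \<and> w z \<in> cdom C"
    using cot_atlasI w_cot[OF zc] by (intro exI[of _ "cot_chart A c0"]) auto
  then have "chart_at (cot_atlas A) (w z) \<in> cot_atlas A \<and> w z \<in> cdom (chart_at (cot_atlas A) (w z))"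
    unfolding chart_at_def by (rule someI_ex)
  then obtain c where c: "c \<in> A" "chart_at (cot_atlas A) (w z) = cot_chart A c" "fst (w z) \<in> cdom c"
    by (auto simp: cot_atlas_def)
  show ?thesis
  proof (intro bexI[OF _ c(1)] conjI allI impI c(3); elim conjE)
    fix U W W1 W2 D1 D2 \<beta> assume zU: "z \<in> U" and rep: "chart_rep c U W W1 W2 D1 D2"
    note r = repD[OF c(1) rep]
    have "((coord (cot_chart A c) \<circ> w) has_derivative (\<lambda>h. Re h *\<^sub>R W1 z + Im h *\<^sub>R W2 z)) (at z)"
      by (rule has_derivative_transform_within_open[OF r(6)[OF zU], of "U \<inter> ball 0 1"])
        (use zU z r(1) r(4) in \<open>auto simp del: cot_chart_simps\<close>)
    from frechet_derivative_at[OF this]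
    have D: "frechet_derivative (coord (cot_chart A c) \<circ> w) (at z) = (\<lambda>h. Re h *\<^sub>R W1 z + Im h *\<^sub>R W2 z)" by simp
    show "pullback (cot_atlas A) \<beta> w z 1 1 = \<beta> (cot_chart A c) (W z) (W1 z) (W1 z)"
      "pullback (cot_atlas A) \<beta> w z \<i> \<i> = \<beta> (cot_chart A c) (W z) (W2 z) (W2 z)"
      "pullback (cot_atlas A) \<beta> w z 1 \<i> = \<beta> (cot_chart A c) (W z) (W1 z) (W2 z)"
      unfolding pullback_def Let_def c(2) D r(4)[OF zU zc] by simp_all
  qed
qed

text \<open>Energy and area densities of a holomorphic map coincide; this turns finite energy into
  integrability of \<open>edens\<close>.\<close>

lemma energy_density:
  assumes z: "z \<in> ball 0 1"
  shows "(pullback (cot_atlas A) (metric_of J) w z 1 1 + pullback (cot_atlas A) (metric_of J) w z \<i> \<i>) / 2 = edens z"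
    and "edens z \<ge> 0"
proof -
  obtain c where c: "c \<in> A" "fst (w z) \<in> cdom c" and p: "\<forall>U W W1 W2 D1 D2. z \<in> U \<and> chart_rep c U W W1 W2 D1 D2 \<longrightarrow>
    (\<forall>\<beta>. pullback (cot_atlas A) \<beta> w z 1 1 = \<beta> (cot_chart A c) (W z) (W1 z) (W1 z) \<and>
         pullback (cot_atlas A) \<beta> w z \<i> \<i> = \<beta> (cot_chart A c) (W z) (W2 z) (W2 z) \<and>
         pullback (cot_atlas A) \<beta> w z 1 \<i> = \<beta> (cot_chart A c) (W z) (W1 z) (W2 z))"
    using pullback_rep[OF z] by blast
  obtain U W W1 W2 D1 D2 where zU: "z \<in> U" and rep: "chart_rep c U W W1 W2 D1 D2"
    using chart_rep_exists[OF interior_not_marked[OF z] c] by blast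
  note r = repD[OF c(1) rep]
  interpret j: compatible_structure "J (cot_chart A c) (W z)" by (rule rep_compatible[OF c(1) rep zU])
  have W2: "W2 z = J (cot_chart A c) (W z) (W1 z)" using r(11)[OF zU] z by auto
  have q: "pullback (cot_atlas A) \<beta> w z 1 1 = \<beta> (cot_chart A c) (W z) (W1 z) (W1 z)"
         "pullback (cot_atlas A) \<beta> w z \<i> \<i> = \<beta> (cot_chart A c) (W z) (W2 z) (W2 z)"
         "pullback (cot_atlas A) \<beta> w z 1 \<i> = \<beta> (cot_chart A c) (W z) (W1 z) (W2 z)" for \<beta>
    using p zU rep by blast+
  have e: "edens z = j.G (W1 z) (W1 z)" by (simp add: edens_def q omega_sform W2 j.G_def)
  show "edens z \<ge> 0" by (simp add: e j.G_nonneg)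
  show "(pullback (cot_atlas A) (metric_of J) w z 1 1 + pullback (cot_atlas A) (metric_of J) w z \<i> \<i>) / 2 = edens z"
    unfolding q e metric_of_def omega_sform j.G_def[symmetric] by (simp add: W2 j.G_J0)
qed

lemma edens_integrable: "set_integrable lborel (ball 0 1) edens"
proof -
  have "set_integrable lborel (ball 0 1) edens \<longleftrightarrow> finite_energy A J w"
    unfolding finite_energy_def by (rule set_integrable_cong) (simp_all add: energy_density(1))
  then show ?thesis using energy by simp
qed

lemma area_edens: "area A w = (LINT z:ball 0 1|lborel. edens z)"
  by (simp add: area_def edens_def)

lemma edens_laplace:
  assumes z: "z \<in> disc_V"
  shows "edens z = frechet_derivative F1 (at z) 1 + frechet_derivative F2 (at z) \<i>"
proof -
  have zb: "z \<in> ball 0 1" using z by (auto simp: disc_V_def)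
  obtain c where c: "c \<in> A" "fst (w z) \<in> cdom c" and p: "\<forall>U W W1 W2 D1 D2. z \<in> U \<and> chart_rep c U W W1 W2 D1 D2 \<longrightarrow>
    (\<forall>\<beta>. pullback (cot_atlas A) \<beta> w z 1 1 = \<beta> (cot_chart A c) (W z) (W1 z) (W1 z) \<and>
         pullback (cot_atlas A) \<beta> w z \<i> \<i> = \<beta> (cot_chart A c) (W z) (W2 z) (W2 z) \<and>
         pullback (cot_atlas A) \<beta> w z 1 \<i> = \<beta> (cot_chart A c) (W z) (W1 z) (W2 z))"
    using pullback_rep[OF zb] by blast
  obtain U W W1 W2 D1 D2 where zU: "z \<in> U" and rep: "chart_rep c U W W1 W2 D1 D2"
    using chart_rep_exists[OF interior_not_marked[OF zb] c] by blast
  have "pullback (cot_atlas A) (\<lambda>_. omega) w z 1 \<i> = (\<lambda>_. omega) (cot_chart A c) (W z) (W1 z) (W2 z)"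
    using p zU rep by blast
  then have "edens z = sform (W1 z) (W2 z)" by (simp add: edens_def omega_sform)
  then show ?thesis using laplace_rep[OF c(1) rep zU z] by simp
qed

lemma edens_rep:
  assumes "c \<in> A" "chart_rep c U W W1 W2 D1 D2" "z \<in> U" "z \<in> disc_V"
  shows "edens z = sform (W1 z) (W2 z)"
  using laplace_rep[OF assms] edens_laplace[OF assms(4)] by simp

text \<open>Up to sign, \<open>F1\<close> and \<open>F2\<close> are the products of the vertical
  vector \<open>R\<close> with \<open>J W2\<close> and with \<open>W2\<close>, and \<open>R\<close>
  has squared length \<open>2 * F z\<close>. The estimate dominates the gradient term by the area
  density, which is integrable even where derivatives of \<open>w\<close> are unbounded.\<close>

lemma gradient_bound:
  assumes z: "z \<in> disc_V"
  shows "(F1 z)\<^sup>2 + (F2 z)\<^sup>2 \<le> 2 * F z * edens z"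
proof -
  have zb: "z \<in> ball 0 1" "w z \<in> V" "z \<in> cball 0 1" using z by (auto simp: disc_V_def)
  obtain c where c: "c \<in> A" "fst (w z) \<in> cdom c" using interior_chart[OF zb(3)] by blast
  obtain U W W1 W2 D1 D2 where zU: "z \<in> U" and rep: "chart_rep c U W W1 W2 D1 D2"
    using chart_rep_exists[OF interior_not_marked[OF zb(1)] c] by blast
  note r = repD[OF c(1) rep]
  interpret m: local_metric "cimg c" "g c" by (rule local_metric[OF c(1)])
  interpret j: compatible_structure "J (cot_chart A c) (W z)" by (rule rep_compatible[OF c(1) rep zU])
  have W2: "W2 z = J (cot_chart A c) (W z) (W1 z)" using r(11)[OF zU] zb by auto
  have fz: "fst (W z) \<in> cimg c" using r(5)[OF zU] by (simp add: mem_Times_iff)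
  define R where "R = (0 :: 'e, snd (W z))"
  have R: "sform R v = - (snd (W z) \<bullet> fst v)" for v by (simp add: R_def sform_def inner_commute)
  have "F1 z = j.G R (J (cot_chart A c) (W z) (W2 z)) * -1" "F2 z = j.G R (W2 z)"
    unfolding F12_rep[OF c(1) rep zU z] using R[of "W2 z"] R[of "W1 z"] by (simp_all add: j.G_def sform_linear W2)
  then have "(F1 z)\<^sup>2 + (F2 z)\<^sup>2 \<le> j.G R R * j.G (W2 z) (W2 z)" using j.G_Bessel[of R "W2 z"] by simp
  also have "j.G (W2 z) (W2 z) = edens z"
    using edens_rep[OF c(1) rep zU z] by (simp add: W2 j.G_J0) (simp add: j.G_def)
  also have "j.G R R = 2 * F z"
  proof -
    have sz: "snd (W z) = snd (w z) c" by (rule rep_components(2)[OF c(1) rep zU zb(3)])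
    have "snd (W z) \<bullet> fst (J (cot_chart A c) (W z) R) = m.dkin (W z) (J (cot_chart A c) (W z) (J (cot_chart A c) (W z) R))"
      using dkin_J[OF c(1) zb(2) w_cot[OF zb(3)] r(3)[OF zU zb(3)], of "J (cot_chart A c) (W z) R"]
      unfolding r(4)[OF zU zb(3)] sz by simp
    also have "\<dots> = - m.dkin (W z) R" by (simp add: linear_neg[OF m.dkin_linear[OF fz]])
    also have "m.dkin (W z) R = 2 * m.kin (W z)" unfolding R_def by (rule m.dkin_vertical[OF fz])
    finally show ?thesis using F_rep[OF c(1) rep zU zb(3)] by (simp add: j.G_def R)
  qed
  finally show ?thesis .
qed

text \<open>The tangent \<open>\<i> * \<zeta>\<close> of the circle has real part
  \<open>- Im \<zeta>\<close> and imaginary part \<open>Re \<zeta>\<close>. The base point is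
  constant along the circle near \<open>\<zeta>\<close>, so the base component of the derivative in
  this direction vanishes.\<close>

lemma tangential_derivative:
  assumes c: "c \<in> A" and rep: "chart_rep c U W W1 W2 D1 D2" and \<zeta>: "\<zeta> \<in> U" "\<zeta> \<in> sphere 0 1"
    and loc: "d > 0" "\<And>t. \<bar>t\<bar> < d \<Longrightarrow> fst (w (\<zeta> * cis t)) = fst (w \<zeta>)"
  shows "Re \<zeta> *\<^sub>R fst (W2 \<zeta>) = Im \<zeta> *\<^sub>R fst (W1 \<zeta>)"
proof -
  note r = repD[OF c rep]
  define \<gamma> where "\<gamma> t = \<zeta> * cis t" for t
  have \<gamma>: "(\<gamma> has_derivative (\<lambda>t. t *\<^sub>R (\<i> * \<zeta>))) (at 0)"
  proof -
    have "cis t = of_real (cos t) + \<i> * of_real (sin t)" for t by (simp add: complex_eq_iff)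
    then have "\<gamma> = (\<lambda>t. \<zeta> * (of_real (cos t) + \<i> * of_real (sin t)))" by (simp add: \<gamma>_def[abs_def])
    moreover have "((\<lambda>t. \<zeta> * (of_real (cos t) + \<i> * of_real (sin t))) has_derivative (\<lambda>t. t *\<^sub>R (\<i> * \<zeta>))) (at (0::real))"
      by (auto intro!: derivative_eq_intros simp: scaleR_conv_of_real)
    ultimately show ?thesis by simp
  qed
  have g0: "\<gamma> 0 = \<zeta>" by (simp add: \<gamma>_def)
  have "((\<lambda>t. fst (W (\<gamma> t))) has_derivative
      (\<lambda>t. fst (Re (t *\<^sub>R (\<i> * \<zeta>)) *\<^sub>R W1 \<zeta> + Im (t *\<^sub>R (\<i> * \<zeta>)) *\<^sub>R W2 \<zeta>))) (at 0)"
    by (rule has_derivative_fst, rule has_derivative_compose[OF \<gamma>, of W]) (use r(6)[OF \<zeta>(1)] g0 in simp)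
  moreover have "open (\<gamma> -` U \<inter> {-d<..<d})"
    by (intro open_Int open_vimage r(1)) (auto simp: \<gamma>_def intro!: continuous_intros)
  moreover have "0 \<in> \<gamma> -` U \<inter> {-d<..<d}" using \<zeta> loc(1) g0 by simp
  moreover have "fst (W (\<gamma> t)) = coord c (fst (w \<zeta>))" if "t \<in> \<gamma> -` U \<inter> {-d<..<d}" for t
  proof -
    have "\<gamma> t \<in> U" "\<gamma> t \<in> cball 0 1" using that \<zeta>(2) by (auto simp: \<gamma>_def norm_mult)
    then have "fst (W (\<gamma> t)) = coord c (fst (w (\<gamma> t)))" by (rule rep_components(1)[OF c rep])
    then show ?thesis using loc(2)[of t] that by (simp add: \<gamma>_def abs_less_iff)
  qed
  ultimately have "((\<lambda>t. coord c (fst (w \<zeta>))) has_derivative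
      (\<lambda>t. fst (Re (t *\<^sub>R (\<i> * \<zeta>)) *\<^sub>R W1 \<zeta> + Im (t *\<^sub>R (\<i> * \<zeta>)) *\<^sub>R W2 \<zeta>))) (at 0)"
    by (rule has_derivative_transform_within_open)
  from has_derivative_unique[OF this has_derivative_const]
  have "fst (Re (1 *\<^sub>R (\<i> * \<zeta>)) *\<^sub>R W1 \<zeta> + Im (1 *\<^sub>R (\<i> * \<zeta>)) *\<^sub>R W2 \<zeta>) = 0" by metis
  then show ?thesis by (simp add: add_eq_0_iff)
qed

text \<open>The divergence of \<open>\<chi>(F) \<nabla>F\<close> is \<open>\<chi>'(F) |\<nabla>F|\<^sup>2 + \<chi>(F) edens\<close>. Where \<open>w\<close> runs in a single
  cotangent fibre along the boundary, the normal derivative of \<open>F\<close> vanishes, because it is the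
  Liouville form of the tangential derivative.\<close>

lemma maximum_principle:
  assumes V: "w ` cball 0 1 \<subseteq> V"
    and bd: "\<And>\<zeta>. \<zeta> \<in> sphere 0 1 \<Longrightarrow> F \<zeta> \<le> b \<or>
      (\<zeta> \<notin> M \<and> (\<exists>d>0. \<forall>t. \<bar>t\<bar> < d \<longrightarrow> fst (w (\<zeta> * cis t)) = fst (w \<zeta>)))"
    and ex: "\<zeta>0 \<in> cball 0 1" "F \<zeta>0 \<le> b" and z: "z \<in> cball 0 1"
  shows "F z \<le> b"
proof (rule field_le_epsilon)
  fix e :: real assume e: "e > 0"
  \<comment> \<open>Strictly above \<open>b\<close>, so that the cutoff vanishes near every boundary
    point with \<open>F \<zeta> \<le> b\<close>. By \<open>bd\<close> this covers the marked points,
    where nothing is known about the gradient.\<close>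
  define b' where "b' = b + e"
  have disc_V: "disc_V = ball 0 1" using V by (auto simp: disc_V_def)
  define cut where "cut x = (max 0 (x - b'))\<^sup>2" for x :: real
  define cut' where "cut' x = 2 * max 0 (x - b')" for x
  have Dcut: "(cut has_derivative (\<lambda>h. cut' x * h)) (at x)" for x
  proof -
    have "((\<lambda>x. (max 0 (x - b'))\<^sup>2) has_real_derivative 2 * max 0 (x - b') * 1) (at x)"
      by (rule DERIV_chain2[OF DERIV_max_0_squared]) (auto intro!: derivative_eq_intros)
    then show ?thesis by (simp add: cut_def[abs_def] cut'_def has_field_derivative_def)
  qed
  have DcutF: "((\<lambda>z. cut (F z)) has_derivative (\<lambda>h. cut' (F z) * (Re h * F1 z + Im h * F2 z))) (at z)" if "z \<in> ball 0 1" for z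
    using has_derivative_compose[OF F12_differentiable(1) Dcut] that by (simp add: disc_V)
  have cF: "continuous_on (ball 0 1) F" by (rule continuous_on_subset[OF continuous_F]) auto
  have cF12: "continuous_on (ball 0 1) F1" "continuous_on (ball 0 1) F2"
    unfolding disc_V[symmetric]
    using has_derivative_continuous[OF F12_differentiable(2)] has_derivative_continuous[OF F12_differentiable(3)]
    by (simp_all add: continuous_at_imp_continuous_on)
  define X where "X z = cut (F z) * F1 z" for z
  define Y where "Y z = cut (F z) * F2 z" for z
  define X' where "X' z h = cut (F z) * frechet_derivative F1 (at z) h + cut' (F z) * (Re h * F1 z + Im h * F2 z) * F1 z" for z h
  define Y' where "Y' z h = cut (F z) * frechet_derivative F2 (at z) h + cut' (F z) * (Re h * F1 z + Im h * F2 z) * F2 z" for z h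
  have DX: "(X has_derivative X' z) (at z)" if "z \<in> ball 0 1" for z
    unfolding X_def X'_def using has_derivative_mult[OF DcutF[OF that] F12_differentiable(2)] that by (simp add: disc_V)
  have DY: "(Y has_derivative Y' z) (at z)" if "z \<in> ball 0 1" for z
    unfolding Y_def Y'_def using has_derivative_mult[OF DcutF[OF that] F12_differentiable(3)] that by (simp add: disc_V)
  have ccut: "continuous_on S (\<lambda>z. cut (f z))" "continuous_on S (\<lambda>z. cut' (f z))" if "continuous_on S f" for S and f :: "complex \<Rightarrow> real"
    unfolding cut_def cut'_def using that by (auto intro!: continuous_intros)
  have cFF: "continuous_on (ball 0 1) (\<lambda>z. frechet_derivative F1 (at z) h)" "continuous_on (ball 0 1) (\<lambda>z. frechet_derivative F2 (at z) h)" for h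
    using F12_differentiable(4,5) disc_V by (auto intro!: continuous_at_imp_continuous_on)
  have cX: "continuous_on (ball 0 1) (\<lambda>z. X' z h)" "continuous_on (ball 0 1) (\<lambda>z. Y' z h)" for h
    unfolding X'_def Y'_def by (intro continuous_intros ccut cF cF12 cFF)+
  have dv: "X' z 1 + Y' z \<i> = cut (F z) * edens z + cut' (F z) * ((F1 z)\<^sup>2 + (F2 z)\<^sup>2)" if "z \<in> ball 0 1" for z
    using edens_laplace[of z] that by (simp add: disc_V X'_def Y'_def power2_eq_square algebra_simps)
  have nn: "0 \<le> cut x" "0 \<le> cut' x" for x by (auto simp: cut_def cut'_def)
  have dvnn: "0 \<le> X' z 1 + Y' z \<i>" if "z \<in> ball 0 1" for z
    using nn energy_density(2)[OF that] by (simp add: dv[OF that])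
  have int: "set_integrable lborel (ball 0 1) (\<lambda>z. X' z 1 + Y' z \<i>)"
  proof -
    have "compact (F ` cball 0 1)" by (intro compact_continuous_image continuous_F compact_cball)
    then obtain B where B: "\<And>z. z \<in> cball 0 1 \<Longrightarrow> \<bar>F z\<bar> \<le> B" by (metis bounded_iff compact_imp_bounded imageI real_norm_def)
    have B0: "B \<ge> 0" using B[of 0] by auto
    define K where "K = (B + \<bar>b'\<bar>)\<^sup>2 + 2 * (B + \<bar>b'\<bar>) * (2 * B)"
    have bnd: "X' z 1 + Y' z \<i> \<le> K * edens z" if z: "z \<in> ball 0 1" for z
    proof -
      have "max 0 (F z - b') \<le> B + \<bar>b'\<bar>" using B[of z] z B0 by auto
      then have 1: "cut (F z) \<le> (B + \<bar>b'\<bar>)\<^sup>2" unfolding cut_def by (rule power_mono) simp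
      have 2: "cut' (F z) \<le> 2 * (B + \<bar>b'\<bar>)" unfolding cut'_def
        using mult_left_mono[OF \<open>max 0 (F z - b') \<le> B + \<bar>b'\<bar>\<close>, of 2] by simp
      have "(F1 z)\<^sup>2 + (F2 z)\<^sup>2 \<le> 2 * F z * edens z" using gradient_bound z disc_V by auto
      also have "\<dots> \<le> 2 * B * edens z" using B[of z] z energy_density(2)[OF z] by (intro mult_right_mono) auto
      finally have 3: "(F1 z)\<^sup>2 + (F2 z)\<^sup>2 \<le> 2 * B * edens z" .
      have "cut' (F z) * ((F1 z)\<^sup>2 + (F2 z)\<^sup>2) \<le> (2 * (B + \<bar>b'\<bar>)) * (2 * B * edens z)"
        by (intro mult_mono 2 3) (use B0 in auto)
      moreover have "cut (F z) * edens z \<le> (B + \<bar>b'\<bar>)\<^sup>2 * edens z" by (intro mult_right_mono 1 energy_density(2)[OF z])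
      ultimately show ?thesis by (simp add: dv[OF z] K_def algebra_simps)
    qed
    show ?thesis
    proof (rule set_integrable_bound[of _ _ "\<lambda>z. K * edens z"])
      show "set_integrable lborel (ball 0 1) (\<lambda>z. K * edens z)" using edens_integrable by simp
      show "set_borel_measurable lborel (ball 0 1) (\<lambda>z. X' z 1 + Y' z \<i>)"
      proof -
        have "continuous_on (ball 0 1) (\<lambda>z. X' z 1 + Y' z \<i>)" by (intro continuous_intros cX)
        from borel_measurable_continuous_on_indicator[OF _ this]
        show ?thesis by (simp add: set_borel_measurable_def)
      qed
      show "AE z in lborel. z \<in> ball 0 1 \<longrightarrow> norm (X' z 1 + Y' z \<i>) \<le> norm (K * edens z)"
        using bnd dvnn by (intro AE_I2) fastforce
    qed
  qed
  have bdry: "((\<lambda>z. X z * Re z + Y z * Im z) \<longlongrightarrow> 0) (at \<zeta> within ball 0 1)" if \<zeta>: "\<zeta> \<in> sphere 0 1" for \<zeta>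
  proof (cases "F \<zeta> \<le> b")
    case True
    have \<zeta>c: "\<zeta> \<in> cball 0 1" using \<zeta> by auto
    have "(F \<longlongrightarrow> F \<zeta>) (at \<zeta> within cball 0 1)" using continuous_F \<zeta>c by (simp add: continuous_on_def)
    then have "(F \<longlongrightarrow> F \<zeta>) (at \<zeta> within ball 0 1)" by (rule tendsto_within_subset) auto
    then have "\<forall>\<^sub>F z in at \<zeta> within ball 0 1. F z < b'" using True e by (auto simp: b'_def intro: order_tendstoD(2))
    then have "\<forall>\<^sub>F z in at \<zeta> within ball 0 1. X z * Re z + Y z * Im z = 0"
      by (rule eventually_mono) (auto simp: X_def Y_def cut_def)
    then show ?thesis by (rule tendsto_eventually)
  next
    case False
    then obtain d where d: "\<zeta> \<notin> M" "d > 0" "\<And>t. \<bar>t\<bar> < d \<Longrightarrow> fst (w (\<zeta> * cis t)) = fst (w \<zeta>)"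
      using bd[OF \<zeta>] by blast
    have \<zeta>c: "\<zeta> \<in> cball 0 1" using \<zeta> by auto
    obtain c where c: "c \<in> A" "fst (w \<zeta>) \<in> cdom c" using interior_chart[OF \<zeta>c] by blast
    obtain U W W1 W2 D1 D2 where zU: "\<zeta> \<in> U" and rep: "chart_rep c U W W1 W2 D1 D2"
      using chart_rep_exists[of \<zeta> c] c d(1) \<zeta>c by blast
    \<comment> \<open>The normal component of the gradient, written through \<open>W\<close> and
      hence continuous across the circle. At \<open>\<zeta>\<close> it pairs the momentum with the
      vector that vanishes by \<open>tangential_derivative\<close>.\<close>
    define N where "N z = - (snd (W z) \<bullet> fst (W2 z)) * Re z + (snd (W z) \<bullet> fst (W1 z)) * Im z" for z
    have "continuous_on U N" unfolding N_def by (intro continuous_intros rep_continuous[OF c(1) rep])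
    then have "isCont N \<zeta>" using zU repD(1)[OF c(1) rep] by (simp add: continuous_on_eq_continuous_at)
    then have "(N \<longlongrightarrow> N \<zeta>) (at \<zeta> within ball 0 1)" unfolding isCont_def by (rule tendsto_within_subset) auto
    moreover have "N \<zeta> = snd (W \<zeta>) \<bullet> (Im \<zeta> *\<^sub>R fst (W1 \<zeta>) - Re \<zeta> *\<^sub>R fst (W2 \<zeta>))"
      by (simp add: N_def inner_diff_right)
    then have "N \<zeta> = 0" using tangential_derivative[OF c(1) rep zU \<zeta> d(2,3)] by simp
    ultimately have limN: "(N \<longlongrightarrow> 0) (at \<zeta> within ball 0 1)" by simp
    have "((\<lambda>z. cut (F z)) \<longlongrightarrow> cut (F \<zeta>)) (at \<zeta> within cball 0 1)"
      using ccut(1)[OF continuous_F] \<zeta>c by (simp add: continuous_on_def)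
    then have "((\<lambda>z. cut (F z)) \<longlongrightarrow> cut (F \<zeta>)) (at \<zeta> within ball 0 1)" by (rule tendsto_within_subset) auto
    from tendsto_mult[OF this limN] have lim: "((\<lambda>z. cut (F z) * N z) \<longlongrightarrow> 0) (at \<zeta> within ball 0 1)" by simp
    have "\<forall>\<^sub>F z in at \<zeta> within ball 0 1. z \<in> U"
      using repD(1)[OF c(1) rep] zU unfolding eventually_at_topological by blast
    moreover have "\<forall>\<^sub>F z in at \<zeta> within ball 0 1. z \<in> ball 0 1" by (simp add: eventually_at_filter)
    ultimately have "\<forall>\<^sub>F z in at \<zeta> within ball 0 1. cut (F z) * N z = X z * Re z + Y z * Im z"
      by eventually_elim (use F12_rep[OF c(1) rep] disc_V in \<open>auto simp: X_def Y_def N_def algebra_simps\<close>)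
    from Lim_transform_eventually[OF lim this] show ?thesis .
  qed
  have "(LINT z:ball 0 1|lborel. X' z 1 + Y' z \<i>) = 0"
    by (rule divergence_disc[OF DX DY cX(1) cX(2) int bdry])
  \<comment> \<open>A continuous nonnegative divergence with integral 0 vanishes identically. Then
    \<open>cut (F z)\<close> has zero derivative, and \<open>\<zeta>0\<close> determines the
    constant.\<close>
  then have zero: "X' z 1 + Y' z \<i> = 0" if "z \<in> ball 0 1" for z
    by (intro continuous_set_integral_eq_0[OF int dvnn open_ball _ _ that] continuous_intros cX) auto
  have "((\<lambda>z. cut (F z)) has_derivative (\<lambda>h. 0)) (at z within ball 0 1)" if z: "z \<in> ball 0 1" for z
  proof -
    have "cut (F z) * edens z + cut' (F z) * ((F1 z)\<^sup>2 + (F2 z)\<^sup>2) = 0" using zero[OF z] dv[OF z] by simp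
    moreover have "0 \<le> cut (F z) * edens z" "0 \<le> cut' (F z) * ((F1 z)\<^sup>2 + (F2 z)\<^sup>2)"
      using nn energy_density(2)[OF z] by auto
    ultimately have "cut' (F z) * ((F1 z)\<^sup>2 + (F2 z)\<^sup>2) = 0" by linarith
    then have "cut' (F z) = 0 \<or> F1 z = 0 \<and> F2 z = 0" by (simp add: sum_power2_eq_zero_iff)
    then have "(\<lambda>h. cut' (F z) * (Re h * F1 z + Im h * F2 z)) = (\<lambda>h. 0)" by auto
    then show ?thesis using has_derivative_at_withinI[OF DcutF[OF z], of "ball 0 1"] by simp
  qed
  then obtain k where k: "\<And>z. z \<in> ball 0 1 \<Longrightarrow> cut (F z) = k"
    using has_derivative_zero_constant[OF convex_ball[of "0::complex" 1], of "\<lambda>z. cut (F z)"] by blast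
  have "cut (F z) = k" if "z \<in> cball 0 1" for z
    by (rule continuous_constant_on_closure[of "ball 0 1" "\<lambda>z. cut (F z)"])
      (use that k ccut(1)[OF continuous_F] closure_ball[of 1 "0::complex"] in auto)
  then have "cut (F z) = cut (F \<zeta>0)" using z ex by metis
  also have "\<dots> = 0" using ex e by (simp add: cut_def b'_def)
  finally show "F z \<le> b + e" by (simp add: cut_def b'_def)
qed

end

section \<open>Monotonicity of the area\<close>

context compatible_structure begin

lemma bounded_linear_J0: "bounded_linear J0"
  using linear_J0 by (simp add: linear_conv_bounded_linear)

lemma bounded_bilinear_G: "bounded_bilinear G"
  unfolding G_def[abs_def]
  by (rule bounded_bilinear.comp[OF bounded_bilinear_sform bounded_linear_ident bounded_linear_J0])

lemma G_quadratic_sum: "G (x + y) (x + y) \<le> 3/2 * G x x + 3 * G y y"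
proof -
  have "0 \<le> G (x - 2 *\<^sub>R y) (x - 2 *\<^sub>R y)" by (rule G_nonneg)
  then have "4 * G x y \<le> G x x + 4 * G y y" using G_sym[of y x] by (simp add: G_linear)
  then show ?thesis using G_sym[of y x] by (simp add: G_linear)
qed

end

context hol_disc begin

text \<open>\<open>G\<close> is the metric frozen at the centre \<open>z0\<close>, and
  \<open>inB\<close> is membership in its ball of squared radius \<open>R\<close>. \<open>BK\<close>
  keeps this ball over a compact part of the chart, \<open>est\<close> measures how fast
  \<open>J\<close> leaves its frozen value, \<open>T\<close> separates the ball from the marked
  points, and \<open>bdry\<close> lets the circle enter the ball only along the fibre through
  \<open>z0\<close>.\<close>

context
  fixes c z0 R \<kappa> K0 T G cc rho inB
  assumes c: "c \<in> A" and z0: "z0 \<in> cimg c \<times> UNIV" and R: "R > 0" and \<kappa>: "\<kappa> \<ge> 0" "\<kappa> * sqrt R \<le> 1/2"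
    and G: "G = compatible_structure.G (J (cot_chart A c) z0)"
    and cc: "cc = (\<lambda>\<zeta>. (coord c (fst (w \<zeta>)), snd (w \<zeta>) c))"
    and rho: "rho = (\<lambda>\<zeta>. G (cc \<zeta> - z0) (cc \<zeta> - z0))"
    and inB: "inB = (\<lambda>\<zeta>. fst (w \<zeta>) \<in> cdom c \<and> rho \<zeta> \<le> R)"
    and K0: "compact K0" "K0 \<subseteq> cimg c"
    and BK: "\<And>z. G (z - z0) (z - z0) \<le> R \<Longrightarrow> fst z \<in> K0"
    and est: "\<And>z a. G (z - z0) (z - z0) \<le> R \<Longrightarrow>
      G (J (cot_chart A c) z a - J (cot_chart A c) z0 a) (J (cot_chart A c) z a - J (cot_chart A c) z0 a)
        \<le> \<kappa>\<^sup>2 * G (z - z0) (z - z0) * G a a"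
    and BV: "\<And>\<zeta>. \<zeta> \<in> cball 0 1 \<Longrightarrow> inB \<zeta> \<Longrightarrow> w \<zeta> \<in> V"
    and T: "openin (mtop (cot_atlas A)) T" "\<And>\<zeta>. \<zeta> \<in> M \<Longrightarrow> w \<zeta> \<in> T"
      "\<And>\<zeta>. \<zeta> \<in> cball 0 1 \<Longrightarrow> w \<zeta> \<in> T \<Longrightarrow> \<not> inB \<zeta>"
    and bdry: "\<And>\<zeta>. \<zeta> \<in> sphere 0 1 \<Longrightarrow> inB \<zeta> \<Longrightarrow> coord c (fst (w \<zeta>)) = fst z0 \<and>
      (\<exists>d>0. \<forall>t. \<bar>t\<bar> < d \<longrightarrow> fst (w (\<zeta> * cis t)) = fst (w \<zeta>))"
begin

interpretation j: compatible_structure "J (cot_chart A c) z0"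
  by (rule compatible[OF c z0])

lemma G_j: "G = j.G" by (rule G)

lemma rho_nonneg: "rho \<zeta> \<ge> 0" by (simp add: rho G_j j.G_nonneg)

definition dcc :: "complex \<Rightarrow> complex \<Rightarrow> 'e \<times> 'e" where
  "dcc z = frechet_derivative (\<lambda>\<zeta>. (coord c (fst (w \<zeta>)), snd (w \<zeta>) c)) (at z)"

definition qform :: "complex \<Rightarrow> real" where
  "qform z = (let x = (coord c (fst (w z)), snd (w z) c) - z0 in
     compatible_structure.G (J (cot_chart A c) z0) x (dcc z 1) * sform x (dcc z \<i>)
     - compatible_structure.G (J (cot_chart A c) z0) x (dcc z \<i>) * sform x (dcc z 1))"

lemma qform: "qform z = G (cc z - z0) (dcc z 1) * sform (cc z - z0) (dcc z \<i>) - G (cc z - z0) (dcc z \<i>) * sform (cc z - z0) (dcc z 1)"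
  by (simp add: qform_def Let_def cc G)

lemma cc_rep:
  assumes "chart_rep c U W W1 W2 D1 D2" "z \<in> U" "z \<in> cball 0 1"
  shows "cc z = W z"
  using repD(4)[OF c assms] by (simp add: cc)

lemma dcc_rep:
  assumes rep: "chart_rep c U W W1 W2 D1 D2" and z: "z \<in> U" "z \<in> ball 0 1"
  shows "dcc z h = Re h *\<^sub>R W1 z + Im h *\<^sub>R W2 z"
proof -
  note r = repD[OF c rep]
  have "(cc has_derivative (\<lambda>h. Re h *\<^sub>R W1 z + Im h *\<^sub>R W2 z)) (at z)"
    by (rule has_derivative_transform_within_open[OF r(6)[OF z(1)], of "U \<inter> ball 0 1"])
      (use z r(1) cc_rep[OF rep] in auto)
  from frechet_derivative_at[OF this] show ?thesis unfolding cc dcc_def by metis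
qed

lemma qform_bound:
  assumes z: "z \<in> ball 0 1" "inB z"
  shows "\<bar>qform z\<bar> \<le> rho z * (1 + 6 * \<kappa> * sqrt (rho z)) * edens z"
proof -
  have zc: "z \<in> cball 0 1" "fst (w z) \<in> cdom c" "rho z \<le> R" using z by (auto simp: inB)
  have zD: "z \<in> disc_V" using BV[OF zc(1) z(2)] z(1) by (simp add: disc_V_def)
  obtain U W W1 W2 D1 D2 where zU: "z \<in> U" and rep: "chart_rep c U W W1 W2 D1 D2"
    using chart_rep_exists[OF interior_not_marked[OF z(1)] c zc(2)] by blast
  note ccW = cc_rep[OF rep zU zc(1)]
  have rW: "G (W z - z0) (W z - z0) = rho z" by (simp add: rho ccW)
  have W2: "W2 z = J (cot_chart A c) (W z) (W1 z)" by (rule repD(11)[OF c rep zU zc(1)])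
  have t: "0 \<le> \<kappa> * sqrt (rho z)" "\<kappa> * sqrt (rho z) \<le> 1/2"
  proof -
    show "0 \<le> \<kappa> * sqrt (rho z)" using \<kappa>(1) rho_nonneg by simp
    have "\<kappa> * sqrt (rho z) \<le> \<kappa> * sqrt R" using \<kappa>(1) zc(3) by (intro mult_left_mono) auto
    then show "\<kappa> * sqrt (rho z) \<le> 1/2" using \<kappa>(2) by simp
  qed
  have d: "j.G (W2 z - J (cot_chart A c) z0 (W1 z)) (W2 z - J (cot_chart A c) z0 (W1 z)) \<le> (\<kappa> * sqrt (rho z))\<^sup>2 * j.G (W1 z) (W1 z)"
    using est[of "W z" "W1 z"] rW zc(3) rho_nonneg[of z] by (simp add: W2 G_j power_mult_distrib)
  have "qform z = j.G (W z - z0) (W1 z) * sform (W z - z0) (W2 z) - j.G (W z - z0) (W2 z) * sform (W z - z0) (W1 z)"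
    by (simp add: qform ccW dcc_rep[OF rep zU z(1)] G_j)
  also have "\<bar>\<dots>\<bar> \<le> j.G (W z - z0) (W z - z0) * (1 + 6 * (\<kappa> * sqrt (rho z))) * sform (W1 z) (W2 z)"
    by (rule j.two_form_estimate(1)[OF t d])
  also have "\<dots> = rho z * (1 + 6 * \<kappa> * sqrt (rho z)) * edens z"
    using rW edens_rep[OF c rep zU zD] by (simp add: G_j mult.assoc)
  finally show ?thesis .
qed

context
  fixes \<phi> \<phi>' :: "real \<Rightarrow> real"
  assumes D\<phi>: "\<And>s. s \<ge> 0 \<Longrightarrow> (\<phi> has_real_derivative \<phi>' s) (at s)" and c\<phi>': "continuous_on {0..} \<phi>'"
    and \<phi>0: "\<And>s. s \<ge> R \<Longrightarrow> \<phi> s = 0" "\<And>s. s \<ge> R \<Longrightarrow> \<phi>' s = 0"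
begin

text \<open>The field \<open>(flux1, flux2)\<close> is dual to the pull-back of the form \<open>\<phi>(rho) \<lambda>\<close>, where
  \<open>\<lambda> u = sform (cc - z0) u / 2\<close> is a primitive of \<open>sform\<close>; \<open>qform\<close> is the pull-back of
  \<open>d rho \<and> \<lambda>\<close>. The form \<open>\<lambda>\<close> vanishes along the cotangent fibre through \<open>z0\<close>, so the boundary does
  not contribute.\<close>

definition flux1 :: "complex \<Rightarrow> real" where
  "flux1 z = (if fst (w z) \<in> cdom c then \<phi> (compatible_structure.G (J (cot_chart A c) z0) ((coord c (fst (w z)), snd (w z) c) - z0) ((coord c (fst (w z)), snd (w z) c) - z0))
     * (sform ((coord c (fst (w z)), snd (w z) c) - z0) (dcc z \<i>) / 2) else 0)"

definition flux2 :: "complex \<Rightarrow> real" where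
  "flux2 z = (if fst (w z) \<in> cdom c then - (\<phi> (compatible_structure.G (J (cot_chart A c) z0) ((coord c (fst (w z)), snd (w z) c) - z0) ((coord c (fst (w z)), snd (w z) c) - z0))
     * (sform ((coord c (fst (w z)), snd (w z) c) - z0) (dcc z 1) / 2)) else 0)"

lemma flux1: "flux1 z = (if fst (w z) \<in> cdom c then \<phi> (rho z) * (sform (cc z - z0) (dcc z \<i>) / 2) else 0)"
  and flux2: "flux2 z = (if fst (w z) \<in> cdom c then - (\<phi> (rho z) * (sform (cc z - z0) (dcc z 1) / 2)) else 0)"
  by (simp_all add: flux1_def flux2_def rho cc G)

lemma continuous_on_\<phi>: "continuous_on {0..} \<phi>"
  using D\<phi> by (intro continuous_at_imp_continuous_on ballI DERIV_isCont) auto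

text \<open>Extending the flux by 0 creates no singularity: points mapped outside the chart are kept
  off the ball by closedness of the compact set over \<open>K0\<close>, marked points by
  \<open>T\<close>.\<close>

lemma zero_neighbourhood:
  assumes \<zeta>: "\<zeta> \<in> cball 0 1" and "\<zeta> \<in> M \<or> fst (w \<zeta>) \<notin> cdom c"
  shows "\<exists>N. open N \<and> \<zeta> \<in> N \<and> (\<forall>z\<in>N \<inter> ball 0 1. flux1 z = 0 \<and> flux2 z = 0 \<and> \<not> inB z)"
proof -
  have "\<exists>T'. openin (mtop (cot_atlas A)) T' \<and> w \<zeta> \<in> T' \<and> (\<forall>z\<in>cball 0 1. w z \<in> T' \<longrightarrow> \<not> inB z)"
  proof (cases "\<zeta> \<in> M")
    case True
    then show ?thesis using T by blast
  next
    case False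
    show ?thesis
    proof (intro exI conjI ballI impI)
      show "openin (mtop (cot_atlas A)) {x \<in> cotangent A. \<not> (fst x \<in> cdom c \<and> coord c (fst x) \<in> K0)}"
        by (rule openin_not_in_compact[OF c K0])
      show "w \<zeta> \<in> {x \<in> cotangent A. \<not> (fst x \<in> cdom c \<and> coord c (fst x) \<in> K0)}"
        using assms(2) False w_cot[OF \<zeta>] by auto
      fix z assume "w z \<in> {x \<in> cotangent A. \<not> (fst x \<in> cdom c \<and> coord c (fst x) \<in> K0)}"
      then show "\<not> inB z" using BK[of "cc z"] by (auto simp: inB rho cc)
    qed
  qed
  then obtain T' where T': "openin (mtop (cot_atlas A)) T'" "w \<zeta> \<in> T'" "\<forall>z\<in>cball 0 1. w z \<in> T' \<longrightarrow> \<not> inB z" by blast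
  obtain N where N: "open N" "{z \<in> cball 0 1. w z \<in> T'} = cball 0 1 \<inter> N" using w_preimage[OF T'(1)] by blast
  have "\<zeta> \<in> N" using N(2) \<zeta> T'(2) by blast
  moreover have "flux1 z = 0 \<and> flux2 z = 0 \<and> \<not> inB z" if z: "z \<in> N \<inter> ball 0 1" for z
  proof -
    have "z \<in> cball 0 1" using z by auto
    then have nB: "\<not> inB z" using N(2) T'(3) z by blast
    then show ?thesis using \<phi>0(1)[of "rho z"] by (auto simp: flux1 flux2 inB)
  qed
  ultimately show ?thesis using N(1) by blast
qed

context
  fixes U W W1 W2 D1 D2
  assumes rep: "chart_rep c U W W1 W2 D1 D2"
begin

lemma rep_rho: "z \<in> U \<Longrightarrow> z \<in> cball 0 1 \<Longrightarrow> rho z = G (W z - z0) (W z - z0)"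
  using cc_rep[OF rep] by (simp add: rho)

lemma flux1_rep:
  assumes "z \<in> U" "z \<in> ball 0 1"
  shows "flux1 z = \<phi> (G (W z - z0) (W z - z0)) * (sform (W z - z0) (W2 z) / 2)"
    "flux2 z = - (\<phi> (G (W z - z0) (W z - z0)) * (sform (W z - z0) (W1 z) / 2))"
proof -
  have zc: "z \<in> cball 0 1" using assms by auto
  show "flux1 z = \<phi> (G (W z - z0) (W z - z0)) * (sform (W z - z0) (W2 z) / 2)"
    "flux2 z = - (\<phi> (G (W z - z0) (W z - z0)) * (sform (W z - z0) (W1 z) / 2))"
    using repD(3)[OF c rep assms(1) zc] cc_rep[OF rep assms(1) zc] rep_rho[OF assms(1) zc] dcc_rep[OF rep assms]
    by (simp_all add: flux1 flux2)
qed

text \<open>One product rule for both components: \<open>V'\<close> is \<open>W2\<close> with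
  \<open>E = D2\<close>, or \<open>W1\<close> with \<open>E = D1\<close>.\<close>

definition flux_deriv :: "complex \<Rightarrow> (complex \<Rightarrow> 'e \<times> 'e) \<Rightarrow> (complex \<Rightarrow> complex \<Rightarrow> 'e \<times> 'e) \<Rightarrow> complex \<Rightarrow> real" where
  "flux_deriv z V' E h = (let x = W z - z0; d = Re h *\<^sub>R W1 z + Im h *\<^sub>R W2 z; s = compatible_structure.G (J (cot_chart A c) z0) x x in
     \<phi> s * ((sform x (E z h) + sform d (V' z)) / 2)
       + \<phi>' s * (2 * compatible_structure.G (J (cot_chart A c) z0) x d) * (sform x (V' z) / 2))"

lemma has_derivative_flux_deriv:
  assumes z: "z \<in> U" and V': "(V' has_derivative E z) (at z)"
  shows "((\<lambda>z. \<phi> (G (W z - z0) (W z - z0)) * (sform (W z - z0) (V' z) / 2)) has_derivative flux_deriv z V' E) (at z)"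
proof -
  have W: "((\<lambda>z. W z - z0) has_derivative (\<lambda>h. Re h *\<^sub>R W1 z + Im h *\<^sub>R W2 z)) (at z)"
    using has_derivative_diff[OF repD(6)[OF c rep z] has_derivative_const[of z0]] by simp
  have "((\<lambda>z. G (W z - z0) (W z - z0)) has_derivative
      (\<lambda>h. 2 * G (W z - z0) (Re h *\<^sub>R W1 z + Im h *\<^sub>R W2 z))) (at z)"
    using bounded_bilinear.FDERIV[OF j.bounded_bilinear_G W W] j.G_sym by (simp add: G_j)
  moreover have "(\<phi> has_derivative (\<lambda>h. \<phi>' (G (W z - z0) (W z - z0)) * h)) (at (G (W z - z0) (W z - z0)))"
    using D\<phi>[of "G (W z - z0) (W z - z0)"] j.G_nonneg by (simp add: has_field_derivative_def G_j)
  ultimately have 1: "((\<lambda>z. \<phi> (G (W z - z0) (W z - z0))) has_derivative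
      (\<lambda>h. \<phi>' (G (W z - z0) (W z - z0)) * (2 * G (W z - z0) (Re h *\<^sub>R W1 z + Im h *\<^sub>R W2 z)))) (at z)"
    by (rule has_derivative_compose)
  have 2: "((\<lambda>z. sform (W z - z0) (V' z) / 2) has_derivative
      (\<lambda>h. (sform (W z - z0) (E z h) + sform (Re h *\<^sub>R W1 z + Im h *\<^sub>R W2 z) (V' z)) / 2)) (at z)"
    using has_derivative_divide[OF bounded_bilinear.FDERIV[OF bounded_bilinear_sform W V'] has_derivative_const[of 2]] by simp
  show ?thesis
    using has_derivative_mult[OF 1 2] unfolding flux_deriv_def Let_def G[symmetric] by simp
qed

lemma continuous_flux_deriv:
  assumes V': "continuous_on U V'" and E: "continuous_on U (\<lambda>z. E z h)"
  shows "continuous_on U (\<lambda>z. flux_deriv z V' E h)"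
proof -
  note cont = rep_continuous[OF c rep]
  have s: "continuous_on U (\<lambda>z. G (f z) (g z))" if "continuous_on U f" "continuous_on U g" for f g
    unfolding G_j by (rule bounded_bilinear.continuous_on[OF j.bounded_bilinear_G that])
  have sf: "continuous_on U (\<lambda>z. sform (f z) (g z))" if "continuous_on U f" "continuous_on U g" for f g :: "complex \<Rightarrow> 'e \<times> 'e"
    by (rule bounded_bilinear.continuous_on[OF bounded_bilinear_sform that])
  have "continuous_on U (\<lambda>z. G (W z - z0) (W z - z0))" by (intro s continuous_intros cont)
  moreover have "(\<lambda>z. G (W z - z0) (W z - z0)) ` U \<subseteq> {0..}" by (auto simp: G_j j.G_nonneg)
  ultimately have p: "continuous_on U (\<lambda>z. \<phi> (G (W z - z0) (W z - z0)))" "continuous_on U (\<lambda>z. \<phi>' (G (W z - z0) (W z - z0)))"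
    using continuous_on_compose2[OF continuous_on_\<phi>] continuous_on_compose2[OF c\<phi>'] by blast+
  then show ?thesis unfolding flux_deriv_def Let_def G[symmetric]
    by (intro continuous_intros s sf cont V' E p) auto
qed

lemma flux1_has_derivative:
  assumes z: "z \<in> U" "z \<in> ball 0 1"
  shows "(flux1 has_derivative flux_deriv z W2 D2) (at z)" "(flux2 has_derivative (\<lambda>h. - flux_deriv z W1 D1 h)) (at z)"
proof -
  note r = repD[OF c rep]
  have o: "open (U \<inter> ball 0 1)" using r(1) by auto
  show "(flux1 has_derivative flux_deriv z W2 D2) (at z)"
    by (rule has_derivative_transform_within_open[OF has_derivative_flux_deriv[where E = D2, OF z(1) r(8)[OF z(1)]] o]) (use z flux1_rep in auto)
  show "(flux2 has_derivative (\<lambda>h. - flux_deriv z W1 D1 h)) (at z)"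
    by (rule has_derivative_transform_within_open[OF has_derivative_minus[OF has_derivative_flux_deriv[where E = D1, OF z(1) r(7)[OF z(1)]]] o])
      (use z flux1_rep in auto)
qed

text \<open>The terms with second derivatives cancel by \<open>rep_mixed\<close>. Those with
  \<open>\<phi>\<close> give twice one half of \<open>sform (W1 z) (W2 z)\<close>, which accounts
  for the 1/2 in the primitive; those with \<open>\<phi>'\<close> give \<open>qform\<close>. Outside
  the ball both cutoff factors vanish.\<close>

lemma divergence_rep:
  assumes z: "z \<in> U" "z \<in> ball 0 1"
  shows "flux_deriv z W2 D2 1 - flux_deriv z W1 D1 \<i> = (if inB z then \<phi> (rho z) * edens z + \<phi>' (rho z) * qform z else 0)"
proof -
  have zc: "z \<in> cball 0 1" using z by auto
  note rr = rep_rho[OF z(1) zc]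
  have e: "flux_deriv z W2 D2 1 - flux_deriv z W1 D1 \<i> = \<phi> (rho z) * sform (W1 z) (W2 z) + \<phi>' (rho z) * qform z"
    using rep_mixed[OF c rep z(1)] sform_skew[of "W2 z" "W1 z"]
    unfolding qform cc_rep[OF rep z(1) zc] dcc_rep[OF rep z] rr flux_deriv_def Let_def G[symmetric]
    by (simp add: field_simps)
  show ?thesis
  proof (cases "inB z")
    case True
    then have "z \<in> disc_V" using BV[OF zc] z(2) by (simp add: disc_V_def)
    then show ?thesis using e edens_rep[OF c rep z(1)] True by simp
  next
    case False
    then have "rho z \<ge> R" using repD(3)[OF c rep z(1) zc] by (simp add: inB)
    then show ?thesis using e \<phi>0 False by simp
  qed
qed

end

lemma flux1_frechet:
  assumes z: "z \<in> ball 0 1"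
  shows "(flux1 has_derivative frechet_derivative flux1 (at z)) (at z)" "(flux2 has_derivative frechet_derivative flux2 (at z)) (at z)"
    "isCont (\<lambda>z. frechet_derivative flux1 (at z) h) z" "isCont (\<lambda>z. frechet_derivative flux2 (at z) h) z"
    "frechet_derivative flux1 (at z) 1 + frechet_derivative flux2 (at z) \<i> = (if inB z then \<phi> (rho z) * edens z + \<phi>' (rho z) * qform z else 0)"
proof -
  have zc: "z \<in> cball 0 1" using z by auto
  have "(flux1 has_derivative frechet_derivative flux1 (at z)) (at z) \<and> (flux2 has_derivative frechet_derivative flux2 (at z)) (at z) \<and>
    isCont (\<lambda>z. frechet_derivative flux1 (at z) h) z \<and> isCont (\<lambda>z. frechet_derivative flux2 (at z) h) z \<and>
    frechet_derivative flux1 (at z) 1 + frechet_derivative flux2 (at z) \<i> = (if inB z then \<phi> (rho z) * edens z + \<phi>' (rho z) * qform z else 0)"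
  proof (cases "fst (w z) \<in> cdom c")
    case True
    obtain U W W1 W2 D1 D2 where zU: "z \<in> U" and rep: "chart_rep c U W W1 W2 D1 D2"
      using chart_rep_exists[OF interior_not_marked[OF z] c True] by blast
    note r = repD[OF c rep] and d = flux1_has_derivative[OF rep]
    have fd: "frechet_derivative flux1 (at y) = flux_deriv W W1 W2 y W2 D2" "frechet_derivative flux2 (at y) = (\<lambda>h. - flux_deriv W W1 W2 y W1 D1 h)"
      if "y \<in> U \<inter> ball 0 1" for y
      using frechet_derivative_at[OF d(1)] frechet_derivative_at[OF d(2)] that by (metis IntD1 IntD2)+
    have o: "open (U \<inter> ball 0 1)" using r(1) by auto
    have "continuous_on (U \<inter> ball 0 1) (\<lambda>z. frechet_derivative flux1 (at z) h)"
      by (rule continuous_on_eq[OF continuous_on_subset[OF continuous_flux_deriv[OF rep rep_continuous(3)[OF c rep] r(10)]]]) (use fd in auto)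
    moreover have "continuous_on (U \<inter> ball 0 1) (\<lambda>z. frechet_derivative flux2 (at z) h)"
      by (rule continuous_on_eq[OF continuous_on_subset[OF continuous_on_minus[OF continuous_flux_deriv[OF rep rep_continuous(2)[OF c rep] r(9)]]]]) (use fd in auto)
    ultimately show ?thesis
      using o z zU fd[of z] divergence_rep[OF rep zU z] has_derivative_frechet[OF d(1)[OF zU z]] has_derivative_frechet[OF d(2)[OF zU z]]
      by (simp add: continuous_on_eq_continuous_at)
  next
    case False
    obtain N where N: "open N" "z \<in> N" "\<forall>y\<in>N \<inter> ball 0 1. flux1 y = 0 \<and> flux2 y = 0 \<and> \<not> inB y"
      using zero_neighbourhood[OF zc] False by blast
    have o: "open (N \<inter> ball 0 1)" using N(1) by auto
    have d: "(flux1 has_derivative (\<lambda>h. 0)) (at y)" "(flux2 has_derivative (\<lambda>h. 0)) (at y)" if "y \<in> N \<inter> ball 0 1" for y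
      by (rule has_derivative_transform_within_open[OF has_derivative_const[of 0] o that], use N(3) in simp)+
    have fd: "frechet_derivative flux1 (at y) = (\<lambda>h. 0)" "frechet_derivative flux2 (at y) = (\<lambda>h. 0)" if "y \<in> N \<inter> ball 0 1" for y
      using frechet_derivative_at[OF d(1)[OF that]] frechet_derivative_at[OF d(2)[OF that]] by simp_all
    have zN: "z \<in> N \<inter> ball 0 1" using N(2) z by simp
    have "continuous_on (N \<inter> ball 0 1) (\<lambda>z. frechet_derivative flux1 (at z) h)" "continuous_on (N \<inter> ball 0 1) (\<lambda>z. frechet_derivative flux2 (at z) h)"
      by (rule continuous_on_eq[of _ "\<lambda>_. 0"], simp, simp add: fd)+
    then show ?thesis
      using o zN N(3) fd[OF zN] has_derivative_frechet[OF d(1)[OF zN]] has_derivative_frechet[OF d(2)[OF zN]]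
      by (simp add: continuous_on_eq_continuous_at)
  qed
  then show "(flux1 has_derivative frechet_derivative flux1 (at z)) (at z)" "(flux2 has_derivative frechet_derivative flux2 (at z)) (at z)"
    "isCont (\<lambda>z. frechet_derivative flux1 (at z) h) z" "isCont (\<lambda>z. frechet_derivative flux2 (at z) h) z"
    "frechet_derivative flux1 (at z) 1 + frechet_derivative flux2 (at z) \<i> = (if inB z then \<phi> (rho z) * edens z + \<phi>' (rho z) * qform z else 0)"
    by blast+
qed

lemma flux1_boundary:
  assumes \<zeta>: "\<zeta> \<in> sphere 0 1"
  shows "((\<lambda>z. flux1 z * Re z + flux2 z * Im z) \<longlongrightarrow> 0) (at \<zeta> within ball 0 1)"
proof -
  have \<zeta>c: "\<zeta> \<in> cball 0 1" using \<zeta> by auto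
  show ?thesis
  proof (cases "\<zeta> \<in> M \<or> fst (w \<zeta>) \<notin> cdom c")
    case True
    obtain N where N: "open N" "\<zeta> \<in> N" "\<forall>y\<in>N \<inter> ball 0 1. flux1 y = 0 \<and> flux2 y = 0 \<and> \<not> inB y"
      using zero_neighbourhood[OF \<zeta>c True] by blast
    have "\<forall>\<^sub>F z in at \<zeta> within ball 0 1. flux1 z * Re z + flux2 z * Im z = 0"
      unfolding eventually_at_topological by (rule exI[of _ N]) (use N in auto)
    then show ?thesis by (rule tendsto_eventually)
  next
    case False
    obtain U W W1 W2 D1 D2 where zU: "\<zeta> \<in> U" and rep: "chart_rep c U W W1 W2 D1 D2"
      using chart_rep_exists[of \<zeta> c] c False \<zeta>c by blast
    note r = repD[OF c rep] and cont = rep_continuous[OF c rep]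
    \<comment> \<open>The normal component of the flux is the one-form applied to the tangent of the
      circle. On the fibre through \<open>z0\<close> both arguments of \<open>sform\<close> are
      vertical, so it vanishes.\<close>
    define N where "N z = \<phi> (G (W z - z0) (W z - z0)) * (sform (W z - z0) (Re z *\<^sub>R W2 z - Im z *\<^sub>R W1 z) / 2)" for z
    have s: "continuous_on U (\<lambda>z. G (W z - z0) (W z - z0))"
      unfolding G_j by (intro bounded_bilinear.continuous_on[OF j.bounded_bilinear_G] continuous_intros cont)
    have "continuous_on U N"
      unfolding N_def
      by (intro continuous_intros continuous_on_compose2[OF continuous_on_\<phi> s] bounded_bilinear.continuous_on[OF bounded_bilinear_sform] cont)
        (auto simp: G_j j.G_nonneg)
    then have "isCont N \<zeta>" using zU r(1) by (simp add: continuous_on_eq_continuous_at)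
    then have lim: "(N \<longlongrightarrow> N \<zeta>) (at \<zeta> within ball 0 1)" unfolding isCont_def by (rule tendsto_within_subset) auto
    have "N \<zeta> = 0"
    proof (cases "inB \<zeta>")
      case True
      obtain d where d: "coord c (fst (w \<zeta>)) = fst z0" "d > 0" "\<And>t. \<bar>t\<bar> < d \<Longrightarrow> fst (w (\<zeta> * cis t)) = fst (w \<zeta>)"
        using bdry[OF \<zeta> True] by blast
      have "fst (W \<zeta>) = fst z0" using rep_components(1)[OF c rep zU \<zeta>c] d(1) by simp
      moreover have "fst (Re \<zeta> *\<^sub>R W2 \<zeta> - Im \<zeta> *\<^sub>R W1 \<zeta>) = 0"
        using tangential_derivative[OF c rep zU \<zeta> d(2,3)] by simp
      ultimately have "sform (W \<zeta> - z0) (Re \<zeta> *\<^sub>R W2 \<zeta> - Im \<zeta> *\<^sub>R W1 \<zeta>) = 0" unfolding sform_def by simp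
      then show ?thesis by (simp add: N_def)
    next
      case False
      then have "rho \<zeta> \<ge> R" using \<open>\<not> (\<zeta> \<in> M \<or> fst (w \<zeta>) \<notin> cdom c)\<close> by (simp add: inB)
      then show ?thesis using \<phi>0(1) rep_rho[OF rep zU \<zeta>c] by (simp add: N_def)
    qed
    moreover have "\<forall>\<^sub>F z in at \<zeta> within ball 0 1. N z = flux1 z * Re z + flux2 z * Im z"
      unfolding eventually_at_topological
    proof (intro exI conjI ballI impI)
      show "open U" "\<zeta> \<in> U" by (rule r(1), rule zU)
      fix z assume z: "z \<in> U" "z \<in> ball 0 1"
      show "N z = flux1 z * Re z + flux2 z * Im z"
        unfolding flux1_rep[OF rep z] N_def by (simp only: sform_linear(4,6)) (simp add: field_simps)
    qed
    ultimately show ?thesis using Lim_transform_eventually[OF lim] by simp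
  qed
qed

lemma cutoff_identity:
  defines "dv z \<equiv> if inB z then \<phi> (rho z) * edens z + \<phi>' (rho z) * qform z else 0"
  shows "set_integrable lborel (ball 0 1) dv" "(LINT z:ball 0 1|lborel. dv z) = 0"
proof -
  let ?d = "\<lambda>z. frechet_derivative flux1 (at z) 1 + frechet_derivative flux2 (at z) \<i>"
  have eq: "?d z = dv z" if "z \<in> ball 0 1" for z using flux1_frechet(5)[OF that] by (simp add: dv_def)
  have cX: "continuous_on (ball 0 1) (\<lambda>z. frechet_derivative flux1 (at z) h)" "continuous_on (ball 0 1) (\<lambda>z. frechet_derivative flux2 (at z) h)" for h
    using flux1_frechet(3,4) by (intro continuous_at_imp_continuous_on ballI; blast)+
  have "compact (\<phi> ` {0..R})" "compact (\<phi>' ` {0..R})"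
    by (intro compact_continuous_image continuous_on_subset[OF continuous_on_\<phi>] continuous_on_subset[OF c\<phi>']; auto)+
  then obtain B1 B2 where B: "\<And>s. s \<in> {0..R} \<Longrightarrow> \<bar>\<phi> s\<bar> \<le> B1" "\<And>s. s \<in> {0..R} \<Longrightarrow> \<bar>\<phi>' s\<bar> \<le> B2"
    by (metis bounded_iff compact_imp_bounded imageI real_norm_def)
  have Bn: "B1 \<ge> 0" "B2 \<ge> 0" using B(1)[of 0] B(2)[of 0] R by auto
  define K where "K = B1 + B2 * (R * (1 + 6 * \<kappa> * sqrt R))"
  have Kn: "K \<ge> 0" using Bn R \<kappa>(1) by (simp add: K_def)
  have bnd: "\<bar>dv z\<bar> \<le> K * edens z" if z: "z \<in> ball 0 1" for z
  proof (cases "inB z")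
    case True
    have e: "edens z \<ge> 0" by (rule energy_density(2)[OF z])
    have s: "rho z \<in> {0..R}" using True rho_nonneg by (simp add: inB)
    have "\<bar>qform z\<bar> \<le> rho z * (1 + 6 * \<kappa> * sqrt (rho z)) * edens z" by (rule qform_bound[OF z True])
    also have "\<dots> \<le> R * (1 + 6 * \<kappa> * sqrt R) * edens z"
      using s \<kappa>(1) e by (intro mult_right_mono mult_mono add_left_mono mult_left_mono) auto
    finally have "\<bar>\<phi>' (rho z) * qform z\<bar> \<le> B2 * (R * (1 + 6 * \<kappa> * sqrt R) * edens z)"
      unfolding abs_mult by (intro mult_mono B(2)[OF s]) (use Bn in auto)
    moreover have "\<bar>\<phi> (rho z) * edens z\<bar> \<le> B1 * edens z" unfolding abs_mult using e Bn by (intro mult_mono B(1)[OF s]) auto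
    ultimately have "\<bar>\<phi> (rho z) * edens z + \<phi>' (rho z) * qform z\<bar> \<le> B1 * edens z + B2 * (R * (1 + 6 * \<kappa> * sqrt R) * edens z)"
      using abs_triangle_ineq[of "\<phi> (rho z) * edens z" "\<phi>' (rho z) * qform z"] by linarith
    then show ?thesis using True by (simp add: dv_def K_def algebra_simps)
  qed (use energy_density(2)[OF z] Kn in \<open>simp add: dv_def\<close>)
  have int: "set_integrable lborel (ball 0 1) ?d"
  proof (rule set_integrable_bound[of _ _ "\<lambda>z. K * edens z"])
    show "set_integrable lborel (ball 0 1) (\<lambda>z. K * edens z)" using edens_integrable by simp
    show "set_borel_measurable lborel (ball 0 1) ?d"
    proof -
      have "continuous_on (ball 0 1) ?d" by (intro continuous_intros cX)
      from borel_measurable_continuous_on_indicator[OF _ this]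
      show ?thesis by (simp add: set_borel_measurable_def)
    qed
    show "AE z in lborel. z \<in> ball 0 1 \<longrightarrow> norm (?d z) \<le> norm (K * edens z)"
    proof (intro AE_I2 impI)
      fix z :: complex assume z: "z \<in> ball 0 1"
      show "norm (?d z) \<le> norm (K * edens z)" unfolding eq[OF z] using bnd[OF z] by simp
    qed
  qed
  have cong: "set_integrable lborel (ball 0 1) ?d \<longleftrightarrow> set_integrable lborel (ball 0 1) dv"
    by (rule set_integrable_cong) (use eq in auto)
  show "set_integrable lborel (ball 0 1) dv" using int cong by simp
  have "(LINT z:ball 0 1|lborel. ?d z) = 0"
    by (rule divergence_disc[OF flux1_frechet(1) flux1_frechet(2) cX(1) cX(2) int flux1_boundary])
  moreover have "(LINT z:ball 0 1|lborel. ?d z) = (LINT z:ball 0 1|lborel. dv z)"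
    by (rule set_lebesgue_integral_cong) (use eq in auto)
  ultimately show "(LINT z:ball 0 1|lborel. dv z) = 0" by simp
qed

end

text \<open>Adding \<open>2 * M0 * edens\<close> to the integrand of the cutoff identity makes it
  nonnegative, and its integral becomes \<open>2 * M0\<close> times the area. On a tiny ball in the
  disc near \<open>\<zeta>0\<close> the excess \<open>3 / (16 * \<epsilon>)\<close> is inversely
  proportional to the area of that ball, so the contribution does not depend on its radius.\<close>

lemma area_lower_bound:
  assumes rep: "chart_rep c U W W1 W2 D1 D2" and \<zeta>0: "\<zeta>0 \<in> U" "\<zeta>0 \<in> cball 0 1" and W0: "W \<zeta>0 = z0" "W1 \<zeta>0 \<noteq> 0"
  shows "3 * unit_ball_vol 2 / 512 / (1 / sqrt R + 6 * \<kappa>)\<^sup>2 \<le> area A w"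
proof -
  note r = repD[OF c rep] and cont = rep_continuous[OF c rep]
  define e0 where "e0 = G (W1 \<zeta>0) (W1 \<zeta>0)"
  have e0: "e0 > 0" using j.G_pos[OF W0(2)] by (simp add: e0_def G_j)
  have W2: "W2 \<zeta>0 = J (cot_chart A c) z0 (W1 \<zeta>0)" using r(11)[OF \<zeta>0] W0(1) by simp
  define M0 where "M0 = (1 / sqrt R + 6 * \<kappa>)\<^sup>2"
  have "1 / sqrt R + 6 * \<kappa> > 0" using R \<kappa>(1) by (intro add_pos_nonneg) auto
  then have M0: "M0 > 0" by (simp add: M0_def)
  define DW where "DW h = Re h *\<^sub>R W1 \<zeta>0 + Im h *\<^sub>R W2 \<zeta>0" for h
  have GDW: "G (DW h) (DW h) = (norm h)\<^sup>2 * e0" for h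
    using j.G_sym[of "J (cot_chart A c) z0 (W1 \<zeta>0)" "W1 \<zeta>0"]
    by (simp add: DW_def W2 G_j e0_def j.G_linear j.G_J0 cmod_power2) (simp add: power2_eq_square algebra_simps)
  obtain Mc where Mc: "Mc > 0" "\<And>a b. norm (j.G a b) \<le> norm a * norm b * Mc"
    using bounded_bilinear.pos_bounded[OF j.bounded_bilinear_G] by blast
  \<comment> \<open>With this tolerance the linearisation error adds at most \<open>e0 / 2\<close>
    times the squared distance to \<open>rho\<close>; together with 3/2 of \<open>e0\<close> from
    the linear part this gives the \<open>2 * e0\<close> in \<open>\<epsilon>\<close>.\<close>
  define \<eta> where "\<eta> = sqrt (e0 / (6 * Mc))"
  have \<eta>: "\<eta> > 0" "3 * (Mc * \<eta>\<^sup>2) = e0 / 2" using e0 Mc(1) by (simp_all add: \<eta>_def)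
  have "(W has_derivative DW) (at \<zeta>0)" using r(6)[OF \<zeta>0(1)] by (simp add: DW_def[abs_def])
  then obtain d1 where d1: "d1 > 0" "\<And>y. norm (y - \<zeta>0) < d1 \<Longrightarrow> norm (W y - W \<zeta>0 - DW (y - \<zeta>0)) \<le> \<eta> * norm (y - \<zeta>0)"
    using \<eta>(1) unfolding has_derivative_at_alt by blast
  obtain d2 where d2: "d2 > 0" "ball \<zeta>0 d2 \<subseteq> U" using r(1) \<zeta>0(1) open_contains_ball by blast
  have "continuous_on U (\<lambda>z. sform (W1 z) (W2 z))"
    by (rule bounded_bilinear.continuous_on[OF bounded_bilinear_sform cont(2,3)])
  then have "isCont (\<lambda>z. sform (W1 z) (W2 z)) \<zeta>0" using r(1) \<zeta>0(1) by (simp add: continuous_on_eq_continuous_at)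
  moreover have s0: "sform (W1 \<zeta>0) (W2 \<zeta>0) = e0" by (simp add: W2 e0_def G_j j.G_def)
  ultimately obtain d3 where d3: "d3 > 0" "\<And>y. dist y \<zeta>0 < d3 \<Longrightarrow> dist (sform (W1 y) (W2 y)) e0 < e0 / 2"
    using e0 unfolding continuous_at_eps_delta by (metis half_gt_zero)
  define \<epsilon>0 where "\<epsilon>0 = min (1 / (4 * M0)) R"
  have \<epsilon>0: "\<epsilon>0 > 0" using M0 R by (simp add: \<epsilon>0_def)
  \<comment> \<open>Within \<open>\<rho>\<close> of \<open>\<zeta>0\<close> the linearisation holds
    (\<open>d1\<close>), \<open>W\<close> is available (\<open>d2\<close>) and the density is at
    least \<open>e0 / 2\<close> (\<open>d3\<close>); the last bound gives
    \<open>\<epsilon> \<le> \<epsilon>0\<close>.\<close>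
  define \<rho> where "\<rho> = min (min 1 (min d1 (min d2 d3))) (sqrt (\<epsilon>0 / (2 * e0)))"
  have \<rho>: "\<rho> > 0" "\<rho> \<le> 1" "\<rho> \<le> d1" "\<rho> \<le> d2" "\<rho> \<le> d3" "\<rho> \<le> sqrt (\<epsilon>0 / (2 * e0))"
    using d1(1) d2(1) d3(1) \<epsilon>0 e0 by (auto simp: \<rho>_def)
  define \<epsilon> where "\<epsilon> = 2 * e0 * \<rho>\<^sup>2"
  have \<epsilon>: "\<epsilon> > 0" using e0 \<rho>(1) by (simp add: \<epsilon>_def)
  have "\<rho>\<^sup>2 \<le> (sqrt (\<epsilon>0 / (2 * e0)))\<^sup>2" using \<rho>(1,6) by (intro power_mono) auto
  then have "\<rho>\<^sup>2 \<le> \<epsilon>0 / (2 * e0)" using \<epsilon>0 e0 by simp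
  then have "\<epsilon> \<le> \<epsilon>0" using e0 by (simp add: \<epsilon>_def field_simps)
  then have \<epsilon>': "\<epsilon> \<le> 1 / (4 * M0)" "\<epsilon> \<le> R" by (simp_all add: \<epsilon>0_def)
  have \<kappa>6: "6 * \<kappa> \<ge> 0" using \<kappa>(1) by simp
  obtain \<phi> \<phi>' where \<phi>: "\<forall>s\<ge>0. (\<phi> has_real_derivative \<phi>' s) (at s)" "continuous_on {0..} \<phi>'"
    "\<forall>s\<ge>0. \<phi> s \<ge> 0 \<and> \<phi>' s \<le> 0" "\<forall>s\<ge>R. \<phi> s = 0 \<and> \<phi>' s = 0"
    "\<forall>s\<ge>0. \<phi> s + \<phi>' s * (s * (1 + 6 * \<kappa> * sqrt s)) \<ge> - 2 * M0"
    "\<forall>s\<ge>0. s \<le> \<epsilon> \<longrightarrow> \<phi> s + \<phi>' s * (s * (1 + 6 * \<kappa> * sqrt s)) \<ge> - 2 * M0 + 3 / (16 * \<epsilon>)"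
    using monotonicity_cutoff[OF R \<kappa>6 \<epsilon> \<epsilon>'(1)[unfolded M0_def], folded M0_def] by (elim exE conjE) (rule that)
  define dv where "dv z = (if inB z then \<phi> (rho z) * edens z + \<phi>' (rho z) * qform z else 0)" for z
  have dv: "set_integrable lborel (ball 0 1) dv" "(LINT z:ball 0 1|lborel. dv z) = 0"
    unfolding dv_def by (rule cutoff_identity; use \<phi> in blast)+
  define f where "f z = dv z + 2 * M0 * edens z" for z
  have i2: "set_integrable lborel (ball 0 1) (\<lambda>z. 2 * M0 * edens z)" using edens_integrable by simp
  have fint: "set_integrable lborel (ball 0 1) f" unfolding f_def by (rule set_integral_add(1)[OF dv(1) i2])
  have fsum: "(LINT z:ball 0 1|lborel. f z) = 2 * M0 * area A w"
    unfolding f_def set_integral_add(2)[OF dv(1) i2] dv(2) area_edens by simp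
  have low: "f z \<ge> (\<phi> (rho z) + \<phi>' (rho z) * (rho z * (1 + 6 * \<kappa> * sqrt (rho z))) + 2 * M0) * edens z"
    if z: "z \<in> ball 0 1" "inB z" for z
  proof -
    have "qform z \<le> rho z * (1 + 6 * \<kappa> * sqrt (rho z)) * edens z" using qform_bound[OF z] by simp
    moreover have "\<phi>' (rho z) \<le> 0" using \<phi>(3) rho_nonneg by blast
    ultimately have "\<phi>' (rho z) * (rho z * (1 + 6 * \<kappa> * sqrt (rho z)) * edens z) \<le> \<phi>' (rho z) * qform z"
      by (intro mult_left_mono_neg)
    then show ?thesis using z(2) by (simp add: f_def dv_def algebra_simps)
  qed
  have nn: "f z \<ge> 0" if z: "z \<in> ball 0 1" for z
  proof (cases "inB z")
    case True
    have "0 \<le> \<phi> (rho z) + \<phi>' (rho z) * (rho z * (1 + 6 * \<kappa> * sqrt (rho z))) + 2 * M0"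
      using \<phi>(5)[rule_format, OF rho_nonneg[of z]] by simp
    then have "0 \<le> (\<phi> (rho z) + \<phi>' (rho z) * (rho z * (1 + 6 * \<kappa> * sqrt (rho z))) + 2 * M0) * edens z"
      using energy_density(2)[OF z] by (rule mult_nonneg_nonneg)
    then show ?thesis using low[OF z True] by simp
  next
    case False
    then show ?thesis using energy_density(2)[OF z] M0 by (simp add: f_def dv_def)
  qed
  \<comment> \<open>The centre is moved towards the origin, so that \<open>B\<close> lies in the
    open disc even if \<open>\<zeta>0\<close> is on the circle, and still within
    \<open>\<rho>\<close> of \<open>\<zeta>0\<close>.\<close>
  define B where "B = ball ((1 - \<rho>/2) *\<^sub>R \<zeta>0) (\<rho>/2)"
  have Bsub: "z \<in> ball 0 1 \<and> norm (z - \<zeta>0) < \<rho>" if z: "z \<in> B" for z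
  proof -
    have nz: "norm (z - (1 - \<rho>/2) *\<^sub>R \<zeta>0) < \<rho>/2" using z by (simp add: B_def dist_norm norm_minus_commute)
    have n0: "norm \<zeta>0 \<le> 1" using \<zeta>0(2) by simp
    have "norm ((1 - \<rho>/2) *\<^sub>R \<zeta>0) \<le> (1 - \<rho>/2) * 1" using \<rho> n0 by (simp add: mult_left_le)
    moreover have "norm z \<le> norm (z - (1 - \<rho>/2) *\<^sub>R \<zeta>0) + norm ((1 - \<rho>/2) *\<^sub>R \<zeta>0)"
      using norm_triangle_ineq[of "z - (1 - \<rho>/2) *\<^sub>R \<zeta>0" "(1 - \<rho>/2) *\<^sub>R \<zeta>0"] by simp
    moreover have "z - \<zeta>0 = (z - (1 - \<rho>/2) *\<^sub>R \<zeta>0) + (- (\<rho>/2)) *\<^sub>R \<zeta>0" by (simp add: algebra_simps)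
    then have "norm (z - \<zeta>0) \<le> norm (z - (1 - \<rho>/2) *\<^sub>R \<zeta>0) + norm ((- (\<rho>/2)) *\<^sub>R \<zeta>0)" by (metis norm_triangle_ineq)
    moreover have "norm ((- (\<rho>/2)) *\<^sub>R \<zeta>0) \<le> \<rho>/2 * 1" using \<rho> n0 by (simp add: mult_left_le)
    ultimately show ?thesis using nz by simp
  qed
  have fB: "f z \<ge> 3 / (16 * \<epsilon>) * (e0 / 2)" if z: "z \<in> B" for z
  proof -
    have zb: "z \<in> ball 0 1" "z \<in> cball 0 1" and n: "norm (z - \<zeta>0) < \<rho>" using Bsub[OF z] by auto
    have zU: "z \<in> U" using d2(2) n \<rho>(4) by (auto simp: dist_norm norm_minus_commute)
    define x where "x = W z - W \<zeta>0 - DW (z - \<zeta>0)"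
    have nx: "norm x \<le> \<eta> * norm (z - \<zeta>0)" unfolding x_def by (rule d1(2)) (use n \<rho>(3) in simp)
    have "G x x \<le> norm x * norm x * Mc" using Mc(2)[of x x] by (simp add: G_j)
    also have "\<dots> \<le> (\<eta> * norm (z - \<zeta>0)) * (\<eta> * norm (z - \<zeta>0)) * Mc"
      using nx Mc(1) \<eta>(1) by (intro mult_right_mono mult_mono) auto
    finally have Gx: "G x x \<le> (norm (z - \<zeta>0))\<^sup>2 * (Mc * \<eta>\<^sup>2)" by (simp add: power2_eq_square algebra_simps)
    have "W z - z0 = DW (z - \<zeta>0) + x" by (simp add: x_def W0)
    then have "rho z \<le> 3/2 * G (DW (z - \<zeta>0)) (DW (z - \<zeta>0)) + 3 * G x x"
      using j.G_quadratic_sum[of "DW (z - \<zeta>0)" x] rho cc_rep[OF rep zU zb(2)] by (simp add: G_j)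
    also have "\<dots> \<le> 3/2 * ((norm (z - \<zeta>0))\<^sup>2 * e0) + (norm (z - \<zeta>0))\<^sup>2 * (3 * (Mc * \<eta>\<^sup>2))"
      using Gx by (simp add: GDW)
    also have "\<dots> = 2 * e0 * (norm (z - \<zeta>0))\<^sup>2" unfolding \<eta>(2) by (simp add: algebra_simps)
    also have "\<dots> \<le> \<epsilon>" unfolding \<epsilon>_def using n e0 by (intro mult_left_mono power_mono) auto
    finally have re: "rho z \<le> \<epsilon>" .
    have iB: "inB z" using re \<epsilon>'(2) r(3)[OF zU zb(2)] by (simp add: inB)
    have zD: "z \<in> disc_V" using BV[OF zb(2) iB] zb(1) by (simp add: disc_V_def)
    have "dist (sform (W1 z) (W2 z)) e0 < e0 / 2" by (rule d3(2)) (use n \<rho>(5) in \<open>simp add: dist_norm\<close>)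
    then have "edens z \<ge> e0 / 2" unfolding edens_rep[OF c rep zU zD] dist_real_def by linarith
    moreover have "\<phi> (rho z) + \<phi>' (rho z) * (rho z * (1 + 6 * \<kappa> * sqrt (rho z))) + 2 * M0 \<ge> 3 / (16 * \<epsilon>)"
      using \<phi>(6)[rule_format, OF rho_nonneg re] by simp
    ultimately have "3 / (16 * \<epsilon>) * (e0 / 2) \<le> (\<phi> (rho z) + \<phi>' (rho z) * (rho z * (1 + 6 * \<kappa> * sqrt (rho z))) + 2 * M0) * edens z"
      using \<epsilon> e0 by (intro mult_mono') auto
    then show ?thesis using low[OF zb(1) iB] by simp
  qed
  have a1: "(3 / (16 * \<epsilon>) * (e0 / 2)) * measure lborel B \<le> 2 * M0 * area A w"
    unfolding fsum[symmetric]
    by (rule set_integral_lower_bound[OF fint nn _ _ _ fB]) (use Bsub in \<open>auto simp: B_def\<close>)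
  have a2: "measure lborel B = unit_ball_vol 2 * (\<rho>/2)\<^sup>2"
    using \<rho>(1) by (simp add: B_def content_ball)
  have a3: "(3 / (16 * \<epsilon>) * (e0 / 2)) * (unit_ball_vol 2 * (\<rho>/2)\<^sup>2) = 3 * unit_ball_vol 2 / 256"
    unfolding \<epsilon>_def using e0 \<rho>(1) by (simp add: field_simps power2_eq_square)
  have "2 * M0 * area A w = 2 * (area A w * M0)" by simp
  then have "3 * unit_ball_vol 2 / 512 \<le> area A w * M0" using a1[unfolded a2 a3] by linarith
  then show ?thesis unfolding M0_def[symmetric] using M0 by (simp only: pos_divide_le_eq)
qed

end

end

section \<open>Uniform constants\<close>

lemma C1_lipschitz:
  fixes f :: "'a::euclidean_space \<Rightarrow> 'b::euclidean_space"
  assumes S: "open S" and f: "Ck_on (Suc 0) S f" and K: "compact K" "convex K" "K \<subseteq> S"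
  shows "\<exists>L\<ge>0. \<forall>x\<in>K. \<forall>y\<in>K. norm (f x - f y) \<le> L * norm (x - y)"
proof -
  have D: "(f has_derivative frechet_derivative f (at x)) (at x)" if "x \<in> K" for x
  proof -
    have "f differentiable_on S" using f by simp
    then have "f differentiable (at x)" using differentiable_on_eq_differentiable_at[OF S] that K(3) by blast
    then show ?thesis by (simp add: frechet_derivative_works[symmetric])
  qed
  have "\<exists>B. \<forall>x\<in>K. norm (frechet_derivative f (at x) i) \<le> B" for i
  proof -
    have "continuous_on S (\<lambda>x. frechet_derivative f (at x) i)" using f unfolding Ck_on.simps by blast
    then have "continuous_on K (\<lambda>x. frechet_derivative f (at x) i)" by (rule continuous_on_subset[OF _ K(3)])
    then have "compact ((\<lambda>x. frechet_derivative f (at x) i) ` K)" using K(1) by (rule compact_continuous_image)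
    from compact_imp_bounded[OF this] show ?thesis by (auto simp: bounded_iff)
  qed
  then obtain B where B: "\<And>i x. x \<in> K \<Longrightarrow> norm (frechet_derivative f (at x) i) \<le> B i" by metis
  define L where "L = (\<Sum>i\<in>Basis. \<bar>B i\<bar>)"
  have L: "L \<ge> 0" by (simp add: L_def sum_nonneg)
  have on: "onorm (frechet_derivative f (at x)) \<le> L" if x: "x \<in> K" for x
  proof (rule onorm_bound[OF L])
    fix h :: 'a
    have "frechet_derivative f (at x) h = (\<Sum>b\<in>Basis. (h \<bullet> b) *\<^sub>R frechet_derivative f (at x) b)"
      by (rule linear_Basis_expand[OF has_derivative_linear[OF D[OF x]]])
    also have "norm \<dots> \<le> (\<Sum>b\<in>Basis. norm h * \<bar>B b\<bar>)"
    proof (rule sum_norm_le)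
      fix b :: 'a assume "b \<in> Basis"
      then show "norm ((h \<bullet> b) *\<^sub>R frechet_derivative f (at x) b) \<le> norm h * \<bar>B b\<bar>"
        unfolding norm_scaleR using Basis_le_norm[of b h] B[OF x, of b] by (intro mult_mono) auto
    qed
    also have "\<dots> = L * norm h" by (simp add: L_def sum_distrib_left mult.commute)
    finally show "norm (frechet_derivative f (at x) h) \<le> L * norm h" .
  qed
  have "norm (f x - f y) \<le> L * norm (x - y)" if "x \<in> K" "y \<in> K" for x y
    by (rule differentiable_bound[OF K(2) has_derivative_at_withinI[OF D] on that])
  then show ?thesis using L by blast
qed

context tame_setup begin

lemma J_lipschitz:
  assumes c: "c \<in> A" and K: "compact K" "convex K" "K \<subseteq> cimg c \<times> UNIV"
  shows "\<exists>L\<ge>0. \<forall>x\<in>K. \<forall>y\<in>K. \<forall>u. norm (J (cot_chart A c) x u - J (cot_chart A c) y u) \<le> L * norm (x - y) * norm u"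
proof -
  let ?J = "J (cot_chart A c)"
  have S: "open (cimg c \<times> (UNIV :: 'e set))" by (intro open_Times open_cimg c open_UNIV)
  have "\<exists>L\<ge>0. \<forall>x\<in>K. \<forall>y\<in>K. norm (?J x b - ?J y b) \<le> L * norm (x - y)" for b
    by (rule C1_lipschitz[OF S smooth_on_open_Ck[OF S smooth_J[OF c]] K])
  then obtain L where L: "\<And>b. L b \<ge> 0" "\<And>b x y. x \<in> K \<Longrightarrow> y \<in> K \<Longrightarrow> norm (?J x b - ?J y b) \<le> L b * norm (x - y)" by metis
  define L' where "L' = sum L Basis"
  have "norm (?J x u - ?J y u) \<le> L' * norm (x - y) * norm u" if xy: "x \<in> K" "y \<in> K" for x y u
  proof -
    have xy': "x \<in> cimg c \<times> UNIV" "y \<in> cimg c \<times> UNIV" using xy K(3) by blast+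
    have "?J x u - ?J y u = (\<Sum>b\<in>Basis. (u \<bullet> b) *\<^sub>R (?J x b - ?J y b))"
      using linear_Basis_expand[OF linear_J[OF c xy'(1)], of u] linear_Basis_expand[OF linear_J[OF c xy'(2)], of u]
      by (simp add: scaleR_diff_right sum_subtractf)
    also have "norm \<dots> \<le> (\<Sum>b\<in>Basis. norm u * (L b * norm (x - y)))"
    proof (rule sum_norm_le)
      fix b :: "'e \<times> 'e" assume "b \<in> Basis"
      then show "norm ((u \<bullet> b) *\<^sub>R (?J x b - ?J y b)) \<le> norm u * (L b * norm (x - y))"
        unfolding norm_scaleR using Basis_le_norm[of b u] L(2)[OF xy, of b] by (intro mult_mono) auto
    qed
    also have "\<dots> = L' * norm (x - y) * norm u" by (simp add: L'_def sum_distrib_left sum_distrib_right mult.commute mult.left_commute)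
    finally show ?thesis .
  qed
  moreover have "L' \<ge> 0" by (simp add: L'_def sum_nonneg L)
  ultimately show ?thesis by blast
qed

lemma metric_bounds:
  assumes c: "c \<in> A" and K: "compact K" "K \<subseteq> cimg c \<times> UNIV"
  shows "\<exists>m B. 0 < m \<and> 0 < B \<and> (\<forall>z\<in>K. \<forall>u. m * (norm u)\<^sup>2 \<le> sform u (J (cot_chart A c) z u) \<and> sform u (J (cot_chart A c) z u) \<le> B * (norm u)\<^sup>2)"
proof (cases "K = {}")
  case True then show ?thesis by (intro exI[of _ 1]) auto
next
  case False
  let ?S = "K \<times> sphere (0::'e \<times> 'e) 1" and ?f = "\<lambda>x. sform (snd x) (J (cot_chart A c) (fst x) (snd x))"
  have cont: "continuous_on ?S ?f"
    by (intro bounded_bilinear.continuous_on[OF bounded_bilinear_sform] continuous_J[OF c] continuous_intros) (use K in auto)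
  have cpt: "compact ?S" using K by (intro compact_Times) auto
  obtain b :: "'e \<times> 'e" where "b \<in> Basis" using nonempty_Basis by blast
  then have ne: "?S \<noteq> {}" using False by (auto intro!: exI[of _ b])
  obtain x1 where x1: "x1 \<in> ?S" "\<forall>x\<in>?S. ?f x1 \<le> ?f x" using continuous_attains_inf[OF cpt ne cont] by blast
  obtain x2 where x2: "x2 \<in> ?S" "\<forall>x\<in>?S. ?f x \<le> ?f x2" using continuous_attains_sup[OF cpt ne cont] by blast
  have pos: "?f x > 0" if "x \<in> ?S" for x
  proof -
    have x: "fst x \<in> cimg c \<times> UNIV" "snd x \<noteq> 0" using that K(2) by auto
    show ?thesis by (rule compatible_structure.tame_J0[OF compatible[OF c x(1)] x(2)])
  qed
  have "?f x1 * (norm u)\<^sup>2 \<le> sform u (J (cot_chart A c) z u) \<and> sform u (J (cot_chart A c) z u) \<le> ?f x2 * (norm u)\<^sup>2"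
    if z: "z \<in> K" for z u
  proof (cases "u = 0")
    case False
    define v where "v = u /\<^sub>R norm u"
    have v: "(z, v) \<in> ?S" using z False by (simp add: v_def)
    have "u = norm u *\<^sub>R v" using False by (simp add: v_def)
    then have "sform u (J (cot_chart A c) z u) = sform (norm u *\<^sub>R v) (J (cot_chart A c) z (norm u *\<^sub>R v))" by simp
    also have "\<dots> = (norm u)\<^sup>2 * sform v (J (cot_chart A c) z v)"
    proof -
      have "z \<in> cimg c \<times> UNIV" using z K(2) by blast
      from linear_cmul[OF linear_J[OF c this]] show ?thesis by (simp add: sform_linear power2_eq_square)
    qed
    finally have e: "sform u (J (cot_chart A c) z u) = (norm u)\<^sup>2 * sform v (J (cot_chart A c) z v)" .
    show ?thesis unfolding e using bspec[OF x1(2) v] bspec[OF x2(2) v]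
      by (simp add: mult.commute mult_left_mono)
  qed (simp add: sform_linear)
  then show ?thesis using pos[OF x1(1)] pos[OF x2(1)] by (intro exI[of _ "?f x1"] exI[of _ "?f x2"]) blast
qed

text \<open>\<open>uniform_nbhd r d s U\<close>: at every point over \<open>U\<close> with energy at most \<open>r\<close> the monotonicity
  estimate applies, in a ball on which the energy varies by less than \<open>d\<close>, and yields area at least \<open>s\<close>.\<close>

definition uniform_nbhd :: "real \<Rightarrow> real \<Rightarrow> real \<Rightarrow> 'n set \<Rightarrow> bool" where
  "uniform_nbhd r d s U \<longleftrightarrow> (\<exists>c\<in>A. U \<subseteq> cdom c \<and>
    (\<forall>x0\<in>cotangent A. fst x0 \<in> U \<and> fibre_energy x0 \<le> r \<longrightarrow>
      (\<exists>\<kappa> R K0 G. \<kappa> \<ge> 0 \<and> R > 0 \<and> \<kappa> * sqrt R \<le> 1/2 \<and> s \<le> 3 * unit_ball_vol 2 / 512 / (1 / sqrt R + 6 * \<kappa>)\<^sup>2 \<and>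
        compact K0 \<and> K0 \<subseteq> cimg c \<and> G = compatible_structure.G (J (cot_chart A c) (coord (cot_chart A c) x0)) \<and>
        (\<forall>z. G (z - coord (cot_chart A c) x0) (z - coord (cot_chart A c) x0) \<le> R \<longrightarrow>
          fst z \<in> K0 \<and> \<bar>local_metric.kin (g c) z - fibre_energy x0\<bar> < d \<and>
          (\<forall>a. G (J (cot_chart A c) z a - J (cot_chart A c) (coord (cot_chart A c) x0) a)
                 (J (cot_chart A c) z a - J (cot_chart A c) (coord (cot_chart A c) x0) a)
             \<le> \<kappa>\<^sup>2 * G (z - coord (cot_chart A c) x0) (z - coord (cot_chart A c) x0) * G a a)))))"

lemma uniform_nbhd_mono: "uniform_nbhd r d s U \<Longrightarrow> s' \<le> s \<Longrightarrow> uniform_nbhd r d s' U"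
  unfolding uniform_nbhd_def
  by (elim bexE conjE, rule_tac x = c in bexI, intro conjI ballI impI, assumption, drule (1) bspec,
      drule (1) mp, elim exE conjE, intro exI conjI) (assumption | erule (1) order_trans)+

lemma uniform_nbhd_exists:
  assumes d: "d > 0" and q: "q \<in> carrier A"
  shows "\<exists>U s. openin (mtop A) U \<and> q \<in> U \<and> s > 0 \<and> uniform_nbhd r d s U"
proof -
  obtain c where c: "c \<in> A" "q \<in> cdom c" using q by (auto simp: carrier_def)
  let ?C = "cot_chart A c" let ?J = "J (cot_chart A c)"
  interpret m: local_metric "cimg c" "g c" by (rule local_metric[OF c(1)])
  have yq: "coord c q \<in> cimg c" using c by auto
  obtain e m1 M1 where e: "e > 0" "M1 > 0" "cball (coord c q) e \<subseteq> cimg c"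
    and M1: "\<forall>y\<in>cball (coord c q) e. \<forall>u. m1 * (u \<bullet> u) \<le> g c y u u \<and> g c y u u \<le> M1 * (u \<bullet> u)"
    using m.local_bounds[OF yq] by blast
  \<comment> \<open>By \<open>kin_lower\<close>, momenta of energy at most \<open>r\<close> over the
    ball have norm at most \<open>P\<close>; the extra 1 in \<open>K\<close> leaves room for the
    coordinate ball around such a point.\<close>
  define P where "P = sqrt (2 * M1 * r)"
  define K where "K = cball (coord c q) e \<times> cball (0::'e) (P + 1)"
  have K: "compact K" "convex K" "K \<subseteq> cimg c \<times> UNIV"
    using e(3) by (auto simp: K_def intro!: compact_Times convex_Times)
  obtain L where L: "L \<ge> 0" "\<And>x y u. x \<in> K \<Longrightarrow> y \<in> K \<Longrightarrow> norm (?J x u - ?J y u) \<le> L * norm (x - y) * norm u"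
    using J_lipschitz[OF c(1) K] by blast
  obtain m B where mB: "m > 0" "B > 0" "\<And>z u. z \<in> K \<Longrightarrow> m * (norm u)\<^sup>2 \<le> sform u (?J z u)"
    "\<And>z u. z \<in> K \<Longrightarrow> sform u (?J z u) \<le> B * (norm u)\<^sup>2"
    using metric_bounds[OF c(1) K(1,3)] by blast
  have "uniformly_continuous_on K m.kin"
    by (rule compact_uniformly_continuous[OF continuous_on_subset[OF continuous_kin[OF c(1)] K(3)] K(1)])
  from this[unfolded uniformly_continuous_on_def, rule_format, OF d]
  obtain \<eta> where \<eta>: "\<eta> > 0" "\<And>z z'. z \<in> K \<Longrightarrow> z' \<in> K \<Longrightarrow> dist z' z < \<eta> \<Longrightarrow> dist (m.kin z') (m.kin z) < d"
    by blast
  \<comment> \<open>Passing between \<open>G\<close> and the Euclidean norm costs the upper constant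
    \<open>B\<close> once and the lower constant \<open>m\<close> twice: the square of
    \<open>\<kappa>\<close> is \<open>B * L\<^sup>2 / m\<^sup>2\<close>.\<close>
  define \<kappa> where "\<kappa> = sqrt B * L / m"
  have \<kappa>: "\<kappa> \<ge> 0" using mB L(1) by (simp add: \<kappa>_def)
  \<comment> \<open>A Euclidean radius. The four bounds keep the ball in the chart, its momenta
    below \<open>P + 1\<close>, the variation of the energy below \<open>d\<close>, and
    \<open>\<kappa> * sqrt R\<close> at most 1/2. With \<open>R = m * s\<^sup>2\<close> the
    \<open>G\<close>-ball of squared radius \<open>R\<close> lies in the Euclidean ball of radius
    \<open>s\<close>.\<close>
  define s where "s = min (min (e/2) (1/2)) (min (\<eta>/2) (1 / (2 * (\<kappa> * sqrt m + 1))))"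
  have ks: "\<kappa> * sqrt m + 1 > 0" using \<kappa> mB(1) by (simp add: add_nonneg_pos)
  have s: "s > 0" "s \<le> e/2" "s \<le> 1/2" "s \<le> \<eta>/2" "s \<le> 1 / (2 * (\<kappa> * sqrt m + 1))"
    using e(1) \<eta>(1) ks by (auto simp: s_def)
  define R where "R = m * s\<^sup>2"
  have R: "R > 0" using mB(1) s(1) by (simp add: R_def)
  have sqR: "sqrt R = sqrt m * s" using s(1) by (simp add: R_def real_sqrt_mult)
  have \<kappa>R: "\<kappa> * sqrt R \<le> 1/2"
  proof -
    have "(\<kappa> * sqrt m) * s \<le> (\<kappa> * sqrt m + 1) * (1 / (2 * (\<kappa> * sqrt m + 1)))"
      using s ks \<kappa> mB(1) by (intro mult_mono) auto
    also have "\<dots> = 1/2" using ks by simp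
    finally show ?thesis by (simp add: sqR mult.assoc)
  qed
  define U where "U = {q' \<in> cdom c. coord c q' \<in> ball (coord c q) (e/2)}"
  have U: "openin (mtop A) U" "q \<in> U" "U \<subseteq> cdom c"
  proof -
    show "openin (mtop A) U" unfolding U_def by (rule openin_chart[OF c(1) open_ball])
  qed (use c e(1) in \<open>auto simp: U_def\<close>)
  define t where "t = 3 * unit_ball_vol 2 / 512 / (1 / sqrt R + 6 * \<kappa>)\<^sup>2"
  have "1 / sqrt R + 6 * \<kappa> > 0" using R \<kappa> by (intro add_pos_nonneg) auto
  then have t: "t > 0" by (simp add: t_def)
  have main: "\<exists>G. G = compatible_structure.G (?J (coord ?C x0)) \<and>
        (\<forall>z. G (z - coord ?C x0) (z - coord ?C x0) \<le> R \<longrightarrow>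
          fst z \<in> cball (coord c q) e \<and> \<bar>m.kin z - fibre_energy x0\<bar> < d \<and>
          (\<forall>a. G (?J z a - ?J (coord ?C x0) a) (?J z a - ?J (coord ?C x0) a)
             \<le> \<kappa>\<^sup>2 * G (z - coord ?C x0) (z - coord ?C x0) * G a a))"
    if x0: "x0 \<in> cotangent A" "fst x0 \<in> U" "fibre_energy x0 \<le> r" for x0
  proof -
    define z0 where "z0 = coord ?C x0"
    have z0': "z0 = (coord c (fst x0), snd x0 c)" by (simp add: z0_def)
    have xc: "fst x0 \<in> cdom c" using x0(2) U(3) by auto
    have y0: "dist (coord c q) (fst z0) < e/2" using x0(2) by (simp add: U_def z0')
    have Fz: "fibre_energy x0 = m.kin z0" unfolding z0_def by (rule fibre_energy_chart[OF x0(1) c(1) xc])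
    have "snd z0 \<bullet> snd z0 \<le> 2 * M1 * m.kin z0"
      by (rule m.kin_lower) (use e M1 y0 in auto)
    also have "\<dots> \<le> 2 * M1 * r" using x0(3) e(2) by (simp add: Fz)
    finally have "(norm (snd z0))\<^sup>2 \<le> 2 * M1 * r" by (simp add: power2_norm_eq_inner)
    then have p0: "norm (snd z0) \<le> P" unfolding P_def by (rule real_le_rsqrt)
    have z0K: "z0 \<in> K" using y0 p0 e(1) by (simp add: K_def mem_Times_iff)
    have z0c: "z0 \<in> cimg c \<times> UNIV" using z0K K(3) by auto
    interpret j: compatible_structure "?J z0" by (rule compatible[OF c(1) z0c])
    have jm: "m * (norm u)\<^sup>2 \<le> j.G u u" "j.G u u \<le> B * (norm u)\<^sup>2" for u
      using mB(3,4)[OF z0K, of u] by (simp_all add: j.G_def)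
    have "fst z \<in> cball (coord c q) e \<and> \<bar>m.kin z - fibre_energy x0\<bar> < d \<and>
      (\<forall>a. j.G (?J z a - ?J z0 a) (?J z a - ?J z0 a) \<le> \<kappa>\<^sup>2 * j.G (z - z0) (z - z0) * j.G a a)"
      if z: "j.G (z - z0) (z - z0) \<le> R" for z
    proof -
      have "m * (norm (z - z0))\<^sup>2 \<le> m * s\<^sup>2" using jm(1)[of "z - z0"] z by (simp add: R_def)
      then have "(norm (z - z0))\<^sup>2 \<le> s\<^sup>2" using mB(1) by simp
      then have nz: "norm (z - z0) \<le> s" by (rule power2_le_imp_le) (use s in simp)
      have nf: "norm (fst z - fst z0) \<le> s" "norm (snd z - snd z0) \<le> s"
        using nz norm_fst_le[of "fst (z - z0)" "snd (z - z0)"] norm_snd_le[of "snd (z - z0)" "fst (z - z0)"]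
        unfolding prod.collapse by (simp_all add: fst_diff[symmetric] snd_diff[symmetric] del: fst_diff snd_diff)
      have 1: "fst z \<in> cball (coord c q) e"
        using y0 nf(1) s(2) dist_triangle[of "coord c q" "fst z" "fst z0"] by (simp add: dist_norm norm_minus_commute)
      have "norm (snd z) \<le> P + 1"
        using nf(2) p0 s(3) norm_triangle_ineq[of "snd z - snd z0" "snd z0"] by simp
      then have zK: "z \<in> K" using 1 by (simp add: K_def mem_Times_iff)
      have 2: "\<bar>m.kin z - fibre_energy x0\<bar> < d"
        using \<eta>(2)[OF z0K zK] nz s(1,4) \<eta>(1) by (simp add: Fz dist_norm dist_real_def)
      have 3: "j.G (?J z a - ?J z0 a) (?J z a - ?J z0 a) \<le> \<kappa>\<^sup>2 * j.G (z - z0) (z - z0) * j.G a a" for a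
      proof -
        have "j.G (?J z a - ?J z0 a) (?J z a - ?J z0 a) \<le> B * (norm (?J z a - ?J z0 a))\<^sup>2" by (rule jm(2))
        also have "\<dots> \<le> B * (L * norm (z - z0) * norm a)\<^sup>2"
          using L(2)[OF zK z0K, of a] mB(2) by (intro mult_left_mono power_mono) auto
        also have "\<dots> = \<kappa>\<^sup>2 * (m * (norm (z - z0))\<^sup>2) * (m * (norm a)\<^sup>2)"
          using mB(1,2) by (simp add: \<kappa>_def power_mult_distrib power_divide) (simp add: power2_eq_square)
        also have "\<dots> \<le> \<kappa>\<^sup>2 * j.G (z - z0) (z - z0) * j.G a a"
          using jm(1)[of "z - z0"] jm(1)[of a] mB(1) j.G_nonneg[of "z - z0"] by (intro mult_mono mult_left_mono) auto
        finally show ?thesis .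
      qed
      show ?thesis using 1 2 3 by blast
    qed
    then show ?thesis unfolding z0_def[symmetric] by blast
  qed
  show ?thesis
  proof (intro exI conjI)
    show "openin (mtop A) U" "q \<in> U" "t > 0" by (rule U t)+
    show "uniform_nbhd r d t U"
      unfolding uniform_nbhd_def
    proof (intro bexI[OF _ c(1)] conjI ballI impI U(3))
      fix x0 assume x0: "x0 \<in> cotangent A" and fx: "fst x0 \<in> U \<and> fibre_energy x0 \<le> r"
      obtain G where "G = compatible_structure.G (?J (coord ?C x0))"
        "\<forall>z. G (z - coord ?C x0) (z - coord ?C x0) \<le> R \<longrightarrow>
          fst z \<in> cball (coord c q) e \<and> \<bar>m.kin z - fibre_energy x0\<bar> < d \<and>
          (\<forall>a. G (?J z a - ?J (coord ?C x0) a) (?J z a - ?J (coord ?C x0) a)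
             \<le> \<kappa>\<^sup>2 * G (z - coord ?C x0) (z - coord ?C x0) * G a a)"
        using main[OF x0] fx by blast
      then show "\<exists>\<kappa> R K0 G. \<kappa> \<ge> 0 \<and> R > 0 \<and> \<kappa> * sqrt R \<le> 1/2 \<and> t \<le> 3 * unit_ball_vol 2 / 512 / (1 / sqrt R + 6 * \<kappa>)\<^sup>2 \<and>
        compact K0 \<and> K0 \<subseteq> cimg c \<and> G = compatible_structure.G (J (cot_chart A c) (coord (cot_chart A c) x0)) \<and>
        (\<forall>z. G (z - coord (cot_chart A c) x0) (z - coord (cot_chart A c) x0) \<le> R \<longrightarrow>
          fst z \<in> K0 \<and> \<bar>local_metric.kin (g c) z - fibre_energy x0\<bar> < d \<and>
          (\<forall>a. G (J (cot_chart A c) z a - J (cot_chart A c) (coord (cot_chart A c) x0) a)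
                 (J (cot_chart A c) z a - J (cot_chart A c) (coord (cot_chart A c) x0) a)
             \<le> \<kappa>\<^sup>2 * G (z - coord (cot_chart A c) x0) (z - coord (cot_chart A c) x0) * G a a))"
        by (intro exI[of _ \<kappa>] exI[of _ R] exI[of _ "cball (coord c q) e"] exI[of _ G] conjI \<kappa> R \<kappa>R e(3) compact_cball)
          (simp_all only: t_def order_refl)
    qed
  qed
qed

end

section \<open>Energy and distance to the zero section\<close>

lemma Ck_on_const: "Ck_on k S (\<lambda>_. c)"
  by (induction k arbitrary: c) auto

lemma Ck_on_affine: "Ck_on k UNIV (\<lambda>s::real. a + s *\<^sub>R b)"
proof (cases k)
  case 0
  then show ?thesis by (auto intro!: continuous_intros)
next
  case (Suc j)
  have "((\<lambda>s::real. a + s *\<^sub>R b) has_derivative (\<lambda>h. h *\<^sub>R b)) (at x)" for x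
    by (auto intro!: derivative_eq_intros)
  from frechet_derivative_at[OF this, symmetric] differentiableI[OF this]
  show ?thesis using Suc by (simp add: Ck_on_const differentiable_on_def)
qed

lemma vector_derivative_within_unit:
  assumes "(f has_vector_derivative f') (at s within {0..1})" "s \<in> {0..1::real}"
  shows "vector_derivative f (at s within {0..1}) = f'"
  using vector_derivative_within_cbox[of 0 1 s f f'] assms by (simp add: cbox_interval)

context tame_setup begin

lemma dkin_eq:
  assumes c: "c \<in> A" and x: "x \<in> V" "x \<in> cotangent A" "fst x \<in> cdom c"
  shows "local_metric.dkin (g c) (coord (cot_chart A c) x) u
    = - (snd x c \<bullet> fst (J (cot_chart A c) (coord (cot_chart A c) x) u))"
proof -
  interpret m: local_metric "cimg c" "g c" by (rule local_metric[OF c])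
  have z: "coord (cot_chart A c) x \<in> cimg c \<times> UNIV" using x(3) by auto
  interpret j: compatible_structure "J (cot_chart A c) (coord (cot_chart A c) x)" by (rule compatible[OF c z])
  have "fst (coord (cot_chart A c) x) \<in> cimg c" using x(3) by auto
  from linear_neg[OF m.dkin_linear[OF this], of u]
  show ?thesis using dkin_J[OF c x, of "J (cot_chart A c) (coord (cot_chart A c) x) u"] j.J0_J0[of u] by simp
qed

lemma vertical_energy:
  assumes c: "c \<in> A" and x: "x \<in> V" "x \<in> cotangent A" "fst x \<in> cdom c"
  shows "sform (0, snd x c) (J (cot_chart A c) (coord (cot_chart A c) x) (0, snd x c)) = 2 * fibre_energy x"
proof -
  interpret m: local_metric "cimg c" "g c" by (rule local_metric[OF c])
  have "fst (coord (cot_chart A c) x) \<in> cimg c" using x(3) by auto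
  from m.dkin_vertical[OF this] dkin_eq[OF c x, of "(0, snd x c)"] fibre_energy_chart[OF x(2) c x(3)]
  show ?thesis by (simp add: sform_def inner_commute)
qed

text \<open>The gradient of the energy is the vertical vector given by the momentum, of length
  \<open>sqrt (2 * fibre_energy x)\<close>. Cauchy-Schwarz thus bounds the slope of
  \<open>sqrt (2 * fibre_energy x)\<close> by 1 on \<open>V\<close>.\<close>

lemma dkin_bound:
  assumes c: "c \<in> A" and x: "x \<in> V" "x \<in> cotangent A" "fst x \<in> cdom c"
  shows "\<bar>local_metric.dkin (g c) (coord (cot_chart A c) x) u\<bar>
    \<le> sqrt (2 * fibre_energy x) * sqrt (sform u (J (cot_chart A c) (coord (cot_chart A c) x) u))"
proof -
  have z: "coord (cot_chart A c) x \<in> cimg c \<times> UNIV" using x(3) by auto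
  interpret j: compatible_structure "J (cot_chart A c) (coord (cot_chart A c) x)" by (rule compatible[OF c z])
  have dk: "local_metric.dkin (g c) (coord (cot_chart A c) x) u = j.G (0, snd x c) u"
    unfolding dkin_eq[OF assms] j.G_def by (simp add: sform_def inner_commute)
  have "(local_metric.dkin (g c) (coord (cot_chart A c) x) u)\<^sup>2 \<le> 2 * fibre_energy x * sform u (J (cot_chart A c) (coord (cot_chart A c) x) u)"
    using j.G_Cauchy_Schwarz[of "(0, snd x c)" u] unfolding dk j.G_def vertical_energy[OF assms] .
  then have "sqrt ((local_metric.dkin (g c) (coord (cot_chart A c) x) u)\<^sup>2) \<le> sqrt (2 * fibre_energy x * sform u (J (cot_chart A c) (coord (cot_chart A c) x) u))"
    by (rule real_sqrt_le_mono)
  then show ?thesis by (simp add: real_sqrt_mult)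
qed

section \<open>Lengths of paths and the energy along them\<close>

lemma path_in_cotangent:
  assumes "smooth_map_into {0..1} (cot_atlas A) \<gamma>" "s \<in> {0..1}"
  shows "\<gamma> s \<in> cotangent A"
proof -
  have "\<gamma> s \<in> topspace (mtop (cot_atlas A))"
    using assms by (auto simp: smooth_map_into_def continuous_map_def)
  then show ?thesis using openin_cot openin_topspace by blast
qed

text \<open>The analogue of \<open>chart_rep\<close> for paths; the extension \<open>W\<close> turns
  the one-sided derivatives at 0 and 1 into ordinary ones.\<close>

lemma path_chart:
  assumes \<gamma>: "smooth_map_into {0..1} (cot_atlas A) \<gamma>" and s: "s \<in> {0..1}" and c: "c \<in> A" "fst (\<gamma> s) \<in> cdom c"
  shows "\<exists>U W. open U \<and> s \<in> U \<and> (\<forall>t\<in>U \<inter> {0..1}. fst (\<gamma> t) \<in> cdom c \<and> coord (cot_chart A c) (\<gamma> t) = W t) \<and>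
    continuous_on U W \<and> continuous_on U (\<lambda>t. frechet_derivative W (at t) 1) \<and>
    (\<forall>t\<in>U. (W has_vector_derivative frechet_derivative W (at t) 1) (at t)) \<and>
    (\<forall>t\<in>U \<inter> {0..1}. vector_derivative (coord (cot_chart A c) \<circ> \<gamma>) (at t within {0..1}) = frechet_derivative W (at t) 1)"
proof -
  let ?C = "cot_chart A c"
  have sm: "smooth_on {t \<in> {0..1}. \<gamma> t \<in> cdom ?C} (coord ?C \<circ> \<gamma>)"
    using \<gamma> cot_atlasI[OF c(1)] unfolding smooth_map_into_def by blast
  have s': "s \<in> {t \<in> {0..1}. \<gamma> t \<in> cdom ?C}" using s c path_in_cotangent[OF \<gamma> s] by auto
  obtain U0 W where U0: "open U0" "s \<in> U0" "\<forall>k. Ck_on k U0 W"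
    "\<forall>y\<in>U0 \<inter> {t \<in> {0..1}. \<gamma> t \<in> cdom ?C}. W y = (coord ?C \<circ> \<gamma>) y"
    using bspec[OF sm[unfolded smooth_on_def] s'] by (elim exE conjE) (rule that)
  have "openin (top_of_set {0..1}) {t \<in> {0..1}. \<gamma> t \<in> cdom ?C}"
    using \<gamma> openin_cdom_cot[OF c(1)] unfolding smooth_map_into_def continuous_map_def by auto
  then obtain Q where Q: "open Q" "{t \<in> {0..1}. \<gamma> t \<in> cdom ?C} = {0..1} \<inter> Q" unfolding openin_open by blast
  define U where "U = U0 \<inter> Q"
  have U: "open U" "s \<in> U" using U0 Q s' by (auto simp: U_def)
  have WU: "fst (\<gamma> t) \<in> cdom c \<and> coord ?C (\<gamma> t) = W t" if "t \<in> U \<inter> {0..1}" for t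
  proof -
    have t: "t \<in> {t \<in> {0..1}. \<gamma> t \<in> cdom ?C}" using that Q(2) by (auto simp: U_def)
    then have "W t = (coord ?C \<circ> \<gamma>) t" using U0(4) that by (auto simp: U_def simp del: cot_chart_simps)
    then show ?thesis using t by simp
  qed
  have C1: "Ck_on (Suc 0) U0 W" using U0(3) by blast
  then have "W differentiable_on U0" and cd: "continuous_on U0 (\<lambda>t. frechet_derivative W (at t) 1)"
    unfolding Ck_on.simps by blast+
  then have Wd: "W differentiable (at t)" if "t \<in> U" for t
    using differentiable_on_eq_differentiable_at[OF U0(1)] that by (auto simp: U_def)
  have vd: "(W has_vector_derivative frechet_derivative W (at t) 1) (at t)" if "t \<in> U" for t
  proof -
    have D: "(W has_derivative frechet_derivative W (at t)) (at t)"
      using Wd[OF that] by (simp add: frechet_derivative_works[symmetric])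
    have fr: "frechet_derivative W (at t) h = h *\<^sub>R frechet_derivative W (at t) 1" for h
      using linear_cmul[OF has_derivative_linear[OF D], of h 1] by simp
    have "frechet_derivative W (at t) = (\<lambda>h. h *\<^sub>R frechet_derivative W (at t) 1)" by (rule ext) (rule fr)
    then show ?thesis using D unfolding has_vector_derivative_def by simp
  qed
  have "vector_derivative (coord ?C \<circ> \<gamma>) (at t within {0..1}) = frechet_derivative W (at t) 1" if t: "t \<in> U \<inter> {0..1}" for t
  proof -
    obtain e where e: "e > 0" "ball t e \<subseteq> U" using U(1) t open_contains_ball by blast
    have "(W has_vector_derivative frechet_derivative W (at t) 1) (at t within {0..1})"
      using vd t by (auto intro: has_vector_derivative_at_within)
    then have "((coord ?C \<circ> \<gamma>) has_vector_derivative frechet_derivative W (at t) 1) (at t within {0..1})"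
      by (rule has_vector_derivative_transform_within[OF _ e(1)])
        (use t e WU in \<open>auto simp: dist_commute subset_iff simp del: cot_chart_simps\<close>)
    then show ?thesis using vector_derivative_within_cbox[of 0 1 t "coord ?C \<circ> \<gamma>"] t by (simp add: cbox_interval)
  qed
  moreover have "continuous_on U W" using Wd by (auto intro!: continuous_at_imp_continuous_on differentiable_imp_continuous_within)
  moreover have "continuous_on U (\<lambda>t. frechet_derivative W (at t) 1)" by (rule continuous_on_subset[OF cd]) (auto simp: U_def)
  ultimately show ?thesis using U WU vd by (intro exI[of _ U] exI[of _ W]) blast
qed

definition speed :: "(real \<Rightarrow> ('n, 'e) cotpt) \<Rightarrow> real \<Rightarrow> real" where
  "speed \<gamma> s = (let c = chart_at (cot_atlas A) (\<gamma> s); v = vector_derivative (coord c \<circ> \<gamma>) (at s within {0..1})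
     in sqrt (metric_of J c (coord c (\<gamma> s)) v v))"

lemma path_length_speed: "path_length (cot_atlas A) (metric_of J) \<gamma> = (\<integral>\<^sup>+ s. ennreal (speed \<gamma> s) * indicator {0..1} s \<partial>lborel)"
  by (simp add: path_length_def speed_def)

lemma chart_at_cot:
  assumes "x \<in> cotangent A"
  shows "\<exists>c\<in>A. fst x \<in> cdom c \<and> chart_at (cot_atlas A) x = cot_chart A c"
proof -
  obtain c0 where "c0 \<in> A" "fst x \<in> cdom c0" using cotangentD(1)[OF assms] by (auto simp: carrier_def)
  then have "\<exists>C. C \<in> cot_atlas A \<and> x \<in> cdom C"
    using cot_atlasI assms by (intro exI[of _ "cot_chart A c0"]) auto
  then have "chart_at (cot_atlas A) x \<in> cot_atlas A \<and> x \<in> cdom (chart_at (cot_atlas A) x)"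
    unfolding chart_at_def by (rule someI_ex)
  then have C: "chart_at (cot_atlas A) x \<in> cot_chart A ` A" "x \<in> cdom (chart_at (cot_atlas A) x)" by (simp_all add: cot_atlas_def)
  obtain c where c: "c \<in> A" "chart_at (cot_atlas A) x = cot_chart A c" using C(1) by blast
  then have "fst x \<in> cdom c" using C(2) by simp
  then show ?thesis using c by blast
qed

lemma energy_along_path:
  assumes \<gamma>: "smooth_map_into {0..1} (cot_atlas A) \<gamma>" and s: "s \<in> {0..1}" and V: "\<gamma> s \<in> V"
  defines "f' t \<equiv> vector_derivative (\<lambda>t. fibre_energy (\<gamma> t)) (at t within {0..1})"
  shows "((\<lambda>t. fibre_energy (\<gamma> t)) has_vector_derivative f' s) (at s within {0..1})"
    "\<bar>f' s\<bar> \<le> sqrt (2 * fibre_energy (\<gamma> s)) * speed \<gamma> s" "continuous (at s within {0..1}) f'"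
proof -
  have "openin (top_of_set {0..1}) {t \<in> {0..1}. \<gamma> t \<in> V}"
    using \<gamma> V_open unfolding smooth_map_into_def continuous_map_def by auto
  then obtain Q where Q: "open Q" "{t \<in> {0..1}. \<gamma> t \<in> V} = {0..1} \<inter> Q" unfolding openin_open by blast
  obtain c where c: "c \<in> A" "fst (\<gamma> s) \<in> cdom c" "chart_at (cot_atlas A) (\<gamma> s) = cot_chart A c"
    using chart_at_cot[OF path_in_cotangent[OF \<gamma> s]] by blast
  let ?C = "cot_chart A c"
  interpret m: local_metric "cimg c" "g c" by (rule local_metric[OF c(1)])
  obtain U W where U: "open U" "s \<in> U" and WU0: "\<forall>t\<in>U \<inter> {0..1}. fst (\<gamma> t) \<in> cdom c \<and> coord ?C (\<gamma> t) = W t"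
    and cW: "continuous_on U W" "continuous_on U (\<lambda>t. frechet_derivative W (at t) 1)"
    and dW0: "\<forall>t\<in>U. (W has_vector_derivative frechet_derivative W (at t) 1) (at t)"
    and vW0: "\<forall>t\<in>U \<inter> {0..1}. vector_derivative (coord ?C \<circ> \<gamma>) (at t within {0..1}) = frechet_derivative W (at t) 1"
    using path_chart[OF \<gamma> s c(1,2)] by (elim exE conjE) (rule that)
  have WU: "\<And>t. t \<in> U \<inter> {0..1} \<Longrightarrow> fst (\<gamma> t) \<in> cdom c" "\<And>t. t \<in> U \<inter> {0..1} \<Longrightarrow> coord ?C (\<gamma> t) = W t"
    using WU0 by blast+
  note dW = dW0[rule_format] and vW = vW0[rule_format]
  define W' where "W' t = frechet_derivative W (at t) 1" for t
  have Wc: "W t \<in> cimg c \<times> UNIV" if "t \<in> U \<inter> {0..1}" for t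
    using WU(1)[OF that] WU(2)[OF that, symmetric] by simp
  have der: "((\<lambda>t. fibre_energy (\<gamma> t)) has_vector_derivative m.dkin (W t) (W' t)) (at t within {0..1})" if t: "t \<in> U \<inter> {0..1}" for t
  proof -
    obtain e where e: "e > 0" "ball t e \<subseteq> U" using U(1) t open_contains_ball by blast
    have fW: "fst (W t) \<in> cimg c" using Wc[OF t] by (simp add: mem_Times_iff)
    have "(W has_derivative (\<lambda>h. h *\<^sub>R W' t)) (at t within {0..1})"
      using dW t by (auto intro: has_derivative_at_withinI simp: has_vector_derivative_def W'_def)
    from has_derivative_compose[OF this m.has_derivative_kin[OF fW]]
    have "((\<lambda>t. m.kin (W t)) has_vector_derivative m.dkin (W t) (W' t)) (at t within {0..1})"
      by (simp add: has_vector_derivative_def linear_cmul[OF m.dkin_linear[OF fW]])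
    then show ?thesis
    proof (rule has_vector_derivative_transform_within[OF _ e(1)])
      fix t' assume "t' \<in> {0..1}" "dist t' t < e"
      then have t': "t' \<in> U \<inter> {0..1}" using e(2) by (auto simp: dist_commute subset_iff)
      then have "\<gamma> t' \<in> cotangent A" by (intro path_in_cotangent[OF \<gamma>]) auto
      from fibre_energy_chart[OF this c(1) WU(1)[OF t']] show "m.kin (W t') = fibre_energy (\<gamma> t')" by (simp only: WU(2)[OF t'])
    qed (use t in simp)
  qed
  have f'eq: "f' t = m.dkin (W t) (W' t)" if t: "t \<in> U \<inter> {0..1}" for t
    using vector_derivative_within_cbox[of 0 1 t "\<lambda>t. fibre_energy (\<gamma> t)"] der[OF t] t by (simp add: f'_def cbox_interval)
  have sU: "s \<in> U \<inter> {0..1}" using U s by simp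
  show "((\<lambda>t. fibre_energy (\<gamma> t)) has_vector_derivative f' s) (at s within {0..1})"
    using der[OF sU] by (simp add: f'eq[OF sU])
  have "speed \<gamma> s = sqrt (sform (W' s) (J ?C (W s) (W' s)))"
    unfolding speed_def Let_def c(3) vW[OF sU] WU(2)[OF sU] metric_of_def omega_sform W'_def ..
  then show "\<bar>f' s\<bar> \<le> sqrt (2 * fibre_energy (\<gamma> s)) * speed \<gamma> s"
    using dkin_bound[OF c(1) V path_in_cotangent[OF \<gamma> s] c(2), of "W' s"] unfolding WU(2)[OF sU] f'eq[OF sU] by simp
  \<comment> \<open>Inside \<open>V\<close> the derivative of the energy is expressed by
    \<open>dkin_eq\<close> through \<open>J\<close>, whose continuity is available.\<close>
  have "continuous_on (U \<inter> {0..1}) (\<lambda>t. - (snd (W t) \<bullet> fst (J ?C (W t) (W' t))))"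
    unfolding W'_def
    by (intro continuous_intros continuous_J[OF c(1)] continuous_on_subset[OF cW(1)] continuous_on_subset[OF cW(2)]) (use Wc in auto)
  then have "continuous_on ((U \<inter> Q) \<inter> {0..1}) (\<lambda>t. - (snd (W t) \<bullet> fst (J ?C (W t) (W' t))))"
    by (rule continuous_on_subset) auto
  then have "continuous_on ((U \<inter> Q) \<inter> {0..1}) f'"
  proof (rule continuous_on_eq)
    fix t assume t: "t \<in> (U \<inter> Q) \<inter> {0..1}"
    then have tU: "t \<in> U \<inter> {0..1}" and "t \<in> {0..1} \<inter> Q" by auto
    then have tV: "\<gamma> t \<in> V" unfolding Q(2)[symmetric] by blast
    have "snd (W t) = snd (\<gamma> t) c" using WU(2)[OF tU, symmetric] by simp
    then show "- (snd (W t) \<bullet> fst (J ?C (W t) (W' t))) = f' t"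
      using dkin_eq[OF c(1) tV path_in_cotangent[OF \<gamma>] WU(1)[OF tU], of "W' t"] tU unfolding f'eq[OF tU] WU(2)[OF tU] by simp
  qed
  then have "continuous (at s within (U \<inter> Q) \<inter> {0..1}) f'"
    using sU Q(2) V s by (auto simp: continuous_on_eq_continuous_within)
  moreover have "at s within (U \<inter> Q) \<inter> {0..1} = at s within {0..1}"
    by (rule at_within_nhd[of _ "U \<inter> Q"]) (use U Q V s in auto)
  ultimately show "continuous (at s within {0..1}) f'" by simp
qed

text \<open>The slope of \<open>sqrt (2 * fibre_energy x)\<close> is controlled on \<open>V\<close>
  only, so the length is estimated after the last time at which the energy is at least
  \<open>s\<close>. From then on \<open>s < r\<close> keeps the path in \<open>V\<close>, wherever
  it started.\<close>

lemma path_length_lower: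
  assumes r: "\<And>x. x \<in> cotangent A \<Longrightarrow> fibre_energy x < r \<Longrightarrow> x \<in> V"
    and \<gamma>: "smooth_map_into {0..1} (cot_atlas A) \<gamma>" "\<gamma> 1 \<in> zero_section A"
    and s: "0 < s" "s < r" "s \<le> fibre_energy (\<gamma> 0)"
  shows "ennreal (sqrt (2 * s)) \<le> path_length (cot_atlas A) (metric_of J) \<gamma>"
proof -
  define f where "f t = fibre_energy (\<gamma> t)" for t
  have cf: "continuous_on {0..1} f"
    unfolding continuous_on_open_invariant
  proof (intro allI impI)
    fix B :: "real set" assume "open B"
    from openin_fibre_energy[OF this] have "openin (top_of_set {0..1}) {t \<in> {0..1}. \<gamma> t \<in> {x \<in> cotangent A. fibre_energy x \<in> B}}"
      using \<gamma>(1) unfolding smooth_map_into_def continuous_map_def by auto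
    moreover have "{t \<in> {0..1}. \<gamma> t \<in> {x \<in> cotangent A. fibre_energy x \<in> B}} = f -` B \<inter> {0..1}"
      using path_in_cotangent[OF \<gamma>(1)] by (auto simp: f_def)
    ultimately show "\<exists>A. open A \<and> A \<inter> {0..1} = f -` B \<inter> {0..1}" unfolding openin_open by (metis Int_commute)
  qed
  define T where "T = {t \<in> {0..1}. s \<le> f t}"
  have "closed T" unfolding T_def by (intro continuous_closed_preimage_constant continuous_on_closed_Collect_le continuous_intros cf closed_atLeastAtMost) 
  then have cT: "compact T" by (rule compact_eq_bounded_closed[THEN iffD2, OF conjI, rotated]) (auto simp: T_def intro: bounded_subset[OF bounded_closed_interval[of 0 1]])
  have "0 \<in> T" using s by (simp add: T_def f_def)
  then obtain t0 where t0: "t0 \<in> T" "\<And>t. t \<in> T \<Longrightarrow> t \<le> t0" using compact_attains_sup[OF cT] by blast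
  have t01: "t0 \<in> {0..1}" "s \<le> f t0" using t0(1) by (auto simp: T_def)
  have f1: "f 1 = 0" using fibre_energy_zero_section[OF \<gamma>(2)] by (simp add: f_def)
  have t0lt: "t0 < 1" using t01 f1 s(1) by (cases "t0 = 1") auto
  have less: "f t < s" if "t \<in> {t0<..1}" for t using t0(2)[of t] that t01(1) by (force simp: T_def)
  have "f t0 \<le> s"
  proof (rule ccontr)
    assume "\<not> f t0 \<le> s"
    then have "f 1 \<le> (f t0 + s)/2" "(f t0 + s)/2 \<le> f t0" using f1 s(1) by auto
    then obtain t where t: "t0 \<le> t" "t \<le> 1" "f t = (f t0 + s)/2"
      using IVT2'[of f 1 "(f t0 + s)/2" t0] t0lt continuous_on_subset[OF cf, of "{t0..1}"] t01(1) by auto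
    have "t \<noteq> t0" using t(3) \<open>\<not> f t0 \<le> s\<close> by auto
    then have "f t < s" using less t by auto
    then show False using t(3) \<open>\<not> f t0 \<le> s\<close> by simp
  qed
  then have ft0: "f t0 = s" using t01 by simp
  have le: "f t \<le> s" if "t \<in> {t0..1}" for t using less[of t] that ft0 by (cases "t = t0") auto
  have inV: "\<gamma> t \<in> V" if "t \<in> {t0..1}" for t
    using r[of "\<gamma> t"] le[OF that] s(2) path_in_cotangent[OF \<gamma>(1), of t] that t01(1) by (auto simp: f_def)
  have fnn: "f t \<ge> 0" if "t \<in> {t0..1}" for t
    using fibre_energy_nonneg[OF path_in_cotangent[OF \<gamma>(1), of t]] that t01(1) by (auto simp: f_def)
  define f' where "f' t = vector_derivative (\<lambda>t. fibre_energy (\<gamma> t)) (at t within {0..1})" for t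
  \<comment> \<open>The square root is not differentiable at energy 0, where the path ends; it is
    smoothed by \<open>\<eta>\<^sup>2\<close>, and \<open>\<eta>\<close> tends to 0
    afterwards.\<close>
  have bound: "ennreal (sqrt (2 * s + \<eta>\<^sup>2) - \<eta>) \<le> path_length (cot_atlas A) (metric_of J) \<gamma>" if \<eta>: "\<eta> > 0" for \<eta>
  proof -
    define H where "H t = sqrt (2 * f t + \<eta>\<^sup>2)" for t
    define H' where "H' t = f' t / H t" for t
    have Hp: "H t > 0" "sqrt (2 * f t) \<le> H t" if "t \<in> {t0..1}" for t
      using fnn[OF that] \<eta> by (auto simp: H_def intro!: add_nonneg_pos)
    have dH: "(H has_vector_derivative H' t) (at t within {t0..1})" if t: "t \<in> {t0..1}" for t
    proof -
      have "(f has_vector_derivative f' t) (at t within {0..1})"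
        unfolding f_def f'_def using energy_along_path(1)[OF \<gamma>(1) _ inV[OF t]] t t01(1) by auto
      then have "(f has_real_derivative f' t) (at t within {t0..1})"
        using t01(1) by (auto simp: has_real_derivative_iff_has_vector_derivative intro: has_vector_derivative_within_subset)
      from DERIV_add[OF DERIV_cmult[OF this, of 2] DERIV_const[of "\<eta>\<^sup>2"]]
      have d1: "((\<lambda>t. 2 * f t + \<eta>\<^sup>2) has_real_derivative 2 * f' t) (at t within {t0..1})" by simp
      have p1: "0 < 2 * f t + \<eta>\<^sup>2" using fnn[OF t] \<eta> by (intro add_nonneg_pos) auto
      have "(H has_real_derivative inverse (sqrt (2 * f t + \<eta>\<^sup>2)) / 2 * (2 * f' t)) (at t within {t0..1})"
        unfolding H_def by (rule DERIV_chain2[OF DERIV_real_sqrt[OF p1] d1])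
      moreover have "inverse (sqrt (2 * f t + \<eta>\<^sup>2)) / 2 * (2 * f' t) = H' t"
        by (simp add: H'_def H_def inverse_eq_divide)
      ultimately have "(H has_real_derivative H' t) (at t within {t0..1})" by simp
      then show ?thesis by (simp add: has_real_derivative_iff_has_vector_derivative)
    qed
    have cf': "continuous_on {t0..1} f'"
      unfolding continuous_on_eq_continuous_within
    proof
      fix t assume t: "t \<in> {t0..1}"
      have "continuous (at t within {0..1}) f'"
        unfolding f'_def[abs_def] using energy_along_path(3)[OF \<gamma>(1) _ inV[OF t]] t t01(1) by auto
      then show "continuous (at t within {t0..1}) f'" by (rule continuous_within_subset) (use t01(1) in auto)
    qed
    have cH': "continuous_on {t0..1} H'"
    proof -
      have "continuous_on {t0..1} H" unfolding H_def
        by (intro continuous_intros continuous_on_subset[OF cf]) (use t01(1) in auto)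
      moreover have "H t \<noteq> 0" if "t \<in> {t0..1}" for t using Hp(1)[OF that] by simp
      ultimately show ?thesis unfolding H'_def by (intro continuous_on_divide cf') auto
    qed
    have hb: "has_bochner_integral lborel (\<lambda>x. indicator {t0..1} x *\<^sub>R H' x) (H 1 - H t0)"
      using has_bochner_integral_FTC_Icc[of t0 1 H H'] dH cH' t0lt by auto
    have "ennreal (norm (H 1 - H t0)) = ennreal (norm (integral\<^sup>L lborel (\<lambda>x. indicator {t0..1} x *\<^sub>R H' x)))"
      using has_bochner_integral_integral_eq[OF hb] by simp
    also have "\<dots> \<le> (\<integral>\<^sup>+ x. ennreal (norm (indicator {t0..1} x *\<^sub>R H' x)) \<partial>lborel)"
      by (rule integral_norm_bound_ennreal) (use hb in \<open>auto simp: has_bochner_integral_iff\<close>)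
    also have "\<dots> \<le> (\<integral>\<^sup>+ s. ennreal (speed \<gamma> s) * indicator {0..1} s \<partial>lborel)"
    proof (rule nn_integral_mono)
      fix t :: real
      show "ennreal (norm (indicator {t0..1} t *\<^sub>R H' t)) \<le> ennreal (speed \<gamma> t) * indicator {0..1} t"
      proof (cases "t \<in> {t0..1}")
        case True
        then have t: "t \<in> {0..1}" using t01(1) by auto
        have "\<bar>f' t\<bar> \<le> sqrt (2 * f t) * speed \<gamma> t"
          unfolding f_def f'_def by (rule energy_along_path(2)[OF \<gamma>(1) t inV[OF True]])
        also have "\<dots> \<le> H t * speed \<gamma> t"
        proof (rule mult_right_mono[OF Hp(2)[OF True]])
          obtain c where c: "c \<in> A" "fst (\<gamma> t) \<in> cdom c" "chart_at (cot_atlas A) (\<gamma> t) = cot_chart A c"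
            using chart_at_cot[OF path_in_cotangent[OF \<gamma>(1) t]] by blast
          have z: "coord (cot_chart A c) (\<gamma> t) \<in> cimg c \<times> UNIV" using c(2) by auto
          interpret j: compatible_structure "J (cot_chart A c) (coord (cot_chart A c) (\<gamma> t))" by (rule compatible[OF c(1) z])
          show "0 \<le> speed \<gamma> t"
            unfolding speed_def Let_def c(3) metric_of_def omega_sform j.G_def[symmetric] by (simp only: real_sqrt_ge_0_iff j.G_nonneg)
        qed
        finally have "\<bar>H' t\<bar> \<le> speed \<gamma> t" using Hp(1)[OF True] by (simp add: H'_def abs_div field_simps)
        then show ?thesis using True t by (simp add: ennreal_leI)
      qed simp
    qed
    finally have "ennreal (norm (H 1 - H t0)) \<le> path_length (cot_atlas A) (metric_of J) \<gamma>" by (simp only: path_length_speed)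
    moreover have "norm (H 1 - H t0) \<ge> sqrt (2 * s + \<eta>\<^sup>2) - \<eta>" using \<eta> by (simp add: H_def ft0 f1)
    ultimately show ?thesis using ennreal_leI order_trans by blast
  qed
  have lim: "((\<lambda>\<eta>. ennreal (sqrt (2 * s + \<eta>\<^sup>2) - \<eta>)) \<longlongrightarrow> ennreal (sqrt (2 * s + 0\<^sup>2) - 0)) (at_right 0)"
    by (intro tendsto_ennrealI tendsto_intros)
  have "\<forall>\<^sub>F \<eta> in at_right (0::real). ennreal (sqrt (2 * s + \<eta>\<^sup>2) - \<eta>) \<le> path_length (cot_atlas A) (metric_of J) \<gamma>"
    using bound by (auto simp: eventually_at_right_field intro: exI[of _ 1])
  from tendsto_upperbound[OF lim this] show ?thesis by simp
qed

lemma fibre_energy_le_of_dist_zero: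
  assumes r: "\<And>x. x \<in> cotangent A \<Longrightarrow> fibre_energy x < r \<Longrightarrow> x \<in> V"
    and \<delta>: "\<delta> > 0" "\<delta>\<^sup>2 / 2 < r" and x: "dist_zero A J x \<le> ennreal \<delta>"
  shows "fibre_energy x \<le> \<delta>\<^sup>2 / 2"
proof (rule ccontr)
  assume c: "\<not> fibre_energy x \<le> \<delta>\<^sup>2 / 2"
  \<comment> \<open>If the energy is large, a level strictly between
    \<open>\<delta>\<^sup>2 / 2\<close> and \<open>r\<close> replaces it, because
    \<open>path_length_lower\<close> needs \<open>s < r\<close>.\<close>
  define s where "s = min (fibre_energy x) ((\<delta>\<^sup>2 / 2 + r) / 2)"
  have "\<delta>\<^sup>2 / 2 < (\<delta>\<^sup>2 / 2 + r) / 2" "(\<delta>\<^sup>2 / 2 + r) / 2 < r" using \<delta>(2) by auto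
  then have s: "\<delta>\<^sup>2 / 2 < s" "s < r" "s \<le> fibre_energy x" using c unfolding s_def min_def by (simp_all split: if_split)
  have s0: "s > 0" using s(1) by (smt (verit) divide_nonneg_pos zero_le_power2)
  have "ennreal (sqrt (2 * s)) \<le> dist_zero A J x"
    unfolding dist_zero_def cdist_def riem_dist_def
    by (intro INF_greatest) (use path_length_lower[OF r _ _ s0 s(2)] s(3) in auto)
  then have "ennreal (sqrt (2 * s)) \<le> ennreal \<delta>" using x by (rule order_trans)
  then have "sqrt (2 * s) \<le> \<delta>" using \<delta>(1) s0 by simp
  then have "2 * s \<le> \<delta>\<^sup>2" using \<delta>(1) s0 by (simp add: real_sqrt_le_iff' sqrt_le_D)
  then show False using s(1) by simp
qed

text \<open>Shrinking the covector linearly to 0 gives a vertical path of constant speed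
  \<open>sqrt (2 * fibre_energy x)\<close>. The energy decreases along it, so it stays in
  \<open>V\<close>, where the length of the vertical vector is known.\<close>

lemma dist_zero_le:
  assumes r: "\<And>x. x \<in> cotangent A \<Longrightarrow> fibre_energy x < r \<Longrightarrow> x \<in> V" and x: "x \<in> cotangent A" "fibre_energy x < r"
  shows "dist_zero A J x \<le> ennreal (sqrt (2 * fibre_energy x))"
proof -
  define \<gamma> where "\<gamma> s = (fst x, \<lambda>c. (1 - s) *\<^sub>R snd x c)" for s :: real
  have \<gamma>c: "\<gamma> s \<in> cotangent A" for s
  proof -
    show ?thesis
      unfolding cotangent_def \<gamma>_def mem_Collect_eq prod.case
    proof (intro conjI allI ballI impI)
      show "fst x \<in> carrier A" by (rule cotangentD(1)[OF x(1)])
      show "(1 - s) *\<^sub>R snd x c = 0" if "c \<notin> A \<or> fst x \<notin> cdom c" for c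
        using cotangentD(3)[OF x(1) that] by simp
      show "(1 - s) *\<^sub>R snd x c \<bullet> u = (1 - s) *\<^sub>R snd x c' \<bullet> transition_deriv c c' (fst x) u"
        if "c \<in> A" "c' \<in> A" "fst x \<in> cdom c \<inter> cdom c'" for c c' u
        using cotangentD(2)[OF x(1) that(1,2), of u] that(3) by simp
    qed
  qed
  obtain c0 where c0: "c0 \<in> A" "fst x \<in> cdom c0" using cotangentD(1)[OF x(1)] by (auto simp: carrier_def)
  have sm: "smooth_map_into {0..1} (cot_atlas A) \<gamma>"
    unfolding smooth_map_into_def
  proof (intro conjI ballI)
    show "continuous_map (top_of_set {0..1}) (mtop (cot_atlas A)) \<gamma>"
      unfolding continuous_map_def
    proof (intro conjI allI impI)
      have "cotangent A \<subseteq> topspace (mtop (cot_atlas A))"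
        using openin_fibre_energy[OF open_UNIV] openin_subset by fastforce
      then show "\<gamma> \<in> topspace (top_of_set {0..1}) \<rightarrow> topspace (mtop (cot_atlas A))" using \<gamma>c by auto
      fix U assume U: "openin (mtop (cot_atlas A)) U"
      define Q where "Q = coord (cot_chart A c0) ` (U \<inter> cdom (cot_chart A c0))"
      have Q: "open Q" using U c0(1) unfolding openin_cot Q_def by blast
      have "\<gamma> s \<in> U \<longleftrightarrow> (coord c0 (fst x), (1 - s) *\<^sub>R snd x c0) \<in> Q" for s
      proof
        assume "\<gamma> s \<in> U"
        then show "(coord c0 (fst x), (1 - s) *\<^sub>R snd x c0) \<in> Q"
          unfolding Q_def using \<gamma>c[of s] c0(2) by (intro image_eqI[of _ _ "\<gamma> s"]) (auto simp: \<gamma>_def)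
      next
        assume "(coord c0 (fst x), (1 - s) *\<^sub>R snd x c0) \<in> Q"
        then obtain y where y: "y \<in> U" "y \<in> cotangent A" "fst y \<in> cdom c0" "coord c0 (fst x) = coord c0 (fst y)" "(1 - s) *\<^sub>R snd x c0 = snd y c0"
          unfolding Q_def by auto
        have "fst x = fst y" using inj_coord[OF c0(1)] y c0(2) by (auto simp: inj_on_def)
        then have "\<gamma> s = y" by (intro cotangent_eqI[OF \<gamma>c y(2) c0(1)]) (use c0(2) y in \<open>auto simp: \<gamma>_def\<close>)
        then show "\<gamma> s \<in> U" using y(1) by simp
      qed
      then have "{s \<in> topspace (top_of_set {0..1}). \<gamma> s \<in> U} = {0..1} \<inter> (\<lambda>s. (coord c0 (fst x), (1 - s) *\<^sub>R snd x c0)) -` Q"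
        by auto
      moreover have "open ((\<lambda>s::real. (coord c0 (fst x), (1 - s) *\<^sub>R snd x c0)) -` Q)"
        by (intro open_vimage Q continuous_intros)
      ultimately show "openin (top_of_set {0..1}) {s \<in> topspace (top_of_set {0..1}). \<gamma> s \<in> U}"
        unfolding openin_open by blast
    qed
    fix C assume "C \<in> cot_atlas A"
    then obtain c where c: "C = cot_chart A c" by (auto simp: cot_atlas_def)
    define L where "L s = (coord c (fst x), snd x c) + s *\<^sub>R (0, - snd x c)" for s :: real
    have L: "coord C (\<gamma> s) = L s" for s
      by (simp add: c \<gamma>_def L_def scaleR_diff_left)
    have CL: "Ck_on k UNIV L" for k unfolding L_def by (rule Ck_on_affine)
    show "smooth_on {s \<in> {0..1}. \<gamma> s \<in> cdom C} (coord C \<circ> \<gamma>)"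
      unfolding smooth_on_def by (intro ballI exI[of _ UNIV] exI[of _ L]) (simp add: L CL)
  qed
  have sp: "speed \<gamma> s = sqrt (2 * fibre_energy x)" if s: "0 \<le> s" "s < 1" for s
  proof -
    obtain c where c: "c \<in> A" "fst (\<gamma> s) \<in> cdom c" "chart_at (cot_atlas A) (\<gamma> s) = cot_chart A c"
      using chart_at_cot[OF \<gamma>c] by blast
    let ?C = "cot_chart A c"
    interpret m: local_metric "cimg c" "g c" by (rule local_metric[OF c(1)])
    have cx: "fst x \<in> cdom c" using c(2) by (simp add: \<gamma>_def)
    have eq: "coord ?C \<circ> \<gamma> = (\<lambda>s. (coord c (fst x), (1 - s) *\<^sub>R snd x c))" by (auto simp: \<gamma>_def)
    have "((\<lambda>s. (coord c (fst x), (1 - s) *\<^sub>R snd x c)) has_vector_derivative (0, - snd x c)) (at s within {0..1})"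
      by (auto intro!: derivative_eq_intros simp: has_vector_derivative_def)
    then have v: "vector_derivative (coord ?C \<circ> \<gamma>) (at s within {0..1}) = (0, - snd x c)"
      unfolding eq by (rule vector_derivative_within_unit) (use s in simp)
    have F: "fibre_energy (\<gamma> s) = (1 - s)\<^sup>2 * fibre_energy x"
      using fibre_energy_chart[OF \<gamma>c c(1,2)] fibre_energy_chart[OF x(1) c(1) cx] m.kin_scale[of "(coord c (fst x), snd x c)" "1 - s"] cx
      by (simp add: \<gamma>_def)
    also have "\<dots> \<le> 1 * fibre_energy x" using s fibre_energy_nonneg[OF x(1)] by (intro mult_right_mono) (auto simp: power_le_one)
    finally have "\<gamma> s \<in> V" using r[OF \<gamma>c] x(2) by simp
    \<comment> \<open>At \<open>\<gamma> s\<close> this measures the momentum \<open>1 - s\<close>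
      times \<open>snd x c\<close>, not the velocity; the latter follows by homogeneity after
      division by \<open>(1 - s)\<^sup>2\<close>. The endpoint \<open>s = 1\<close> is thereby
      excluded, which is harmless for the integral.\<close>
    from vertical_energy[OF c(1) this \<gamma>c c(2)]
    have e: "sform (0, (1 - s) *\<^sub>R snd x c) (J ?C (coord ?C (\<gamma> s)) (0, (1 - s) *\<^sub>R snd x c)) = 2 * ((1 - s)\<^sup>2 * fibre_energy x)"
      by (simp add: F) (simp add: \<gamma>_def)
    have z: "coord ?C (\<gamma> s) \<in> cimg c \<times> UNIV" using c(2) by auto
    interpret j: compatible_structure "J ?C (coord ?C (\<gamma> s))" by (rule compatible[OF c(1) z])
    have w: "(0, (1 - s) *\<^sub>R snd x c) = (- (1 - s)) *\<^sub>R (0, - snd x c)" by (simp add: scaleR_Pair) (simp add: algebra_simps)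
    have "(1 - s)\<^sup>2 * j.G (0, - snd x c) (0, - snd x c) = j.G (0, (1 - s) *\<^sub>R snd x c) (0, (1 - s) *\<^sub>R snd x c)"
      unfolding w by (simp only: j.G_linear) (simp add: power2_eq_square algebra_simps)
    also have "\<dots> = (1 - s)\<^sup>2 * (2 * fibre_energy x)" using e unfolding j.G_def by (simp only: mult_ac)
    finally have "j.G (0, - snd x c) (0, - snd x c) = 2 * fibre_energy x" using s(2) by simp
    then show ?thesis unfolding speed_def Let_def c(3) v metric_of_def omega_sform j.G_def by simp
  qed
  have "path_length (cot_atlas A) (metric_of J) \<gamma> \<le> (\<integral>\<^sup>+ s. ennreal (sqrt (2 * fibre_energy x)) * indicator {0..1::real} s \<partial>lborel)"
    unfolding path_length_speed
  proof (rule nn_integral_mono_AE)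
    have "AE s in lborel. s \<noteq> (1::real)" by (rule AE_lborel_singleton)
    then show "AE s in lborel. ennreal (speed \<gamma> s) * indicator {0..1} s \<le> ennreal (sqrt (2 * fibre_energy x)) * indicator {0..1} s"
      by eventually_elim (auto simp: indicator_def sp)
  qed
  also have "\<dots> = ennreal (sqrt (2 * fibre_energy x))" by (simp add: nn_integral_cmult_indicator)
  finally have len: "path_length (cot_atlas A) (metric_of J) \<gamma> \<le> ennreal (sqrt (2 * fibre_energy x))" .
  have g0: "\<gamma> 0 = x" by (simp add: \<gamma>_def)
  have g1: "\<gamma> 1 \<in> zero_section A" using cotangentD(1)[OF x(1)] by (simp add: \<gamma>_def zero_section_def)
  have "dist_zero A J x \<le> cdist A J x (\<gamma> 1)" unfolding dist_zero_def by (rule INF_lower[OF g1])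
  also have "\<dots> \<le> path_length (cot_atlas A) (metric_of J) \<gamma>"
    unfolding cdist_def riem_dist_def by (rule INF_lower) (use sm g0 in simp)
  finally show ?thesis using len by (rule order_trans)
qed

end

section \<open>The dichotomy\<close>

text \<open>Between the first time at level \<open>s1\<close> and the last earlier time at level
  \<open>s0\<close> the values stay in the window, and the mean value theorem applies.
  Differentiability is asked only inside the window, since the curve may start or end at a marked
  point.\<close>

lemma exists_nonzero_derivative:
  fixes \<phi> :: "real \<Rightarrow> real"
  assumes ab: "a \<le> b" and cont: "continuous_on {a..b} \<phi>" and s: "\<phi> a \<le> s0" "s0 < s1" "s1 \<le> \<phi> b"
    and diff: "\<And>t. a < t \<Longrightarrow> t < b \<Longrightarrow> s0 < \<phi> t \<Longrightarrow> \<phi> t < s1 \<Longrightarrow> \<exists>D. (\<phi> has_real_derivative D) (at t)"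
  shows "\<exists>t. a < t \<and> t < b \<and> s0 < \<phi> t \<and> \<phi> t < s1 \<and> \<not> (\<phi> has_real_derivative 0) (at t)"
proof -
  define T1 where "T1 = {t \<in> {a..b}. s1 \<le> \<phi> t}"
  have "closed T1" unfolding T1_def by (intro continuous_on_closed_Collect_le continuous_intros cont closed_atLeastAtMost)
  moreover have "bounded T1" unfolding T1_def by (rule bounded_subset[OF bounded_closed_interval[of a b]]) auto
  ultimately have "compact T1" by (simp add: compact_eq_bounded_closed)
  moreover have "b \<in> T1" using ab s by (simp add: T1_def)
  ultimately obtain tb where tb: "tb \<in> T1" "\<And>t. t \<in> T1 \<Longrightarrow> tb \<le> t" using compact_attains_inf[of T1] by blast
  have tb': "a \<le> tb" "tb \<le> b" "s1 \<le> \<phi> tb" using tb(1) by (auto simp: T1_def)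
  have cont': "continuous_on {a..tb} \<phi>" by (rule continuous_on_subset[OF cont]) (use tb' in auto)
  define T0 where "T0 = {t \<in> {a..tb}. \<phi> t \<le> s0}"
  have "closed T0" unfolding T0_def by (intro continuous_on_closed_Collect_le continuous_intros cont' closed_atLeastAtMost)
  moreover have "bounded T0" unfolding T0_def by (rule bounded_subset[OF bounded_closed_interval[of a tb]]) auto
  ultimately have "compact T0" by (simp add: compact_eq_bounded_closed)
  moreover have "a \<in> T0" using tb' s by (simp add: T0_def)
  ultimately obtain ta where ta: "ta \<in> T0" "\<And>t. t \<in> T0 \<Longrightarrow> t \<le> ta" using compact_attains_sup[of T0] by blast
  have ta': "a \<le> ta" "ta \<le> tb" "\<phi> ta \<le> s0" using ta(1) by (auto simp: T0_def)
  have lt: "ta < tb" using ta' tb' s by (cases "ta = tb") auto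
  have mid: "s0 < \<phi> t \<and> \<phi> t < s1" if t: "ta < t" "t < tb" for t
  proof -
    have "t \<notin> T0" using ta(2) t by fastforce
    moreover have "t \<notin> T1" using tb(2) t by fastforce
    ultimately show ?thesis using t ta' tb' by (auto simp: T0_def T1_def)
  qed
  have "\<exists>D. (\<phi> has_real_derivative D) (at t)" if "ta < t" "t < tb" for t
    using diff[of t] mid[OF that] that ta' tb' by auto
  then have "\<phi> differentiable (at t)" if "ta < t" "t < tb" for t
    using that by (auto simp: real_differentiable_def)
  then obtain l t where t: "ta < t" "t < tb" "(\<phi> has_real_derivative l) (at t)" "\<phi> tb - \<phi> ta = (tb - ta) * l"
    using MVT[OF lt continuous_on_subset[OF cont']] ta' by force
  have "l \<noteq> 0" using t(4) ta'(3) tb'(3) s(2) by auto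
  then have "\<not> (\<phi> has_real_derivative 0) (at t)" using DERIV_unique[OF t(3)] by auto
  then show ?thesis using t(1,2) mid[OF t(1,2)] ta' tb' by (intro exI[of _ t]) auto
qed

lemma sphere_cis_interval:
  assumes "\<zeta> \<in> sphere 0 1"
  shows "\<exists>t. t0 \<le> t \<and> t < t0 + 2 * pi \<and> \<zeta> = cis t"
proof -
  define k where "k = \<lfloor>(Arg \<zeta> - t0) / (2 * pi)\<rfloor>"
  define t where "t = Arg \<zeta> - 2 * pi * of_int k"
  have "\<zeta> \<noteq> 0" using assms by auto
  then have "\<zeta> = cis (Arg \<zeta>)" using assms by (simp add: cis_Arg sgn_eq)
  also have "cis (Arg \<zeta>) = cis (t + 2 * pi * of_int k)" by (simp add: t_def)
  also have "\<dots> = cis t * cis (2 * pi * of_int k)" by (rule cis_mult[symmetric])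
  also have "cis (2 * pi * of_int k) = 1" by (rule cis_multiple_2pi) auto
  finally have "\<zeta> = cis t" by simp
  moreover have "of_int k \<le> (Arg \<zeta> - t0) / (2 * pi)" "(Arg \<zeta> - t0) / (2 * pi) < of_int k + 1"
    unfolding k_def by linarith+
  then have "t0 \<le> t" "t < t0 + 2 * pi" by (simp_all add: t_def field_simps)
  ultimately show ?thesis by blast
qed

context hol_disc begin

text \<open>Where \<open>W1\<close> vanishes so does \<open>W2\<close>, by the Cauchy-Riemann
  equation, and the energy is critical along every curve. Conversely, a nonzero derivative certifies
  an immersed point. The curve may run along the circle, because \<open>W\<close> extends across
  it.\<close>

lemma F_curve:
  assumes c: "c \<in> A" and rep: "chart_rep c U W W1 W2 D1 D2" and t: "p t \<in> U" "p t \<in> cball 0 1"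
    and S: "open S" "t \<in> S" "\<And>u. u \<in> S \<Longrightarrow> p u \<in> cball 0 1" and p: "(p has_vector_derivative p') (at t)"
  shows "((\<lambda>u. F (p u)) has_real_derivative local_metric.dkin (g c) (W (p t)) (Re p' *\<^sub>R W1 (p t) + Im p' *\<^sub>R W2 (p t))) (at t)"
    "W1 (p t) = 0 \<Longrightarrow> ((\<lambda>u. F (p u)) has_real_derivative 0) (at t)"
proof -
  interpret m: local_metric "cimg c" "g c" by (rule local_metric[OF c])
  note r = repD[OF c rep]
  have fz: "fst (W (p t)) \<in> cimg c" using r(5)[OF t(1)] by (simp add: mem_Times_iff)
  have lin: "linear (m.dkin (W (p t)))" by (rule m.dkin_linear[OF fz])
  have "isCont p t" using p has_vector_derivative_continuous by blast
  from continuous_at_open[THEN iffD1, OF this, rule_format, of U] r(1) t(1)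
  obtain S' where S': "open S'" "t \<in> S'" "\<forall>u\<in>S'. p u \<in> U" by blast
  have "((\<lambda>u. m.kin (W (p u))) has_derivative (\<lambda>h. m.dkin (W (p t)) (Re (h *\<^sub>R p') *\<^sub>R W1 (p t) + Im (h *\<^sub>R p') *\<^sub>R W2 (p t)))) (at t)"
    by (rule has_derivative_compose[OF p[unfolded has_vector_derivative_def] has_derivative_compose[OF r(6)[OF t(1)] m.has_derivative_kin[OF fz]]])
  then have "((\<lambda>u. F (p u)) has_derivative (\<lambda>h. m.dkin (W (p t)) (Re (h *\<^sub>R p') *\<^sub>R W1 (p t) + Im (h *\<^sub>R p') *\<^sub>R W2 (p t)))) (at t)"
    by (rule has_derivative_transform_within_open[OF _ open_Int[OF S(1) S'(1)]])
      (use S S' F_rep[OF c rep] in auto)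
  moreover have "m.dkin (W (p t)) (Re (h *\<^sub>R p') *\<^sub>R W1 (p t) + Im (h *\<^sub>R p') *\<^sub>R W2 (p t))
      = m.dkin (W (p t)) (Re p' *\<^sub>R W1 (p t) + Im p' *\<^sub>R W2 (p t)) * h" for h
  proof -
    have "Re (h *\<^sub>R p') *\<^sub>R W1 (p t) + Im (h *\<^sub>R p') *\<^sub>R W2 (p t) = h *\<^sub>R (Re p' *\<^sub>R W1 (p t) + Im p' *\<^sub>R W2 (p t))"
      by (simp add: scaleR_add_right)
    then show ?thesis by (simp only: linear_cmul[OF lin]) (simp add: mult.commute)
  qed
  ultimately show D: "((\<lambda>u. F (p u)) has_real_derivative m.dkin (W (p t)) (Re p' *\<^sub>R W1 (p t) + Im p' *\<^sub>R W2 (p t))) (at t)"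
    by (simp add: has_field_derivative_def)
  assume "W1 (p t) = 0"
  moreover have "W2 (p t) = 0"
    using r(11)[OF t] linear_0[OF linear_J[OF c r(5)[OF t(1)]]] \<open>W1 (p t) = 0\<close> by simp
  ultimately show "((\<lambda>u. F (p u)) has_real_derivative 0) (at t)" using D linear_0[OF lin] by simp
qed

text \<open>The numbers fit as follows: where \<open>w\<close> is in the coordinate ball, the energy
  is above \<open>3 * r / 8 - r / 16 = 5 * r / 16\<close>, hence beyond the values at the marked
  points, and below \<open>3 * r / 4 + r / 16\<close>, hence below \<open>r\<close> and inside
  \<open>V\<close>.\<close>

lemma area_lower_bound_in_chart:
  assumes r: "r > 0" "\<And>x. x \<in> cotangent A \<Longrightarrow> fibre_energy x < r \<Longrightarrow> x \<in> V"
    and geo: "uniform_nbhd r (r / 16) s U0"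
    and \<zeta>0: "\<zeta>0 \<in> cball 0 1 - M" "fst (w \<zeta>0) \<in> U0" "3 * r / 8 < F \<zeta>0" "F \<zeta>0 < 3 * r / 4"
    and nondeg: "\<And>c U W W1 W2 D1 D2. c \<in> A \<Longrightarrow> chart_rep c U W W1 W2 D1 D2 \<Longrightarrow> \<zeta>0 \<in> U \<Longrightarrow> W1 \<zeta>0 \<noteq> 0"
    and marked: "\<And>\<zeta>. \<zeta> \<in> M \<Longrightarrow> F \<zeta> \<le> r / 4"
    and bd: "\<And>\<zeta>. \<zeta> \<in> sphere 0 1 \<Longrightarrow> \<bar>F \<zeta> - F \<zeta>0\<bar> < r / 16 \<Longrightarrow> fst (w \<zeta>) = fst (w \<zeta>0) \<and>
      (\<exists>d>0. \<forall>t. \<bar>t\<bar> < d \<longrightarrow> fst (w (\<zeta> * cis t)) = fst (w \<zeta>))"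
  shows "s \<le> area A w"
proof -
  have \<zeta>c: "\<zeta>0 \<in> cball 0 1" using \<zeta>0(1) by simp
  define x0 where "x0 = w \<zeta>0"
  have x0: "x0 \<in> cotangent A" unfolding x0_def by (rule w_cot[OF \<zeta>c])
  have Fx0: "fibre_energy x0 = F \<zeta>0" by (simp add: x0_def F_def)
  obtain c where c: "c \<in> A" "U0 \<subseteq> cdom c" and geo1: "\<forall>x0\<in>cotangent A. fst x0 \<in> U0 \<and> fibre_energy x0 \<le> r \<longrightarrow>
      (\<exists>\<kappa> R K0 G. \<kappa> \<ge> 0 \<and> R > 0 \<and> \<kappa> * sqrt R \<le> 1/2 \<and> s \<le> 3 * unit_ball_vol 2 / 512 / (1 / sqrt R + 6 * \<kappa>)\<^sup>2 \<and>
        compact K0 \<and> K0 \<subseteq> cimg c \<and> G = compatible_structure.G (J (cot_chart A c) (coord (cot_chart A c) x0)) \<and>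
        (\<forall>z. G (z - coord (cot_chart A c) x0) (z - coord (cot_chart A c) x0) \<le> R \<longrightarrow>
          fst z \<in> K0 \<and> \<bar>local_metric.kin (g c) z - fibre_energy x0\<bar> < r / 16 \<and>
          (\<forall>a. G (J (cot_chart A c) z a - J (cot_chart A c) (coord (cot_chart A c) x0) a)
                 (J (cot_chart A c) z a - J (cot_chart A c) (coord (cot_chart A c) x0) a)
             \<le> \<kappa>\<^sup>2 * G (z - coord (cot_chart A c) x0) (z - coord (cot_chart A c) x0) * G a a)))"
    using geo unfolding uniform_nbhd_def by (elim bexE conjE) (rule that)
  have xU: "fst x0 \<in> U0" "fst x0 \<in> cdom c" using \<zeta>0(2) c(2) by (auto simp: x0_def)
  have "fibre_energy x0 \<le> r" using \<zeta>0(4) r(1) by (simp add: Fx0)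
  with xU have "fst x0 \<in> U0 \<and> fibre_energy x0 \<le> r" by simp
  define z0 where "z0 = coord (cot_chart A c) x0"
  obtain \<kappa> R K0 G where \<kappa>: "\<kappa> \<ge> 0" and R: "R > 0" and \<kappa>R: "\<kappa> * sqrt R \<le> 1/2"
    and s: "s \<le> 3 * unit_ball_vol 2 / 512 / (1 / sqrt R + 6 * \<kappa>)\<^sup>2"
    and K0: "compact K0" "K0 \<subseteq> cimg c" and G: "G = compatible_structure.G (J (cot_chart A c) z0)"
    and ball: "\<forall>z. G (z - z0) (z - z0) \<le> R \<longrightarrow>
          fst z \<in> K0 \<and> \<bar>local_metric.kin (g c) z - fibre_energy x0\<bar> < r / 16 \<and>
          (\<forall>a. G (J (cot_chart A c) z a - J (cot_chart A c) z0 a) (J (cot_chart A c) z a - J (cot_chart A c) z0 a)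
             \<le> \<kappa>\<^sup>2 * G (z - z0) (z - z0) * G a a)"
    using geo1[rule_format, OF x0 \<open>fst x0 \<in> U0 \<and> fibre_energy x0 \<le> r\<close>, folded z0_def] by (elim exE conjE) (rule that)
  define cc where "cc = (\<lambda>\<zeta>. (coord c (fst (w \<zeta>)), snd (w \<zeta>) c))"
  define rho where "rho = (\<lambda>\<zeta>. G (cc \<zeta> - z0) (cc \<zeta> - z0))"
  define inB where "inB = (\<lambda>\<zeta>. fst (w \<zeta>) \<in> cdom c \<and> rho \<zeta> \<le> R)"
  have near: "\<bar>F \<zeta> - F \<zeta>0\<bar> < r / 16" if "\<zeta> \<in> cball 0 1" "inB \<zeta>" for \<zeta>
  proof -
    have i: "fst (w \<zeta>) \<in> cdom c" "G (cc \<zeta> - z0) (cc \<zeta> - z0) \<le> R" using that(2) by (auto simp: inB_def rho_def)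
    have "F \<zeta> = local_metric.kin (g c) (cc \<zeta>)"
      using fibre_energy_chart[OF w_cot[OF that(1)] c(1) i(1)] by (simp add: F_def cc_def)
    then show ?thesis using conjunct1[OF conjunct2[OF ball[rule_format, OF i(2)]]] by (simp add: Fx0)
  qed
  have z0c: "z0 \<in> cimg c \<times> UNIV" using xU(2) by (simp add: z0_def)
  obtain U W W1 W2 D1 D2 where \<zeta>U: "\<zeta>0 \<in> U" and rep: "chart_rep c U W W1 W2 D1 D2"
    using chart_rep_exists[OF \<zeta>0(1) c(1) xU(2)[unfolded x0_def]] by blast
  define T where "T = {x \<in> cotangent A. fibre_energy x \<in> {..<5 * r / 16}}"
  have 1: "fst z \<in> K0" if "G (z - z0) (z - z0) \<le> R" for z using ball that by blast
  have 2: "G (J (cot_chart A c) z a - J (cot_chart A c) z0 a) (J (cot_chart A c) z a - J (cot_chart A c) z0 a)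
             \<le> \<kappa>\<^sup>2 * G (z - z0) (z - z0) * G a a" if "G (z - z0) (z - z0) \<le> R" for z a using ball that by blast
  have 3: "w \<zeta> \<in> V" if "\<zeta> \<in> cball 0 1" "inB \<zeta>" for \<zeta>
  proof -
    have "F \<zeta> < r" using near[OF that] \<zeta>0(4) r(1) unfolding abs_less_iff by linarith
    then show ?thesis using r(2)[OF w_cot[OF that(1)]] by (simp add: F_def)
  qed
  have 4: "openin (mtop (cot_atlas A)) T" unfolding T_def by (rule openin_fibre_energy[OF open_lessThan])
  have 5: "w \<zeta> \<in> T" if "\<zeta> \<in> M" for \<zeta>
  proof -
    have "\<zeta> \<in> cball 0 1" using that M(2) by auto
    then show ?thesis using marked[OF that] w_cot r(1) by (auto simp: T_def F_def)
  qed
  have 6: "\<not> inB \<zeta>" if "\<zeta> \<in> cball 0 1" "w \<zeta> \<in> T" for \<zeta>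
  proof
    assume "inB \<zeta>"
    from near[OF that(1) this] have "F \<zeta>0 - r / 16 < F \<zeta>" unfolding abs_less_iff by linarith
    moreover have "F \<zeta> < 5 * r / 16" using that(2) by (simp add: T_def F_def)
    ultimately show False using \<zeta>0(3) by linarith
  qed
  have 7: "coord c (fst (w \<zeta>)) = fst z0 \<and> (\<exists>d>0. \<forall>t. \<bar>t\<bar> < d \<longrightarrow> fst (w (\<zeta> * cis t)) = fst (w \<zeta>))"
    if "\<zeta> \<in> sphere 0 1" "inB \<zeta>" for \<zeta>
  proof -
    have "\<zeta> \<in> cball 0 1" using that(1) by auto
    from bd[OF that(1) near[OF this that(2)]] have a: "fst (w \<zeta>) = fst (w \<zeta>0)"
      and b: "\<exists>d>0. \<forall>t. \<bar>t\<bar> < d \<longrightarrow> fst (w (\<zeta> * cis t)) = fst (w \<zeta>)" by blast+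
    have "coord c (fst (w \<zeta>)) = fst z0" using a by (simp add: z0_def x0_def)
    then show ?thesis using b by blast
  qed
  have W0: "W \<zeta>0 = z0" using repD(4)[OF c(1) rep \<zeta>U \<zeta>c] by (simp add: z0_def x0_def)
  have "3 * unit_ball_vol 2 / 512 / (1 / sqrt R + 6 * \<kappa>)\<^sup>2 \<le> area A w"
    by (rule area_lower_bound[OF c(1) z0c R \<kappa> \<kappa>R G cc_def rho_def inB_def K0 1 2 3 4 5 6 7 rep \<zeta>U \<zeta>c W0 nondeg[OF c(1) rep \<zeta>U]])
  then show ?thesis using s by simp
qed

text \<open>If the fibre arc reaches energy \<open>r / 2\<close>, the monotonicity estimate is applied at a boundary point
  on it; otherwise at an interior point of energy above \<open>5 r / 8\<close>, whose ball avoids the boundary.\<close>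

lemma triangle_dichotomy:
  assumes r: "r > 0" "\<And>x. x \<in> cotangent A \<Longrightarrow> fibre_energy x < r \<Longrightarrow> x \<in> V" and b: "0 \<le> b" "b \<le> r / 4"
    and geo: "\<forall>q\<in>carrier A. \<exists>U. q \<in> U \<and> uniform_nbhd r (r / 16) s U"
    and t012: "t0 < t1" "t1 < t2" "t2 < t0 + 2 * pi" and M_eq: "M = {cis t0, cis t1, cis t2}"
    and L: "\<And>t. t0 \<le> t \<Longrightarrow> t \<le> t1 \<Longrightarrow> F (cis t) \<le> b"
    and zero: "\<And>t. t1 \<le> t \<Longrightarrow> t \<le> t2 \<Longrightarrow> F (cis t) = 0"
    and fibre: "\<And>t. t2 \<le> t \<Longrightarrow> t \<le> t0 + 2 * pi \<Longrightarrow> fst (w (cis t)) = q"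
  shows "(w ` cball 0 1 \<subseteq> V \<and> (\<forall>z\<in>cball 0 1. F z \<le> b)) \<or> (\<not> w ` cball 0 1 \<subseteq> V \<and> s \<le> area A w)"
proof -
  have marked: "F \<zeta> \<le> b" if "\<zeta> \<in> M" for \<zeta>
    using that L[of t0] L[of t1] zero[of t2] t012 b(1) by (auto simp: M_eq)
  have arc: "\<exists>d>0. \<forall>u. \<bar>u\<bar> < d \<longrightarrow> fst (w (cis t * cis u)) = fst (w (cis t))" if "t2 < t" "t < t0 + 2 * pi" for t
  proof (intro exI conjI allI impI)
    show "0 < min (t - t2) (t0 + 2 * pi - t)" using that by simp
    fix u assume "\<bar>u\<bar> < min (t - t2) (t0 + 2 * pi - t)"
    then have "t2 \<le> t + u" "t + u \<le> t0 + 2 * pi" by auto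
    then show "fst (w (cis t * cis u)) = fst (w (cis t))"
      using fibre[of t] fibre[of "t + u"] that by (simp add: cis_mult)
  qed
  \<comment> \<open>Energy above \<open>b\<close> on the circle occurs only on the open fibre arc:
    the other two arcs and the marked points have energy at most \<open>b\<close>.\<close>
  have classify: "F \<zeta> \<le> b \<or> (\<zeta> \<notin> M \<and> (\<exists>t. t2 < t \<and> t < t0 + 2 * pi \<and> \<zeta> = cis t))" if \<zeta>S: "\<zeta> \<in> sphere 0 1" for \<zeta>
  proof (rule disjCI)
    assume n: "\<not> (\<zeta> \<notin> M \<and> (\<exists>t. t2 < t \<and> t < t0 + 2 * pi \<and> \<zeta> = cis t))"
    obtain t where t: "t0 \<le> t" "t < t0 + 2 * pi" "\<zeta> = cis t" using sphere_cis_interval[OF \<zeta>S] by blast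
    show "F \<zeta> \<le> b"
    proof (cases "\<zeta> \<in> M")
      case False
      then have "\<not> t2 < t" using n t by (metis (no_types))
      then have "t \<le> t2" by simp
      then show ?thesis using L[of t] zero[of t] t b(1) by (cases "t \<le> t1") auto
    qed (rule marked)
  qed
  show ?thesis
  proof (cases "w ` cball 0 1 \<subseteq> V")
    case True
    have "F z \<le> b" if z: "z \<in> cball 0 1" for z
    proof (rule maximum_principle[OF True _ _ _ z])
      show "F \<zeta> \<le> b \<or> (\<zeta> \<notin> M \<and> (\<exists>d>0. \<forall>t. \<bar>t\<bar> < d \<longrightarrow> fst (w (\<zeta> * cis t)) = fst (w \<zeta>)))"
        if "\<zeta> \<in> sphere 0 1" for \<zeta>
        using classify[OF that] arc by blast
      show "cis t0 \<in> cball 0 1" "F (cis t0) \<le> b" using L[of t0] t012 by auto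
    qed
    then show ?thesis using True by blast
  next
    case False
    then obtain z' where z': "z' \<in> cball 0 1" "w z' \<notin> V" by blast
    have Fz': "F z' \<ge> r" using r(2)[OF w_cot[OF z'(1)]] z'(2) by (force simp: F_def)
    have marked': "F \<zeta> \<le> r / 4" if "\<zeta> \<in> M" for \<zeta> using marked[OF that] b(2) by simp
    have "s \<le> area A w"
    proof (cases "\<exists>t. t2 \<le> t \<and> t \<le> t0 + 2 * pi \<and> r / 2 \<le> F (cis t)")
      case True
      then obtain ts where ts: "t2 \<le> ts" "ts \<le> t0 + 2 * pi" "r / 2 \<le> F (cis ts)" by blast
      have p: "(cis has_vector_derivative (\<i> * cis t)) (at t)" for t
      proof -
        have "cis = (\<lambda>t. of_real (cos t) + \<i> * of_real (sin t))" by (auto simp: complex_eq_iff)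
        moreover have "((\<lambda>t. of_real (cos t) + \<i> * of_real (sin t)) has_vector_derivative (\<i> * cis t)) (at t)"
          unfolding has_vector_derivative_def
          by (auto intro!: derivative_eq_intros simp: complex_eq_iff)
        ultimately show ?thesis by simp
      qed
      have notM: "cis t \<in> cball 0 1 - M" if "3 * r / 8 < F (cis t)" for t
        using marked'[of "cis t"] that r(1) by auto
      have curve: "\<exists>D. ((\<lambda>u. F (cis u)) has_real_derivative D) (at t)" if t: "3 * r / 8 < F (cis t)" for t
      proof -
        obtain c where c: "c \<in> A" "fst (w (cis t)) \<in> cdom c" using interior_chart[of "cis t"] by auto
        obtain U W W1 W2 D1 D2 where "cis t \<in> U" and rep: "chart_rep c U W W1 W2 D1 D2"
          using chart_rep_exists[OF notM[OF t] c] by blast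
        then show ?thesis using F_curve(1)[where p = cis and S = UNIV, OF c(1) rep _ _ open_UNIV UNIV_I _ p] by auto
      qed
      have "continuous_on {t2..ts} (\<lambda>t. F (cis t))"
        by (rule continuous_on_compose2[OF continuous_F]) (auto intro!: continuous_intros)
      then obtain t where t: "t2 < t" "t < ts" "3 * r / 8 < F (cis t)" "F (cis t) < r / 2"
        and nd: "\<not> ((\<lambda>t. F (cis t)) has_real_derivative 0) (at t)"
        using exists_nonzero_derivative[OF ts(1), of "\<lambda>t. F (cis t)" "3 * r / 8" "r / 2"] curve zero[of t2] t012 ts(3) r(1) by auto
      have "fst (w (cis t)) \<in> carrier A" by (rule cotangentD(1)[OF w_cot]) simp
      then obtain U1 where U1: "fst (w (cis t)) \<in> U1" "uniform_nbhd r (r / 16) s U1" using geo by blast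
      have q: "fst (w (cis t)) = q" using fibre[of t] t(1,2) ts(2) by simp
      show ?thesis
      proof (rule area_lower_bound_in_chart[OF r U1(2) notM[OF t(3)] U1(1) t(3)])
        show "F (cis t) < 3 * r / 4" using t(4) r(1) by simp
        show "F \<zeta> \<le> r / 4" if "\<zeta> \<in> M" for \<zeta> by (rule marked'[OF that])
        show "W1 (cis t) \<noteq> 0" if "c \<in> A" "chart_rep c U W W1 W2 D1 D2" "cis t \<in> U" for c U W W1 W2 D1 D2
          using F_curve(2)[where p = cis and S = UNIV, OF that _ open_UNIV UNIV_I _ p] nd by auto
        \<comment> \<open>Energies within \<open>r / 16\<close> of a value above
          \<open>3 * r / 8\<close> exceed \<open>r / 4\<close>, so the boundary point is again on
          the fibre arc, over the same base point as the centre.\<close>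
        fix \<zeta> assume \<zeta>: "\<zeta> \<in> sphere 0 1" "\<bar>F \<zeta> - F (cis t)\<bar> < r / 16"
        have "F (cis t) - r / 16 < F \<zeta>" using \<zeta>(2) unfolding abs_less_iff by linarith
        then have "b < F \<zeta>" using b(2) t(3) r(1) by linarith
        then obtain u where u: "t2 < u" "u < t0 + 2 * pi" "\<zeta> = cis u" using classify[OF \<zeta>(1)] by auto
        then show "fst (w \<zeta>) = fst (w (cis t)) \<and> (\<exists>d>0. \<forall>t. \<bar>t\<bar> < d \<longrightarrow> fst (w (\<zeta> * cis t)) = fst (w \<zeta>))"
          using arc[OF u(1,2)] fibre[of u] q by simp
      qed
    next
      case low: False
      have sph: "F \<zeta> < r / 2" if \<zeta>S: "\<zeta> \<in> sphere 0 1" for \<zeta>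
      proof -
        consider "F \<zeta> \<le> b" | t where "t2 < t" "t < t0 + 2 * pi" "\<zeta> = cis t" using classify[OF \<zeta>S] by blast
        then show ?thesis
        proof cases
          case 1 then show ?thesis using b(2) r(1) by simp
        next
          case 2 then show ?thesis using low by (meson less_imp_le not_le)
        qed
      qed
      \<comment> \<open>A point of energy 0 on the circle; \<open>z'\<close> may lie there as well.
        Both are moved radially inwards, so that the segment between them runs in the open disc,
        clear of the marked points.\<close>
      define z2 where "z2 = cis t2"
      have z2: "z2 \<in> cball 0 1" "F z2 = 0" using zero[of t2] t012 by (auto simp: z2_def)
      have shrink: "((\<lambda>\<eta>. F ((1 - \<eta>) *\<^sub>R z)) \<longlongrightarrow> F z) (at_right (0::real))" if z: "z \<in> cball 0 1" for z
      proof -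
        have "continuous_on {0..1} (\<lambda>\<eta>::real. F ((1 - \<eta>) *\<^sub>R z))"
        proof (rule continuous_on_compose2[OF continuous_F])
          show "(\<lambda>\<eta>::real. (1 - \<eta>) *\<^sub>R z) ` {0..1} \<subseteq> cball 0 1"
            using z by (auto intro!: mult_le_one)
        qed (intro continuous_intros)
        then have "((\<lambda>\<eta>. F ((1 - \<eta>) *\<^sub>R z)) \<longlongrightarrow> F ((1 - 0) *\<^sub>R z)) (at 0 within {0..1})"
          unfolding continuous_on_def by (rule bspec) simp
        moreover have "at (0::real) within {0..1} = at_right 0"
          by (rule at_within_Icc_at_right) simp
        ultimately show ?thesis by simp
      qed
      have "\<forall>\<^sub>F \<eta> in at_right (0::real). F ((1 - \<eta>) *\<^sub>R z2) < 5 * r / 8"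
        using order_tendstoD(2)[OF shrink[OF z2(1)], of "5 * r / 8"] z2(2) r(1) by simp
      moreover have "\<forall>\<^sub>F \<eta> in at_right (0::real). F ((1 - \<eta>) *\<^sub>R z') > 3 * r / 4"
        using order_tendstoD(1)[OF shrink[OF z'(1)], of "3 * r / 4"] Fz' r(1) by simp
      moreover have "\<forall>\<^sub>F \<eta> in at_right (0::real). \<eta> < 1" unfolding eventually_at_right_field by (intro exI[of _ 1]) simp
      moreover have "\<forall>\<^sub>F \<eta> in at_right (0::real). 0 < \<eta>" by (rule eventually_at_right_less)
      ultimately have "\<forall>\<^sub>F \<eta> in at_right (0::real). F ((1 - \<eta>) *\<^sub>R z2) < 5 * r / 8 \<and> F ((1 - \<eta>) *\<^sub>R z') > 3 * r / 4 \<and> \<eta> < 1 \<and> 0 < \<eta>"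
        by eventually_elim blast
      then obtain \<eta> where \<eta>: "F ((1 - \<eta>) *\<^sub>R z2) < 5 * r / 8" "F ((1 - \<eta>) *\<^sub>R z') > 3 * r / 4" "\<eta> < 1" "0 < \<eta>"
        using eventually_happens'[OF trivial_limit_at_right_real] by blast
      define za where "za = (1 - \<eta>) *\<^sub>R z2"
      define zb where "zb = (1 - \<eta>) *\<^sub>R z'"
      have ball: "(1 - \<eta>) *\<^sub>R z \<in> ball 0 1" if "z \<in> cball 0 1" for z :: complex
      proof -
        have "norm ((1 - \<eta>) *\<^sub>R z) \<le> (1 - \<eta>) * 1" using that \<eta>(3,4) by (simp add: mult_left_le)
        then show ?thesis using \<eta>(4) by simp
      qed
      define p where "p t = za + t *\<^sub>R (zb - za)" for t :: real
      have pin: "p t \<in> ball 0 1" if "t \<in> {0..1}" for t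
      proof -
        have "p t = (1 - t) *\<^sub>R za + t *\<^sub>R zb" by (simp add: p_def algebra_simps)
        also have "\<dots> \<in> ball 0 1"
          using convexD[OF convex_ball, of za "0::complex" 1 zb "1 - t" t] ball[OF z2(1)] ball[OF z'(1)] that by (auto simp: za_def zb_def)
        finally show ?thesis .
      qed
      have pd: "(p has_vector_derivative (zb - za)) (at t)" for t
        unfolding p_def has_vector_derivative_def by (auto intro!: derivative_eq_intros)
      have pS: "p u \<in> cball 0 1" if "u \<in> {0<..<1}" for u using pin[of u] that by auto
      have curve: "\<exists>D. ((\<lambda>u. F (p u)) has_real_derivative D) (at t)" if t: "t \<in> {0<..<1}" for t
      proof -
        have pc: "p t \<in> cball 0 1" "p t \<in> ball 0 1" using pin[of t] t by auto
        obtain c where c: "c \<in> A" "fst (w (p t)) \<in> cdom c" using interior_chart[OF pc(1)] by blast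
        obtain U W W1 W2 D1 D2 where U: "p t \<in> U" and rep: "chart_rep c U W W1 W2 D1 D2"
          using chart_rep_exists[OF interior_not_marked[OF pc(2)] c] by blast
        show ?thesis
          using F_curve(1)[where p = p, OF c(1) rep U pc(1) open_greaterThanLessThan t pS pd] by blast
      qed
      have "continuous_on {0..1} p" unfolding p_def by (intro continuous_intros)
      then have cp: "continuous_on {0..1} (\<lambda>u. F (p u))"
        by (rule continuous_on_compose2[OF continuous_F]) (use pin in force)
      have ends: "F (p 0) \<le> 5 * r / 8" "3 * r / 4 \<le> F (p 1)" using \<eta>(1,2) by (simp_all add: p_def za_def zb_def)
      obtain t where t: "0 < t" "t < 1" "5 * r / 8 < F (p t)" "F (p t) < 3 * r / 4"
        and nd: "\<not> ((\<lambda>u. F (p u)) has_real_derivative 0) (at t)"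
        using exists_nonzero_derivative[OF zero_le_one cp ends(1) _ ends(2)] curve r(1) by auto
      have tS: "t \<in> {0<..<1}" using t by simp
      have pt: "p t \<in> ball 0 1" "p t \<in> cball 0 1" using pin[of t] t by auto
      show ?thesis
      proof -
        obtain c where c: "c \<in> A" "fst (w (p t)) \<in> cdom c" using interior_chart[OF pt(2)] by blast
        have "fst (w (p t)) \<in> carrier A" using cotangentD(1)[OF w_cot[OF pt(2)]] .
        then obtain U1 where U1: "fst (w (p t)) \<in> U1" "uniform_nbhd r (r / 16) s U1" using geo by blast
        show ?thesis
        proof (rule area_lower_bound_in_chart[OF r U1(2) interior_not_marked[OF pt(1)] U1(1)])
          show "3 * r / 8 < F (p t)" using t(3) r(1) by simp
          show "F (p t) < 3 * r / 4" by (rule t(4))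
          show "F \<zeta> \<le> r / 4" if "\<zeta> \<in> M" for \<zeta> by (rule marked'[OF that])
          show "W1 (p t) \<noteq> 0" if "c \<in> A" "chart_rep c U W W1 W2 D1 D2" "p t \<in> U" for c U W W1 W2 D1 D2
            using F_curve(2)[where p = p, OF that pt(2) open_greaterThanLessThan tS pS pd] nd by blast
          \<comment> \<open>\<open>5 * r / 8 - r / 16\<close> exceeds \<open>r / 2\<close>, the
            bound for \<open>F\<close> on the circle, so no boundary point is mapped into the
            ball.\<close>
          fix \<zeta> assume \<zeta>: "\<zeta> \<in> sphere 0 1" "\<bar>F \<zeta> - F (p t)\<bar> < r / 16"
          have "F (p t) - r / 16 < F \<zeta>" using \<zeta>(2) unfolding abs_less_iff by linarith
          then have False using sph[OF \<zeta>(1)] t(3) r(1) by linarith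
          then show "fst (w \<zeta>) = fst (w (p t)) \<and> (\<exists>d>0. \<forall>t. \<bar>t\<bar> < d \<longrightarrow> fst (w (\<zeta> * cis t)) = fst (w \<zeta>))" ..
        qed
      qed
    qed
    then show ?thesis using False by blast
  qed
qed

end

theorem theorem6p10:
  fixes A :: "('n, 'e::euclidean_space) chart set"
    and g :: "('n, 'e) bilin_field"
    and J0 :: "(('n, 'e) cotpt, 'e \<times> 'e) endo_field"
    and V :: "('n, 'e) cotpt set"
  assumes N: "manifold A" "compact_space (mtop A)"
    and g: "riemannian_metric A g"
    and J0: "almost_complex (cot_atlas A) J0" "omega_tame A J0" "omega_compatible A J0"
    and V: "openin (mtop (cot_atlas A)) V" "zero_section A \<subseteq> V"
    and J0_V: "equals_sasaki_on A g J0 V"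
    and convex: "J_convex_boundary (cot_atlas A) J0 V"
  shows "\<exists>C>0. \<forall>q\<in>carrier A. \<exists>\<delta>0>0. \<forall>\<delta>. 0 < \<delta> \<and> \<delta> \<le> \<delta>0 \<longrightarrow>
    (\<forall>H\<in>H_engulf A J0 V \<delta>.
      transverse (cot_atlas A) (L_ham A H) (zero_section A) \<and>
      transverse (cot_atlas A) (L_ham A H) (cot_fibre A q) \<longrightarrow>
      (\<forall>(w, z)\<in>M3 A J0 (L_ham A H) (zero_section A) (cot_fibre A q).
        (w ` cball 0 1 \<subseteq> V \<and> (SUP \<zeta>\<in>sphere 0 1. dist_zero A J0 (w \<zeta>)) \<le> ennreal \<delta>) \<or>
        (\<not> w ` cball 0 1 \<subseteq> V \<and> area A w \<ge> C)))"
proof -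
  interpret tame_setup A g J0 V
    by (unfold_locales; rule N(1) g J0 V(1) J0_V)
  obtain r where r: "r > 0" "\<forall>x\<in>cotangent A. fibre_energy x < r \<longrightarrow> x \<in> V"
    using energy_sublevel_subset[OF N(2) V] by blast
  have rV: "x \<in> V" if "x \<in> cotangent A" "fibre_energy x < r" for x using r(2) that by blast
  have "\<exists>s>0. \<forall>q\<in>carrier A. \<exists>U. q \<in> U \<and> uniform_nbhd r (r / 16) s U"
  proof (rule compact_cover[OF N(2)])
    show "\<exists>U s. openin (mtop A) U \<and> q \<in> U \<and> s > 0 \<and> uniform_nbhd r (r / 16) s U" if "q \<in> carrier A" for q
      using uniform_nbhd_exists[OF _ that, of "r / 16"] r(1) by simp
    show "uniform_nbhd r (r / 16) s' U" if "uniform_nbhd r (r / 16) s U" "0 < s'" "s' \<le> s" for U s s'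
      by (rule uniform_nbhd_mono[OF that(1,3)])
  qed
  \<comment> \<open>\<open>C\<close> is fixed before \<open>q\<close>, \<open>\<delta>\<close>,
    \<open>H\<close> and \<open>w\<close>; it comes from covering the base by neighbourhoods with
    uniform estimates.\<close>
  then obtain C where C: "C > 0" "\<forall>q\<in>carrier A. \<exists>U. q \<in> U \<and> uniform_nbhd r (r / 16) C U" by blast
  have main: "(w ` cball 0 1 \<subseteq> V \<and> (SUP \<zeta>\<in>sphere 0 1. dist_zero A J0 (w \<zeta>)) \<le> ennreal \<delta>) \<or>
        (\<not> w ` cball 0 1 \<subseteq> V \<and> area A w \<ge> C)"
    if \<delta>: "0 < \<delta>" "\<delta> \<le> sqrt (r / 2)" and H: "H \<in> H_engulf A J0 V \<delta>"
      and w: "(w, z) \<in> M3 A J0 (L_ham A H) (zero_section A) (cot_fibre A q)" for q \<delta> H w z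
  proof -
    \<comment> \<open>The choice of \<open>sqrt (r / 2)\<close> for the threshold makes
      \<open>\<delta>\<^sup>2 / 2\<close>, the energy bound on the arc in \<open>L_ham A H\<close>,
      at most \<open>r / 4\<close>, as the dichotomy requires.\<close>
    have "\<delta>\<^sup>2 \<le> (sqrt (r / 2))\<^sup>2" using \<delta> by (intro power_mono) auto
    then have d2: "\<delta>\<^sup>2 / 2 \<le> r / 4" using r(1) by simp
    then have d2r: "\<delta>\<^sup>2 / 2 < r" using r(1) by simp
    obtain z0 z1 z2 where z: "z = (z0, z1, z2)" by (cases z) auto
    obtain x0 x1 x2 where w': "(w, (z0, z1, z2)) \<in> M3_at A J0 (L_ham A H) (zero_section A) (cot_fibre A q) x1 x2 x0"
      using w unfolding M3_def z by blast
    obtain t0 t1 t2 where t: "t0 < t1" "t1 < t2" "t2 < t0 + 2 * pi" and zt: "z0 = cis t0" "z1 = cis t1" "z2 = cis t2"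
      and arcs: "w ` cis ` {t0..t1} \<subseteq> L_ham A H" "w ` cis ` {t1..t2} \<subseteq> zero_section A" "w ` cis ` {t2..t0 + 2 * pi} \<subseteq> cot_fibre A q"
      and ww: "continuous_map (top_of_set (cball 0 1)) (mtop (cot_atlas A)) w"
        "J_holomorphic_on (cot_atlas A) J0 (cball 0 1 - {z0, z1, z2}) w" "finite_energy A J0 w"
      using w' unfolding M3_at_def mem_Collect_eq prod.case by (elim conjE exE) (rule that)
    interpret hol_disc A g J0 V w "{z0, z1, z2}"
      by (unfold_locales; (rule ww)?) (auto simp: zt)
    \<comment> \<open>The point of the zero section that the flow carries to
      \<open>w (cis u)\<close> is within \<open>\<delta>\<close> of it, by the bound on
      \<open>dbar\<close>.\<close>
    have L: "F (cis u) \<le> \<delta>\<^sup>2 / 2" if "t0 \<le> u" "u \<le> t1" for u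
    proof -
      have "w (cis u) \<in> L_ham A H" using arcs(1) that by auto
      then obtain x where x: "x \<in> zero_section A" "w (cis u) = ham_flow A H 1 x" by (auto simp: L_ham_def)
      have xc: "x \<in> cotangent A" using x(1) zero_section_cotangent by blast
      have "dist_zero A J0 (w (cis u)) \<le> cdist A J0 (w (cis u)) x" unfolding dist_zero_def by (rule INF_lower[OF x(1)])
      also have "\<dots> = cdist A J0 (ham_flow A H 1 x) (id x)" by (simp add: x(2))
      also have "\<dots> \<le> (SUP x\<in>cotangent A. cdist A J0 (ham_flow A H 1 x) (id x))" by (rule SUP_upper[OF xc])
      also have "\<dots> \<le> dbar A J0 (ham_flow A H 1) id" unfolding dbar_def by (rule max.cobounded1)
      also have "\<dots> \<le> ennreal \<delta>" using H by (simp add: H_engulf_def)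
      finally have dz: "dist_zero A J0 (w (cis u)) \<le> ennreal \<delta>" .
      show ?thesis unfolding F_def by (rule fibre_energy_le_of_dist_zero[OF _ \<delta>(1) d2r dz]) (rule rV)
    qed
    have zero: "F (cis u) = 0" if "t1 \<le> u" "u \<le> t2" for u
      unfolding F_def by (rule fibre_energy_zero_section) (use arcs(2) that in auto)
    have fibre: "fst (w (cis u)) = q" if "t2 \<le> u" "u \<le> t0 + 2 * pi" for u
    proof -
      have "w (cis u) \<in> cot_fibre A q" using arcs(3) that by auto
      then show ?thesis by (simp add: cot_fibre_def)
    qed
    have "(w ` cball 0 1 \<subseteq> V \<and> (\<forall>z\<in>cball 0 1. F z \<le> \<delta>\<^sup>2 / 2)) \<or> (\<not> w ` cball 0 1 \<subseteq> V \<and> C \<le> area A w)"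
      by (rule triangle_dichotomy[OF r(1) rV _ d2 C(2) t _ L zero fibre]) (simp_all add: zt)
    then show ?thesis
    proof (elim disjE conjE)
      assume V': "w ` cball 0 1 \<subseteq> V" and Fb: "\<forall>z\<in>cball 0 1. F z \<le> \<delta>\<^sup>2 / 2"
      have "dist_zero A J0 (w \<zeta>) \<le> ennreal \<delta>" if \<zeta>: "\<zeta> \<in> sphere 0 1" for \<zeta>
      proof -
        have \<zeta>c: "\<zeta> \<in> cball 0 1" using \<zeta> by auto
        have Fz: "fibre_energy (w \<zeta>) \<le> \<delta>\<^sup>2 / 2" using Fb \<zeta>c by (simp add: F_def)
        have "dist_zero A J0 (w \<zeta>) \<le> ennreal (sqrt (2 * fibre_energy (w \<zeta>)))"
          by (rule dist_zero_le[OF rV w_cot[OF \<zeta>c]]) (use Fz d2r in auto)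
        also have "sqrt (2 * fibre_energy (w \<zeta>)) \<le> sqrt (\<delta>\<^sup>2)" using Fz by (intro real_sqrt_le_mono) simp
        then have "ennreal (sqrt (2 * fibre_energy (w \<zeta>))) \<le> ennreal \<delta>" using \<delta>(1) by (intro ennreal_leI) simp
        finally show ?thesis .
      qed
      then have "(SUP \<zeta>\<in>sphere 0 1. dist_zero A J0 (w \<zeta>)) \<le> ennreal \<delta>" by (rule SUP_least)
      then show ?thesis using V' by blast
    qed blast
  qed
  show ?thesis
  proof (rule exI[of _ C], intro conjI ballI)
    show "C > 0" by (rule C(1))
    fix q assume "q \<in> carrier A"
    have "0 < sqrt (r / 2)" using r(1) by simp
    then show "\<exists>\<delta>0>0. \<forall>\<delta>. 0 < \<delta> \<and> \<delta> \<le> \<delta>0 \<longrightarrow>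
    (\<forall>H\<in>H_engulf A J0 V \<delta>.
      transverse (cot_atlas A) (L_ham A H) (zero_section A) \<and>
      transverse (cot_atlas A) (L_ham A H) (cot_fibre A q) \<longrightarrow>
      (\<forall>(w, z)\<in>M3 A J0 (L_ham A H) (zero_section A) (cot_fibre A q).
        (w ` cball 0 1 \<subseteq> V \<and> (SUP \<zeta>\<in>sphere 0 1. dist_zero A J0 (w \<zeta>)) \<le> ennreal \<delta>) \<or>
        (\<not> w ` cball 0 1 \<subseteq> V \<and> area A w \<ge> C)))"
      using main by blast
  qed
qed

end
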